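(* Let $\varphi\in\mathcal{M}$. For $j=1,\dots,r$ let $\mathfrak{B}_j=\{b_{mj}:m\in\mathbb{N}_0\}$ be a periodic sequence of complex numbers with minimal period $l_j$ and let $0<\alpha_j<1$. Let $h_1,h_{21},\dots,h_{2r}>0$ and suppose that the elements of $$L(\underline{\alpha},\underline{h})=\{h_1\log p:p\in\mathbb{P}\}\cup\bigcup_{j=1}^r\{h_{2j}\log(m+\alpha_j):m\in\mathbb{N}_0\}\cup\{\pi\}$$ are linearly independent over $\mathbb{Q}$. Let $D_1$ be an open subset of $D_\varphi$ and, for each $j$, $D_{2j}$ an open subset of $D_{\zeta_j}$; put $\underline{H}_r=H(D_1)\times H(D_{21})\times\cdots\times H(D_{2r})$ and $\underline{Z}(s_1,s_{21},\dots,s_{2r})=(\varphi(s_1),\zeta(s_{21},\alpha_1;\mathfrak{B}_1),\dots,\zeta(s_{2r},\alpha_r;\mathfrak{B}_r))\in\underline{H}_r$. Then the probability measure $$\underline{P}_N(A)=\frac1{N+1}\#\big\{0\le k\le N:\ \underline{Z}(s_1+ikh_1,s_{21}+ikh_{21},\dots,s_{2r}+ikh_{2r})\in A\big\},\quad A\in\mathcal{B}(\underline{H}_r),$$ converges weakly to $\underline{P}_{\underline{Z}}$ as $N\to\infty$.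
   Context: $\mathbb{P}$ is the set of primes, $p_m$ the $m$-th prime, $\mathbb{N}_0=\mathbb{N}\cup\{0\}$, $s=\sigma+it$. For open $G\subset\mathbb{C}$, $H(G)$ is the space of holomorphic functions on $G$ with the topology of uniform convergence on compact subsets; $\mathcal{B}(\cdot)$ is the Borel $\sigma$-field. Class $\mathcal{M}$: for $m\in\mathbb{N}$ let $g(m)\in\mathbb{N}$, $f(j,m)\in\mathbb{N}$, $a_m^{(j)}\in\mathbb{C}$ ($1\le j\le g(m)$) with $g(m)\le C_1p_m^{\alpha_0}$, $|a_m^{(j)}|\le p_m^{\beta_0}$ for constants $C_1>0$, $\alpha_0,\beta_0\ge0$; $A_m(X)=\prod_{j=1}^{g(m)}(1-a_m^{(j)}X^{f(j,m)})$, $\widetilde\varphi(s)=\prod_mA_m(p_m^{-s})^{-1}$, $\varphi(s)=\widetilde\varphi(s+\alpha_0+\beta_0)=\sum_{k\ge1}c_kk^{-s}$ ($\sigma>1$). $\varphi\in\mathcal{M}$ requires: (i) meromorphic continuation to $\sigma\ge\sigma_0$ for some $1/2\le\sigma_0<1$, with all poles $s_1(\varphi),\dots,s_l(\varphi)$ there contained in a compact set disjoint from $\sigma=\sigma_0$; (ii) $\varphi(\sigma+it)=O(|t|^{C_2})$ for $\sigma\ge\sigma_0$; (iii) $\int_0^T|\varphi(\sigma_0+it)|^2dt=O(T)$. $D_\varphi=\{s:\sigma>\sigma_0,\sigma\ne\Re s_j(\varphi),j=1,\dots,l\}$. Periodic Hurwitz zeta-function: $\zeta_j:=\zeta(s,\alpha_j;\mathfrak{B}_j)=\sum_{m\ge0}b_{mj}(m+\alpha_j)^{-s}$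 for $\sigma>1$, continued to $\mathbb{C}$ except a possible simple pole at $s=1$ with residue $b_j=\frac1{l_j}\sum_{r=0}^{l_j-1}b_{rj}$; $D_{\zeta_j}=\{\sigma>1/2\}$ if $b_j=0$, else $\{\sigma>1/2,\sigma\ne1\}$. Random element: $\gamma$ the unit circle, $\Omega_1=\prod_{p\in\mathbb{P}}\gamma$, $\Omega_{2j}=\prod_{m\in\mathbb{N}_0}\gamma$ ($j=1,\dots,r$), $\underline\Omega=\Omega_1\times\Omega_{21}\times\cdots\times\Omega_{2r}$ with probability Haar measure $m_{Hr}$ (product of the Haar measures on the factors). For $\omega_1\in\Omega_1$, $\omega_1(p)$ is its $p$-th coordinate, $\omega_1(m)=\prod_p\omega_1(p)^{g_p}$ for $m=\prod_pp^{g_p}$; $\omega_{2j}(m)$ is the $m$-th coordinate of $\omega_{2j}$. Set $\varphi(s_1,\omega_1)=\sum_{m\ge1}c_m\omega_1(m)m^{-s_1}$, $\zeta(s_{2j},\alpha_j,\omega_{2j};\mathfrak{B}_j)=\sum_{m\ge0}b_{mj}\omega_{2j}(m)(m+\alpha_j)^{-s_{2j}}$, and $\underline{Z}(\underline{s},\underline\alpha,\underline\omega)=(\varphi(s_1,\omega_1),\zeta(s_{21},\alpha_1,\omega_{21};\mathfrak{B}_1),\dots,\zeta(s_{2r},\alpha_r,\omega_{2r};\mathfrak{B}_r))$, an $\underline{H}_r$-valued random element on $(\underline\Omega,\mathcal{B}(\underline\Omega),m_{Hr})$. $\underline{P}_{\underline{Z}}(A)=m_{Hr}\{\underline\omega\in\underline\Omega:\underline{Z}(\underline{s},\underline\alpha,\underline\omega)\in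 A\}$.
   Formalization: Linear independence of L(α,h) is taken for the indexed family, so the listed elements must also be pairwise distinct; with L read as a plain set the claim fails, e.g. for r=2 with equal α_j, h_{2j}, 𝔅_j and D_{2j}. *)

theory Defs
  imports
    "HOL-Probability.Probability"
    "HOL-Complex_Analysis.Complex_Analysis"
    "HOL-Computational_Algebra.Primes"
begin

section \<open>The class of Matsumoto zeta-functions\<close>

text \<open>One-based: \<open>nth_prime 1 = 2\<close>, \<open>nth_prime 2 = 3\<close>, and so on.\<close>

definition nth_prime :: "nat \<Rightarrow> nat" where
  "nth_prime m = enumerate {p. prime p} (m - 1)"

text \<open>Throughout, \<open>a m j\<close> is the coefficient $a_m^{(j)}$ and \<open>f j m\<close> is $f(j,m)$.\<close>

definition euler_poly ::
    "(nat \<Rightarrow> nat) \<Rightarrow> (nat \<Rightarrow> nat \<Rightarrow> nat) \<Rightarrow> (nat \<Rightarrow> nat \<Rightarrow> complex) \<Rightarrow> nat \<Rightarrow> complex \<Rightarrow> complex" where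
  "euler_poly g f a m X = (\<Prod>j=1..g m. 1 - a m j * X ^ f j m)"

definition euler_product ::
    "(nat \<Rightarrow> nat) \<Rightarrow> (nat \<Rightarrow> nat \<Rightarrow> nat) \<Rightarrow> (nat \<Rightarrow> nat \<Rightarrow> complex) \<Rightarrow> complex \<Rightarrow> complex" where
  "euler_product g f a s =
     (\<Prod>m. inverse (euler_poly g f a (Suc m) (of_nat (nth_prime (Suc m)) powr (- s))))"

definition euler_data ::
    "(nat \<Rightarrow> nat) \<Rightarrow> (nat \<Rightarrow> nat \<Rightarrow> nat) \<Rightarrow> (nat \<Rightarrow> nat \<Rightarrow> complex) \<Rightarrow> real \<Rightarrow> real \<Rightarrow> real \<Rightarrow> bool" where
  "euler_data g f a C1 \<alpha>0 \<beta>0 \<longleftrightarrow>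
     C1 > 0 \<and> \<alpha>0 \<ge> 0 \<and> \<beta>0 \<ge> 0 \<and>
     (\<forall>m\<ge>1. 1 \<le> g m \<and> real (g m) \<le> C1 * real (nth_prime m) powr \<alpha>0 \<and>
        (\<forall>j\<in>{1..g m}. 1 \<le> f j m \<and> cmod (a m j) \<le> real (nth_prime m) powr \<beta>0))"

definition poles_right :: "real \<Rightarrow> (complex \<Rightarrow> complex) \<Rightarrow> complex set" where
  "poles_right \<sigma>0 \<phi> = {z. Re z \<ge> \<sigma>0 \<and> is_pole \<phi> z}"

text \<open>
  \<open>matsumoto_class \<sigma>0 \<phi> c\<close>: the function \<open>\<phi>\<close> belongs to the class, \<open>\<sigma>0\<close> is an abscissa for which
  the three analytic conditions hold, and \<open>c k\<close> for \<open>k \<ge> 1\<close> are the Dirichlet coefficients of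
  \<open>\<phi>\<close> (the value \<open>c 0\<close> is never used). The total function \<open>\<phi>\<close> is itself the meromorphic
  continuation; \<open>nicely_meromorphic_on\<close> is meromorphy plus the convention that removable
  singularities are filled in and that the junk value at a pole is \<open>0\<close>. The values of \<open>\<phi>\<close> to
  the left of \<open>\<sigma>0\<close> play no role.
\<close>

definition matsumoto_class :: "real \<Rightarrow> (complex \<Rightarrow> complex) \<Rightarrow> (nat \<Rightarrow> complex) \<Rightarrow> bool" where
  "matsumoto_class \<sigma>0 \<phi> c \<longleftrightarrow>
     (\<exists>g f a C1 \<alpha>0 \<beta>0. euler_data g f a C1 \<alpha>0 \<beta>0 \<and>
        (\<forall>s. Re s > 1 \<longrightarrow> \<phi> s = euler_product g f a (s + of_real (\<alpha>0 + \<beta>0)))) \<and>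
     (\<forall>s. Re s > 1 \<longrightarrow> (\<lambda>k. c (Suc k) * of_nat (Suc k) powr (- s)) sums \<phi> s) \<and>
     1/2 \<le> \<sigma>0 \<and> \<sigma>0 < 1 \<and>
     \<phi> nicely_meromorphic_on {s. Re s \<ge> \<sigma>0} \<and>
     (\<exists>K. compact K \<and> K \<inter> {s. Re s = \<sigma>0} = {} \<and> poles_right \<sigma>0 \<phi> \<subseteq> K) \<and>
     (\<exists>C2 B T0. T0 > 0 \<and>
        (\<forall>s. Re s \<ge> \<sigma>0 \<and> \<bar>Im s\<bar> \<ge> T0 \<longrightarrow> cmod (\<phi> s) \<le> B * \<bar>Im s\<bar> powr C2)) \<and>
     (\<lambda>T. integral {0..T} (\<lambda>t. (cmod (\<phi> (Complex \<sigma>0 t)))\<^sup>2)) \<in> O[at_top](\<lambda>T. T)"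

definition D_matsumoto :: "real \<Rightarrow> (complex \<Rightarrow> complex) \<Rightarrow> complex set" where
  "D_matsumoto \<sigma>0 \<phi> = {s. Re s > \<sigma>0 \<and> (\<forall>z\<in>poles_right \<sigma>0 \<phi>. Re s \<noteq> Re z)}"


section \<open>Periodic Hurwitz zeta-functions\<close>

definition minimal_period :: "(nat \<Rightarrow> complex) \<Rightarrow> nat \<Rightarrow> bool" where
  "minimal_period b l \<longleftrightarrow>
     l > 0 \<and> (\<forall>m. b (m + l) = b m) \<and> (\<forall>l'. 0 < l' \<and> l' < l \<longrightarrow> \<not> (\<forall>m. b (m + l') = b m))"

definition period_mean :: "(nat \<Rightarrow> complex) \<Rightarrow> nat \<Rightarrow> complex" where
  "period_mean b l = (\<Sum>m<l. b m) / of_nat l"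

text \<open>
  Here \<open>b m\<close> is $b_{mj}$ for a fixed $j$; for the whole collection \<open>b j m\<close> is $b_{mj}$.
  \<open>is_periodic_hurwitz_zeta \<alpha> b Z\<close>: \<open>Z\<close> is the periodic Hurwitz zeta-function of \<open>\<alpha>\<close> and \<open>b\<close>. By the identity theorem this
  determines \<open>Z\<close> on the whole plane: \<open>nicely_meromorphic_on\<close> fixes the value at \<open>1\<close>, which is the
  limit there if the singularity is removable and \<open>0\<close> if \<open>1\<close> is a pole.
\<close>

definition is_periodic_hurwitz_zeta ::
    "real \<Rightarrow> (nat \<Rightarrow> complex) \<Rightarrow> (complex \<Rightarrow> complex) \<Rightarrow> bool" where
  "is_periodic_hurwitz_zeta \<alpha> b Z \<longleftrightarrow>
     (\<forall>s. Re s > 1 \<longrightarrow> (\<lambda>m. b m * (of_nat m + of_real \<alpha>) powr (- s)) sums Z s) \<and>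
     Z holomorphic_on (- {1}) \<and> Z nicely_meromorphic_on UNIV"

definition D_hurwitz :: "(nat \<Rightarrow> complex) \<Rightarrow> nat \<Rightarrow> complex set" where
  "D_hurwitz b l =
     (if period_mean b l = 0 then {s. Re s > 1/2} else {s. Re s > 1/2 \<and> Re s \<noteq> 1})"


section \<open>Linear independence over the rationals\<close>

text \<open>
  The elements of $L(\underline\alpha,\underline h)$ are indexed, because their linear independence
  is that of a family: in particular no two members of the list coincide. (For the mere underlying
  set, two identical periodic Hurwitz zeta-functions with equal steps would be admitted.)
\<close>

datatype L_index = Ind_Prime nat | Ind_Hurwitz nat nat | Ind_Pi

fun L_elem :: "real \<Rightarrow> (nat \<Rightarrow> real) \<Rightarrow> (nat \<Rightarrow> real) \<Rightarrow> L_index \<Rightarrow> real" where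
  "L_elem h1 h2 \<alpha> (Ind_Prime p) = h1 * ln (real p)"
| "L_elem h1 h2 \<alpha> (Ind_Hurwitz j m) = h2 j * ln (real m + \<alpha> j)"
| "L_elem h1 h2 \<alpha> Ind_Pi = pi"

definition L_indices :: "nat \<Rightarrow> L_index set" where
  "L_indices r =
     Ind_Prime ` {p. prime p} \<union> (\<Union>j\<in>{1..r}. Ind_Hurwitz j ` UNIV) \<union> {Ind_Pi}"

definition rat_independent_family :: "('i \<Rightarrow> real) \<Rightarrow> 'i set \<Rightarrow> bool" where
  "rat_independent_family x I \<longleftrightarrow>
     inj_on x I \<and> module.independent (\<lambda>(q::rat) (y::real). of_rat q * y) (x ` I)"


section \<open>Spaces of holomorphic functions, Borel sets, weak convergence\<close>

text \<open>
  Holomorphic functions on \<open>G\<close> are total functions that are \<open>undefined\<close> off \<open>G\<close>, so that equality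
  in the type is equality on \<open>G\<close>.
\<close>

definition hol_space :: "complex set \<Rightarrow> (complex \<Rightarrow> complex) set" where
  "hol_space G = {f. f \<in> extensional G \<and> f holomorphic_on G}"

definition hol_topology :: "complex set \<Rightarrow> (complex \<Rightarrow> complex) topology" where
  "hol_topology G = topology (\<lambda>U. U \<subseteq> hol_space G \<and>
     (\<forall>f\<in>U. \<exists>K e. compact K \<and> K \<subseteq> G \<and> e > 0 \<and>
        {g \<in> hol_space G. \<forall>z\<in>K. dist (g z) (f z) < e} \<subseteq> U))"

lemma openin_hol_topology:
  "openin (hol_topology G) U \<longleftrightarrow> U \<subseteq> hol_space G \<and>
     (\<forall>f\<in>U. \<exists>K e. compact K \<and> K \<subseteq> G \<and> e > 0 \<and>
        {g \<in> hol_space G. \<forall>z\<in>K. dist (g z) (f z) < e} \<subseteq> U)"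
proof -
  define V where "V = (\<lambda>f K e. {g \<in> hol_space G. \<forall>z\<in>K. dist (g z) (f z) < e})"
  define N where "N = (\<lambda>U f. \<exists>K e. compact K \<and> K \<subseteq> G \<and> e > 0 \<and> V f K e \<subseteq> U)"
  have N_mono: "N U' f" if "N U f" "U \<subseteq> U'" for U U' f
    using that unfolding N_def by (meson order_trans)
  have N_Int: "N (S \<inter> T) f" if S: "N S f" and T: "N T f" for S T f
  proof -
    obtain K e where 1: "compact K" "K \<subseteq> G" "e > 0" "V f K e \<subseteq> S"
      using S unfolding N_def by (elim exE conjE)
    obtain K' e' where 2: "compact K'" "K' \<subseteq> G" "e' > 0" "V f K' e' \<subseteq> T"
      using T unfolding N_def by (elim exE conjE)
    have "V f (K \<union> K') (min e e') \<subseteq> V f K e \<inter> V f K' e'"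
      unfolding V_def by auto
    with 1 2 have "V f (K \<union> K') (min e e') \<subseteq> S \<inter> T" by (meson Int_mono order_trans)
    moreover have "compact (K \<union> K')" "K \<union> K' \<subseteq> G" "min e e' > 0"
      using 1 2 by auto
    ultimately show ?thesis unfolding N_def by (intro exI conjI)
  qed
  have "istopology (\<lambda>U. U \<subseteq> hol_space G \<and> (\<forall>f\<in>U. N U f))"
    unfolding istopology_def
  proof (rule conjI; intro allI impI)
    fix S T assume "S \<subseteq> hol_space G \<and> (\<forall>f\<in>S. N S f)" "T \<subseteq> hol_space G \<and> (\<forall>f\<in>T. N T f)"
    then show "S \<inter> T \<subseteq> hol_space G \<and> (\<forall>f\<in>S \<inter> T. N (S \<inter> T) f)"
      using N_Int by auto
  next
    fix \<U> assume U: "\<forall>S\<in>\<U>. S \<subseteq> hol_space G \<and> (\<forall>f\<in>S. N S f)"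
    have "N (\<Union>\<U>) f" if "S \<in> \<U>" "f \<in> S" for S f
      using U that by (intro N_mono[of S f "\<Union>\<U>"]) auto
    with U show "\<Union>\<U> \<subseteq> hol_space G \<and> (\<forall>f\<in>\<Union>\<U>. N (\<Union>\<U>) f)" by auto
  qed
  then show ?thesis
    unfolding hol_topology_def N_def V_def by (simp add: topology_inverse')
qed

lemma topspace_hol_topology [simp]: "topspace (hol_topology G) = hol_space G"
proof -
  have "openin (hol_topology G) (hol_space G)"
    unfolding openin_hol_topology by (auto intro!: exI[of _ "{}"] exI[of _ "1::real"])
  moreover have "topspace (hol_topology G) \<subseteq> hol_space G"
    using openin_topspace[of "hol_topology G"] unfolding openin_hol_topology by blast
  ultimately show ?thesis
    using openin_subset by blast
qed

definition borel_of :: "'a topology \<Rightarrow> 'a measure" where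
  "borel_of T = sigma (topspace T) {U. openin T U}"

lemma space_borel_of: "space (borel_of T) = topspace T"
  by (auto simp: borel_of_def space_measure_of_conv)

lemma sets_borel_of: "sets (borel_of T) = sigma_sets (topspace T) {U. openin T U}"
  unfolding borel_of_def by (rule sets_measure_of) (use openin_subset in auto)

text \<open>
  Requiring all measures to be probability measures on the Borel sets rules out degenerate
  readings of \<open>distr\<close>, which is the null measure if the map is not measurable.
\<close>

definition weakly_converges :: "'a topology \<Rightarrow> (nat \<Rightarrow> 'a measure) \<Rightarrow> 'a measure \<Rightarrow> bool" where
  "weakly_converges T \<mu> \<nu> \<longleftrightarrow>
     (\<forall>n. prob_space (\<mu> n) \<and> sets (\<mu> n) = sets (borel_of T)) \<and>
     prob_space \<nu> \<and> sets \<nu> = sets (borel_of T) \<and>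
     (\<forall>f. continuous_map T euclideanreal f \<and> bounded (f ` topspace T) \<longrightarrow>
        (\<lambda>n. \<integral>x. f x \<partial>\<mu> n) \<longlonglongrightarrow> (\<integral>x. f x \<partial>\<nu>))"

definition H_product ::
    "nat \<Rightarrow> complex set \<Rightarrow> (nat \<Rightarrow> complex set) \<Rightarrow>
       ((complex \<Rightarrow> complex) \<times> (nat \<Rightarrow> complex \<Rightarrow> complex)) topology" where
  "H_product r D1 D2 =
     prod_topology (hol_topology D1) (product_topology (\<lambda>j. hol_topology (D2 j)) {1..r})"


section \<open>The torus and its Haar measure\<close>

text \<open>
  Normalised arc length, i.e. the Haar probability measure of the unit circle; invariance is
  \<open>circle_measure_rotation\<close>.
\<close>

definition circle_measure :: "complex measure" where
  "circle_measure =
     distr (uniform_measure lborel {0..<1}) (restrict_space borel (sphere 0 1))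
       (\<lambda>t::real. cis (2 * pi * t))"

text \<open>
  The components of \<open>(\<omega>1, \<omega>2)\<close> are \<open>\<omega>1 p\<close> for primes \<open>p\<close> and \<open>\<omega>2 j m\<close> for
  \<open>j \<in> {1..r}\<close> and all \<open>m\<close>. The index sets are countable and the circle is second countable, so the
  product sigma-algebra is the Borel sigma-algebra of the product topology. Translation invariance
  is \<open>torus_haar_invariant\<close>.
\<close>

definition torus_haar :: "nat \<Rightarrow> ((nat \<Rightarrow> complex) \<times> (nat \<Rightarrow> nat \<Rightarrow> complex)) measure" where
  "torus_haar r =
     (\<Pi>\<^sub>M p\<in>{p. prime p}. circle_measure) \<Otimes>\<^sub>M
     (\<Pi>\<^sub>M j\<in>{1..r}. \<Pi>\<^sub>M m\<in>UNIV. circle_measure)"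

definition torus_mult ::
    "nat \<Rightarrow> (nat \<Rightarrow> complex) \<times> (nat \<Rightarrow> nat \<Rightarrow> complex) \<Rightarrow>
       (nat \<Rightarrow> complex) \<times> (nat \<Rightarrow> nat \<Rightarrow> complex) \<Rightarrow> (nat \<Rightarrow> complex) \<times> (nat \<Rightarrow> nat \<Rightarrow> complex)" where
  "torus_mult r a \<omega> =
     ((\<lambda>p\<in>{p. prime p}. fst a p * fst \<omega> p), (\<lambda>j\<in>{1..r}. \<lambda>m. snd a j m * snd \<omega> j m))"

lemma space_circle_measure [simp]: "space circle_measure = sphere 0 1"
  by (simp add: circle_measure_def space_restrict_space)

lemma sets_circle_measure [measurable_cong]:
  "sets circle_measure = sets (restrict_space borel (sphere 0 1))"
  by (simp add: circle_measure_def)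

lemma measurable_cis_circle:
  "(\<lambda>t::real. cis (2 * pi * t)) \<in> borel \<rightarrow>\<^sub>M restrict_space borel (sphere 0 1)"
  by (intro measurable_restrict_space2 borel_measurable_continuous_onI)
     (auto intro!: continuous_intros)

lemma prob_space_circle_measure: "prob_space circle_measure"
  unfolding circle_measure_def
proof (rule prob_space.prob_space_distr)
  show "prob_space (uniform_measure lborel {0..<1::real})"
    by (rule prob_space_uniform_measure) auto
  show "(\<lambda>t::real. cis (2 * pi * t)) \<in>
      uniform_measure lborel {0..<1} \<rightarrow>\<^sub>M restrict_space borel (sphere 0 1)"
    using measurable_cis_circle by (simp add: measurable_def)
qed

lemma measurable_circle_mult:
  assumes "w \<in> sphere 0 1"
  shows "(*) w \<in> circle_measure \<rightarrow>\<^sub>M circle_measure"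
proof -
  have "(*) w \<in> restrict_space borel (sphere 0 1) \<rightarrow>\<^sub>M restrict_space borel (sphere 0 1)"
    using assms by (intro measurable_restrict_space3) (auto simp: norm_mult)
  then show ?thesis
    by (simp cong: measurable_cong_sets add: sets_circle_measure)
qed

lemma emeasure_circle_measure:
  assumes "A \<in> sets circle_measure"
  shows "emeasure circle_measure A = emeasure lborel ({0..<1} \<inter> {t. cis (2 * pi * t) \<in> A})"
proof -
  have A: "A \<in> sets (restrict_space borel (sphere 0 1))"
    using assms by (simp add: sets_circle_measure)
  have m: "(\<lambda>t::real. cis (2 * pi * t)) \<in>
      uniform_measure lborel {0..<1} \<rightarrow>\<^sub>M restrict_space borel (sphere 0 1)"
    using measurable_cis_circle by (simp add: measurable_def)
  have "{t. cis (2 * pi * t) \<in> A} \<in> sets borel"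
    using measurable_sets[OF measurable_cis_circle A] by (simp add: vimage_def)
  then show ?thesis
    unfolding circle_measure_def
    by (simp add: emeasure_distr[OF m A] vimage_def emeasure_uniform_measure divide_ennreal_def)
qed

lemma circle_measure_rotation:
  assumes w: "w \<in> sphere 0 1"
  shows "distr circle_measure circle_measure ((*) w) = circle_measure"
proof (rule measure_eqI)
  fix A assume "A \<in> sets (distr circle_measure circle_measure ((*) w))"
  then have A: "A \<in> sets circle_measure" by simp
  define u where "u = frac (Arg w / (2 * pi))"
  have u: "0 \<le> u" "u < 1" by (auto simp: u_def frac_lt_1)
  have "Arg w = 2 * pi * u + 2 * pi * of_int \<lfloor>Arg w / (2 * pi)\<rfloor>"
    by (simp add: u_def frac_def field_simps)
  then have "cis (Arg w) = cis (2 * pi * u) * cis (2 * pi * of_int \<lfloor>Arg w / (2 * pi)\<rfloor>)"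
    by (simp only: cis_mult)
  also have "\<dots> = cis (2 * pi * u)"
    using cis_multiple_2pi[OF Ints_of_int] by simp
  finally have "cis (Arg w) = cis (2 * pi * u)" .
  moreover have "cis (Arg w) = w"
    using w complex_norm_eq_1_exp_eq[of w] by (simp add: cis_conv_exp)
  ultimately have wu: "w = cis (2 * pi * u)" by simp
  define B where "B = {t::real. cis (2 * pi * t) \<in> A}"
  have B[measurable]: "B \<in> sets borel"
    using measurable_sets[OF measurable_cis_circle, of A] A
    by (simp add: vimage_def B_def sets_circle_measure)
  have per: "1 + t \<in> B \<longleftrightarrow> t \<in> B" for t
    by (simp add: B_def distrib_left cis_mult[symmetric])
  have shift: "emeasure lborel X = emeasure lborel {t. v + t \<in> X}"
    if "X \<in> sets borel" for X and v :: real
    using that by (subst lborel_distr_plus[of v, symmetric])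
      (simp add: emeasure_distr vimage_def)
  have mX: "(*) w -` A \<inter> space circle_measure \<in> sets circle_measure"
    by (rule measurable_sets[OF measurable_circle_mult[OF w] A])
  have "emeasure (distr circle_measure circle_measure ((*) w)) A =
      emeasure circle_measure ((*) w -` A \<inter> space circle_measure)"
    by (rule emeasure_distr[OF measurable_circle_mult[OF w] A])
  also have "\<dots> = emeasure lborel ({0..<1} \<inter> {t. u + t \<in> B})"
    by (subst emeasure_circle_measure[OF mX])
       (simp add: B_def wu distrib_left cis_mult)
  also have "\<dots> = emeasure lborel ({u..<1 + u} \<inter> B)"
    by (subst shift[of "{u..<1 + u} \<inter> B" u]) (auto intro!: arg_cong2[of _ _ _ _ emeasure])
  also have "\<dots> = emeasure lborel (({u..<1} \<inter> B) \<union> ({1..<1 + u} \<inter> B))"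
    using u by (intro arg_cong2[of _ _ _ _ emeasure]) auto
  also have "\<dots> = emeasure lborel ({u..<1} \<inter> B) + emeasure lborel ({1..<1 + u} \<inter> B)"
    by (subst plus_emeasure) auto
  also have "emeasure lborel ({1..<1 + u} \<inter> B) = emeasure lborel ({0..<u} \<inter> B)"
    by (subst shift[of "{1..<1 + u} \<inter> B" 1]) (auto intro!: arg_cong2[of _ _ _ _ emeasure] simp: per)
  also have "emeasure lborel ({u..<1} \<inter> B) + \<dots> = emeasure lborel ({0..<1} \<inter> B)"
    using u by (subst plus_emeasure) (auto intro!: arg_cong2[of _ _ _ _ emeasure])
  also have "\<dots> = emeasure circle_measure A"
    by (simp add: emeasure_circle_measure[OF A] B_def)
  finally show "emeasure (distr circle_measure circle_measure ((*) w)) A = emeasure circle_measure A" .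
qed simp

lemma PiM_invariant:
  fixes M :: "'i \<Rightarrow> 'a measure"
  assumes M: "\<And>i. i \<in> I \<Longrightarrow> prob_space (M i)"
    and f: "\<And>i. i \<in> I \<Longrightarrow> f i \<in> M i \<rightarrow>\<^sub>M M i"
    and inv: "\<And>i. i \<in> I \<Longrightarrow> distr (M i) (M i) (f i) = M i"
  shows "(\<lambda>\<omega>. \<lambda>i\<in>I. f i (\<omega> i)) \<in> PiM I M \<rightarrow>\<^sub>M PiM I M"
    and "distr (PiM I M) (PiM I M) (\<lambda>\<omega>. \<lambda>i\<in>I. f i (\<omega> i)) = PiM I M"
proof -
  let ?F = "\<lambda>\<omega>. \<lambda>i\<in>I. f i (\<omega> i)"
  show meas: "?F \<in> PiM I M \<rightarrow>\<^sub>M PiM I M"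
    using f by (intro measurable_restrict) (auto intro: measurable_compose[OF measurable_component_singleton])
  define N where "N i = (if i \<in> I then M i else return (count_space UNIV) undefined)" for i
  have NM: "PiM I N = PiM I M" by (intro PiM_cong) (auto simp: N_def)
  interpret N: product_prob_space N I
    by (rule product_prob_spaceI) (auto simp: N_def M intro!: prob_space_return)
  have "PiM I N = distr (PiM I M) (PiM I M) ?F"
  proof (rule sym, rule N.PiM_eq)
    show "sets (distr (PiM I M) (PiM I M) ?F) = sets (PiM I N)" by (simp add: NM)
    fix J A assume J: "finite J" "J \<subseteq> I" "\<And>j. j \<in> J \<Longrightarrow> A j \<in> sets (N j)"
    have A: "A j \<in> sets (M j)" if "j \<in> J" for j
    proof -
      have "j \<in> I" using J(2) that by blast
      then show ?thesis using J(3)[OF that] by (simp add: N_def)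
    qed
    have pre: "f j -` A j \<inter> space (M j) \<in> sets (M j)" if "j \<in> J" for j
      using that J A f by (blast intro: measurable_sets)
    have "prod_emb I M J (PiE J A) \<in> sets (PiM I M)"
      using J A by (intro sets_PiM_I) auto
    moreover have "prod_emb I N J (PiE J A) = prod_emb I M J (PiE J A)"
      using J(2) by (auto simp: prod_emb_def N_def PiE_def Pi_def extensional_def)
    ultimately have "emeasure (distr (PiM I M) (PiM I M) ?F) (prod_emb I N J (PiE J A)) =
        emeasure (PiM I M) (?F -` prod_emb I M J (PiE J A) \<inter> space (PiM I M))"
      by (simp add: emeasure_distr[OF meas])
    also have "?F -` prod_emb I M J (PiE J A) \<inter> space (PiM I M) =
        prod_emb I M J (PiE J (\<lambda>j. f j -` A j \<inter> space (M j)))"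
      using J(2) measurable_space[OF f] by (auto simp: prod_emb_def space_PiM PiE_iff
          extensional_def Pi_iff restrict_def subset_eq)
    also have "emeasure (PiM I M) \<dots> = (\<Prod>j\<in>J. emeasure (M j) (f j -` A j \<inter> space (M j)))"
      using J pre by (intro emeasure_PiM_emb M) auto
    also have "\<dots> = (\<Prod>j\<in>J. emeasure (M j) (A j))"
    proof (rule prod.cong)
      fix j assume "j \<in> J"
      then have "j \<in> I" using J by auto
      then show "emeasure (M j) (f j -` A j \<inter> space (M j)) = emeasure (M j) (A j)"
        using emeasure_distr[OF f A, of j] inv \<open>j \<in> J\<close> by metis
    qed simp
    also have "\<dots> = (\<Prod>j\<in>J. emeasure (N j) (A j))"
      using J by (intro prod.cong) (auto simp: N_def)
    finally show "emeasure (distr (PiM I M) (PiM I M) ?F) (prod_emb I N J (PiE J A)) =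
        (\<Prod>j\<in>J. emeasure (N j) (A j))" .
  qed
  then show "distr (PiM I M) (PiM I M) ?F = PiM I M" by (simp add: NM)
qed

lemma prob_space_torus_haar: "prob_space (torus_haar r)"
  unfolding torus_haar_def
  by (intro prob_space_pair prob_space_PiM prob_space_circle_measure)

lemma torus_haar_invariant:
  assumes a: "a \<in> space (torus_haar r)"
  shows "distr (torus_haar r) (torus_haar r) (torus_mult r a) = torus_haar r"
proof -
  let ?M1 = "\<Pi>\<^sub>M p\<in>{p::nat. prime p}. circle_measure"
  let ?C = "\<Pi>\<^sub>M m\<in>(UNIV::nat set). circle_measure"
  let ?M2 = "\<Pi>\<^sub>M j\<in>{1..r}. ?C"
  let ?f1 = "\<lambda>x. \<lambda>p\<in>{p::nat. prime p}. fst a p * x p"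
  let ?f2 = "\<lambda>y. \<lambda>j\<in>{1..r}. (\<lambda>z m. snd a j m * z m) (y j)"
  have a1: "fst a p \<in> sphere 0 1" if "prime p" for p
    using a that by (auto simp: torus_haar_def space_pair_measure space_PiM PiE_iff)
  have a2: "snd a j m \<in> sphere 0 1" if "j \<in> {1..r}" for j m
    using a that by (auto simp: torus_haar_def space_pair_measure space_PiM PiE_iff)
  note 1 = PiM_invariant[of "{p::nat. prime p}" "\<lambda>_. circle_measure" "\<lambda>p. (*) (fst a p)",
      OF prob_space_circle_measure measurable_circle_mult circle_measure_rotation]
  have f1: "?f1 \<in> ?M1 \<rightarrow>\<^sub>M ?M1" "distr ?M1 ?M1 ?f1 = ?M1"
    using 1 a1 by auto
  have f: "(\<lambda>z m. snd a j m * z m) \<in> ?C \<rightarrow>\<^sub>M ?C"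
    "distr ?C ?C (\<lambda>z m. snd a j m * z m) = ?C" if "j \<in> {1..r}" for j
    using PiM_invariant[of "UNIV::nat set" "\<lambda>_. circle_measure" "\<lambda>m. (*) (snd a j m)",
      OF prob_space_circle_measure measurable_circle_mult circle_measure_rotation] a2[OF that]
    by (simp_all add: restrict_UNIV)
  have C: "prob_space ?C" by (intro prob_space_PiM prob_space_circle_measure)
  have f2: "?f2 \<in> ?M2 \<rightarrow>\<^sub>M ?M2" "distr ?M2 ?M2 ?f2 = ?M2"
    using PiM_invariant[of "{1..r}" "\<lambda>_. ?C" "\<lambda>j z m. snd a j m * z m", OF C f] by auto
  have "prob_space ?M2" by (intro prob_space_PiM C)
  then have "sigma_finite_measure ?M2"
    by (rule prob_space_imp_sigma_finite)
  then have "?M1 \<Otimes>\<^sub>M ?M2 = distr (?M1 \<Otimes>\<^sub>M ?M2) (?M1 \<Otimes>\<^sub>M ?M2) (\<lambda>(x, y). (?f1 x, ?f2 y))"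
    by (rule pair_measure_distr[OF f1(1) f2(1), unfolded f1(2) f2(2)])
  then have "distr (torus_haar r) (torus_haar r) (\<lambda>(x, y). (?f1 x, ?f2 y)) = torus_haar r"
    unfolding torus_haar_def by (rule sym)
  also have "(\<lambda>(x, y). (?f1 x, ?f2 y)) = torus_mult r a"
    by (simp add: torus_mult_def fun_eq_iff split_beta)
  finally show ?thesis .
qed

section \<open>The random element\<close>

definition omega_ext :: "(nat \<Rightarrow> complex) \<Rightarrow> nat \<Rightarrow> complex" where
  "omega_ext \<omega> m = (\<Prod>p\<in>prime_factors m. \<omega> p ^ multiplicity p m)"

text \<open>
  The sum of a function series as an element of \<open>hol_space G\<close>. The random series below converge
  locally uniformly only for almost every \<open>\<omega>\<close>; on the exceptional null set the random element is
  taken to be \<open>0\<close>, which does not influence its distribution.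
\<close>

definition hol_series :: "complex set \<Rightarrow> (nat \<Rightarrow> complex \<Rightarrow> complex) \<Rightarrow> complex \<Rightarrow> complex" where
  "hol_series G u =
     (if \<forall>K. compact K \<and> K \<subseteq> G \<longrightarrow> uniformly_convergent_on K (\<lambda>n s. \<Sum>m<n. u m s)
      then (\<lambda>s\<in>G. \<Sum>m. u m s) else (\<lambda>s\<in>G. 0))"

definition random_matsumoto ::
    "complex set \<Rightarrow> (nat \<Rightarrow> complex) \<Rightarrow> (nat \<Rightarrow> complex) \<Rightarrow> complex \<Rightarrow> complex" where
  "random_matsumoto G c \<omega> =
     hol_series G (\<lambda>k s. c (Suc k) * omega_ext \<omega> (Suc k) * of_nat (Suc k) powr (- s))"

definition random_hurwitz ::
    "complex set \<Rightarrow> real \<Rightarrow> (nat \<Rightarrow> complex) \<Rightarrow> (nat \<Rightarrow> complex) \<Rightarrow> complex \<Rightarrow> complex" where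
  "random_hurwitz G \<alpha> b \<omega> =
     hol_series G (\<lambda>m s. b m * \<omega> m * (of_nat m + of_real \<alpha>) powr (- s))"

definition random_Z ::
    "nat \<Rightarrow> complex set \<Rightarrow> (nat \<Rightarrow> complex set) \<Rightarrow> (nat \<Rightarrow> complex) \<Rightarrow> (nat \<Rightarrow> real) \<Rightarrow>
       (nat \<Rightarrow> nat \<Rightarrow> complex) \<Rightarrow> (nat \<Rightarrow> complex) \<times> (nat \<Rightarrow> nat \<Rightarrow> complex) \<Rightarrow>
       (complex \<Rightarrow> complex) \<times> (nat \<Rightarrow> complex \<Rightarrow> complex)" where
  "random_Z r D1 D2 c \<alpha> b \<omega> =
     (random_matsumoto D1 c (fst \<omega>),
      (\<lambda>j\<in>{1..r}. random_hurwitz (D2 j) (\<alpha> j) (b j) (snd \<omega> j)))"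

definition P_Z ::
    "nat \<Rightarrow> complex set \<Rightarrow> (nat \<Rightarrow> complex set) \<Rightarrow> (nat \<Rightarrow> complex) \<Rightarrow> (nat \<Rightarrow> real) \<Rightarrow>
       (nat \<Rightarrow> nat \<Rightarrow> complex) \<Rightarrow> ((complex \<Rightarrow> complex) \<times> (nat \<Rightarrow> complex \<Rightarrow> complex)) measure" where
  "P_Z r D1 D2 c \<alpha> b =
     distr (torus_haar r) (borel_of (H_product r D1 D2)) (random_Z r D1 D2 c \<alpha> b)"


section \<open>Discrete shifts\<close>

definition shifted_Z ::
    "nat \<Rightarrow> complex set \<Rightarrow> (nat \<Rightarrow> complex set) \<Rightarrow> (complex \<Rightarrow> complex) \<Rightarrow>
       (nat \<Rightarrow> complex \<Rightarrow> complex) \<Rightarrow> real \<Rightarrow> (nat \<Rightarrow> real) \<Rightarrow> nat \<Rightarrow>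
       (complex \<Rightarrow> complex) \<times> (nat \<Rightarrow> complex \<Rightarrow> complex)" where
  "shifted_Z r D1 D2 \<phi> \<zeta> h1 h2 k =
     ((\<lambda>s\<in>D1. \<phi> (s + \<i> * of_nat k * of_real h1)),
      (\<lambda>j\<in>{1..r}. \<lambda>s\<in>D2 j. \<zeta> j (s + \<i> * of_nat k * of_real (h2 j))))"

definition P_shift ::
    "nat \<Rightarrow> complex set \<Rightarrow> (nat \<Rightarrow> complex set) \<Rightarrow> (complex \<Rightarrow> complex) \<Rightarrow>
       (nat \<Rightarrow> complex \<Rightarrow> complex) \<Rightarrow> real \<Rightarrow> (nat \<Rightarrow> real) \<Rightarrow> nat \<Rightarrow>
       ((complex \<Rightarrow> complex) \<times> (nat \<Rightarrow> complex \<Rightarrow> complex)) measure" where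
  "P_shift r D1 D2 \<phi> \<zeta> h1 h2 N =
     distr (uniform_count_measure {0..N}) (borel_of (H_product r D1 D2))
       (shifted_Z r D1 D2 \<phi> \<zeta> h1 h2)"

lemma measure_P_shift:
  assumes "\<And>k. shifted_Z r D1 D2 \<phi> \<zeta> h1 h2 k \<in> topspace (H_product r D1 D2)"
    and "A \<in> sets (borel_of (H_product r D1 D2))"
  shows "measure (P_shift r D1 D2 \<phi> \<zeta> h1 h2 N) A =
           real (card {k\<in>{0..N}. shifted_Z r D1 D2 \<phi> \<zeta> h1 h2 k \<in> A}) / (real N + 1)"
proof -
  let ?Z = "shifted_Z r D1 D2 \<phi> \<zeta> h1 h2"
  have "?Z \<in> measurable (uniform_count_measure {0..N}) (borel_of (H_product r D1 D2))"
    using assms(1) by (simp add: measurable_def space_borel_of sets_uniform_count_measure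
        space_uniform_count_measure)
  then have "measure (P_shift r D1 D2 \<phi> \<zeta> h1 h2 N) A =
      measure (uniform_count_measure {0..N}) (?Z -` A \<inter> {0..N})"
    unfolding P_shift_def using assms(2) by (simp add: measure_distr space_uniform_count_measure)
  also have "?Z -` A \<inter> {0..N} = {k\<in>{0..N}. ?Z k \<in> A}" by auto
  also have "measure (uniform_count_measure {0..N}) {k\<in>{0..N}. ?Z k \<in> A} =
      real (card {k\<in>{0..N}. ?Z k \<in> A}) / real (card {0..N})"
    by (rule measure_uniform_count_measure) auto
  finally show ?thesis by simp
qed

end

theory Submission
  imports Defs "HOL-Real_Asymp.Real_Asymp"
begin

text \<open>
All component functions are treated alike, as Dirichlet series \<open>\<Sum>m. a m * (m + \<beta>) powr (- s)\<close> that
continue to a half-plane up to finite order and with a mean square \<open>O(T)\<close> on its boundary line;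
the Euler product plays no role. Mean square estimates bound \<open>\<Sum>m. \<bar>a m\<bar>\<^sup>2 * (m + \<beta>) powr (- 2 * \<sigma>)\<close>,
so \<open>F\<close> minus a partial sum has bounded mean square on any interior line, while far to the right it is
uniformly small by absolute convergence. Cauchy's integral formula interpolates between the two lines
and shows that partial sums approximate \<open>F\<close> uniformly on compact sets, in mean square over the
discrete shifts.
For a partial sum the shifts by \<open>\<i> k h\<close> multiply the coefficients by values of characters of
the torus along an orbit, and linear independence makes the orbit equidistributed.
On the torus the characters are orthonormal, so the random series converges almost
surely, again uniformly on compact sets, with the same square-summable coefficients. Since
lower semicontinuous functions are limits of Lipschitz ones, it suffices to compare
averages of Lipschitz functions, where both approximations can be applied.
\<close>

section \<open>Discrete mean squares from mean squares on vertical lines\<close>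

text \<open>The random factors at distinct integers in the series of \<phi> are products of the same
  torus coordinates: orthogonal, but not independent. Almost sure convergence therefore rests on a
  Rademacher--Menshov maximal inequality; its logarithmic loss is harmless, since a small move of
  the abscissa gains a geometric factor on dyadic blocks. Square summability is a Bessel inequality.
  It needs the means of F against (m + \<beta>)^s on interior lines, obtained from Re s = 3 by
  Cauchy's theorem; the horizontal sides are O(sqrt T) because suprema over unit boxes are
  square-bounded on average, whereas the assumed growth of arbitrary order would not do. In the
  interpolation the weight exp(y (w - s)) is decisive: the mean square on the left line is only
  bounded, and the weight makes it small at the price of a constant factor on the right line, where
  the error tends to 0. The number pi belongs to the independent family because the shifts are
  discrete: a character is constant along the orbit exactly when its frequency is an integer
  multiple of 2 pi.\<close>

lemma contour_integral_rectpath_eq: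
  fixes g :: "complex \<Rightarrow> complex"
  assumes ab: "a < b" and cd: "c < d"
    and g: "continuous_on (path_image (rectpath (Complex a c) (Complex b d))) g"
  shows "contour_integral (rectpath (Complex a c) (Complex b d)) g =
     contour_integral (linepath (Complex a c) (Complex b c)) g
     + \<i> * integral {c..d} (\<lambda>u. g (Complex b u))
     + contour_integral (linepath (Complex b d) (Complex a d)) g
     - \<i> * integral {c..d} (\<lambda>u. g (Complex a u))"
proof -
  let ?p = "Complex a c" and ?q = "Complex b c" and ?r = "Complex b d" and ?s = "Complex a d"
  have rp: "rectpath ?p ?r = linepath ?p ?q +++ linepath ?q ?r +++ linepath ?r ?s +++ linepath ?s ?p"
    by (simp add: rectpath_def Let_def)
  have im: "path_image (rectpath ?p ?r) =
     closed_segment ?p ?q \<union> closed_segment ?q ?r \<union> closed_segment ?r ?s \<union> closed_segment ?s ?p"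
    unfolding rp by (simp add: path_image_join Un_assoc)
  have i1: "g contour_integrable_on linepath ?p ?q" "g contour_integrable_on linepath ?q ?r"
     "g contour_integrable_on linepath ?r ?s" "g contour_integrable_on linepath ?s ?p"
    using g unfolding im
    by (auto intro!: contour_integrable_continuous_linepath intro: continuous_on_subset)
  have "contour_integral (rectpath ?p ?r) g = contour_integral (linepath ?p ?q) g
     + contour_integral (linepath ?q ?r) g + contour_integral (linepath ?r ?s) g
     + contour_integral (linepath ?s ?p) g"
    unfolding rp using i1 by (simp add: contour_integrable_joinI valid_path_join)
  also have "contour_integral (linepath ?q ?r) g = \<i> * integral {c..d} (\<lambda>u. g (Complex b u))"
    by (rule contour_integral_linepath_same_Re) (use cd in auto)
  also have "contour_integral (linepath ?s ?p) g = - contour_integral (linepath ?p ?s) g"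
    using contour_integral_reversepath[of "linepath ?p ?s" g] by simp
  also have "contour_integral (linepath ?p ?s) g = \<i> * integral {c..d} (\<lambda>u. g (Complex a u))"
    by (rule contour_integral_linepath_same_Re) (use cd in auto)
  finally show ?thesis by simp
qed

lemma in_cbox_Complex_iff:
  "z \<in> cbox (Complex a c) (Complex b d) \<longleftrightarrow> a \<le> Re z \<and> Re z \<le> b \<and> c \<le> Im z \<and> Im z \<le> d"
  by (auto simp: in_cbox_complex_iff)

lemma contour_integral_horizontal_bound:
  assumes "continuous_on (closed_segment (Complex a c) (Complex b c)) g"
    and "\<And>z. Im z = c \<Longrightarrow> min a b \<le> Re z \<Longrightarrow> Re z \<le> max a b \<Longrightarrow> cmod (g z) \<le> M" and "0 \<le> M"
  shows "cmod (contour_integral (linepath (Complex a c) (Complex b c)) g) \<le> M * \<bar>b - a\<bar>"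
proof -
  have "cmod (contour_integral (linepath (Complex a c) (Complex b c)) g) \<le> M * cmod (Complex b c - Complex a c)"
  proof (rule contour_integral_bound_linepath)
    show "g contour_integrable_on linepath (Complex a c) (Complex b c)"
      using assms(1) by (rule contour_integrable_continuous_linepath)
    fix z assume "z \<in> closed_segment (Complex a c) (Complex b c)"
    then have "Im z = c" "min a b \<le> Re z" "Re z \<le> max a b"
      by (auto simp: closed_segment_same_Im closed_segment_eq_real_ivl split: if_splits)
    then show "cmod (g z) \<le> M" by (rule assms(2))
  qed (use assms in auto)
  also have "Complex b c - Complex a c = of_real (b - a)" by (simp add: complex_eq_iff)
  finally show ?thesis by (simp only: norm_of_real)
qed

text \<open>Cauchy's theorem on the rectangle: the two vertical integrals differ only by the
  horizontal sides, each bounded by its supremum times the width. This is how mean values are moved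
  from one vertical line to another.\<close>

lemma integral_vertical_diff_bound:
  fixes f :: "complex \<Rightarrow> complex"
  assumes ab: "a < b" and cd: "c < d"
    and f: "f holomorphic_on cbox (Complex a c) (Complex b d)"
    and M: "\<And>x. a \<le> x \<Longrightarrow> x \<le> b \<Longrightarrow> cmod (f (Complex x c)) \<le> M1"
       "\<And>x. a \<le> x \<Longrightarrow> x \<le> b \<Longrightarrow> cmod (f (Complex x d)) \<le> M2"
  shows "cmod (integral {c..d} (\<lambda>u. f (Complex a u)) - integral {c..d} (\<lambda>u. f (Complex b u)))
           \<le> (M1 + M2) * (b - a)"
proof -
  let ?R = "rectpath (Complex a c) (Complex b d)"
  have sub: "path_image ?R \<subseteq> cbox (Complex a c) (Complex b d)"
    using ab cd by (intro path_image_rectpath_subset_cbox) auto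
  have cont: "continuous_on (cbox (Complex a c) (Complex b d)) f"
    using f holomorphic_on_imp_continuous_on by blast
  have "(f has_contour_integral 0) ?R"
    by (rule Cauchy_theorem_convex_simple[OF f]) (use sub in auto)
  then have 0: "contour_integral ?R f = 0" by (rule contour_integral_unique)
  let ?H1 = "contour_integral (linepath (Complex a c) (Complex b c)) f"
  let ?H2 = "contour_integral (linepath (Complex b d) (Complex a d)) f"
  let ?I = "integral {c..d} (\<lambda>u. f (Complex a u)) - integral {c..d} (\<lambda>u. f (Complex b u))"
  have "0 = ?H1 + ?H2 - \<i> * ?I"
    using contour_integral_rectpath_eq[OF ab cd continuous_on_subset[OF cont sub]] 0
    by (simp add: algebra_simps)
  then have "\<i> * ?I = ?H1 + ?H2" by simp
  then have "cmod (\<i> * ?I) = cmod (?H1 + ?H2)" by (rule arg_cong)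
  then have "cmod ?I \<le> cmod ?H1 + cmod ?H2"
    using norm_triangle_ineq[of ?H1 ?H2] by (simp add: norm_mult)
  also have "cmod ?H1 \<le> M1 * \<bar>b - a\<bar>"
  proof (rule contour_integral_horizontal_bound)
    show "continuous_on (closed_segment (Complex a c) (Complex b c)) f"
      using ab cd by (intro continuous_on_subset[OF cont])
         (auto simp: closed_segment_same_Im closed_segment_eq_real_ivl in_cbox_Complex_iff)
    show "cmod (f z) \<le> M1" if "Im z = c" "min a b \<le> Re z" "Re z \<le> max a b" for z
      using M(1)[of "Re z"] that ab by (cases z) auto
    show "0 \<le> M1" using order_trans[OF norm_ge_zero M(1)[of a]] ab by simp
  qed
  also have "cmod ?H2 \<le> M2 * \<bar>a - b\<bar>"
  proof (rule contour_integral_horizontal_bound)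
    show "continuous_on (closed_segment (Complex b d) (Complex a d)) f"
      using ab cd by (intro continuous_on_subset[OF cont])
         (auto simp: closed_segment_same_Im closed_segment_eq_real_ivl in_cbox_Complex_iff)
    show "cmod (f z) \<le> M2" if "Im z = d" "min b a \<le> Re z" "Re z \<le> max b a" for z
      using M(2)[of "Re z"] that ab by (cases z) auto
    show "0 \<le> M2" using order_trans[OF norm_ge_zero M(2)[of a]] ab by simp
  qed
  finally show ?thesis using ab by (simp add: algebra_simps)
qed

text \<open>Integrability can be left open, since the integral of a non-integrable function is 0 by
  convention.\<close>

lemma integral_nonneg_of_nonneg_fun:
  fixes f :: "real \<Rightarrow> real"
  assumes "\<And>x. 0 \<le> f x"
  shows "0 \<le> integral S f"
  by (cases "f integrable_on S") (use assms in \<open>auto simp: integral_nonneg not_integrable_integral\<close>)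

lemma continuous_on_Complex_vertical: "continuous_on S (\<lambda>u. Complex x u)"
  unfolding Complex_eq by (intro continuous_intros)

text \<open>Cauchy's integral formula with winding number 1. The kernel is at most 1 / \<delta> on
  the vertical sides, which keep their integrals, and at most 1 / H on the horizontal sides, which
  are only estimated by their suprema.\<close>

lemma Cauchy_rectangle_bound:
  fixes f :: "complex \<Rightarrow> complex"
  assumes f: "f holomorphic_on cbox (Complex a c) (Complex b d)"
    and s: "a + \<delta> \<le> Re s" "Re s \<le> b - \<delta>" "c + H \<le> Im s" "Im s \<le> d - H" and pos: "\<delta> > 0" "H > 0"
    and M: "\<And>x. a \<le> x \<Longrightarrow> x \<le> b \<Longrightarrow> cmod (f (Complex x c)) \<le> M"
       "\<And>x. a \<le> x \<Longrightarrow> x \<le> b \<Longrightarrow> cmod (f (Complex x d)) \<le> M"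
  shows "2 * pi * cmod (f s) \<le> integral {c..d} (\<lambda>u. cmod (f (Complex a u))) / \<delta>
     + integral {c..d} (\<lambda>u. cmod (f (Complex b u))) / \<delta> + 2 * (b - a) * M / H"
proof -
  let ?R = "rectpath (Complex a c) (Complex b d)"
  let ?B = "cbox (Complex a c) (Complex b d)"
  define g where "g w = f w / (w - s)" for w
  have ab: "a < b" and cd: "c < d" using s pos by auto
  have sub: "path_image ?R \<subseteq> ?B - {s}"
    using ab cd s pos unfolding path_image_rectpath_cbox_minus_box[of "Complex a c" "Complex b d", simplified, OF less_imp_le[OF ab] less_imp_le[OF cd]]
    by (auto simp: in_box_complex_iff)
  have cont: "continuous_on ?B f"
    using f holomorphic_on_imp_continuous_on by blast
  have sbox: "s \<in> box (Complex a c) (Complex b d)"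
    using s pos by (auto simp: in_box_complex_iff)
  have "(g has_contour_integral (2*pi * \<i> * winding_number ?R s * f s)) ?R"
    unfolding g_def
    by (rule Cauchy_integral_formula_convex_simple[OF _ f]) (use sub sbox in auto)
  moreover have "winding_number ?R s = 1"
    by (rule winding_number_rectpath[OF sbox])
  ultimately have 0: "contour_integral ?R g = 2*pi * \<i> * f s"
    using contour_integral_unique by fastforce
  have cg: "continuous_on (?B - {s}) g"
    unfolding g_def by (intro continuous_intros continuous_on_subset[OF cont]) auto
  let ?H1 = "contour_integral (linepath (Complex a c) (Complex b c)) g"
  let ?H2 = "contour_integral (linepath (Complex b d) (Complex a d)) g"
  let ?I = "integral {c..d} (\<lambda>u. g (Complex b u))" and ?J = "integral {c..d} (\<lambda>u. g (Complex a u))"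
  have eq: "2*pi * \<i> * f s = ?H1 + \<i> * ?I + ?H2 - \<i> * ?J"
    using contour_integral_rectpath_eq[OF ab cd continuous_on_subset[OF cg sub]] 0 by simp
  have M0: "0 \<le> M" using order_trans[OF norm_ge_zero M(1)[of a]] ab by simp
  have gb: "cmod (g z) \<le> M / H" if "cmod (f z) \<le> M" "H \<le> cmod (z - s)" for z
    unfolding g_def norm_divide using that pos M0 by (intro frac_le) auto
  have gd: "cmod (g z) \<le> cmod (f z) / \<delta>" if "\<delta> \<le> cmod (z - s)" for z
    unfolding g_def norm_divide using that pos by (intro frac_le) auto
  have H1: "cmod ?H1 \<le> M / H * \<bar>b - a\<bar>"
  proof (rule contour_integral_horizontal_bound)
    show "continuous_on (closed_segment (Complex a c) (Complex b c)) g"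
      using ab cd s pos by (intro continuous_on_subset[OF cg])
         (auto simp: closed_segment_same_Im closed_segment_eq_real_ivl in_cbox_Complex_iff)
    show "cmod (g z) \<le> M / H" if "Im z = c" "min a b \<le> Re z" "Re z \<le> max a b" for z
    proof (rule gb)
      show "cmod (f z) \<le> M" using M(1)[of "Re z"] that ab by (cases z) auto
      have "H \<le> \<bar>Im (z - s)\<bar>" using that s by simp
      then show "H \<le> cmod (z - s)" using abs_Im_le_cmod order_trans by blast
    qed
  qed (use M0 pos in auto)
  have H2: "cmod ?H2 \<le> M / H * \<bar>a - b\<bar>"
  proof (rule contour_integral_horizontal_bound)
    show "continuous_on (closed_segment (Complex b d) (Complex a d)) g"
      using ab cd s pos by (intro continuous_on_subset[OF cg])
         (auto simp: closed_segment_same_Im closed_segment_eq_real_ivl in_cbox_Complex_iff)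
    show "cmod (g z) \<le> M / H" if "Im z = d" "min b a \<le> Re z" "Re z \<le> max b a" for z
    proof (rule gb)
      show "cmod (f z) \<le> M" using M(2)[of "Re z"] that ab by (cases z) auto
      have "H \<le> \<bar>Im (z - s)\<bar>" using that s by simp
      then show "H \<le> cmod (z - s)" using abs_Im_le_cmod order_trans by blast
    qed
  qed (use M0 pos in auto)
  have vert: "cmod (integral {c..d} (\<lambda>u. g (Complex x u))) \<le> integral {c..d} (\<lambda>u. cmod (f (Complex x u))) / \<delta>"
    if x: "a \<le> x" "x \<le> b" "\<delta> \<le> \<bar>x - Re s\<bar>" for x
  proof -
    have ne: "\<delta> \<le> cmod (Complex x u - s)" for u
      using x(3) abs_Re_le_cmod[of "Complex x u - s"] by simp
    have "continuous_on {c..d} (\<lambda>u. f (Complex x u))"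
      by (rule continuous_on_compose2[OF cont continuous_on_Complex_vertical])
         (use x in \<open>auto simp: in_cbox_Complex_iff\<close>)
    moreover have "Complex x u \<noteq> s" for u using ne[of u] pos by auto
    ultimately have i1: "(\<lambda>u. g (Complex x u)) integrable_on {c..d}"
       and i2: "(\<lambda>u. cmod (f (Complex x u)) / \<delta>) integrable_on {c..d}"
      using pos unfolding g_def by (auto intro!: integrable_continuous_interval continuous_intros simp: Complex_eq)
    have "cmod (integral {c..d} (\<lambda>u. g (Complex x u))) \<le> integral {c..d} (\<lambda>u. cmod (f (Complex x u)) / \<delta>)"
      by (rule integral_norm_bound_integral[OF i1]) (use i2 gd ne in auto)
    then show ?thesis by simp
  qed
  have "2 * pi * cmod (f s) = cmod (2*pi * \<i> * f s)" by (simp add: norm_mult)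
  also have "\<dots> \<le> cmod ?H1 + cmod (\<i> * ?I) + cmod ?H2 + cmod (\<i> * ?J)"
    unfolding eq by (smt (verit) norm_triangle_ineq norm_triangle_ineq4)
  also have "cmod (\<i> * ?I) = cmod ?I" by (simp add: norm_mult)
  also have "cmod (\<i> * ?J) = cmod ?J" by (simp add: norm_mult)
  finally have "2 * pi * cmod (f s) \<le> cmod ?H1 + cmod ?I + cmod ?H2 + cmod ?J" .
  moreover have "cmod ?I \<le> integral {c..d} (\<lambda>u. cmod (f (Complex b u))) / \<delta>"
    by (rule vert) (use s pos ab in auto)
  moreover have "cmod ?J \<le> integral {c..d} (\<lambda>u. cmod (f (Complex a u))) / \<delta>"
    by (rule vert) (use s pos ab in auto)
  moreover have "2 * (b - a) * M / H = M / H * \<bar>b - a\<bar> + M / H * \<bar>a - b\<bar>"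
    using ab by (simp add: algebra_simps)
  ultimately show ?thesis using H1 H2 by (smt (verit, ccfv_SIG))
qed

text \<open>A pointwise bound by local mean squares on the two boundary lines, in the manner of the
  three lines theorem. Working with the square of \<open>G\<close> makes mean squares appear without
  Cauchy--Schwarz. The rectangle is placed symmetrically about Im s, whence the upper height
  \<open>2 * Im s - T1\<close>: both horizontal sides are at distance Im s - T1.\<close>

lemma strip_bound:
  fixes G :: "complex \<Rightarrow> complex"
  assumes G: "G analytic_on {z. \<sigma>1 \<le> Re z \<and> Re z \<le> \<sigma>2 \<and> T1 \<le> Im z}"
    and s: "\<sigma>1 + \<delta> \<le> Re s" "Re s \<le> \<sigma>2 - \<delta>" "T1 + 1 \<le> Im s" and \<delta>: "\<delta> > 0" and y: "y \<ge> 0"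
    and M: "\<And>x. \<sigma>1 \<le> x \<Longrightarrow> x \<le> \<sigma>2 \<Longrightarrow> cmod (G (Complex x T1)) \<le> M"
       "\<And>x. \<sigma>1 \<le> x \<Longrightarrow> x \<le> \<sigma>2 \<Longrightarrow> cmod (G (Complex x (2 * Im s - T1))) \<le> M"
  defines "D \<equiv> \<sigma>2 - \<sigma>1"
  defines "I \<equiv> (\<lambda>\<sigma>. integral {T1..2 * Im s - T1} (\<lambda>u. (cmod (G (Complex \<sigma> u)))\<^sup>2 * exp (- \<bar>u - Im s\<bar>)))"
  shows "(cmod (G s))\<^sup>2 \<le> exp (D\<^sup>2) * (1 / \<delta> + D) *
           (exp (- (y * \<delta>)) * I \<sigma>1 + exp (y * D) * I \<sigma>2 + exp (y * D) * exp (- (Im s - T1)\<^sup>2) * M\<^sup>2)"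
proof -
  define H where "H = Im s - T1"
  \<comment> \<open>The linear exponent is at most \<open>- (y * \<delta>)\<close> on the left line
    and \<open>y * D\<close> on the right one, so \<open>y\<close> shifts weight from left to right.
    The quadratic exponent decays like a Gaussian in the vertical direction and suppresses the
    horizontal sides. The exponential equals 1 at s.\<close>
  define f where "f w = (G w)\<^sup>2 * exp (of_real y * (w - s) + (w - s)\<^sup>2)" for w
  let ?R = "cbox (Complex \<sigma>1 T1) (Complex \<sigma>2 (2 * Im s - T1))"
  have GR: "G holomorphic_on ?R"
    by (rule analytic_imp_holomorphic, rule analytic_on_subset[OF G])
       (auto simp: in_cbox_Complex_iff)
  have H: "H \<ge> 1" using s by (simp add: H_def)
  have D: "D > 0" using s \<delta> by (simp add: D_def)
  have fn: "cmod (f (Complex x u)) = (cmod (G (Complex x u)))\<^sup>2 * exp (y * (x - Re s) + (x - Re s)\<^sup>2 - (u - Im s)\<^sup>2)" for x u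
    by (simp add: f_def norm_mult norm_power power2_eq_square algebra_simps)
  have sqD: "(x - Re s)\<^sup>2 \<le> D\<^sup>2" if "\<sigma>1 \<le> x" "x \<le> \<sigma>2" for x
    unfolding D_def using that s \<delta> by (intro power2_le_iff_abs_le[THEN iffD2]) auto
  have M0: "0 \<le> M" using order_trans[OF norm_ge_zero M(1)[of \<sigma>1]] D D_def by simp
  have hor: "cmod (f (Complex x u)) \<le> exp (y * D + D\<^sup>2 - H\<^sup>2) * M\<^sup>2"
    if "\<sigma>1 \<le> x" "x \<le> \<sigma>2" "cmod (G (Complex x u)) \<le> M" "(u - Im s)\<^sup>2 = H\<^sup>2" for x u
  proof -
    have "y * (x - Re s) \<le> y * D" using that s \<delta> y unfolding D_def by (intro mult_left_mono) auto
    then have "y * (x - Re s) + (x - Re s)\<^sup>2 - (u - Im s)\<^sup>2 \<le> y * D + D\<^sup>2 - H\<^sup>2"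
      using sqD[OF that(1,2)] that(4) by linarith
    moreover have "(cmod (G (Complex x u)))\<^sup>2 \<le> M\<^sup>2" using that by (intro power_mono) auto
    ultimately show ?thesis unfolding fn by (subst mult.commute, intro mult_mono) auto
  qed
  have "2 * pi * cmod (f s) \<le> integral {T1..2 * Im s - T1} (\<lambda>u. cmod (f (Complex \<sigma>1 u))) / \<delta>
     + integral {T1..2 * Im s - T1} (\<lambda>u. cmod (f (Complex \<sigma>2 u))) / \<delta>
     + 2 * (\<sigma>2 - \<sigma>1) * (exp (y * D + D\<^sup>2 - H\<^sup>2) * M\<^sup>2) / H"
  proof (rule Cauchy_rectangle_bound)
    show "f holomorphic_on ?R" unfolding f_def by (intro holomorphic_intros GR)
    fix x assume x: "\<sigma>1 \<le> x" "x \<le> \<sigma>2"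
    show "cmod (f (Complex x T1)) \<le> exp (y * D + D\<^sup>2 - H\<^sup>2) * M\<^sup>2"
      by (rule hor[OF x M(1)[OF x]]) (simp add: H_def power2_eq_square algebra_simps)
    show "cmod (f (Complex x (2 * Im s - T1))) \<le> exp (y * D + D\<^sup>2 - H\<^sup>2) * M\<^sup>2"
      by (rule hor[OF x M(2)[OF x]]) (simp add: H_def power2_eq_square algebra_simps)
  qed (use s \<delta> H in \<open>auto simp: H_def\<close>)
  moreover have "cmod (f s) = (cmod (G s))\<^sup>2" by (simp add: f_def norm_power norm_mult)
  moreover have "2 * (\<sigma>2 - \<sigma>1) * (exp (y * D + D\<^sup>2 - H\<^sup>2) * M\<^sup>2) / H \<le> 2 * D * (exp (D\<^sup>2) * (exp (y * D) * exp (- H\<^sup>2) * M\<^sup>2))"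
  proof -
    have "2 * D * (exp (y * D + D\<^sup>2 - H\<^sup>2) * M\<^sup>2) / H \<le> 2 * D * (exp (y * D + D\<^sup>2 - H\<^sup>2) * M\<^sup>2) / 1"
      using D H by (intro divide_left_mono) auto
    then show ?thesis by (simp add: exp_add exp_diff exp_minus D_def field_simps)
  qed
  moreover have vert: "integral {T1..2 * Im s - T1} (\<lambda>u. cmod (f (Complex x u))) \<le> exp e * exp (D\<^sup>2) * 2 * I x"
    if x: "\<sigma>1 \<le> x" "x \<le> \<sigma>2" and e: "y * (x - Re s) \<le> e" for x e
  proof -
    have c: "continuous_on {T1..2 * Im s - T1} (\<lambda>u. G (Complex x u))"
      by (rule continuous_on_compose2[OF holomorphic_on_imp_continuous_on[OF GR] continuous_on_Complex_vertical])
         (use x in \<open>auto simp: in_cbox_Complex_iff\<close>)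
    have "integral {T1..2 * Im s - T1} (\<lambda>u. cmod (f (Complex x u))) \<le>
      integral {T1..2 * Im s - T1} (\<lambda>u. exp e * exp (D\<^sup>2) * 2 * ((cmod (G (Complex x u)))\<^sup>2 * exp (- \<bar>u - Im s\<bar>)))"
    proof (rule integral_le)
      show "(\<lambda>u. cmod (f (Complex x u))) integrable_on {T1..2 * Im s - T1}"
        unfolding fn by (intro integrable_continuous_interval continuous_intros c)
      show "(\<lambda>u. exp e * exp (D\<^sup>2) * 2 * ((cmod (G (Complex x u)))\<^sup>2 * exp (- \<bar>u - Im s\<bar>))) integrable_on {T1..2 * Im s - T1}"
        by (intro integrable_continuous_interval continuous_intros c)
      fix u
      \<comment> \<open>The Gaussian is weakened to exp(- |u - Im s|), whose sums over arithmetic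
        progressions are geometric; the price exp(1/4) is absorbed in the factor 2.\<close>
      have "\<bar>u - Im s\<bar> \<le> (u - Im s)\<^sup>2 + 1/4"
        using zero_le_power2[of "\<bar>u - Im s\<bar> - 1/2"] by (simp add: power2_eq_square algebra_simps)
      then have "y * (x - Re s) + (x - Re s)\<^sup>2 - (u - Im s)\<^sup>2 \<le> e + D\<^sup>2 + 1/4 + (- \<bar>u - Im s\<bar>)"
        using e sqD[OF x] by linarith
      then have "exp (y * (x - Re s) + (x - Re s)\<^sup>2 - (u - Im s)\<^sup>2) \<le> exp (e + D\<^sup>2 + 1/4 + (- \<bar>u - Im s\<bar>))" by simp
      also have "\<dots> = exp e * exp (D\<^sup>2) * exp (1/4) * exp (- \<bar>u - Im s\<bar>)" by (simp only: exp_add)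
      also have "\<dots> \<le> exp e * exp (D\<^sup>2) * 2 * exp (- \<bar>u - Im s\<bar>)"
        using exp_bound_half[of "1/4::real"] by (intro mult_right_mono mult_left_mono) auto
      finally have "(cmod (G (Complex x u)))\<^sup>2 * exp (y * (x - Re s) + (x - Re s)\<^sup>2 - (u - Im s)\<^sup>2)
         \<le> (cmod (G (Complex x u)))\<^sup>2 * (exp e * exp (D\<^sup>2) * 2 * exp (- \<bar>u - Im s\<bar>))"
        by (rule mult_left_mono) simp
      then show "cmod (f (Complex x u)) \<le> exp e * exp (D\<^sup>2) * 2 * ((cmod (G (Complex x u)))\<^sup>2 * exp (- \<bar>u - Im s\<bar>))"
        unfolding fn by (simp only: mult_ac)
    qed
    then show ?thesis by (simp add: I_def)
  qed
  moreover have "integral {T1..2 * Im s - T1} (\<lambda>u. cmod (f (Complex \<sigma>1 u))) \<le> exp (- (y * \<delta>)) * exp (D\<^sup>2) * 2 * I \<sigma>1"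
    using mult_left_mono[of "\<sigma>1 - Re s" "-\<delta>" y] s y D D_def by (intro vert) auto
  moreover have "integral {T1..2 * Im s - T1} (\<lambda>u. cmod (f (Complex \<sigma>2 u))) \<le> exp (y * D) * exp (D\<^sup>2) * 2 * I \<sigma>2"
    using mult_left_mono[of "\<sigma>2 - Re s" D y] s y D \<delta> D_def by (intro vert) auto
  ultimately have le: "2 * pi * (cmod (G s))\<^sup>2 \<le> exp (- (y * \<delta>)) * exp (D\<^sup>2) * 2 * I \<sigma>1 / \<delta>
      + exp (y * D) * exp (D\<^sup>2) * 2 * I \<sigma>2 / \<delta> + 2 * D * (exp (D\<^sup>2) * (exp (y * D) * exp (- H\<^sup>2) * M\<^sup>2))"
    using divide_right_mono[of _ _ \<delta>] \<delta> by (smt (verit))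
  define P Q E where "P = exp (- (y * \<delta>)) * I \<sigma>1 + exp (y * D) * I \<sigma>2"
    and "Q = exp (y * D) * exp (- H\<^sup>2) * M\<^sup>2" and "E = exp (D\<^sup>2)"
  have I0: "I x \<ge> 0" for x unfolding I_def by (rule integral_nonneg_of_nonneg_fun) auto
  have PQ: "P \<ge> 0" "Q \<ge> 0" "E > 0" using I0 by (auto simp: P_def Q_def E_def)
  have "2 * pi * (cmod (G s))\<^sup>2 \<le> 2 * (E * (1 / \<delta>) * P + E * D * Q)"
    using le by (simp add: P_def Q_def E_def algebra_simps add_divide_distrib)
  also have "\<dots> \<le> 2 * (E * (1 / \<delta> + D) * (P + Q))"
  proof -
    have "E * (1 / \<delta>) * Q \<ge> 0" "E * D * P \<ge> 0" using PQ D \<delta> by auto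
    then show ?thesis by (simp only: distrib_left distrib_right)
  qed
  finally have "pi * (cmod (G s))\<^sup>2 \<le> E * (1 / \<delta> + D) * (P + Q)" by simp
  moreover have "1 * (cmod (G s))\<^sup>2 \<le> pi * (cmod (G s))\<^sup>2"
    using pi_gt3 by (intro mult_right_mono) auto
  ultimately show ?thesis by (simp add: P_def Q_def E_def H_def)
qed

text \<open>Rounding u down to the multiple n h costs the factor exp h. On either side of n the map
  from k to |k - n| is injective, so each half is dominated by a full geometric series. The bound is
  uniform in u and in the set of shifts, so a sum over shifts can be exchanged with the integral
  over u.\<close>

lemma geometric_two_sided:
  assumes "h > 0" "finite S"
  shows "(\<Sum>k\<in>S. exp (- \<bar>u - real k * h\<bar>)) \<le> 2 * exp h / (1 - exp (- h))"
proof -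
  define q where "q = exp (- h)"
  have q: "0 < q" "q < 1" using assms by (auto simp: q_def)
  define n where "n = \<lfloor>u / h\<rfloor>"
  have n: "of_int n * h \<le> u" "u < (of_int n + 1) * h"
    using floor_divide_lower[OF assms(1), of u] floor_divide_upper[OF assms(1), of u] by (auto simp: n_def)
  have ge: "exp (- \<bar>u - real k * h\<bar>) \<le> exp h * q ^ nat \<bar>int k - n\<bar>" for k
  proof -
    have "real (nat \<bar>int k - n\<bar>) = \<bar>real k - of_int n\<bar>" by (simp add: of_nat_nat)
    moreover have "\<bar>real k - of_int n\<bar> * h - h \<le> \<bar>u - real k * h\<bar>"
      using n assms(1) by (cases "real k \<ge> of_int n") (auto simp: algebra_simps abs_if)
    ultimately have "- \<bar>u - real k * h\<bar> \<le> h + real (nat \<bar>int k - n\<bar>) * (- h)" by (simp add: algebra_simps)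
    then have "exp (- \<bar>u - real k * h\<bar>) \<le> exp (h + real (nat \<bar>int k - n\<bar>) * (- h))" by simp
    then show ?thesis by (simp only: exp_add exp_of_nat_mult q_def)
  qed
  have geo: "(\<Sum>j\<in>J. q ^ j) \<le> 1 / (1 - q)" if "finite J" for J :: "nat set"
    using sum_le_suminf[of "\<lambda>j. q ^ j" J] that q suminf_geometric[of q] by (simp add: summable_geometric)
  have part: "(\<Sum>k\<in>S'. q ^ nat \<bar>int k - n\<bar>) \<le> 1 / (1 - q)"
    if "finite S'" "inj_on (\<lambda>k. nat \<bar>int k - n\<bar>) S'" for S'
    using geo[of "(\<lambda>k. nat \<bar>int k - n\<bar>) ` S'"] that by (simp add: sum.reindex)
  have "(\<Sum>k\<in>S. exp (- \<bar>u - real k * h\<bar>)) \<le> (\<Sum>k\<in>S. exp h * q ^ nat \<bar>int k - n\<bar>)"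
    by (rule sum_mono) (rule ge)
  also have "\<dots> = exp h * ((\<Sum>k\<in>{k\<in>S. int k \<ge> n}. q ^ nat \<bar>int k - n\<bar>) + (\<Sum>k\<in>{k\<in>S. int k < n}. q ^ nat \<bar>int k - n\<bar>))"
    unfolding sum_distrib_left[symmetric] using assms(2)
    by (subst sum.union_disjoint[symmetric]) (auto intro!: sum.cong)
  also have "\<dots> \<le> exp h * (1 / (1 - q) + 1 / (1 - q))"
    using assms(2) by (intro mult_left_mono add_mono part) (auto simp: inj_on_def)
  finally show ?thesis by (simp add: q_def field_simps)
qed

text \<open>A single term of the exponential series is at most the whole. It turns polynomial growth
  into an exponential, which the Gaussian then beats.\<close>

lemma power_le_fact_exp:
  fixes x :: real
  assumes "x \<ge> 0"
  shows "x ^ n \<le> fact n * exp x"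
proof -
  have "(\<Sum>k\<in>{n}. x ^ k /\<^sub>R fact k) \<le> (\<Sum>k. x ^ k /\<^sub>R fact k)"
    by (rule sum_le_suminf[OF summable_exp_generic]) (use assms in auto)
  then have "x ^ n / fact n \<le> exp x" by (simp add: exp_def divide_inverse mult.commute)
  then show ?thesis by (simp add: field_simps)
qed

text \<open>In the application \<open>m1\<close> is merely bounded but \<open>m2\<close> tends to \<open>0\<close>: first \<open>y\<close> is chosen large to make
\<open>exp (- (y * \<delta>)) * m1\<close> small, then \<open>m2\<close> small.\<close>

lemma strip_discrete_mean_square:
  fixes G :: "complex \<Rightarrow> complex" and C :: nat
  assumes \<delta>: "\<delta> > 0" and h: "h > 0" and Y: "Y \<ge> 0" and T1: "T1 \<ge> 0" and y: "y \<ge> 0" and e: "e > 0"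
    and G: "G analytic_on {z. \<sigma>1 \<le> Re z \<and> Re z \<le> \<sigma>2 \<and> T1 \<le> Im z}"
    and B: "\<And>z. \<sigma>1 \<le> Re z \<Longrightarrow> Re z \<le> \<sigma>2 \<Longrightarrow> T1 \<le> Im z \<Longrightarrow> cmod (G z) \<le> B * Im z ^ C"
    and m1: "\<forall>\<^sub>F T in at_top. integral {T1..T} (\<lambda>u. (cmod (G (Complex \<sigma>1 u)))\<^sup>2) \<le> m1 * T"
    and m2: "\<forall>\<^sub>F T in at_top. integral {T1..T} (\<lambda>u. (cmod (G (Complex \<sigma>2 u)))\<^sup>2) \<le> m2 * T"
    and \<sigma>: "\<sigma>1 + \<delta> \<le> \<sigma>2 - \<delta>"
  defines "D \<equiv> \<sigma>2 - \<sigma>1"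
  defines "A \<equiv> exp (D\<^sup>2) * (1 / \<delta> + D) * exp Y * (2 * exp h / (1 - exp (- h))) * (2 * h + 2 * Y)"
  obtains k0 :: nat and q :: "nat \<Rightarrow> real" where
    "\<And>k. q k \<ge> 0"
    "\<And>k z. k \<ge> k0 \<Longrightarrow> \<sigma>1 + \<delta> \<le> Re z \<Longrightarrow> Re z \<le> \<sigma>2 - \<delta> \<Longrightarrow> \<bar>Im z\<bar> \<le> Y \<Longrightarrow>
       (cmod (G (z + \<i> * of_nat k * of_real h)))\<^sup>2 \<le> q k"
    "\<forall>\<^sub>F N in sequentially. (\<Sum>k=k0..N. q k) \<le> (A * (exp (- (y * \<delta>)) * m1 + exp (y * D) * m2) + e) * (real N + 1)"
proof -
  define A0 where "A0 = exp (D\<^sup>2) * (1 / \<delta> + D)"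
  have D: "D > 0" using \<sigma> \<delta> by (simp add: D_def)
  have A0: "A0 > 0" using D \<delta> by (auto simp: A0_def intro!: mult_pos_pos add_pos_pos)
  have \<sigma>12: "\<sigma>1 \<le> \<sigma>2" using D by (simp add: D_def)
  \<comment> \<open>A common upper end for all z with |Im z| \<le> Y: the rectangle around s = z + i
    k h reaches up to 2 Im s - T1, which is at most \<open>U k\<close> because \<open>T1\<close> is
    nonnegative.\<close>
  define U where "U k = 2 * real k * h + 2 * Y" for k :: nat
  define g where "g \<sigma> u = (cmod (G (Complex \<sigma> u)))\<^sup>2" for \<sigma> u
  define J where "J \<sigma> k = integral {T1..U k} (\<lambda>u. g \<sigma> u * exp (- \<bar>u - real k * h\<bar>))" for \<sigma> k
  define B' where "B' = max B 0"
  \<comment> \<open>The contribution of the horizontal sides. Polynomial growth against a Gaussian: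
    it tends to 0 and matters only for finitely many k.\<close>
  define r where "r k = exp (- (real k * h - Y - T1)\<^sup>2) * (B' * U k ^ C)\<^sup>2" for k
  define q where "q k = A0 * (exp Y * (exp (- (y * \<delta>)) * J \<sigma>1 k + exp (y * D) * J \<sigma>2 k) + exp (y * D) * r k)" for k
  have B': "cmod (G z) \<le> B' * Im z ^ C" if "\<sigma>1 \<le> Re z" "Re z \<le> \<sigma>2" "T1 \<le> Im z" for z
    using B[OF that] mult_right_mono[of B B' "Im z ^ C"] that T1 by (fastforce simp: B'_def)
  have gcont: "continuous_on {T1..b} (g \<sigma>)" if "\<sigma>1 \<le> \<sigma>" "\<sigma> \<le> \<sigma>2" for b \<sigma>
    unfolding g_def
    by (intro continuous_intros continuous_on_compose2[OF holomorphic_on_imp_continuous_on[OF analytic_imp_holomorphic[OF G]] continuous_on_Complex_vertical])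
       (use that in auto)
  have g0: "g \<sigma> u \<ge> 0" for \<sigma> u by (simp add: g_def)
  have J0: "J \<sigma> k \<ge> 0" for \<sigma> k unfolding J_def
    by (rule integral_nonneg_of_nonneg_fun) (auto simp: g0)
  have r0: "r k \<ge> 0" for k by (simp add: r_def)
  have q0: "q k \<ge> 0" for k unfolding q_def using A0 J0 r0 by (intro mult_nonneg_nonneg add_nonneg_nonneg) auto
  obtain k0 :: nat where k0: "real k0 * h \<ge> T1 + 1 + Y"
    using reals_Archimedean3[OF h] less_imp_le by blast
  have pt: "(cmod (G (z + \<i> * of_nat k * of_real h)))\<^sup>2 \<le> q k"
    if k: "k \<ge> k0" and z: "\<sigma>1 + \<delta> \<le> Re z" "Re z \<le> \<sigma>2 - \<delta>" "\<bar>Im z\<bar> \<le> Y" for k z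
  proof -
    define s where "s = z + \<i> * of_nat k * of_real h"
    have s: "Re s = Re z" "Im s = Im z + real k * h" by (auto simp: s_def)
    have kh: "real k0 * h \<le> real k * h" using k h by (intro mult_right_mono) auto
    have ims: "T1 + 1 \<le> Im s" "2 * Im s - T1 \<le> U k" "real k * h - Y - T1 \<le> Im s - T1" "0 \<le> real k * h - Y - T1"
      using z kh k0 T1 by (auto simp: s U_def)
    define I where "I \<sigma> = integral {T1..2 * Im s - T1} (\<lambda>u. (cmod (G (Complex \<sigma> u)))\<^sup>2 * exp (- \<bar>u - Im s\<bar>))" for \<sigma>
    have M: "cmod (G (Complex x v)) \<le> B' * U k ^ C" if "\<sigma>1 \<le> x" "x \<le> \<sigma>2" "T1 \<le> v" "v \<le> U k" for x v
    proof -
      have "cmod (G (Complex x v)) \<le> B' * v ^ C" using B'[of "Complex x v"] that by simp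
      also have "\<dots> \<le> B' * U k ^ C" using that T1 by (intro mult_left_mono power_mono) (auto simp: B'_def)
      finally show ?thesis .
    qed
    have 1: "(cmod (G s))\<^sup>2 \<le> A0 * (exp (- (y * \<delta>)) * I \<sigma>1 + exp (y * D) * I \<sigma>2 + exp (y * D) * exp (- (Im s - T1)\<^sup>2) * (B' * U k ^ C)\<^sup>2)"
      unfolding A0_def D_def I_def
      by (rule strip_bound[OF G]) (use z s \<delta> y ims T1 M in auto)
    have I: "I \<sigma> \<le> exp Y * J \<sigma> k" if "\<sigma>1 \<le> \<sigma>" "\<sigma> \<le> \<sigma>2" for \<sigma>
    proof -
      have "I \<sigma> \<le> integral {T1..2 * Im s - T1} (\<lambda>u. exp Y * (g \<sigma> u * exp (- \<bar>u - real k * h\<bar>)))"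
        unfolding I_def g_def[symmetric]
      proof (rule integral_le)
        fix u
        have "- \<bar>u - Im s\<bar> \<le> Y + (- \<bar>u - real k * h\<bar>)" using z(3) s by linarith
        then have "exp (- \<bar>u - Im s\<bar>) \<le> exp (Y + (- \<bar>u - real k * h\<bar>))" by simp
        also have "\<dots> = exp Y * exp (- \<bar>u - real k * h\<bar>)" by (rule exp_add)
        finally have "g \<sigma> u * exp (- \<bar>u - Im s\<bar>) \<le> g \<sigma> u * (exp Y * exp (- \<bar>u - real k * h\<bar>))"
          by (rule mult_left_mono) (rule g0)
        then show "g \<sigma> u * exp (- \<bar>u - Im s\<bar>) \<le> exp Y * (g \<sigma> u * exp (- \<bar>u - real k * h\<bar>))"
          by (simp only: mult_ac)
      qed (intro integrable_continuous_interval continuous_intros gcont that)+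
      also have "\<dots> = exp Y * integral {T1..2 * Im s - T1} (\<lambda>u. g \<sigma> u * exp (- \<bar>u - real k * h\<bar>))" by simp
      also have "\<dots> \<le> exp Y * J \<sigma> k"
        unfolding J_def
      proof (intro mult_left_mono integral_subset_le)
        show "{T1..2 * Im s - T1} \<subseteq> {T1..U k}" using ims by auto
      qed (auto intro!: integrable_continuous_interval continuous_intros gcont that mult_nonneg_nonneg g0)
      finally show ?thesis .
    qed
    have "(real k * h - Y - T1)\<^sup>2 \<le> (Im s - T1)\<^sup>2" using ims by (intro power_mono) auto
    then have "exp (- (Im s - T1)\<^sup>2) * (B' * U k ^ C)\<^sup>2 \<le> r k"
      unfolding r_def by (intro mult_right_mono) auto
    then have 2: "exp (y * D) * (exp (- (Im s - T1)\<^sup>2) * (B' * U k ^ C)\<^sup>2) \<le> exp (y * D) * r k"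
      by (intro mult_left_mono) auto
    have "exp (- (y * \<delta>)) * I \<sigma>1 + exp (y * D) * I \<sigma>2 \<le> exp (- (y * \<delta>)) * (exp Y * J \<sigma>1 k) + exp (y * D) * (exp Y * J \<sigma>2 k)"
      using D D_def by (intro add_mono mult_left_mono I) auto
    with 1 2 A0 have "(cmod (G s))\<^sup>2 \<le> q k"
      unfolding q_def by (smt (verit) mult_left_mono mult.assoc mult.left_commute distrib_left)
    then show ?thesis by (simp add: s_def)
  qed
  define Ch where "Ch = 2 * exp h / (1 - exp (- h))"
  have Ch: "Ch > 0" using h by (auto simp: Ch_def intro!: divide_pos_pos)
  have U: "filterlim U at_top sequentially" unfolding U_def using h by real_asymp
  have U_le: "U N \<le> (2 * h + 2 * Y) * (real N + 1)" for N
    using h Y by (simp add: U_def algebra_simps)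
  \<comment> \<open>The sum over k goes under the integral, where the kernels add up to at most
    \<open>Ch\<close> at every height; what remains is one mean square over a range of length
    O(N).\<close>
  have Jsum: "\<forall>\<^sub>F N in sequentially. (\<Sum>k=k0..N. J \<sigma> k) \<le> Ch * (2 * h + 2 * Y) * m * (real N + 1)"
    if \<sigma>: "\<sigma>1 \<le> \<sigma>" "\<sigma> \<le> \<sigma>2" and m: "\<forall>\<^sub>F T in at_top. integral {T1..T} (g \<sigma>) \<le> m * T" for \<sigma> m
  proof -
    have "\<forall>\<^sub>F N in sequentially. integral {T1..U N} (g \<sigma>) \<le> m * U N"
      using filterlim_iff[THEN iffD1, rule_format, OF U m] .
    moreover have "\<forall>\<^sub>F N in sequentially. U N > 0"
      using U by (simp add: filterlim_at_top_dense)
    ultimately show ?thesis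
    proof eventually_elim
      case (elim N)
      have int0: "integral {T1..U N} (g \<sigma>) \<ge> 0" by (rule integral_nonneg_of_nonneg_fun) (rule g0)
      \<comment> \<open>No sign is assumed for \<open>m\<close>; it follows from a nonnegative
        integral being at most \<open>m * U N\<close> with \<open>U N\<close> positive.\<close>
      then have "0 \<le> m" using elim by (meson linorder_not_less mult_neg_pos order_trans order_less_le_trans)
      have "(\<Sum>k=k0..N. J \<sigma> k) \<le> (\<Sum>k=k0..N. integral {T1..U N} (\<lambda>u. g \<sigma> u * exp (- \<bar>u - real k * h\<bar>)))"
      proof (rule sum_mono)
        fix k assume k: "k \<in> {k0..N}"
        then have "real k * h \<le> real N * h" using h by (intro mult_right_mono) auto
        then have "U k \<le> U N" by (auto simp: U_def)
        then show "J \<sigma> k \<le> integral {T1..U N} (\<lambda>u. g \<sigma> u * exp (- \<bar>u - real k * h\<bar>))"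
          unfolding J_def
          by (intro integral_subset_le)
             (auto intro!: integrable_continuous_interval continuous_intros gcont that mult_nonneg_nonneg g0)
      qed
      also have "\<dots> = integral {T1..U N} (\<lambda>u. \<Sum>k=k0..N. g \<sigma> u * exp (- \<bar>u - real k * h\<bar>))"
        by (rule integral_sum[symmetric])
           (auto intro!: integrable_continuous_interval continuous_intros gcont that)
      also have "\<dots> \<le> integral {T1..U N} (\<lambda>u. Ch * g \<sigma> u)"
      proof (rule integral_le)
        fix u
        have "(\<Sum>k=k0..N. exp (- \<bar>u - real k * h\<bar>)) \<le> Ch"
          unfolding Ch_def by (rule geometric_two_sided[OF h]) simp
        then have "g \<sigma> u * (\<Sum>k=k0..N. exp (- \<bar>u - real k * h\<bar>)) \<le> g \<sigma> u * Ch"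
          by (rule mult_left_mono) (rule g0)
        then show "(\<Sum>k=k0..N. g \<sigma> u * exp (- \<bar>u - real k * h\<bar>)) \<le> Ch * g \<sigma> u"
          by (simp only: sum_distrib_left mult.commute[of Ch])
      qed (intro integrable_continuous_interval continuous_intros gcont that)+
      also have "\<dots> = Ch * integral {T1..U N} (g \<sigma>)" by simp
      also have "\<dots> \<le> Ch * (m * ((2 * h + 2 * Y) * (real N + 1)))"
        using elim Ch \<open>0 \<le> m\<close> U_le[of N] by (intro mult_left_mono order_trans[OF elim(1)]) auto
      finally show ?case by (simp add: mult_ac)
    qed
  qed
  have rlim: "(\<lambda>k. r k) \<longlonglongrightarrow> 0"
  proof (rule Lim_null_comparison)
    define F where "F = B'\<^sup>2 * fact (2 * C)"
    show "\<forall>\<^sub>F k in sequentially. norm (r k) \<le> F * exp (- (real k * h - Y - T1)\<^sup>2 + (2 * real k * h + 2 * Y))"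
    proof (rule always_eventually, rule allI)
      fix k
      have "U k ^ (2 * C) \<le> fact (2 * C) * exp (U k)" using h Y by (intro power_le_fact_exp) (auto simp: U_def)
      then have "B'\<^sup>2 * U k ^ (2 * C) \<le> F * exp (U k)" unfolding F_def mult.assoc by (intro mult_left_mono) auto
      then have "r k \<le> exp (- (real k * h - Y - T1)\<^sup>2) * (F * exp (U k))"
        unfolding r_def by (intro mult_left_mono) (simp_all add: power_mult_distrib power_mult[symmetric] mult.commute)
      then show "norm (r k) \<le> F * exp (- (real k * h - Y - T1)\<^sup>2 + (2 * real k * h + 2 * Y))"
        unfolding U_def exp_add using r0[of k] by (simp add: mult_ac)
    qed
    have "(\<lambda>k. exp (- (real k * h - Y - T1)\<^sup>2 + (2 * real k * h + 2 * Y))) \<longlonglongrightarrow> 0" using h by real_asymp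
    then show "(\<lambda>k. F * exp (- (real k * h - Y - T1)\<^sup>2 + (2 * real k * h + 2 * Y))) \<longlonglongrightarrow> 0"
      using tendsto_mult_right_zero by blast
  qed
  define \<eta> where "\<eta> = e / (2 * A0 * exp (y * D))"
  have \<eta>: "\<eta> > 0" using e A0 by (simp add: \<eta>_def)
  \<comment> \<open>One \<eta> bounds every late term; the fixed sum of the early terms is absorbed
    by a second \<eta> (N + 1). Hence the factor 2 in the definition of \<eta>.\<close>
  have rsum: "\<forall>\<^sub>F N in sequentially. (\<Sum>k=k0..N. r k) \<le> 2 * \<eta> * (real N + 1)"
  proof -
    obtain k1 where k1: "\<And>k. k \<ge> k1 \<Longrightarrow> r k < \<eta>"
      using order_tendstoD(2)[OF rlim \<eta>] unfolding eventually_sequentially by auto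
    define S where "S = (\<Sum>k<k1. r k)"
    have "\<forall>\<^sub>F N in sequentially. S \<le> \<eta> * (real N + 1)" using \<eta> by real_asymp
    then show ?thesis
    proof eventually_elim
      case (elim N)
      have "(\<Sum>k=k0..N. r k) \<le> (\<Sum>k=k0..N. \<eta> + (if k < k1 then r k else 0))"
        using k1 \<eta> by (intro sum_mono) (force simp: not_less intro: less_imp_le)
      also have "\<dots> \<le> \<eta> * (real N + 1) + (\<Sum>k=k0..N. if k < k1 then r k else 0)"
        using \<eta> by (simp add: sum.distrib mult.commute)
      also have "(\<Sum>k=k0..N. if k < k1 then r k else 0) = (\<Sum>k\<in>{k0..N} \<inter> {k. k < k1}. r k)"
        by (simp add: sum.inter_restrict)
      also have "\<dots> \<le> S" unfolding S_def using r0 by (intro sum_mono2) auto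
      finally show ?case using elim by linarith
    qed
  qed
  have qsum: "\<forall>\<^sub>F N in sequentially. (\<Sum>k=k0..N. q k) \<le> (A * (exp (- (y * \<delta>)) * m1 + exp (y * D) * m2) + e) * (real N + 1)"
    using Jsum[OF order_refl \<sigma>12 m1[folded g_def]] Jsum[OF \<sigma>12 order_refl m2[folded g_def]] rsum
  proof eventually_elim
    case (elim N)
    define n where "n = real N + 1"
    define c where "c = Ch * (2 * h + 2 * Y)"
    have "(\<Sum>k=k0..N. q k) = A0 * (exp Y * (exp (- (y * \<delta>)) * (\<Sum>k=k0..N. J \<sigma>1 k) + exp (y * D) * (\<Sum>k=k0..N. J \<sigma>2 k)) + exp (y * D) * (\<Sum>k=k0..N. r k))"
      unfolding q_def by (simp add: sum.distrib sum_distrib_left[symmetric])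
    also have "\<dots> \<le> A0 * (exp Y * (exp (- (y * \<delta>)) * (c * m1 * n) + exp (y * D) * (c * m2 * n)) + exp (y * D) * (2 * \<eta> * n))"
      using elim A0 \<sigma> \<delta> unfolding n_def c_def by (intro mult_left_mono add_mono) auto
    also have "\<dots> = (A0 * exp Y * c * (exp (- (y * \<delta>)) * m1 + exp (y * D) * m2) + 2 * A0 * exp (y * D) * \<eta>) * n"
      by (simp add: algebra_simps)
    also have "2 * A0 * exp (y * D) * \<eta> = e" using A0 by (simp add: \<eta>_def)
    also have "A0 * exp Y * c = A" by (simp add: A_def A0_def c_def Ch_def)
    finally show ?case by (simp add: n_def)
  qed
  show ?thesis using that[OF q0 pt qsum] by blast
qed

section \<open>Mean squares of continued Dirichlet series\<close>

text \<open>The mean value of an almost periodic function on a half-line. Continuity is part of the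
  notion so that all integrals over bounded ranges exist; the lower end \<open>T1\<close> keeps the
  path above possible poles and does not affect the limit.\<close>

definition has_mean :: "real \<Rightarrow> (real \<Rightarrow> complex) \<Rightarrow> complex \<Rightarrow> bool" where
  "has_mean T1 f L \<longleftrightarrow> continuous_on {T1..} f \<and> ((\<lambda>T. integral {T1..T} f / of_real T) \<longlongrightarrow> L) at_top"

lemma has_mean_integrable: "has_mean T1 f L \<Longrightarrow> f integrable_on {T1..T}"
  unfolding has_mean_def by (intro integrable_continuous_interval) (auto intro: continuous_on_subset)

lemma has_mean_add:
  assumes "has_mean T1 f L" "has_mean T1 g M"
  shows "has_mean T1 (\<lambda>u. f u + g u) (L + M)"
proof -
  have "integral {T1..T} (\<lambda>u. f u + g u) / of_real T = integral {T1..T} f / of_real T + integral {T1..T} g / of_real T" for T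
    by (simp add: integral_add has_mean_integrable[OF assms(1)] has_mean_integrable[OF assms(2)] add_divide_distrib)
  then show ?thesis using assms unfolding has_mean_def by (auto intro!: tendsto_add continuous_intros)
qed

lemma has_mean_cmult:
  assumes "has_mean T1 f L"
  shows "has_mean T1 (\<lambda>u. c * f u) (c * L)"
proof -
  have "((\<lambda>T. c * (integral {T1..T} f / of_real T)) \<longlongrightarrow> c * L) at_top"
    using assms unfolding has_mean_def by (intro tendsto_intros) auto
  then show ?thesis using assms unfolding has_mean_def by (auto intro!: continuous_intros)
qed

lemma has_mean_sum:
  assumes "\<And>i. i \<in> I \<Longrightarrow> has_mean T1 (f i) (L i)" "finite I"
  shows "has_mean T1 (\<lambda>u. \<Sum>i\<in>I. f i u) (\<Sum>i\<in>I. L i)"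
  using assms(2,1)
proof (induction I rule: finite_induct)
  case empty
  then show ?case by (simp add: has_mean_def)
next
  case (insert i I)
  then show ?case by (auto intro!: has_mean_add)
qed

text \<open>The primitive is bounded by 1 / |c|, so the bound does not grow with the interval. This
  makes distinct frequencies orthogonal in mean.\<close>

lemma norm_integral_cis_le:
  assumes "c \<noteq> 0"
  shows "cmod (integral {a..b} (\<lambda>u. cis (c * u))) \<le> 2 / \<bar>c\<bar>"
proof (cases "a \<le> b")
  case True
  define k where "k = \<i> * of_real c"
  have k: "k \<noteq> 0" using assms by (simp add: k_def)
  have cis: "cis (c * u) = exp (k * of_real u)" for u by (simp add: k_def cis_conv_exp mult_ac)
  have "((\<lambda>u. cis (c * u)) has_integral (cis (c * b) / k - cis (c * a) / k)) {a..b}"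
    unfolding cis
  proof (rule fundamental_theorem_of_calculus[OF True])
    fix x assume "x \<in> {a..b}"
    have "((\<lambda>w. exp (k * w) / k) has_field_derivative exp (k * of_real x)) (at (of_real x))"
      using k by (auto intro!: derivative_eq_intros)
    from has_vector_derivative_real_field[OF this]
    show "((\<lambda>u. exp (k * of_real u) / k) has_vector_derivative exp (k * of_real x)) (at x within {a..b})" .
  qed
  then have "integral {a..b} (\<lambda>u. cis (c * u)) = (cis (c * b) - cis (c * a)) / k"
    by (simp add: integral_unique diff_divide_distrib)
  also have "cmod \<dots> \<le> 2 / \<bar>c\<bar>"
    using norm_triangle_ineq4[of "cis (c * b)" "cis (c * a)"]
    by (auto simp: norm_divide norm_mult k_def intro!: divide_right_mono)
  finally show ?thesis .
qed auto

lemma has_mean_const: "has_mean T1 (\<lambda>u. c) c"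
proof -
  have "((\<lambda>T. (T - T1) / T) \<longlongrightarrow> 1) at_top" by real_asymp
  then have "((\<lambda>T. of_real ((T - T1) / T) * c) \<longlongrightarrow> of_real 1 * c) at_top" by (intro tendsto_intros)
  moreover have "\<forall>\<^sub>F T in at_top. of_real ((T - T1) / T) * c = integral {T1..T} (\<lambda>u. c) / of_real T"
    using eventually_ge_at_top[of T1] by eventually_elim (auto simp: scaleR_conv_of_real)
  ultimately show ?thesis unfolding has_mean_def by (auto elim: Lim_transform_eventually)
qed

lemma has_mean_cis:
  "has_mean T1 (\<lambda>u. cis (c * u)) (if c = 0 then 1 else 0)"
proof (cases "c = 0")
  case True
  then show ?thesis using has_mean_const[of T1 1] by simp
next
  case False
  have "((\<lambda>T. integral {T1..T} (\<lambda>u. cis (c * u)) / of_real T) \<longlongrightarrow> 0) at_top"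
  proof (rule Lim_null_comparison)
    show "\<forall>\<^sub>F T in at_top. cmod (integral {T1..T} (\<lambda>u. cis (c * u)) / of_real T) \<le> 2 / \<bar>c\<bar> / T"
      using eventually_gt_at_top[of 0]
      by eventually_elim (use norm_integral_cis_le[OF False, of T1] in \<open>auto simp: norm_divide intro!: divide_right_mono simp del: divide_divide_eq_left\<close>)
    show "((\<lambda>T. 2 / \<bar>c\<bar> / T) \<longlongrightarrow> 0) at_top" by real_asymp
  qed
  then show ?thesis using False by (auto simp: has_mean_def cis_conv_exp intro!: continuous_intros)
qed

text \<open>Means are stable under uniform approximation. All approximants are required to have the
  same mean L, as partial sums have for a fixed coefficient once they contain it.\<close>

lemma has_mean_approx:
  assumes f: "continuous_on {T1..} f" and T1: "T1 \<ge> 0"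
    and *: "\<And>e. e > 0 \<Longrightarrow> \<exists>g. has_mean T1 g L \<and> (\<forall>u\<ge>T1. cmod (f u - g u) \<le> e)"
  shows "has_mean T1 f L"
proof -
  have "((\<lambda>T. integral {T1..T} f / of_real T) \<longlongrightarrow> L) at_top"
  proof (rule tendstoI)
  fix e :: real assume "e > 0"
  then obtain g where g: "has_mean T1 g L" "\<And>u. u \<ge> T1 \<Longrightarrow> cmod (f u - g u) \<le> e / 2"
    using *[of "e / 2"] by auto
  have "\<forall>\<^sub>F T in at_top. dist (integral {T1..T} g / of_real T) L < e / 2"
    by (rule tendstoD[OF conjunct2[OF g(1)[unfolded has_mean_def]] half_gt_zero[OF \<open>e > 0\<close>]])
  then show "\<forall>\<^sub>F T in at_top. dist (integral {T1..T} f / of_real T) L < e"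
    using eventually_gt_at_top[of T1] eventually_gt_at_top[of 0]
  proof eventually_elim
    case (elim T)
    have fi: "f integrable_on {T1..T}" using f by (intro integrable_continuous_interval) (auto intro: continuous_on_subset)
    have gi: "g integrable_on {T1..T}" by (rule has_mean_integrable[OF g(1)])
    have "cmod (integral {T1..T} f - integral {T1..T} g) = cmod (integral {T1..T} (\<lambda>u. f u - g u))"
      using fi gi by (simp add: integral_diff)
    also have "\<dots> \<le> integral {T1..T} (\<lambda>u. e / 2)"
      by (rule integral_norm_bound_integral) (use g(2) fi gi in \<open>auto intro: integrable_diff\<close>)
    also have "\<dots> \<le> e / 2 * T" using elim T1 \<open>e > 0\<close> by (simp add: algebra_simps)
    finally have "dist (integral {T1..T} f / of_real T) (integral {T1..T} g / of_real T) \<le> e / 2"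
      using elim by (simp add: dist_norm diff_divide_distrib[symmetric] norm_divide field_simps)
    then show ?case using elim(1) dist_triangle[of "integral {T1..T} f / of_real T" L "integral {T1..T} g / of_real T"] by linarith
  qed
  qed
  then show ?thesis using f by (simp add: has_mean_def)
qed

text \<open>The common term of all series involved: \<beta> = 1 gives an ordinary Dirichlet series
  with index moved by one, and \<beta> = \<alpha> a Hurwitz-type series.\<close>

definition dterm :: "real \<Rightarrow> nat \<Rightarrow> complex \<Rightarrow> complex" where
  "dterm \<beta> m s = complex_of_real (real m + \<beta>) powr (- s)"

lemma dterm_eq_exp: "\<beta> > 0 \<Longrightarrow> dterm \<beta> m s = exp (- (s * of_real (ln (real m + \<beta>))))"
proof -
  assume "\<beta> > 0"
  then have "real m + \<beta> > 0" by simp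
  then have "complex_of_real (real m + \<beta>) \<noteq> 0" "real m + \<beta> > 0" unfolding of_real_eq_0_iff by auto
  then show ?thesis unfolding dterm_def powr_def by (simp only: Ln_of_real if_False) simp
qed

lemma norm_dterm: "\<beta> > 0 \<Longrightarrow> cmod (dterm \<beta> m s) = (real m + \<beta>) powr (- Re s)"
  by (simp add: dterm_eq_exp powr_def)

lemma dterm_holomorphic [holomorphic_intros]: "\<beta> > 0 \<Longrightarrow> dterm \<beta> m holomorphic_on A"
  by (subst holomorphic_cong[OF refl dterm_eq_exp]) (auto intro!: holomorphic_intros)

lemma dterm_analytic: "\<beta> > 0 \<Longrightarrow> dterm \<beta> m analytic_on A"
  using dterm_holomorphic[of \<beta> m UNIV] analytic_on_open[OF open_UNIV] analytic_on_subset by blast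

lemma dterm_add: "\<beta> > 0 \<Longrightarrow> dterm \<beta> m (s + t) = dterm \<beta> m s * dterm \<beta> m t"
  by (simp add: dterm_eq_exp exp_add[symmetric] algebra_simps)

lemma dterm_Complex:
  assumes "\<beta> > 0"
  shows "dterm \<beta> m (Complex \<sigma> u) = of_real ((real m + \<beta>) powr (- \<sigma>)) * cis (- ln (real m + \<beta>) * u)"
proof -
  have "real m + \<beta> > 0" using assms by simp
  then have "complex_of_real ((real m + \<beta>) powr (- \<sigma>)) = exp (of_real (- \<sigma> * ln (real m + \<beta>)))"
    unfolding exp_of_real by (simp add: powr_def)
  then show ?thesis
    using assms by (simp add: dterm_eq_exp cis_conv_exp exp_add[symmetric] Complex_eq algebra_simps)
qed

definition ptl :: "real \<Rightarrow> (nat \<Rightarrow> complex) \<Rightarrow> nat \<Rightarrow> complex \<Rightarrow> complex" where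
  "ptl \<beta> a n s = (\<Sum>m<n. a m * dterm \<beta> m s)"

lemma ptl_holomorphic: "\<beta> > 0 \<Longrightarrow> ptl \<beta> a n holomorphic_on A"
  unfolding ptl_def by (intro holomorphic_intros) auto

lemma ptl_analytic: "\<beta> > 0 \<Longrightarrow> ptl \<beta> a n analytic_on A"
  unfolding ptl_def by (intro analytic_intros dterm_analytic) auto

lemma continuous_on_compose_vertical:
  assumes "continuous_on A f" "\<And>u. u \<in> S \<Longrightarrow> Complex \<sigma> u \<in> A"
  shows "continuous_on S (\<lambda>u. f (Complex \<sigma> u))"
  by (rule continuous_on_compose2[OF assms(1) continuous_on_Complex_vertical]) (use assms(2) in auto)

text \<open>The larger endpoint value depends on whether x is below 1, as m + \<beta> may be for m =
  0. Adding both endpoints avoids the distinction.\<close>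

lemma powr_strip_bound:
  fixes x :: real
  assumes "x > 0" "\<sigma>1 \<le> \<sigma>" "\<sigma> \<le> \<sigma>2"
  shows "x powr \<sigma> \<le> x powr \<sigma>1 + x powr \<sigma>2"
proof (cases "x \<ge> 1")
  case True
  then have "x powr \<sigma> \<le> x powr \<sigma>2" using assms by (intro powr_mono) auto
  then show ?thesis by (simp add: add_increasing)
next
  case False
  then have "x powr \<sigma> \<le> x powr \<sigma>1" using assms by (intro powr_mono') auto
  then show ?thesis by (simp add: add_increasing2)
qed

lemma ptl_strip_bound:
  assumes "\<beta> > 0"
  obtains M where "M \<ge> 0" "\<And>s. \<sigma>1 \<le> Re s \<Longrightarrow> Re s \<le> \<sigma>2 \<Longrightarrow> cmod (ptl \<beta> a n s) \<le> M"
proof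
  let ?M = "\<Sum>m<n. cmod (a m) * ((real m + \<beta>) powr (- \<sigma>2) + (real m + \<beta>) powr (- \<sigma>1))"
  show "?M \<ge> 0" by (intro sum_nonneg) auto
  fix s assume s: "\<sigma>1 \<le> Re s" "Re s \<le> \<sigma>2"
  show "cmod (ptl \<beta> a n s) \<le> ?M"
    unfolding ptl_def
    by (rule sum_norm_le)
       (use assms s in \<open>auto simp: norm_mult norm_dterm intro!: mult_left_mono powr_strip_bound\<close>)
qed

text \<open>Parseval for a finite sum: the frequencies ln (m + \<beta>) are distinct, so after
  squaring only the diagonal has a nonzero mean.\<close>

lemma has_mean_ptl_norm:
  assumes \<beta>: "\<beta> > 0"
  shows "has_mean T1 (\<lambda>u. of_real ((cmod (ptl \<beta> a n (Complex \<sigma> u)))\<^sup>2))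
           (of_real (\<Sum>m<n. (cmod (a m))\<^sup>2 * (real m + \<beta>) powr (- 2 * \<sigma>)))"
proof -
  define x where "x m = complex_of_real ((real m + \<beta>) powr (- \<sigma>))" for m
  define l where "l m = ln (real m + \<beta>)" for m
  have inj: "l m = l k \<longleftrightarrow> m = k" for m k using \<beta> by (simp add: l_def)
  have "complex_of_real ((cmod (ptl \<beta> a n (Complex \<sigma> u)))\<^sup>2) =
     (\<Sum>m<n. \<Sum>k<n. (a m * x m * cnj (a k) * x k) * cis ((l k - l m) * u))" for u
    unfolding complex_norm_square ptl_def cnj_sum sum_product
  proof (intro sum.cong refl)
    fix m k
    have "cis ((l k - l m) * u) = cis (- l m * u) * cis (l k * u)"
      by (simp add: cis_mult algebra_simps)
    then show "a m * dterm \<beta> m (Complex \<sigma> u) * cnj (a k * dterm \<beta> k (Complex \<sigma> u)) =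
        a m * x m * cnj (a k) * x k * cis ((l k - l m) * u)"
      by (simp add: dterm_Complex \<beta> x_def l_def cis_cnj mult_ac)
  qed
  moreover have "has_mean T1 (\<lambda>u. \<Sum>m<n. \<Sum>k<n. (a m * x m * cnj (a k) * x k) * cis ((l k - l m) * u))
      (\<Sum>m<n. \<Sum>k<n. (a m * x m * cnj (a k) * x k) * (if l k - l m = 0 then 1 else 0))"
    by (intro has_mean_sum has_mean_cmult has_mean_cis) auto
  moreover have "(\<Sum>m<n. \<Sum>k<n. (a m * x m * cnj (a k) * x k) * (if l k - l m = 0 then 1 else 0))
     = of_real (\<Sum>m<n. (cmod (a m))\<^sup>2 * (real m + \<beta>) powr (- 2 * \<sigma>))"
  proof -
    have "(real m + \<beta>) powr (- 2 * \<sigma>) = (real m + \<beta>) powr (- \<sigma>) * (real m + \<beta>) powr (- \<sigma>)" for m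
      by (simp add: powr_add[symmetric])
    then have sq: "a m * x m * cnj (a m) * x m = of_real ((cmod (a m))\<^sup>2 * (real m + \<beta>) powr (- 2 * \<sigma>))" for m
      unfolding of_real_mult complex_norm_square by (simp add: x_def)
    have "(\<Sum>m<n. \<Sum>k<n. (a m * x m * cnj (a k) * x k) * (if l k - l m = 0 then 1 else 0))
       = (\<Sum>m<n. \<Sum>k<n. if m = k then a m * x m * cnj (a m) * x m else 0)"
      by (intro sum.cong refl) (auto simp: inj)
    also have "\<dots> = (\<Sum>m<n. a m * x m * cnj (a m) * x m)" by simp
    finally show ?thesis by (simp only: sq of_real_sum)
  qed
  ultimately show ?thesis by simp
qed

text \<open>Abscissa 3 is a fixed place well inside absolute convergence. Conditions on the
  continuation are imposed only above height \<open>T1\<close>, which can be chosen above all poles,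
  and only on the closed half-plane from \<sigma>0 on. The growth exponent may depend on the right
  edge of the strip.\<close>

locale continued_dirichlet =
  fixes \<beta> \<sigma>0 T1 :: real and a :: "nat \<Rightarrow> complex" and F :: "complex \<Rightarrow> complex"
  assumes \<beta>: "0 < \<beta>" and T1: "T1 \<ge> 1" and \<sigma>0: "\<sigma>0 < 3"
    and abs_conv: "summable (\<lambda>m. cmod (a m) * (real m + \<beta>) powr (-3))"
    and F_sums: "\<And>s. Re s \<ge> 3 \<Longrightarrow> (\<lambda>m. a m * dterm \<beta> m s) sums F s"
    and F_analytic: "F analytic_on {s. \<sigma>0 \<le> Re s \<and> T1 \<le> Im s}"
    and growth: "\<And>\<sigma>2. \<exists>B. \<exists>C::nat. \<forall>s. \<sigma>0 \<le> Re s \<and> Re s \<le> \<sigma>2 \<and> T1 \<le> Im s \<longrightarrow> cmod (F s) \<le> B * Im s ^ C"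
    and mean_square: "\<exists>C. \<forall>\<^sub>F T in at_top. integral {T1..T} (\<lambda>u. (cmod (F (Complex \<sigma>0 u)))\<^sup>2) \<le> C * T"
begin

section \<open>Partial sums far to the right, and mean squares inside the strip\<close>

lemma abs_conv': "\<sigma> \<ge> 3 \<Longrightarrow> summable (\<lambda>m. cmod (a m) * (real m + \<beta>) powr (- \<sigma>))"
proof (rule summable_comparison_test_ev[OF _ abs_conv])
  assume "\<sigma> \<ge> 3"
  show "\<forall>\<^sub>F m in sequentially. norm (cmod (a m) * (real m + \<beta>) powr (- \<sigma>)) \<le> cmod (a m) * (real m + \<beta>) powr (-3)"
    using eventually_ge_at_top[of 1]
    by eventually_elim (use \<beta> \<open>\<sigma> \<ge> 3\<close> in \<open>auto simp: abs_mult intro!: mult_left_mono powr_mono\<close>)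
qed

definition tl_sum :: "real \<Rightarrow> nat \<Rightarrow> real" where
  "tl_sum \<sigma> n = (\<Sum>m. cmod (a m) * (real m + \<beta>) powr (- \<sigma>)) - (\<Sum>m<n. cmod (a m) * (real m + \<beta>) powr (- \<sigma>))"

lemma tl_sum_lim: "\<sigma> \<ge> 3 \<Longrightarrow> tl_sum \<sigma> \<longlonglongrightarrow> 0"
  using tendsto_diff[OF tendsto_const summable_LIMSEQ[OF abs_conv'[of \<sigma>]], of "\<Sum>m. cmod (a m) * (real m + \<beta>) powr (- \<sigma>)"]
  unfolding tl_sum_def[abs_def] by simp

lemma F_ptl_bound:
  assumes "\<sigma> \<ge> 3"
  shows "cmod (F (Complex \<sigma> u) - ptl \<beta> a n (Complex \<sigma> u)) \<le> tl_sum \<sigma> n"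
proof -
  let ?t = "\<lambda>m. a m * dterm \<beta> m (Complex \<sigma> u)"
  have n: "norm (?t m) = cmod (a m) * (real m + \<beta>) powr (- \<sigma>)" for m by (simp add: norm_mult norm_dterm \<beta>)
  have s: "?t sums F (Complex \<sigma> u)" by (rule F_sums) (use assms in simp)
  have sn: "summable (\<lambda>m. norm (?t m))" unfolding n by (rule abs_conv'[OF assms])
  have "F (Complex \<sigma> u) - ptl \<beta> a n (Complex \<sigma> u) = (\<Sum>m. ?t (m + n))"
    using suminf_minus_initial_segment[OF sums_summable[OF s], of n] sums_unique[OF s] by (simp add: ptl_def)
  also have "norm \<dots> \<le> (\<Sum>m. norm (?t (m + n)))"
    by (rule summable_norm) (use sn in \<open>simp add: summable_iff_shift[of "\<lambda>m. norm (?t m)"]\<close>)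
  also have "\<dots> = tl_sum \<sigma> n"
    unfolding tl_sum_def n[symmetric] by (rule suminf_minus_initial_segment[OF sn])
  finally show ?thesis .
qed

lemma F_continuous: "\<sigma> \<ge> \<sigma>0 \<Longrightarrow> continuous_on {T1..} (\<lambda>u. F (Complex \<sigma> u))"
  by (rule continuous_on_compose_vertical[OF holomorphic_on_imp_continuous_on[OF analytic_imp_holomorphic[OF F_analytic]]]) auto

lemma F_sq_integrable: "\<sigma> \<ge> \<sigma>0 \<Longrightarrow> T1 \<le> T \<Longrightarrow> (\<lambda>u. (cmod (F (Complex \<sigma> u)))\<^sup>2) integrable_on {T..T'}"
  by (intro integrable_continuous_interval continuous_intros continuous_on_subset[OF F_continuous]) auto

lemma mean_square_right:
  assumes "\<sigma> \<ge> 3"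
  shows "\<forall>\<^sub>F T in at_top. integral {T1..T} (\<lambda>u. (cmod (F (Complex \<sigma> u) - ptl \<beta> a n (Complex \<sigma> u)))\<^sup>2) \<le> (tl_sum \<sigma> n)\<^sup>2 * T"
  using eventually_ge_at_top[of T1]
proof eventually_elim
  case (elim T)
  have "integral {T1..T} (\<lambda>u. (cmod (F (Complex \<sigma> u) - ptl \<beta> a n (Complex \<sigma> u)))\<^sup>2) \<le> integral {T1..T} (\<lambda>u. (tl_sum \<sigma> n)\<^sup>2)"
  proof (rule integral_le)
    show "(\<lambda>u. (cmod (F (Complex \<sigma> u) - ptl \<beta> a n (Complex \<sigma> u)))\<^sup>2) integrable_on {T1..T}"
      using assms \<sigma>0
      by (intro integrable_continuous_interval continuous_intros continuous_on_subset[OF F_continuous]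
           continuous_on_compose_vertical[OF holomorphic_on_imp_continuous_on[OF ptl_holomorphic[OF \<beta>, of a n UNIV]]]) auto
  qed (auto intro!: power_mono F_ptl_bound assms)
  also have "\<dots> = (tl_sum \<sigma> n)\<^sup>2 * (T - T1)" using elim by simp
  also have "\<dots> \<le> (tl_sum \<sigma> n)\<^sup>2 * T" using T1 by (intro mult_left_mono) auto
  finally show ?case .
qed

text \<open>The discrete mean square with steps of length 1 and weight parameter y = 0: one sequence
  \<open>q\<close> majorises the square of F on whole unit boxes and is bounded on average. It
  serves both the interior mean square and the pointwise bound on horizontal segments.\<close>

lemma unit_steps:
  assumes \<sigma>: "\<sigma>0 < \<sigma>" "\<sigma> \<le> 3"
  obtains q C k0 where "\<And>k. q k \<ge> 0" "C \<ge> 0" "real k0 \<ge> T1"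
    "\<And>k x v. k \<ge> k0 \<Longrightarrow> \<sigma> \<le> x \<Longrightarrow> x \<le> 3 \<Longrightarrow> real k \<le> v \<Longrightarrow> v \<le> real k + 1 \<Longrightarrow> (cmod (F (Complex x v)))\<^sup>2 \<le> q k"
    "\<forall>\<^sub>F N in sequentially. (\<Sum>k=k0..N. q k) \<le> C * (real N + 1)"
proof -
  \<comment> \<open>The right line is taken at 4; \<delta> \<le> 1 then leaves the abscissas up to 3
    inside the admissible strip.\<close>
  define \<delta> where "\<delta> = min (\<sigma> - \<sigma>0) 1"
  have \<delta>: "\<delta> > 0" "\<sigma>0 + \<delta> \<le> \<sigma>" "\<delta> \<le> 1" using \<sigma> by (auto simp: \<delta>_def)
  obtain B and C :: nat where BC: "\<And>s. \<sigma>0 \<le> Re s \<Longrightarrow> Re s \<le> 4 \<Longrightarrow> T1 \<le> Im s \<Longrightarrow> cmod (F s) \<le> B * Im s ^ C"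
    using growth[of 4] by blast
  obtain m1 where m1: "\<forall>\<^sub>F T in at_top. integral {T1..T} (\<lambda>u. (cmod (F (Complex \<sigma>0 u)))\<^sup>2) \<le> m1 * T"
    using mean_square by blast
  have m2: "\<forall>\<^sub>F T in at_top. integral {T1..T} (\<lambda>u. (cmod (F (Complex 4 u)))\<^sup>2) \<le> (tl_sum 4 0)\<^sup>2 * T"
    using mean_square_right[of 4 0] by (simp add: ptl_def)
  have an: "F analytic_on {z. \<sigma>0 \<le> Re z \<and> Re z \<le> 4 \<and> T1 \<le> Im z}"
    by (rule analytic_on_subset[OF F_analytic]) auto
  define C' where "C' = (exp ((4 - \<sigma>0)\<^sup>2) * (1 / \<delta> + (4 - \<sigma>0)) * exp 1 * (2 * exp 1 / (1 - exp (- 1))) * (2 * 1 + 2 * 1)) *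
     (exp (- (0 * \<delta>)) * m1 + exp (0 * (4 - \<sigma>0)) * (tl_sum 4 0)\<^sup>2) + 1"
  obtain k0 q where kq: "\<And>k. q k \<ge> 0"
    "\<And>k z. k \<ge> k0 \<Longrightarrow> \<sigma>0 + \<delta> \<le> Re z \<Longrightarrow> Re z \<le> 4 - \<delta> \<Longrightarrow> \<bar>Im z\<bar> \<le> 1 \<Longrightarrow>
       (cmod (F (z + \<i> * of_nat k * of_real 1)))\<^sup>2 \<le> q k"
    and C': "\<forall>\<^sub>F N in sequentially. (\<Sum>k=k0..N. q k) \<le> C' * (real N + 1)"
    unfolding C'_def
  proof (rule strip_discrete_mean_square[where h = 1 and Y = 1 and y = 0 and e = 1 and ?T1.0 = T1 and G = F
        and ?\<sigma>1.0 = \<sigma>0 and ?\<sigma>2.0 = 4 and \<delta> = \<delta> and B = B and C = C and ?m1.0 = m1 and ?m2.0 = "(tl_sum 4 0)\<^sup>2"])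
    show "\<delta> > 0" "\<sigma>0 + \<delta> \<le> 4 - \<delta>" using \<delta> \<sigma> by auto
    show "F analytic_on {z. \<sigma>0 \<le> Re z \<and> Re z \<le> 4 \<and> T1 \<le> Im z}" by (rule an)
    show "cmod (F z) \<le> B * Im z ^ C" if "\<sigma>0 \<le> Re z" "Re z \<le> 4" "T1 \<le> Im z" for z
      by (rule BC[OF that])
    show "\<forall>\<^sub>F T in at_top. integral {T1..T} (\<lambda>u. (cmod (F (Complex \<sigma>0 u)))\<^sup>2) \<le> m1 * T" by (rule m1)
    show "\<forall>\<^sub>F T in at_top. integral {T1..T} (\<lambda>u. (cmod (F (Complex 4 u)))\<^sup>2) \<le> (tl_sum 4 0)\<^sup>2 * T" by (rule m2)
  qed (use T1 in auto)
  obtain k1 :: nat where k1: "real k1 \<ge> T1" using real_arch_simple by blast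
  show ?thesis
  proof (rule that[of q "max C' 0" "max k0 k1"])
    show "T1 \<le> real (max k0 k1)" using k1 by simp
    show "(cmod (F (Complex x v)))\<^sup>2 \<le> q k"
      if "k \<ge> max k0 k1" "\<sigma> \<le> x" "x \<le> 3" "real k \<le> v" "v \<le> real k + 1" for k x v
    proof -
      have "Complex x (v - real k) + \<i> * of_nat k * of_real 1 = Complex x v"
        by (simp add: complex_eq_iff)
      then show ?thesis using kq(2)[of k "Complex x (v - real k)"] that \<delta> by simp
    qed
    show "\<forall>\<^sub>F N in sequentially. (\<Sum>k=max k0 k1..N. q k) \<le> max C' 0 * (real N + 1)"
      using C'
    proof eventually_elim
      case (elim N)
      have "(\<Sum>k=max k0 k1..N. q k) \<le> (\<Sum>k=k0..N. q k)" by (rule sum_mono2) (use kq in auto)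
      also have "\<dots> \<le> C' * (real N + 1)" by (rule elim)
      also have "\<dots> \<le> max C' 0 * (real N + 1)" by (intro mult_right_mono) auto
      finally show ?case .
    qed
  qed (use kq in auto)
qed

text \<open>The O(T) mean square on the boundary line spreads to the interior: each interval
  [k, k + 1] contributes at most \<open>q k\<close>.\<close>

lemma mean_square_interior:
  assumes \<sigma>: "\<sigma>0 < \<sigma>" "\<sigma> \<le> 3"
  shows "\<exists>C. \<forall>\<^sub>F T in at_top. integral {T1..T} (\<lambda>u. (cmod (F (Complex \<sigma> u)))\<^sup>2) \<le> C * T"
proof -
  obtain q C k0 where q: "\<And>k. q k \<ge> 0" and C: "C \<ge> 0" and k0: "real k0 \<ge> T1"
    and Fq: "\<And>k x v. k \<ge> k0 \<Longrightarrow> \<sigma> \<le> x \<Longrightarrow> x \<le> 3 \<Longrightarrow> real k \<le> v \<Longrightarrow> v \<le> real k + 1 \<Longrightarrow> (cmod (F (Complex x v)))\<^sup>2 \<le> q k"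
    and ev: "\<forall>\<^sub>F N in sequentially. (\<Sum>k=k0..N. q k) \<le> C * (real N + 1)"
    by (rule unit_steps[OF \<sigma>]) blast
  define g where "g u = (cmod (F (Complex \<sigma> u)))\<^sup>2" for u
  have gi: "g integrable_on {T..T'}" if "T1 \<le> T" for T T'
    unfolding g_def by (rule F_sq_integrable) (use that \<sigma> in auto)
  have g0: "g u \<ge> 0" for u by (simp add: g_def)
  define S where "S = integral {T1..real k0} g"
  have step: "integral {T1..real N} g \<le> S + (\<Sum>k=k0..<N. q k)" if "N \<ge> k0" for N
    using that
  proof (induction N rule: dec_induct)
    case base
    then show ?case by (simp add: S_def)
  next
    case (step N)
    have "integral {T1..real (Suc N)} g = integral {T1..real N} g + integral {real N..real (Suc N)} g"
      by (rule Henstock_Kurzweil_Integration.integral_combine[symmetric]) (use k0 step gi in auto)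
    also have "integral {real N..real (Suc N)} g \<le> integral {real N..real (Suc N)} (\<lambda>_. q N)"
      by (rule integral_le) (use k0 step gi \<sigma> Fq[of N \<sigma>] in \<open>auto simp: g_def[symmetric]\<close>)
    also have "\<dots> = q N" by simp
    finally show ?case using step by simp
  qed
  have "\<forall>\<^sub>F T in at_top. integral {T1..T} g \<le> (C * 4 + 1) * T"
  proof -
    have c: "filterlim (\<lambda>T::real. nat \<lceil>T\<rceil>) at_top at_top" 
      by real_asymp
    have "\<forall>\<^sub>F T::real in at_top. (\<Sum>k=k0..nat \<lceil>T\<rceil>. q k) \<le> C * (real (nat \<lceil>T\<rceil>) + 1)"
      using filterlim_iff[THEN iffD1, rule_format, OF c ev] .
    then show ?thesis
      using eventually_ge_at_top[of "max S 1"] eventually_ge_at_top[of "real k0"]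
    proof eventually_elim
      case (elim T)
      define N where "N = nat \<lceil>T\<rceil>"
      have N: "T \<le> real N" "real N \<le> T + 1" "N \<ge> k0" using elim unfolding N_def by linarith+
      have "integral {T1..T} g \<le> integral {T1..real N} g"
        by (rule integral_subset_le) (use N gi g0 in auto)
      also have "\<dots> \<le> S + (\<Sum>k=k0..<N. q k)" by (rule step[OF N(3)])
      also have "(\<Sum>k=k0..<N. q k) \<le> (\<Sum>k=k0..N. q k)" by (rule sum_mono2) (use q in auto)
      also have "\<dots> \<le> C * (real N + 1)" using elim(1) by (simp add: N_def)
      also have "\<dots> \<le> C * (4 * T)" using C N elim by (intro mult_left_mono) auto
      also have "S + C * (4 * T) \<le> (C * 4 + 1) * T" using elim by (simp add: algebra_simps)
      finally show ?case by simp
    qed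
  qed
  then show ?thesis unfolding g_def by blast
qed

text \<open>One term of a nonnegative sum is at most the sum, so \<open>q N\<close> = O(N) and F =
  O(sqrt T) uniformly up to abscissa 3. This replaces the growth hypothesis, whose exponent is
  arbitrary, wherever horizontal sides must be o(T).\<close>

lemma horizontal_bound:
  assumes \<sigma>: "\<sigma>0 < \<sigma>" "\<sigma> \<le> 3"
  shows "\<exists>C. \<forall>\<^sub>F T in at_top. \<forall>x. \<sigma> \<le> x \<and> x \<le> 3 \<longrightarrow> cmod (F (Complex x T)) \<le> C * sqrt T"
proof -
  obtain q C k0 where q: "\<And>k. q k \<ge> 0" and C: "C \<ge> 0" and k0: "real k0 \<ge> T1"
    and Fq: "\<And>k x v. k \<ge> k0 \<Longrightarrow> \<sigma> \<le> x \<Longrightarrow> x \<le> 3 \<Longrightarrow> real k \<le> v \<Longrightarrow> v \<le> real k + 1 \<Longrightarrow> (cmod (F (Complex x v)))\<^sup>2 \<le> q k"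
    and ev: "\<forall>\<^sub>F N in sequentially. (\<Sum>k=k0..N. q k) \<le> C * (real N + 1)"
    by (rule unit_steps[OF \<sigma>]) blast
  have c: "filterlim (\<lambda>T::real. nat \<lfloor>T\<rfloor>) at_top at_top" 
    by real_asymp
  have "\<forall>\<^sub>F T::real in at_top. (\<Sum>k=k0..nat \<lfloor>T\<rfloor>. q k) \<le> C * (real (nat \<lfloor>T\<rfloor>) + 1)"
    using filterlim_iff[THEN iffD1, rule_format, OF c ev] .
  then have "\<forall>\<^sub>F T in at_top. \<forall>x. \<sigma> \<le> x \<and> x \<le> 3 \<longrightarrow> cmod (F (Complex x T)) \<le> sqrt (2 * C) * sqrt T"
    using eventually_ge_at_top[of 1] eventually_ge_at_top[of "real k0"]
  proof eventually_elim
    case (elim T)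
    define N where "N = nat \<lfloor>T\<rfloor>"
    have N: "real N \<le> T" "T \<le> real N + 1" "N \<ge> k0" using elim unfolding N_def by linarith+
    have "q N \<le> (\<Sum>k=k0..N. q k)" by (rule member_le_sum) (use q N in auto)
    also have "\<dots> \<le> C * (real N + 1)" using elim(1) by (simp add: N_def)
    also have "\<dots> \<le> C * (2 * T)" using C N elim by (intro mult_left_mono) auto
    finally have *: "q N \<le> 2 * C * T" by simp
    show ?case
    proof (intro allI impI)
      fix x assume "\<sigma> \<le> x \<and> x \<le> 3"
      then have "(cmod (F (Complex x T)))\<^sup>2 \<le> 2 * C * T" using Fq[of N x T] N * by auto
      then show "cmod (F (Complex x T)) \<le> sqrt (2 * C) * sqrt T"
        by (simp add: real_le_rsqrt real_sqrt_mult[symmetric])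
    qed
  qed
  then show ?thesis by blast
qed

section \<open>Coefficients as mean values, and Bessel's inequality\<close>

lemma dterm_uminus_Complex:
  "dterm \<beta> m (- Complex \<sigma> u) = of_real ((real m + \<beta>) powr \<sigma>) * cis (ln (real m + \<beta>) * u)"
  using dterm_Complex[OF \<beta>, of m "-\<sigma>" "-u"] by (simp add: uminus_complex.code)

text \<open>The classical formula for Dirichlet coefficients on a line of absolute convergence: in a
  partial sum, multiplying by (m + \<beta>)^s leaves frequency zero only in the m-th term, and the
  tails are uniformly small.\<close>

lemma has_mean_coeff_right:
  "has_mean T1 (\<lambda>u. F (Complex 3 u) * dterm \<beta> m (- Complex 3 u)) (a m)"
proof (rule has_mean_approx)
  show "continuous_on {T1..} (\<lambda>u. F (Complex 3 u) * dterm \<beta> m (- Complex 3 u))"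
    unfolding dterm_uminus_Complex cis_conv_exp
    using \<sigma>0 by (intro continuous_intros F_continuous) auto
  define L where "L = (real m + \<beta>) powr 3"
  have L: "L > 0" using \<beta> by (simp add: L_def)
  fix e :: real assume e: "e > 0"
  \<comment> \<open>The error is multiplied by the constant modulus L of (m + \<beta>)^s, hence e /
    L. Below, n is also taken larger than m so that the m-th term is present.\<close>
  have "\<forall>\<^sub>F n in sequentially. tl_sum 3 n < e / L"
    using order_tendstoD(2)[OF tl_sum_lim[of 3], of "e / L"] e L by simp
  then have "\<forall>\<^sub>F n in sequentially. tl_sum 3 n < e / L \<and> m < n"
    using eventually_gt_at_top[of m] by eventually_elim auto
  from eventually_happens[OF this] obtain n where n: "tl_sum 3 n < e / L" "m < n"
    by (auto simp only: trivial_limit_sequentially)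
  define x where "x k = complex_of_real ((real k + \<beta>) powr (- 3))" for k
  define l where "l k = ln (real k + \<beta>)" for k
  have inj: "l m - l k = 0 \<longleftrightarrow> k = m" for k using \<beta> by (auto simp: l_def)
  have "has_mean T1 (\<lambda>u. \<Sum>k<n. (a k * x k * of_real L) * cis ((l m - l k) * u))
      (\<Sum>k<n. (a k * x k * of_real L) * (if l m - l k = 0 then 1 else 0))"
    by (intro has_mean_sum has_mean_cmult has_mean_cis) auto
  also have "(\<Sum>k<n. (a k * x k * of_real L) * (if l m - l k = 0 then 1 else 0)) = (\<Sum>k<n. if k = m then a k * x k * of_real L else 0)"
    unfolding inj by (intro sum.cong) auto
  also have "\<dots> = a m * (x m * of_real L)" using n(2) by simp
  also have "x m * of_real L = 1" unfolding x_def L_def of_real_mult[symmetric] powr_add[symmetric] using \<beta> by simp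
  also have "(\<lambda>u. \<Sum>k<n. (a k * x k * of_real L) * cis ((l m - l k) * u)) = (\<lambda>u. ptl \<beta> a n (Complex 3 u) * dterm \<beta> m (- Complex 3 u))"
  proof
    fix u
    have "cis ((l m - l k) * u) = cis (- l k * u) * cis (l m * u)" for k
      by (simp add: cis_mult algebra_simps)
    then show "(\<Sum>k<n. (a k * x k * of_real L) * cis ((l m - l k) * u)) = ptl \<beta> a n (Complex 3 u) * dterm \<beta> m (- Complex 3 u)"
      unfolding ptl_def sum_distrib_right dterm_uminus_Complex dterm_Complex[OF \<beta>]
      by (intro sum.cong) (simp_all add: x_def L_def l_def mult_ac)
  qed
  finally have "has_mean T1 (\<lambda>u. ptl \<beta> a n (Complex 3 u) * dterm \<beta> m (- Complex 3 u)) (a m)" by simp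
  moreover have "cmod (F (Complex 3 u) * dterm \<beta> m (- Complex 3 u) - ptl \<beta> a n (Complex 3 u) * dterm \<beta> m (- Complex 3 u)) \<le> e" for u
  proof -
    have "cmod (F (Complex 3 u) - ptl \<beta> a n (Complex 3 u)) \<le> e / L" using F_ptl_bound[of 3 u n] n(1) by simp
    moreover have "cmod (dterm \<beta> m (- Complex 3 u)) = L" by (simp add: norm_dterm \<beta> L_def)
    ultimately show ?thesis
      unfolding left_diff_distrib[symmetric] norm_mult using L by (simp add: field_simps)
  qed
  ultimately show "\<exists>g. has_mean T1 g (a m) \<and> (\<forall>u\<ge>T1. cmod (F (Complex 3 u) * dterm \<beta> m (- Complex 3 u) - g u) \<le> e)"
    by blast
qed (use T1 in auto)

text \<open>The line is moved from 3 to \<sigma> by Cauchy's theorem. The lower side is fixed and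
  the upper one is O(sqrt T), so both disappear after division by T. The series itself may diverge
  on the new line.\<close>

lemma has_mean_coeff:
  assumes \<sigma>: "\<sigma>0 < \<sigma>" "\<sigma> \<le> 3"
  shows "has_mean T1 (\<lambda>u. F (Complex \<sigma> u) * dterm \<beta> m (- Complex \<sigma> u)) (a m)"
proof (cases "\<sigma> = 3")
  case True
  then show ?thesis using has_mean_coeff_right by simp
next
  case False
  define f where "f s = F s * dterm \<beta> m (- s)" for s
  have dh: "(\<lambda>s. dterm \<beta> m (- s)) holomorphic_on A" for A
    by (rule holomorphic_on_compose[OF _ dterm_holomorphic[OF \<beta>], unfolded o_def]) (intro holomorphic_intros)
  have fh: "f holomorphic_on {s. \<sigma>0 \<le> Re s \<and> T1 \<le> Im s}"
    unfolding f_def by (intro holomorphic_intros analytic_imp_holomorphic[OF F_analytic] dh)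
  have fc: "continuous_on {T1..} (\<lambda>u. f (Complex x u))" if "x \<ge> \<sigma>0" for x
    by (rule continuous_on_compose_vertical[OF holomorphic_on_imp_continuous_on[OF fh]]) (use that in auto)
  define L where "L = (real m + \<beta>) powr \<sigma> + (real m + \<beta>) powr 3"
  have L: "cmod (dterm \<beta> m (- Complex x u)) \<le> L" if "\<sigma> \<le> x" "x \<le> 3" for x u
    using powr_strip_bound[of "real m + \<beta>" \<sigma> x 3] that \<beta> by (simp add: norm_dterm L_def)
  obtain C where C: "\<forall>\<^sub>F T in at_top. \<forall>x. \<sigma> \<le> x \<and> x \<le> 3 \<longrightarrow> cmod (F (Complex x T)) \<le> C * sqrt T"
    using horizontal_bound[OF \<sigma>] by blast
  obtain B and D :: nat where B: "\<And>s. \<sigma>0 \<le> Re s \<Longrightarrow> Re s \<le> 3 \<Longrightarrow> T1 \<le> Im s \<Longrightarrow> cmod (F s) \<le> B * Im s ^ D"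
    using growth[of 3] by blast
  define M1 where "M1 = B * T1 ^ D * L"
  have L0: "L \<ge> 0" by (simp add: L_def)
  have "\<forall>\<^sub>F T in at_top. cmod (integral {T1..T} (\<lambda>u. f (Complex \<sigma> u)) / of_real T - integral {T1..T} (\<lambda>u. f (Complex 3 u)) / of_real T)
      \<le> (M1 + C * sqrt T * L) * (3 - \<sigma>) / T"
    using C eventually_gt_at_top[of T1]
  proof eventually_elim
    case (elim T)
    have "cmod (integral {T1..T} (\<lambda>u. f (Complex \<sigma> u)) - integral {T1..T} (\<lambda>u. f (Complex 3 u))) \<le> (M1 + C * sqrt T * L) * (3 - \<sigma>)"
    proof (rule integral_vertical_diff_bound)
      show "f holomorphic_on cbox (Complex \<sigma> T1) (Complex 3 T)"
        by (rule holomorphic_on_subset[OF fh]) (use \<sigma> in \<open>auto simp: in_cbox_Complex_iff\<close>)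
      show "cmod (f (Complex x T1)) \<le> M1" if "\<sigma> \<le> x" "x \<le> 3" for x
        unfolding f_def M1_def norm_mult
        using B[of "Complex x T1"] that \<sigma> L[OF that] L0 order_trans[OF norm_ge_zero B[of "Complex x T1"]] by (intro mult_mono) auto
      show "cmod (f (Complex x T)) \<le> C * sqrt T * L" if "\<sigma> \<le> x" "x \<le> 3" for x
        unfolding f_def norm_mult
        using elim(1) that L[OF that] L0 order_trans[OF norm_ge_zero, of "F (Complex x T)" "C * sqrt T"] by (intro mult_mono) auto
    qed (use False \<sigma> elim in auto)
    then show ?case
      using elim T1 by (simp add: diff_divide_distrib[symmetric] norm_divide divide_right_mono)
  qed
  then have "((\<lambda>T. integral {T1..T} (\<lambda>u. f (Complex \<sigma> u)) / of_real T - integral {T1..T} (\<lambda>u. f (Complex 3 u)) / of_real T) \<longlongrightarrow> 0) at_top"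
    by (rule Lim_null_comparison) real_asymp
  moreover have "((\<lambda>T. integral {T1..T} (\<lambda>u. f (Complex 3 u)) / of_real T) \<longlongrightarrow> a m) at_top"
    using has_mean_coeff_right[of m] by (simp add: has_mean_def f_def)
  ultimately have "((\<lambda>T. integral {T1..T} (\<lambda>u. f (Complex \<sigma> u)) / of_real T) \<longlongrightarrow> a m) at_top"
    using tendsto_add by fastforce
  then show ?thesis using fc[of \<sigma>] \<sigma> by (simp add: has_mean_def f_def)
qed

text \<open>On the line Re s = \<sigma> the conjugate of (m + \<beta>)^(-s) equals (m +
  \<beta>)^(-2\<sigma>) times (m + \<beta>)^s, so the correlation of F with a partial sum is a
  finite combination of coefficient means.\<close>

lemma has_mean_F_cnj_ptl:
  assumes \<sigma>: "\<sigma>0 < \<sigma>" "\<sigma> \<le> 3"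
  shows "has_mean T1 (\<lambda>u. F (Complex \<sigma> u) * cnj (ptl \<beta> a n (Complex \<sigma> u)))
    (of_real (\<Sum>m<n. (cmod (a m))\<^sup>2 * (real m + \<beta>) powr (- 2 * \<sigma>)))"
proof -
  define w where "w m = cnj (a m) * of_real ((real m + \<beta>) powr (- 2 * \<sigma>))" for m
  have "has_mean T1 (\<lambda>u. \<Sum>m<n. w m * (F (Complex \<sigma> u) * dterm \<beta> m (- Complex \<sigma> u))) (\<Sum>m<n. w m * a m)"
    by (intro has_mean_sum has_mean_cmult has_mean_coeff \<sigma>) auto
  also have "(\<Sum>m<n. w m * a m) = of_real (\<Sum>m<n. (cmod (a m))\<^sup>2 * (real m + \<beta>) powr (- 2 * \<sigma>))"
    unfolding of_real_sum of_real_mult complex_norm_square by (simp add: w_def mult_ac)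
  also have "(\<lambda>u. \<Sum>m<n. w m * (F (Complex \<sigma> u) * dterm \<beta> m (- Complex \<sigma> u))) = (\<lambda>u. F (Complex \<sigma> u) * cnj (ptl \<beta> a n (Complex \<sigma> u)))"
  proof
    fix u
    have "complex_of_real ((real m + \<beta>) powr (- \<sigma>)) = of_real ((real m + \<beta>) powr (- 2 * \<sigma>)) * of_real ((real m + \<beta>) powr \<sigma>)" for m
      unfolding of_real_mult[symmetric] powr_add[symmetric] by simp
    then show "(\<Sum>m<n. w m * (F (Complex \<sigma> u) * dterm \<beta> m (- Complex \<sigma> u))) = F (Complex \<sigma> u) * cnj (ptl \<beta> a n (Complex \<sigma> u))"
      unfolding ptl_def cnj_sum sum_distrib_left dterm_uminus_Complex dterm_Complex[OF \<beta>]
      by (intro sum.cong) (simp_all add: w_def mult_ac cis_cnj)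
  qed
  finally show ?thesis .
qed

lemma mean_square_ptl:
  "((\<lambda>T. integral {T1..T} (\<lambda>u. (cmod (ptl \<beta> a n (Complex \<sigma> u)))\<^sup>2) / T) \<longlongrightarrow>
     (\<Sum>m<n. (cmod (a m))\<^sup>2 * (real m + \<beta>) powr (- 2 * \<sigma>))) at_top"
proof -
  let ?f = "\<lambda>u. (cmod (ptl \<beta> a n (Complex \<sigma> u)))\<^sup>2"
  have c: "?f integrable_on {T1..T}" for T
    by (intro integrable_continuous_interval continuous_intros
      continuous_on_compose_vertical[OF holomorphic_on_imp_continuous_on[OF ptl_holomorphic[OF \<beta>, of a n UNIV]]]) auto
  have "integral {T1..T} (\<lambda>u. complex_of_real (?f u)) = of_real (integral {T1..T} ?f)" for T
    using has_integral_of_real[OF integrable_integral[OF c]] by (rule integral_unique)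
  then have "((\<lambda>T. complex_of_real (integral {T1..T} ?f / T)) \<longlongrightarrow>
     of_real (\<Sum>m<n. (cmod (a m))\<^sup>2 * (real m + \<beta>) powr (- 2 * \<sigma>))) at_top"
    using has_mean_ptl_norm[OF \<beta>, of T1 a n \<sigma>] unfolding has_mean_def by simp
  then show ?thesis unfolding tendsto_of_real_iff .
qed

text \<open>Bessel's inequality in the mean: the mean of |F - P|^2 is nonnegative, the mean of |P|^2
  and the correlation of F with P both equal S, and F contributes at most C; so C + S - 2 S \<ge> 0,
  uniformly in the number of terms.\<close>

lemma coeff_square_summable_strip:
  assumes \<sigma>: "\<sigma>0 < \<sigma>" "\<sigma> \<le> 3"
  shows "summable (\<lambda>m. (cmod (a m))\<^sup>2 * (real m + \<beta>) powr (- 2 * \<sigma>))"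
proof -
  obtain C where C: "\<forall>\<^sub>F T in at_top. integral {T1..T} (\<lambda>u. (cmod (F (Complex \<sigma> u)))\<^sup>2) \<le> C * T"
    using mean_square_interior[OF \<sigma>] by blast
  have "(\<Sum>m<n. (cmod (a m))\<^sup>2 * (real m + \<beta>) powr (- 2 * \<sigma>)) \<le> C" for n
  proof -
    define S where "S = (\<Sum>m<n. (cmod (a m))\<^sup>2 * (real m + \<beta>) powr (- 2 * \<sigma>))"
    define P where "P u = ptl \<beta> a n (Complex \<sigma> u)" for u
    define G where "G u = F (Complex \<sigma> u)" for u
    have Pc: "continuous_on A P" for A unfolding P_def
      by (rule continuous_on_compose_vertical[OF holomorphic_on_imp_continuous_on[OF ptl_holomorphic[OF \<beta>, of a n UNIV]]]) auto
    have Gc: "continuous_on {T1..T} G" for T unfolding G_def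
      by (rule continuous_on_subset[OF F_continuous]) (use \<sigma> in auto)
    let ?GP = "\<lambda>T. integral {T1..T} (\<lambda>u. G u * cnj (P u))"
    have i: "(\<lambda>u. (cmod (G u))\<^sup>2) integrable_on {T1..T}" "(\<lambda>u. (cmod (P u))\<^sup>2) integrable_on {T1..T}"
        "(\<lambda>u. G u * cnj (P u)) integrable_on {T1..T}" "(\<lambda>u. Re (G u * cnj (P u))) integrable_on {T1..T}" for T
      by (intro integrable_continuous_interval continuous_intros Gc Pc)+
    have m: "((\<lambda>T. ?GP T / of_real T) \<longlongrightarrow> of_real S) at_top"
      using has_mean_F_cnj_ptl[OF \<sigma>, of n] unfolding has_mean_def S_def G_def P_def by simp
    have "((\<lambda>T. C + integral {T1..T} (\<lambda>u. (cmod (P u))\<^sup>2) / T - 2 * Re (?GP T / of_real T)) \<longlongrightarrow> C + S - 2 * Re (of_real S)) at_top"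
      by (intro tendsto_intros m mean_square_ptl[of n \<sigma>, folded P_def S_def])
    moreover have "\<forall>\<^sub>F T in at_top. 0 \<le> C + integral {T1..T} (\<lambda>u. (cmod (P u))\<^sup>2) / T - 2 * Re (?GP T / of_real T)"
      using C eventually_gt_at_top[of 0]
    proof eventually_elim
      case (elim T)
      have "0 \<le> integral {T1..T} (\<lambda>u. (cmod (G u))\<^sup>2 + (cmod (P u))\<^sup>2 - 2 * Re (G u * cnj (P u)))"
      proof (rule integral_nonneg_of_nonneg_fun)
        fix u
        have "(cmod (G u - P u))\<^sup>2 = (cmod (G u))\<^sup>2 + (cmod (P u))\<^sup>2 - 2 * Re (G u * cnj (P u))"
          unfolding cmod_power2 by (simp add: power2_eq_square algebra_simps)
        then show "0 \<le> (cmod (G u))\<^sup>2 + (cmod (P u))\<^sup>2 - 2 * Re (G u * cnj (P u))"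
          by (metis zero_le_power2)
      qed
      also have "\<dots> = integral {T1..T} (\<lambda>u. (cmod (G u))\<^sup>2) + integral {T1..T} (\<lambda>u. (cmod (P u))\<^sup>2) - 2 * integral {T1..T} (\<lambda>u. Re (G u * cnj (P u)))"
        using i by (simp add: integral_diff integral_add integrable_add integrable_on_cmult_left del: times_complex.simps)
      also have "integral {T1..T} (\<lambda>u. Re (G u * cnj (P u))) = Re (?GP T)"
        using integral_linear[OF i(3) bounded_linear_Re] by (simp only: o_def)
      also have "integral {T1..T} (\<lambda>u. (cmod (G u))\<^sup>2) \<le> C * T" using elim(1) by (simp add: G_def)
      finally have "0 \<le> C * T + integral {T1..T} (\<lambda>u. (cmod (P u))\<^sup>2) - 2 * Re (?GP T)" by simp
      then have "0 \<le> (C * T + integral {T1..T} (\<lambda>u. (cmod (P u))\<^sup>2) - 2 * Re (?GP T)) / T" using elim by simp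
      also have "\<dots> = C + integral {T1..T} (\<lambda>u. (cmod (P u))\<^sup>2) / T - 2 * Re (?GP T / of_real T)"
        using elim by (simp add: add_divide_distrib diff_divide_distrib)
      finally show ?case .
    qed
    ultimately have "0 \<le> C + S - 2 * Re (of_real S)"
      by (intro tendsto_lowerbound) auto
    then show ?thesis by (simp add: S_def)
  qed
  then have "(\<Sum>m\<le>n. (cmod (a m))\<^sup>2 * (real m + \<beta>) powr (- 2 * \<sigma>)) \<le> C" for n
    by (simp only: lessThan_Suc_atMost[symmetric])
  then show ?thesis by (rule bounded_imp_summable[rotated]) simp
qed

lemma coeff_square_summable:
  assumes \<sigma>: "\<sigma>0 < \<sigma>"
  shows "summable (\<lambda>m. (cmod (a m))\<^sup>2 * (real m + \<beta>) powr (- 2 * \<sigma>))"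
proof (rule summable_comparison_test_ev[OF _ coeff_square_summable_strip[of "min \<sigma> 3"]])
  show "\<forall>\<^sub>F m in sequentially. norm ((cmod (a m))\<^sup>2 * (real m + \<beta>) powr (- 2 * \<sigma>)) \<le> (cmod (a m))\<^sup>2 * (real m + \<beta>) powr (- 2 * min \<sigma> 3)"
    using eventually_ge_at_top[of 1]
    by eventually_elim (use \<beta> in \<open>auto simp: abs_mult intro!: mult_left_mono powr_mono\<close>)
qed (use \<sigma> \<sigma>0 in auto)

text \<open>On the left line the mean square of F minus a partial sum is bounded independently of
  the length n, by Bessel's inequality; on the right line it tends to 0 with n. This independence
  allows the weight y to be fixed before n.\<close>

theorem ptl_approx:
  assumes h: "h > 0" and e: "e > 0" and l: "\<sigma>0 < \<sigma>l" "\<sigma>l \<le> \<sigma>r" and Y: "Y \<ge> 0"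
  shows "\<exists>n0. \<forall>n\<ge>n0. \<exists>k0 q. (\<forall>k. 0 \<le> q k) \<and>
     (\<forall>k\<ge>k0. \<forall>z. \<sigma>l \<le> Re z \<and> Re z \<le> \<sigma>r \<and> \<bar>Im z\<bar> \<le> Y \<longrightarrow>
        (cmod (F (z + \<i> * of_nat k * of_real h) - ptl \<beta> a n (z + \<i> * of_nat k * of_real h)))\<^sup>2 \<le> q k) \<and>
     (\<forall>\<^sub>F N in sequentially. (\<Sum>k=k0..N. q k) \<le> e * (real N + 1))"
proof -
  \<comment> \<open>Strictly right of \<sigma>0, so that the coefficient sum \<open>S\<close>
    converges, strictly left of the target strip, so that \<delta> is positive, and at most
    3.\<close>
  define \<sigma>1 where "\<sigma>1 = (\<sigma>0 + min \<sigma>l 3) / 2"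
  define \<sigma>2 where "\<sigma>2 = max 3 \<sigma>r + 1"
  define \<delta> where "\<delta> = min (\<sigma>l - \<sigma>1) 1"
  have \<sigma>: "\<sigma>0 < \<sigma>1" "\<sigma>1 \<le> 3" "\<sigma>1 < \<sigma>l" "\<sigma>2 \<ge> 3" using l \<sigma>0 by (auto simp: \<sigma>1_def \<sigma>2_def min_def)
  have \<delta>: "\<delta> > 0" "\<sigma>1 + \<delta> \<le> \<sigma>l" "\<sigma>r \<le> \<sigma>2 - \<delta>" using \<sigma> by (auto simp: \<delta>_def \<sigma>2_def)
  define D where "D = \<sigma>2 - \<sigma>1"
  define A where "A = exp (D\<^sup>2) * (1 / \<delta> + D) * exp Y * (2 * exp h / (1 - exp (- h))) * (2 * h + 2 * Y)"
  have D: "D > 0" using \<sigma> \<delta> l by (simp add: D_def)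
  have A: "A > 0" unfolding A_def using D \<delta> h Y by (intro mult_pos_pos add_pos_pos divide_pos_pos add_pos_nonneg) auto
  obtain C where C: "\<forall>\<^sub>F T in at_top. integral {T1..T} (\<lambda>u. (cmod (F (Complex \<sigma>1 u)))\<^sup>2) \<le> C * T"
    using mean_square_interior[OF \<sigma>(1,2)] by blast
  define S where "S = (\<Sum>m. (cmod (a m))\<^sup>2 * (real m + \<beta>) powr (- 2 * \<sigma>1))"
  \<comment> \<open>From |F - P|^2 \<le> 2 |F|^2 + 2 |P|^2; the 1 added to \<open>S\<close> covers
    the fact that the mean square of P reaches its limit only asymptotically.\<close>
  define m1 where "m1 = 2 * C + 2 * (S + 1)"
  have "((\<lambda>y. A * (exp (- (y * \<delta>)) * m1)) \<longlongrightarrow> 0) at_top" using \<delta>(1) by real_asymp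
  then have "\<forall>\<^sub>F y in at_top. A * (exp (- (y * \<delta>)) * m1) < e / 4"
    by (rule order_tendstoD(2)) (use e in simp)
  then have "\<forall>\<^sub>F y in at_top. A * (exp (- (y * \<delta>)) * m1) < e / 4 \<and> 0 \<le> y"
    using eventually_ge_at_top[of 0] by (rule eventually_conj)
  from eventually_happens[OF this]
  obtain y where y: "A * (exp (- (y * \<delta>)) * m1) < e / 4" "0 \<le> y"
    by (auto simp only: trivial_limit_at_top_linorder)
  have "(\<lambda>n. A * (exp (y * D) * (tl_sum \<sigma>2 n)\<^sup>2)) \<longlonglongrightarrow> A * (exp (y * D) * 0\<^sup>2)"
    by (intro tendsto_intros tl_sum_lim \<sigma>)
  then have "\<forall>\<^sub>F n in sequentially. A * (exp (y * D) * (tl_sum \<sigma>2 n)\<^sup>2) < e / 4"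
    by (rule order_tendstoD(2)) (use e in simp)
  then obtain n0 where n0: "\<And>n. n \<ge> n0 \<Longrightarrow> A * (exp (y * D) * (tl_sum \<sigma>2 n)\<^sup>2) < e / 4"
    unfolding eventually_sequentially by blast
  show ?thesis
  proof (rule exI[of _ n0], intro allI impI)
    fix n assume n: "n \<ge> n0"
    define G where "G s = F s - ptl \<beta> a n s" for s
    obtain B and E :: nat where BE: "\<And>s. \<sigma>0 \<le> Re s \<Longrightarrow> Re s \<le> \<sigma>2 \<Longrightarrow> T1 \<le> Im s \<Longrightarrow> cmod (F s) \<le> B * Im s ^ E"
      using growth[of \<sigma>2] by blast
    obtain M where M: "M \<ge> 0" "\<And>s. \<sigma>1 \<le> Re s \<Longrightarrow> Re s \<le> \<sigma>2 \<Longrightarrow> cmod (ptl \<beta> a n s) \<le> M"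
      using ptl_strip_bound[OF \<beta>] by blast
    have Pc: "continuous_on X (\<lambda>u. ptl \<beta> a n (Complex \<sigma>1 u))" for X
      by (rule continuous_on_compose_vertical[OF holomorphic_on_imp_continuous_on[OF ptl_holomorphic[OF \<beta>, of a n UNIV]]]) auto
    have Fc: "continuous_on {T1..T} (\<lambda>u. F (Complex \<sigma>1 u))" for T
      by (rule continuous_on_subset[OF F_continuous]) (use \<sigma> in auto)
    have "(\<Sum>m<n. (cmod (a m))\<^sup>2 * (real m + \<beta>) powr (- 2 * \<sigma>1)) \<le> S"
      unfolding S_def by (rule sum_le_suminf[OF coeff_square_summable[OF \<sigma>(1)]]) auto
    then have "\<forall>\<^sub>F T in at_top. integral {T1..T} (\<lambda>u. (cmod (ptl \<beta> a n (Complex \<sigma>1 u)))\<^sup>2) / T < S + 1"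
      by (intro order_tendstoD(2)[OF mean_square_ptl]) auto
    with C have ms1: "\<forall>\<^sub>F T in at_top. integral {T1..T} (\<lambda>u. (cmod (G (Complex \<sigma>1 u)))\<^sup>2) \<le> m1 * T"
      using eventually_gt_at_top[of 0]
    proof eventually_elim
      case (elim T)
      have "integral {T1..T} (\<lambda>u. (cmod (G (Complex \<sigma>1 u)))\<^sup>2) \<le>
         integral {T1..T} (\<lambda>u. 2 * (cmod (F (Complex \<sigma>1 u)))\<^sup>2 + 2 * (cmod (ptl \<beta> a n (Complex \<sigma>1 u)))\<^sup>2)"
      proof (rule integral_le)
        fix u
        have "(cmod (G (Complex \<sigma>1 u)))\<^sup>2 \<le> (cmod (F (Complex \<sigma>1 u)) + cmod (ptl \<beta> a n (Complex \<sigma>1 u)))\<^sup>2"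
          unfolding G_def by (intro power_mono norm_triangle_ineq4) auto
        also have "\<dots> \<le> 2 * (cmod (F (Complex \<sigma>1 u)))\<^sup>2 + 2 * (cmod (ptl \<beta> a n (Complex \<sigma>1 u)))\<^sup>2"
          using sum_squares_bound[of "cmod (F (Complex \<sigma>1 u))" "cmod (ptl \<beta> a n (Complex \<sigma>1 u))"] by (simp add: power2_sum)
        finally show "(cmod (G (Complex \<sigma>1 u)))\<^sup>2 \<le> 2 * (cmod (F (Complex \<sigma>1 u)))\<^sup>2 + 2 * (cmod (ptl \<beta> a n (Complex \<sigma>1 u)))\<^sup>2" .
      qed (unfold G_def, (intro integrable_continuous_interval continuous_intros Pc Fc)+)
      also have "\<dots> = 2 * integral {T1..T} (\<lambda>u. (cmod (F (Complex \<sigma>1 u)))\<^sup>2) + 2 * integral {T1..T} (\<lambda>u. (cmod (ptl \<beta> a n (Complex \<sigma>1 u)))\<^sup>2)"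
        by (subst integral_add) (auto intro!: integrable_continuous_interval continuous_intros Pc Fc)
      also have "\<dots> \<le> 2 * (C * T) + 2 * ((S + 1) * T)"
        using elim by (intro add_mono mult_left_mono) (auto simp: field_simps)
      finally show ?case by (simp add: m1_def algebra_simps)
    qed
    have ms2: "\<forall>\<^sub>F T in at_top. integral {T1..T} (\<lambda>u. (cmod (G (Complex \<sigma>2 u)))\<^sup>2) \<le> (tl_sum \<sigma>2 n)\<^sup>2 * T"
      unfolding G_def by (rule mean_square_right[OF \<sigma>(4)])
    obtain k0 q where kq: "\<And>k. q k \<ge> 0"
      "\<And>k z. k \<ge> k0 \<Longrightarrow> \<sigma>1 + \<delta> \<le> Re z \<Longrightarrow> Re z \<le> \<sigma>2 - \<delta> \<Longrightarrow> \<bar>Im z\<bar> \<le> Y \<Longrightarrow>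
         (cmod (G (z + \<i> * of_nat k * of_real h)))\<^sup>2 \<le> q k"
      and q: "\<forall>\<^sub>F N in sequentially. (\<Sum>k=k0..N. q k) \<le> (A * (exp (- (y * \<delta>)) * m1 + exp (y * D) * (tl_sum \<sigma>2 n)\<^sup>2) + e / 4) * (real N + 1)"
      unfolding A_def D_def
    proof (rule strip_discrete_mean_square[where h = h and Y = Y and y = y and e = "e / 4" and ?T1.0 = T1 and G = G
          and ?\<sigma>1.0 = \<sigma>1 and ?\<sigma>2.0 = \<sigma>2 and \<delta> = \<delta> and B = "B + M" and C = E and ?m1.0 = m1 and ?m2.0 = "(tl_sum \<sigma>2 n)\<^sup>2"])
      show "G analytic_on {z. \<sigma>1 \<le> Re z \<and> Re z \<le> \<sigma>2 \<and> T1 \<le> Im z}"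
        unfolding G_def
        by (intro analytic_intros ptl_analytic \<beta> analytic_on_subset[OF F_analytic]) (use \<sigma> in auto)
      show "cmod (G z) \<le> (B + M) * Im z ^ E" if z: "\<sigma>1 \<le> Re z" "Re z \<le> \<sigma>2" "T1 \<le> Im z" for z
      proof -
        have "cmod (G z) \<le> cmod (F z) + cmod (ptl \<beta> a n z)" unfolding G_def by (rule norm_triangle_ineq4)
        also have "cmod (F z) \<le> B * Im z ^ E" using BE[of z] z \<sigma> by simp
        also have "cmod (ptl \<beta> a n z) \<le> M * 1" using M(2) z by simp
        also have "M * 1 \<le> M * Im z ^ E" using M(1) T1 z by (intro mult_left_mono one_le_power) auto
        finally show ?thesis by (simp add: algebra_simps)
      qed
      show "\<sigma>1 + \<delta> \<le> \<sigma>2 - \<delta>" using \<delta> l by simp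
      show "\<forall>\<^sub>F T in at_top. integral {T1..T} (\<lambda>u. (cmod (G (Complex \<sigma>1 u)))\<^sup>2) \<le> m1 * T" by (rule ms1)
      show "\<forall>\<^sub>F T in at_top. integral {T1..T} (\<lambda>u. (cmod (G (Complex \<sigma>2 u)))\<^sup>2) \<le> (tl_sum \<sigma>2 n)\<^sup>2 * T" by (rule ms2)
      show "0 \<le> T1" "0 < e / 4" using T1 e by auto
    qed (use \<delta> h Y y in blast)+
    have "A * (exp (- (y * \<delta>)) * m1 + exp (y * D) * (tl_sum \<sigma>2 n)\<^sup>2) + e / 4 \<le> e"
      using y(1) n0[OF n] e by (simp add: distrib_left)
    then have le: "(A * (exp (- (y * \<delta>)) * m1 + exp (y * D) * (tl_sum \<sigma>2 n)\<^sup>2) + e / 4) * (real N + 1) \<le> e * (real N + 1)" for N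
      by (rule mult_right_mono) auto
    show "\<exists>k0 q. (\<forall>k. 0 \<le> q k) \<and>
     (\<forall>k\<ge>k0. \<forall>z. \<sigma>l \<le> Re z \<and> Re z \<le> \<sigma>r \<and> \<bar>Im z\<bar> \<le> Y \<longrightarrow>
        (cmod (F (z + \<i> * of_nat k * of_real h) - ptl \<beta> a n (z + \<i> * of_nat k * of_real h)))\<^sup>2 \<le> q k) \<and>
     (\<forall>\<^sub>F N in sequentially. (\<Sum>k=k0..N. q k) \<le> e * (real N + 1))"
    proof (intro exI[of _ k0] exI[of _ q] conjI allI impI)
      show "(cmod (F (z + \<i> * of_nat k * of_real h) - ptl \<beta> a n (z + \<i> * of_nat k * of_real h)))\<^sup>2 \<le> q k"
        if "k \<ge> k0" "\<sigma>l \<le> Re z \<and> Re z \<le> \<sigma>r \<and> \<bar>Im z\<bar> \<le> Y" for k z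
        unfolding G_def[symmetric] by (rule kq(2)) (use that \<delta> in linarith)+
      show "\<forall>\<^sub>F N in sequentially. (\<Sum>k=k0..N. q k) \<le> e * (real N + 1)"
        using q by eventually_elim (rule order_trans[OF _ le])
    qed (rule kq)
  qed
qed

end

section \<open>Periodic Hurwitz zeta-functions to the right of the critical line\<close>

text \<open>The derivative is taken in the shift y at fixed s: as y runs from 0 to 1 the term m
  passes continuously into the term m + 1, which is what summation by parts uses.\<close>

lemma has_vector_derivative_dterm:
  assumes "\<beta> > 0" "y \<ge> 0"
  shows "((\<lambda>y. dterm (\<beta> + y) m s) has_vector_derivative (- s * dterm (\<beta> + y) m (s + 1))) (at y within A)"
proof -
  define c where "c = complex_of_real (real m + \<beta>)"
  have nz: "c + of_real y \<notin> \<real>\<^sub>\<le>\<^sub>0"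
  proof -
    have "c + of_real y = of_real (real m + \<beta> + y)" by (simp add: c_def)
    moreover have "real m + \<beta> + y > 0" using assms by simp
    ultimately show ?thesis by (metis complex_nonpos_Reals_iff Re_complex_of_real not_le)
  qed
  have "((\<lambda>w. (c + w) powr (- s)) has_field_derivative (- s * (c + of_real y) powr (- s - 1))) (at (of_real y))"
    using nz by (auto intro!: derivative_eq_intros)
  from has_vector_derivative_real_field[OF this]
  have "((\<lambda>x. (c + of_real x) powr (- s)) has_vector_derivative (- s * (c + of_real y) powr (- s - 1))) (at y within A)" .
  moreover have "complex_of_real (real m + (\<beta> + x)) = c + of_real x" for x by (simp add: c_def)
  moreover have "- (s + 1) = - s - 1" by simp
  ultimately show ?thesis unfolding dterm_def by presburger
qed

lemma summable_shift_powr: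
  assumes "\<beta> > 0" "p > 1"
  shows "summable (\<lambda>m. (real m + \<beta>) powr (- p))"
proof (rule summable_comparison_test_ev)
  show "summable (\<lambda>m. real m powr (- p))" using assms by (simp add: summable_real_powr_iff)
  show "\<forall>\<^sub>F m in sequentially. norm ((real m + \<beta>) powr (- p)) \<le> real m powr (- p)"
    using eventually_gt_at_top[of 0]
    by eventually_elim (use assms in \<open>auto intro!: powr_mono2'\<close>)
qed

lemma periodic_bounded:
  fixes f :: "nat \<Rightarrow> complex"
  assumes "l > 0" "\<And>m. f (m + l) = f m"
  obtains K where "K > 0" "\<And>m. cmod (f m) \<le> K"
proof
  have mod: "f m = f (m mod l)" for m
  proof (induction m rule: less_induct)
    case (less m)
    show ?case
    proof (cases "m < l")
      case False
      then have "f m = f (m - l)" using assms(2)[of "m - l"] by simp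
      also have "\<dots> = f ((m - l) mod l)" using less.IH[of "m - l"] False assms(1) by simp
      also have "(m - l) mod l = m mod l" using False by (simp add: le_mod_geq)
      finally show ?thesis .
    qed simp
  qed
  show "1 + (\<Sum>k<l. cmod (f k)) > 0" by (rule add_pos_nonneg) (auto intro: sum_nonneg)
  fix m
  have "cmod (f (m mod l)) \<le> (\<Sum>k<l. cmod (f k))"
    using member_le_sum[of "m mod l" "{..<l}" "\<lambda>k. cmod (f k)"] assms(1) by auto
  then show "cmod (f m) \<le> 1 + (\<Sum>k<l. cmod (f k))" using mod[of m] by simp
qed

text \<open>From ln t \<le> t - 1 at t = x / y. It makes the off-diagonal terms of a mean square
  explicit.\<close>

lemma inverse_ln_diff_le:
  fixes x y :: real
  assumes "0 < x" "x < y"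
  shows "1 / \<bar>ln x - ln y\<bar> \<le> y / (y - x)"
proof -
  have "ln (x / y) \<le> x / y - 1" using assms by (intro ln_le_minus_one) auto
  then have "(y - x) / y \<le> ln y - ln x" using assms by (simp add: ln_div field_simps)
  moreover have "(y - x) / y > 0" using assms by simp
  ultimately have "1 / (ln y - ln x) \<le> 1 / ((y - x) / y)" by (intro frac_le) auto
  then show ?thesis using assms by (simp add: abs_if)
qed

text \<open>The elementary mean value estimate: diagonal terms give the length of the interval,
  off-diagonal integrals are at most 2 over the difference of frequencies. The 4 is this 2 times the
  two orders of a pair. It is weaker than Hilbert's inequality, but abscissas strictly right of 1/2
  leave room for the loss.\<close>

lemma mean_value_trivial:
  fixes a :: "nat \<Rightarrow> complex"
  assumes \<beta>: "\<beta> > 0" and I: "finite I" and AB: "A \<le> B"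
  shows "integral {A..B} (\<lambda>u. (cmod (\<Sum>m\<in>I. a m * cis (- ln (real m + \<beta>) * u)))\<^sup>2) \<le>
    (B - A) * (\<Sum>m\<in>I. (cmod (a m))\<^sup>2)
    + 4 * (\<Sum>m\<in>I. \<Sum>k\<in>{k\<in>I. k < m}. cmod (a m) * cmod (a k) * ((real m + \<beta>) / (real m - real k)))"
proof -
  define l where "l m = ln (real m + \<beta>)" for m
  define J where "J c = integral {A..B} (\<lambda>u. cis (c * u))" for c
  have l: "\<bar>l m - l k\<bar> > 0" if "m \<noteq> k" for m k using that \<beta> by (auto simp: l_def)
  have sq: "of_real ((cmod (\<Sum>m\<in>I. a m * cis (- l m * u)))\<^sup>2) = (\<Sum>m\<in>I. \<Sum>k\<in>I. (a m * cnj (a k)) * cis ((l k - l m) * u))" for u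
    unfolding complex_norm_square cnj_sum sum_product
  proof (intro sum.cong refl)
    fix m k
    have "cis ((l k - l m) * u) = cis (- l m * u) * cis (l k * u)" by (simp add: cis_mult algebra_simps)
    then show "a m * cis (- l m * u) * cnj (a k * cis (- l k * u)) = a m * cnj (a k) * cis ((l k - l m) * u)"
      by (simp add: cis_cnj mult_ac)
  qed
  have ci: "(\<lambda>u. cis (c * u)) integrable_on {A..B}" for c
    unfolding cis_conv_exp by (intro integrable_continuous_interval continuous_intros)
  have i: "(\<lambda>u. (cmod (\<Sum>m\<in>I. a m * cis (- l m * u)))\<^sup>2) integrable_on {A..B}"
    unfolding cis_conv_exp by (intro integrable_continuous_interval continuous_intros)
  have "complex_of_real (integral {A..B} (\<lambda>u. (cmod (\<Sum>m\<in>I. a m * cis (- l m * u)))\<^sup>2)) =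
      integral {A..B} (\<lambda>u. of_real ((cmod (\<Sum>m\<in>I. a m * cis (- l m * u)))\<^sup>2))"
    using has_integral_of_real[OF integrable_integral[OF i]] by (rule integral_unique[symmetric])
  also have "\<dots> = (\<Sum>m\<in>I. \<Sum>k\<in>I. (a m * cnj (a k)) * J (l k - l m))"
  proof -
    have cci: "(\<lambda>u. d * cis (c * u)) integrable_on {A..B}" for c d
      unfolding cis_conv_exp by (intro integrable_continuous_interval continuous_intros)
    show ?thesis unfolding sq J_def
      by (simp only: integral_sum[OF I] integrable_sum[OF I] cci integral_mult_right)
  qed
  finally have eq: "complex_of_real (integral {A..B} (\<lambda>u. (cmod (\<Sum>m\<in>I. a m * cis (- l m * u)))\<^sup>2)) = \<dots>" .
  have "integral {A..B} (\<lambda>u. (cmod (\<Sum>m\<in>I. a m * cis (- l m * u)))\<^sup>2) \<le>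
     cmod (complex_of_real (integral {A..B} (\<lambda>u. (cmod (\<Sum>m\<in>I. a m * cis (- l m * u)))\<^sup>2)))"
    unfolding norm_of_real by simp
  also have "\<dots> \<le> (\<Sum>m\<in>I. \<Sum>k\<in>I. cmod (a m) * cmod (a k) * cmod (J (l k - l m)))"
    unfolding eq by (intro order_trans[OF norm_sum] sum_mono) (auto simp: norm_mult)
  also have "\<dots> \<le> (\<Sum>m\<in>I. \<Sum>k\<in>I. (if k = m then (cmod (a m))\<^sup>2 * (B - A) else 0)
       + (if k < m then cmod (a m) * cmod (a k) * (2 * ((real m + \<beta>) / (real m - real k))) else 0)
       + (if m < k then cmod (a m) * cmod (a k) * (2 * ((real k + \<beta>) / (real k - real m))) else 0))"
  proof (intro sum_mono)
    fix m k
    have lt: "cmod (J (l k - l m)) \<le> 2 * ((real m + \<beta>) / (real m - real k))" if "k < m" for m k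
    proof -
      have "cmod (J (l k - l m)) \<le> 2 * (1 / \<bar>l k - l m\<bar>)"
        unfolding J_def using norm_integral_cis_le[of "l k - l m" A B] l[of k m] that by auto
      also have "\<dots> \<le> 2 * ((real m + \<beta>) / ((real m + \<beta>) - (real k + \<beta>)))"
        unfolding l_def using that \<beta> by (intro mult_left_mono inverse_ln_diff_le) auto
      finally show ?thesis by simp
    qed
    have sym: "cmod (J (- c)) = cmod (J c)" for c
    proof -
      have "J (- c) = cnj (J c)" unfolding J_def
        using integral_linear[OF ci[of c] bounded_linear_cnj] by (simp add: o_def cis_cnj)
      then show ?thesis by simp
    qed
    have gt: "cmod (J (l k - l m)) \<le> 2 * ((real k + \<beta>) / (real k - real m))" if "m < k"
      using lt[OF that] sym[of "l m - l k"] by simp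
    have eq: "cmod (J 0) = B - A" unfolding J_def using AB by simp
    consider "k = m" | "k < m" | "m < k" by linarith
    then show "cmod (a m) * cmod (a k) * cmod (J (l k - l m)) \<le> (if k = m then (cmod (a m))\<^sup>2 * (B - A) else 0)
       + (if k < m then cmod (a m) * cmod (a k) * (2 * ((real m + \<beta>) / (real m - real k))) else 0)
       + (if m < k then cmod (a m) * cmod (a k) * (2 * ((real k + \<beta>) / (real k - real m))) else 0)"
    proof cases
      case 1
      then show ?thesis using eq by (simp add: power2_eq_square)
    next
      case 2
      then show ?thesis using mult_left_mono[OF lt[OF 2], of "cmod (a m) * cmod (a k)"] by simp
    next
      case 3
      then show ?thesis using mult_left_mono[OF gt[OF 3], of "cmod (a m) * cmod (a k)"] by simp
    qed
  qed
  also have "\<dots> = (B - A) * (\<Sum>m\<in>I. (cmod (a m))\<^sup>2)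
      + (\<Sum>m\<in>I. \<Sum>k\<in>I. if k < m then cmod (a m) * cmod (a k) * (2 * ((real m + \<beta>) / (real m - real k))) else 0)
      + (\<Sum>m\<in>I. \<Sum>k\<in>I. if m < k then cmod (a m) * cmod (a k) * (2 * ((real k + \<beta>) / (real k - real m))) else 0)"
    using I by (simp add: sum.distrib sum_distrib_left mult.commute)
  also have "(\<Sum>m\<in>I. \<Sum>k\<in>I. if m < k then cmod (a m) * cmod (a k) * (2 * ((real k + \<beta>) / (real k - real m))) else 0)
     = (\<Sum>m\<in>I. \<Sum>k\<in>I. if k < m then cmod (a m) * cmod (a k) * (2 * ((real m + \<beta>) / (real m - real k))) else 0)"
    by (subst sum.swap, intro sum.cong refl) (simp add: mult.commute)
  also have "(\<Sum>m\<in>I. \<Sum>k\<in>I. if k < m then cmod (a m) * cmod (a k) * (2 * ((real m + \<beta>) / (real m - real k))) else 0)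
     = 2 * (\<Sum>m\<in>I. \<Sum>k\<in>{k\<in>I. k < m}. cmod (a m) * cmod (a k) * ((real m + \<beta>) / (real m - real k)))"
    unfolding sum.inter_filter[OF I] sum_distrib_left by (intro sum.cong refl) (auto simp: mult_ac)
  finally show ?thesis by (simp add: l_def)
qed

text \<open>After exchanging the sums, the substitution d = m - k - 1 decouples them: the inner sum
  is part of a convergent zeta series, uniformly in k.\<close>

lemma pair_sum_bound:
  fixes w :: "nat \<Rightarrow> real"
  assumes \<eta>: "\<eta> > 0" and I: "finite I" and w: "\<And>k. w k \<ge> 0" "summable w"
  shows "(\<Sum>m\<in>I. \<Sum>k\<in>{k\<in>I. k < m}. w k * (real m - real k) powr (- (1 + \<eta>))) \<le>
     (\<Sum>k. w k) * (\<Sum>d. (real d + 1) powr (- (1 + \<eta>)))"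
proof -
  define z where "z = (\<Sum>d. (real d + 1) powr (- (1 + \<eta>)))"
  have zs: "summable (\<lambda>d. (real d + 1) powr (- (1 + \<eta>)))" by (rule summable_shift_powr) (use \<eta> in auto)
  have z0: "z \<ge> 0" unfolding z_def by (rule suminf_nonneg[OF zs]) auto
  have inner: "(\<Sum>m\<in>{m\<in>I. k < m}. (real m - real k) powr (- (1 + \<eta>))) \<le> z" for k
  proof -
    have "(\<Sum>m\<in>{m\<in>I. k < m}. (real m - real k) powr (- (1 + \<eta>))) = (\<Sum>m\<in>{m\<in>I. k < m}. (real (m - k - 1) + 1) powr (- (1 + \<eta>)))"
      by (intro sum.cong refl arg_cong2[of _ _ _ _ "(powr)"]) (auto simp: of_nat_diff)
    also have "\<dots> = (\<Sum>d\<in>(\<lambda>m. m - k - 1) ` {m\<in>I. k < m}. (real d + 1) powr (- (1 + \<eta>)))"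
      by (subst sum.reindex) (auto simp: inj_on_def)
    also have "\<dots> \<le> z" unfolding z_def by (rule sum_le_suminf[OF zs]) (use I in auto)
    finally show ?thesis .
  qed
  have "(\<Sum>m\<in>I. \<Sum>k\<in>{k\<in>I. k < m}. w k * (real m - real k) powr (- (1 + \<eta>))) =
      (\<Sum>m\<in>I. \<Sum>k\<in>I. if k < m then w k * (real m - real k) powr (- (1 + \<eta>)) else 0)"
    unfolding sum.inter_filter[OF I] ..
  also have "\<dots> = (\<Sum>k\<in>I. \<Sum>m\<in>I. if k < m then w k * (real m - real k) powr (- (1 + \<eta>)) else 0)"
    by (rule sum.swap)
  also have "\<dots> = (\<Sum>k\<in>I. w k * (\<Sum>m\<in>{m\<in>I. k < m}. (real m - real k) powr (- (1 + \<eta>))))"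
    unfolding sum.inter_filter[OF I] sum_distrib_left by (intro sum.cong refl) auto
  also have "\<dots> \<le> (\<Sum>k\<in>I. w k * z)" by (intro sum_mono mult_left_mono inner w)
  also have "\<dots> \<le> (\<Sum>k. w k) * z"
    unfolding sum_distrib_right[symmetric] by (intro mult_right_mono sum_le_suminf w I z0)
  finally show ?thesis by (simp add: z_def)
qed

text \<open>The variance of f about its mean c over the unit interval is nonnegative; expanding |f -
  c|^2 gives the claim.\<close>

lemma norm_integral_unit_square_le:
  fixes f :: "real \<Rightarrow> complex"
  assumes f: "continuous_on {0..1} f"
  shows "(cmod (integral {0..1} f))\<^sup>2 \<le> integral {0..1} (\<lambda>y. (cmod (f y))\<^sup>2)"
proof -
  define c where "c = integral {0..1} f"
  have fi: "f integrable_on {0..1}" "(\<lambda>y. (cmod (f y))\<^sup>2) integrable_on {0..1}" "(\<lambda>y. Re (cnj c * f y)) integrable_on {0..1}"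
    by (intro integrable_continuous_interval continuous_intros f)+
  have "bounded_linear (\<lambda>z. Re (cnj c * z))"
    by (intro bounded_linear_compose[OF bounded_linear_Re] bounded_linear_mult_right)
  from integral_linear[OF fi(1) this]
  have "integral {0..1} (\<lambda>y. Re (cnj c * f y)) = Re (cnj c * c)" by (simp only: o_def c_def)
  also have "\<dots> = (cmod c)\<^sup>2" unfolding cmod_power2 by (simp add: power2_eq_square)
  finally have 1: "integral {0..1} (\<lambda>y. Re (cnj c * f y)) = (cmod c)\<^sup>2" .
  have "0 \<le> integral {0..1} (\<lambda>y. (cmod (f y))\<^sup>2 + (cmod c)\<^sup>2 - 2 * Re (cnj c * f y))"
  proof (rule integral_nonneg_of_nonneg_fun)
    fix y
    have "(cmod (f y - c))\<^sup>2 = (cmod (f y))\<^sup>2 + (cmod c)\<^sup>2 - 2 * Re (cnj c * f y)"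
      unfolding cmod_power2 by (simp add: power2_eq_square algebra_simps)
    then show "0 \<le> (cmod (f y))\<^sup>2 + (cmod c)\<^sup>2 - 2 * Re (cnj c * f y)" by (metis zero_le_power2)
  qed
  also have "\<dots> = integral {0..1} (\<lambda>y. (cmod (f y))\<^sup>2) + (cmod c)\<^sup>2 - 2 * integral {0..1} (\<lambda>y. Re (cnj c * f y))"
  proof (rule integral_unique, intro has_integral_diff has_integral_add has_integral_mult_right integrable_integral fi)
    show "((\<lambda>y. (cmod c)\<^sup>2) has_integral (cmod c)\<^sup>2) {0..1::real}"
      using has_integral_const_real[of "(cmod c)\<^sup>2" 0 1] by simp
  qed
  finally show ?thesis using 1 by (simp add: c_def)
qed

locale periodic_hurwitz =
  fixes \<alpha> :: real and b :: "nat \<Rightarrow> complex" and l :: nat and Z :: "complex \<Rightarrow> complex"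
  assumes \<alpha>: "0 < \<alpha>" "\<alpha> < 1" and l: "l > 0" and periodic: "\<And>m. b (m + l) = b m"
    and Z: "is_periodic_hurwitz_zeta \<alpha> b Z"
begin

section \<open>Analytic continuation by summation by parts\<close>

definition "mean = period_mean b l"
text \<open>Without its mean the periodic sequence has a periodic, hence bounded, summatory
  function. The mean itself is responsible for the possible pole at 1.\<close>

definition "dev_sum m = (\<Sum>k<m. b k - mean)" for m :: nat

lemma dev_sum_periodic: "dev_sum (m + l) = dev_sum m"
proof (induction m)
  case 0
  show ?case using l by (simp add: dev_sum_def mean_def period_mean_def sum_subtractf)
next
  case (Suc m)
  then show ?case by (simp add: dev_sum_def periodic)
qed

lemma dev_sum_bounded: "\<exists>K>0. \<forall>m. cmod (dev_sum m) \<le> K"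
  using periodic_bounded[OF l, of dev_sum] dev_sum_periodic by metis

lemma b_bounded: "\<exists>K>0. \<forall>m. cmod (b m) \<le> K"
  using periodic_bounded[OF l, of b] periodic by metis

text \<open>Summation by parts: \<open>E M s\<close> is the partial sum with boundary terms removed. Its increments
\<open>incr m s\<close> are of order \<open>m powr (- Re s - 1)\<close>, so its limit continues the series to \<open>Re s > 0\<close>.\<close>

definition "gap m y = dev_sum (Suc m) + mean * of_real (1 - y)" for m :: nat and y :: real
definition "E M s = ptl \<alpha> b M s - dev_sum M * dterm \<alpha> M s + mean * dterm \<alpha> M (s - 1) / (s - 1)" for M :: nat and s :: complex
definition "incr m s = s * integral {0..1} (\<lambda>y. gap m y * dterm (\<alpha> + y) m (s + 1))" for m :: nat and s :: complex

text \<open>One step of Euler--Maclaurin summation. The excluded case is s = 1 with nonzero mean; if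
  the mean vanishes, the term with the denominator s - 1 vanishes too.\<close>

lemma E_step:
  assumes "s \<noteq> 1 \<or> mean = 0"
  shows "E (Suc m) s - E m s = incr m s"
proof -
  \<comment> \<open>The primitive of the integrand of \<open>incr\<close>: differentiating
    \<open>gap\<close> produces mean times the term at s, which cancels against the derivative of
    the last summand. At y = 1 the term m becomes the term m + 1, so the endpoint difference is the
    increment of \<open>E\<close>.\<close>
  define H where "H y = - gap m y * dterm (\<alpha> + y) m s + mean * dterm (\<alpha> + y) m (s - 1) / (s - 1)" for y
  have "((\<lambda>y. s * (gap m y * dterm (\<alpha> + y) m (s + 1))) has_integral (H 1 - H 0)) {0..1}"
  proof (rule fundamental_theorem_of_calculus)
    fix y :: real assume y: "y \<in> {0..1}"
    have g: "((\<lambda>y. gap m y) has_vector_derivative - mean) (at y within {0..1})"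
      unfolding gap_def of_real_diff by (auto intro!: derivative_eq_intros has_vector_derivative_of_real)
    have "(H has_vector_derivative (- (gap m y * (- s * dterm (\<alpha> + y) m (s + 1)) + (- mean) * dterm (\<alpha> + y) m s)
        + mean * (- (s - 1) * dterm (\<alpha> + y) m (s - 1 + 1)) / (s - 1))) (at y within {0..1})"
      unfolding H_def using y \<alpha>
      by (auto intro!: derivative_eq_intros has_vector_derivative_mult g has_vector_derivative_dterm has_vector_derivative_divide)
    also have "(- (gap m y * (- s * dterm (\<alpha> + y) m (s + 1)) + (- mean) * dterm (\<alpha> + y) m s)
        + mean * (- (s - 1) * dterm (\<alpha> + y) m (s - 1 + 1)) / (s - 1)) = s * (gap m y * dterm (\<alpha> + y) m (s + 1))"
      using assms by (auto simp: field_simps)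
    finally show "(H has_vector_derivative s * (gap m y * dterm (\<alpha> + y) m (s + 1))) (at y within {0..1})" .
  qed simp
  then have "incr m s = H 1 - H 0"
    unfolding incr_def by (simp add: integral_unique flip: integral_mult_right)
  also have "dterm (\<alpha> + 1) m t = dterm \<alpha> (Suc m) t" for t
    by (simp add: dterm_def algebra_simps)
  then have "H 1 - H 0 = E (Suc m) s - E m s"
    by (simp add: H_def E_def gap_def ptl_def dev_sum_def algebra_simps diff_divide_distrib)
  finally show ?thesis by simp
qed

lemma E_sum:
  assumes "s \<noteq> 1 \<or> mean = 0" "N \<le> M"
  shows "E M s = E N s + (\<Sum>m=N..<M. incr m s)"
  using assms(2)
proof (induction M rule: dec_induct)
  case (step M)
  then show ?case using E_step[OF assms(1), of M] by (simp add: algebra_simps)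
qed simp

lemma gap_bounded: "\<exists>G>0. \<forall>m. \<forall>y\<in>{0..1}. cmod (gap m y) \<le> G"
proof -
  obtain K where K: "K > 0" "\<And>m. cmod (dev_sum m) \<le> K" using dev_sum_bounded by blast
  show ?thesis
  proof (intro exI[of _ "K + cmod mean"] conjI allI ballI)
    fix m y assume y: "y \<in> {0..1::real}"
    have "cmod (gap m y) \<le> cmod (dev_sum (Suc m)) + cmod (mean * of_real (1 - y))"
      unfolding gap_def by (rule norm_triangle_ineq)
    also have "cmod (mean * of_real (1 - y)) \<le> cmod mean * 1"
      unfolding norm_mult norm_of_real using y by (intro mult_left_mono) auto
    finally show "cmod (gap m y) \<le> K + cmod mean" using K(2)[of "Suc m"] by simp
  qed (use K in \<open>simp add: add_pos_nonneg\<close>)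
qed

lemma continuous_on_dterm_shift: "continuous_on {0..1} (\<lambda>y. dterm (\<alpha> + y) m s)"
  by (rule continuous_on_vector_derivative) (rule has_vector_derivative_dterm, use \<alpha> in auto)

lemma continuous_on_gap_dterm: "continuous_on {0..1} (\<lambda>y. gap m y * dterm (\<alpha> + y) m s)"
  unfolding gap_def by (intro continuous_intros continuous_on_dterm_shift)

lemma incr_bound:
  assumes G: "\<And>m y. y \<in> {0..1} \<Longrightarrow> cmod (gap m y) \<le> G" and s: "Re s > 0"
  shows "cmod (incr m s) \<le> cmod s * (G * (real m + \<alpha>) powr (- (Re s + 1)))"
proof -
  have G0: "G \<ge> 0" using order_trans[OF norm_ge_zero G[of 0 m]] by simp
  have "cmod (integral {0..1} (\<lambda>y. gap m y * dterm (\<alpha> + y) m (s + 1))) \<le> (G * (real m + \<alpha>) powr (- (Re s + 1))) * (1 - 0)"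
  proof (rule integral_bound)
    fix y :: real assume y: "y \<in> {0..1}"
    have "cmod (dterm (\<alpha> + y) m (s + 1)) \<le> (real m + \<alpha>) powr (- (Re s + 1))"
      using y \<alpha> s by (subst norm_dterm) (auto intro!: powr_mono2')
    then show "cmod (gap m y * dterm (\<alpha> + y) m (s + 1)) \<le> G * (real m + \<alpha>) powr (- (Re s + 1))"
      unfolding norm_mult using G[OF y, of m] G0 by (intro mult_mono) auto
  qed (auto intro: continuous_on_gap_dterm)
  then show ?thesis unfolding incr_def norm_mult by (intro mult_left_mono) auto
qed

definition "L s = E 0 s + (\<Sum>m. incr m s)"
text \<open>The point 1 is kept when the mean vanishes, so that holomorphy of \<open>L\<close> on
  this set includes regularity at 1.\<close>

definition "S = {s. Re s > 0 \<and> (s \<noteq> 1 \<or> mean = 0)}"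

lemma open_S: "open S"
proof (cases "mean = 0")
  case True
  then show ?thesis by (simp add: S_def open_halfspace_Re_gt)
next
  case False
  then have "S = {s. Re s > 0} - {1}" by (auto simp: S_def)
  then show ?thesis by (simp add: open_halfspace_Re_gt open_delete)
qed

text \<open>A Weierstrass majorant on bounded parts of Re s \<ge> \<delta>. The radius R bounds the
  factor s and also Re s from above; the latter is needed for m = 0, where m + \<alpha> is below
  1.\<close>

lemma incr_summable_bound:
  assumes "\<delta> > 0" "R > 0"
  shows "\<exists>g. summable g \<and> (\<forall>m s. \<delta> \<le> Re s \<longrightarrow> cmod s \<le> R \<longrightarrow> cmod (incr m s) \<le> g m)"
proof -
  obtain G where G: "G > 0" "\<And>m y. y \<in> {0..1} \<Longrightarrow> cmod (gap m y) \<le> G" using gap_bounded by blast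
  define g where "g m = R * (G * ((real m + \<alpha>) powr (- (R + 1)) + (real m + \<alpha>) powr (- (\<delta> + 1))))" for m
  show ?thesis
  proof (intro exI[of _ g] conjI allI impI)
    show "summable g" unfolding g_def
      by (intro summable_mult summable_add summable_shift_powr) (use assms \<alpha> in auto)
    fix m s assume s: "\<delta> \<le> Re s" "cmod s \<le> R"
    have r: "Re s \<le> R" using complex_Re_le_cmod[of s] s by linarith
    have "cmod (incr m s) \<le> cmod s * (G * (real m + \<alpha>) powr (- (Re s + 1)))"
      by (rule incr_bound[OF G(2)]) (use s assms in auto)
    also have "\<dots> \<le> g m" unfolding g_def
      using s r \<alpha> G assms by (intro mult_mono mult_nonneg_nonneg powr_strip_bound) auto
    finally show "cmod (incr m s) \<le> g m" .
  qed
qed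

lemma incr_summable: "Re s > 0 \<Longrightarrow> summable (\<lambda>m. incr m s)"
proof -
  assume s: "Re s > 0"
  then have "s \<noteq> 0" by auto
  then have "\<exists>g. summable g \<and> (\<forall>m s'. Re s \<le> Re s' \<longrightarrow> cmod s' \<le> cmod s \<longrightarrow> cmod (incr m s') \<le> g m)"
    by (intro incr_summable_bound s) simp
  then obtain g where g: "summable g" "cmod (incr m s) \<le> g m" for m by blast
  show ?thesis by (rule summable_comparison_test'[OF g(1), of 0]) (rule g(2))
qed

lemma E_holomorphic: "E M holomorphic_on S"
proof -
  have dh: "(\<lambda>s. dterm \<alpha> M (s - 1)) holomorphic_on S"
    by (rule holomorphic_on_compose[OF _ dterm_holomorphic[OF \<alpha>(1)], unfolded o_def]) (intro holomorphic_intros)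
  show ?thesis
  proof (cases "mean = 0")
    case True
    then show ?thesis unfolding E_def[abs_def]
      by (simp, intro holomorphic_intros ptl_holomorphic \<alpha>)
  next
    case False
    then show ?thesis unfolding E_def[abs_def]
      by (intro holomorphic_intros ptl_holomorphic \<alpha> dh) (auto simp: S_def)
  qed
qed

lemma E_eq_sum: "s \<in> S \<Longrightarrow> E 0 s + (\<Sum>m<M. incr m s) = E M s"
  using E_sum[of s 0 M] by (simp add: S_def atLeast0LessThan)

lemma E_tendsto: "s \<in> S \<Longrightarrow> (\<lambda>M. E M s) \<longlonglongrightarrow> L s"
proof -
  assume s: "s \<in> S"
  then have "(\<lambda>M. E 0 s + (\<Sum>m<M. incr m s)) \<longlonglongrightarrow> L s"
    unfolding L_def by (intro tendsto_intros summable_LIMSEQ incr_summable) (simp add: S_def)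
  then show ?thesis by (simp only: E_eq_sum[OF s])
qed

lemma L_holomorphic: "L holomorphic_on S"
proof (rule holomorphic_uniform_sequence[OF open_S E_holomorphic])
  fix x assume x: "x \<in> S"
  obtain d0 where d0: "d0 > 0" "cball x d0 \<subseteq> S" using open_contains_cball[of S] open_S x by blast
  define d where "d = min d0 (Re x / 2)"
  have xp: "Re x > 0" using x by (simp add: S_def)
  have d: "d > 0" "cball x d \<subseteq> S" using d0 xp by (auto simp: d_def)
  obtain g where g: "summable g" "\<And>m s. Re x / 2 \<le> Re s \<Longrightarrow> cmod s \<le> cmod x + d \<Longrightarrow> cmod (incr m s) \<le> g m"
    using incr_summable_bound[of "Re x / 2" "cmod x + d", OF half_gt_zero[OF xp] add_nonneg_pos[OF norm_ge_zero d(1)]] by blast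
  have "uniform_limit (cball x d) (\<lambda>M s. \<Sum>m<M. incr m s) (\<lambda>s. \<Sum>m. incr m s) sequentially"
  proof (rule Weierstrass_m_test[OF _ g(1)])
    fix m s assume s: "s \<in> cball x d"
    have "Re x - Re s \<le> d" using s complex_Re_le_cmod[of "x - s"] by (simp add: dist_norm)
    then have "Re x / 2 \<le> Re s" by (simp add: d_def min_def split: if_splits)
    moreover have "cmod s \<le> cmod x + d"
      using s norm_triangle_sub[of s x] by (simp add: dist_norm norm_minus_commute)
    ultimately show "cmod (incr m s) \<le> g m" by (rule g(2))
  qed
  then have "uniform_limit (cball x d) (\<lambda>M s. E 0 s + (\<Sum>m<M. incr m s)) L sequentially"
    unfolding L_def[abs_def] by (intro uniform_limit_intros)
  moreover have "E 0 s + (\<Sum>m<M. incr m s) = E M s" if "s \<in> cball x d" for s M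
  proof -
    have "s \<in> S" using that d by blast
    then show ?thesis by (rule E_eq_sum)
  qed
  ultimately have "uniform_limit (cball x d) E L sequentially"
    by (subst uniform_limit_cong'[where g = "\<lambda>M s. E 0 s + (\<Sum>m<M. incr m s)" and i = L]) auto
  then show "\<exists>d. 0 < d \<and> cball x d \<subseteq> S \<and> uniform_limit (cball x d) E L sequentially"
    using d by blast
qed

lemma powr_shift_tendsto_0: "p > 0 \<Longrightarrow> (\<lambda>M. (real M + \<alpha>) powr (- p)) \<longlonglongrightarrow> 0"
  by (rule tendsto_neg_powr) (simp, real_asymp)

lemma Z_sums: "Re s > 1 \<Longrightarrow> (\<lambda>m. b m * dterm \<alpha> m s) sums Z s"
  using Z unfolding is_periodic_hurwitz_zeta_def dterm_def by simp

lemma E_tendsto_Z: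
  assumes "Re s > 1"
  shows "(\<lambda>M. E M s) \<longlonglongrightarrow> Z s"
proof -
  obtain K where K: "K > 0" "\<And>m. cmod (dev_sum m) \<le> K" using dev_sum_bounded by blast
  have 1: "(\<lambda>M. ptl \<alpha> b M s) \<longlonglongrightarrow> Z s"
    using Z_sums[OF assms] by (simp add: sums_def ptl_def[abs_def])
  have 2: "(\<lambda>M. dev_sum M * dterm \<alpha> M s) \<longlonglongrightarrow> 0"
  proof (rule Lim_null_comparison)
    show "\<forall>\<^sub>F M in sequentially. cmod (dev_sum M * dterm \<alpha> M s) \<le> K * (real M + \<alpha>) powr (- Re s)"
      by (intro always_eventually allI) (auto simp: norm_mult norm_dterm \<alpha> intro!: mult_right_mono K)
    show "(\<lambda>M. K * (real M + \<alpha>) powr (- Re s)) \<longlonglongrightarrow> 0"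
      using powr_shift_tendsto_0[of "Re s"] assms by (intro tendsto_mult_right_zero) auto
  qed
  have 3: "(\<lambda>M. dterm \<alpha> M (s - 1)) \<longlonglongrightarrow> 0"
  proof (rule tendsto_norm_zero_cancel)
    have "cmod (dterm \<alpha> M (s - 1)) = (real M + \<alpha>) powr (- (Re s - 1))" for M
      by (simp add: norm_dterm \<alpha>)
    then show "(\<lambda>M. cmod (dterm \<alpha> M (s - 1))) \<longlonglongrightarrow> 0"
      using powr_shift_tendsto_0[of "Re s - 1"] assms by simp
  qed
  have "(\<lambda>M. ptl \<alpha> b M s - dev_sum M * dterm \<alpha> M s + mean * dterm \<alpha> M (s - 1) / (s - 1)) \<longlonglongrightarrow> Z s - 0 + mean * 0 / (s - 1)"
    using assms by (intro tendsto_intros 1 2 3) auto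
  then show ?thesis by (simp add: E_def[abs_def])
qed

text \<open>The identity theorem on the half-plane without the point 1, which is still connected.
  For Re s > 1 the boundary terms removed in \<open>E\<close> tend to 0, so both functions are the
  limit of the same sequence.\<close>

lemma Z_eq_L:
  assumes s: "Re s > 0" "s \<noteq> 1"
  shows "Z s = L s"
proof (rule analytic_continuation_open[of "{s. Re s > 1}" "{s. Re s > 0} - {1}" Z L])
  show "connected ({s. Re s > 0} - {1})"
    by (rule connected_open_delete) (auto simp: open_halfspace_Re_gt convex_halfspace_Re_gt intro!: convex_connected)
  show "Z holomorphic_on {s. Re s > 0} - {1}"
    using Z holomorphic_on_subset unfolding is_periodic_hurwitz_zeta_def by blast
  show "L holomorphic_on {s. Re s > 0} - {1}"
    by (rule holomorphic_on_subset[OF L_holomorphic]) (auto simp: S_def)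
  show "Z z = L z" if "z \<in> {s. 1 < Re s}" for z
    by (rule LIMSEQ_unique[OF E_tendsto_Z E_tendsto]) (use that in \<open>auto simp: S_def\<close>)
  show "{s. Re s > 1} \<noteq> {}" by (auto intro!: exI[of _ 2])
qed (use s in \<open>auto simp: open_halfspace_Re_gt open_delete\<close>)

text \<open>With mean 0 the continuation \<open>L\<close> is continuous at 1 and agrees with
  \<open>Z\<close> around it, so \<open>Z\<close> has a finite limit there and no pole; the
  convention on removable singularities then yields analyticity.\<close>

lemma Z_analytic_at_1:
  assumes "mean = 0"
  shows "Z analytic_on {1}"
proof (rule nicely_meromorphic_on_imp_analytic_at[of Z UNIV])
  show "Z nicely_meromorphic_on UNIV" using Z by (simp add: is_periodic_hurwitz_zeta_def)
  have "isCont L 1"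
    using holomorphic_on_imp_continuous_on[OF L_holomorphic] assms
    unfolding continuous_on_eq_continuous_at[OF open_S] by (auto simp: S_def)
  then have "L \<midarrow>1\<rightarrow> L 1" by (simp add: isCont_def)
  moreover have "\<forall>\<^sub>F s in at 1. L s = Z s"
  proof -
    have "\<forall>\<^sub>F s in at (1::complex). s \<in> {s. Re s > 0}"
      by (rule eventually_at_in_open') (auto simp: open_halfspace_Re_gt)
    moreover have "\<forall>\<^sub>F s in at (1::complex). s \<noteq> 1" by (rule eventually_neq_at_within)
    ultimately show ?thesis by eventually_elim (simp add: Z_eq_L)
  qed
  ultimately have "Z \<midarrow>1\<rightarrow> L 1" by (rule Lim_transform_eventually)
  then show "\<not> is_pole Z 1"
    unfolding is_pole_def using not_tendsto_and_filterlim_at_infinity[of "at (1::complex)"] by auto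
qed simp

text \<open>The increments carry s only as a linear factor beside a uniformly summable weight, and
  |s - 1| \<ge> 1 at these heights, so the growth is linear in Im s on each strip.\<close>

lemma growth:
  assumes \<sigma>: "0 < \<sigma>1"
  shows "\<exists>B. \<forall>s. \<sigma>1 \<le> Re s \<and> Re s \<le> \<sigma>2 \<and> 1 \<le> Im s \<longrightarrow> cmod (Z s) \<le> B * Im s ^ 1"
proof -
  obtain G where G: "G > 0" "\<And>m y. y \<in> {0..1} \<Longrightarrow> cmod (gap m y) \<le> G" using gap_bounded by blast
  define c where "c m = (real m + \<alpha>) powr (- (\<sigma>2 + 1)) + (real m + \<alpha>) powr (- (\<sigma>1 + 1))" for m
  define W where "W = (\<Sum>m. c m)"
  define B1 where "B1 = cmod mean * (\<alpha> powr (- (\<sigma>2 - 1)) + \<alpha> powr (- (\<sigma>1 - 1)))"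
  show ?thesis
  proof (intro exI[of _ "B1 + (\<sigma>2 + 1) * (G * W)"] allI impI)
    fix s assume s: "\<sigma>1 \<le> Re s \<and> Re s \<le> \<sigma>2 \<and> 1 \<le> Im s"
    have cs: "summable c" unfolding c_def
      by (intro summable_add summable_shift_powr) (use \<sigma> s \<alpha> in auto)
    have c0: "c m \<ge> 0" for m by (simp add: c_def)
    have W: "W \<ge> 0" unfolding W_def by (rule suminf_nonneg[OF cs c0])
    have s1: "s \<noteq> 1" using s by auto
    have Ims: "cmod (s - 1) \<ge> Im s" using abs_Im_le_cmod[of "s - 1"] s by simp
    have incr: "cmod (incr m s) \<le> cmod s * G * c m" for m
    proof -
      have "cmod (incr m s) \<le> cmod s * (G * (real m + \<alpha>) powr (- (Re s + 1)))"
        by (rule incr_bound[OF G(2)]) (use s \<sigma> in auto)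
      also have "\<dots> \<le> cmod s * (G * c m)"
        unfolding c_def using s \<alpha> G by (intro mult_left_mono powr_strip_bound) auto
      finally show ?thesis by simp
    qed
    have "cmod (\<Sum>m. incr m s) \<le> (\<Sum>m. cmod s * G * c m)"
      by (rule norm_suminf_le[OF incr]) (intro summable_mult cs)
    also have "\<dots> = cmod s * (G * W)" unfolding W_def using suminf_mult[OF cs] by simp
    also have "\<dots> \<le> ((\<sigma>2 + 1) * Im s) * (G * W)"
    proof (intro mult_right_mono)
      have "cmod s \<le> \<bar>Re s\<bar> + \<bar>Im s\<bar>" by (rule cmod_le)
      also have "\<dots> \<le> \<sigma>2 * Im s + Im s" using s \<sigma> mult_mono[of "Re s" \<sigma>2 1 "Im s"] by auto
      finally show "cmod s \<le> (\<sigma>2 + 1) * Im s" by (simp add: algebra_simps)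
    qed (use G W in auto)
    finally have 2: "cmod (\<Sum>m. incr m s) \<le> ((\<sigma>2 + 1) * Im s) * (G * W)" .
    have "cmod (E 0 s) = cmod mean * \<alpha> powr (- (Re s - 1)) / cmod (s - 1)"
      by (simp add: E_def ptl_def dev_sum_def norm_divide norm_mult norm_dterm \<alpha>)
    also have "\<dots> \<le> B1 / 1"
      unfolding B1_def using Ims s \<alpha> by (intro frac_le mult_left_mono powr_strip_bound mult_nonneg_nonneg) auto
    also have "\<dots> \<le> B1 * Im s"
      using s mult_left_mono[of 1 "Im s" B1] by (simp add: B1_def)
    finally have 1: "cmod (E 0 s) \<le> B1 * Im s" .
    have "cmod (Z s) \<le> cmod (E 0 s) + cmod (\<Sum>m. incr m s)"
      using Z_eq_L[of s] s1 s \<sigma> by (simp add: L_def norm_triangle_ineq)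
    then show "cmod (Z s) \<le> (B1 + (\<sigma>2 + 1) * (G * W)) * Im s ^ 1"
      using 1 2 by (simp add: algebra_simps)
  qed
qed

context
  fixes \<sigma> :: real
  assumes \<sigma>: "1/2 < \<sigma>" "\<sigma> < 1"
begin

text \<open>The surplus over the critical line. It is spent so as to leave exponent 1 + \<eta> both
  on the smaller index of a pair (the weight \<open>w\<close>) and on the difference of the indices,
  making both sums converge.\<close>

definition "\<eta> = \<sigma> - 1/2"
definition "w k = (real k + \<alpha>) powr (- (1 + \<eta>))" for k :: nat
definition "\<kappa> = (\<Sum>k. w k)"
definition "\<kappa>2 = (\<Sum>k. (real k + \<alpha>) powr (- (2 * \<sigma>)))"
definition "zc = (\<Sum>d. (real d + 1) powr (- (1 + \<eta>)))"

lemma \<eta>: "\<eta> > 0" using \<sigma> by (simp add: \<eta>_def)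
lemma w_nonneg: "w k \<ge> 0" by (simp add: w_def)
lemma w_summable: "summable w" unfolding w_def by (rule summable_shift_powr) (use \<eta> \<alpha> in auto)
lemma w2_summable: "summable (\<lambda>k. (real k + \<alpha>) powr (- (2 * \<sigma>)))"
  by (rule summable_shift_powr) (use \<sigma> \<alpha> in auto)
lemma \<kappa>_nonneg: "\<kappa> \<ge> 0" unfolding \<kappa>_def by (rule suminf_nonneg[OF w_summable w_nonneg])
lemma \<kappa>2_nonneg: "\<kappa>2 \<ge> 0" unfolding \<kappa>2_def by (rule suminf_nonneg[OF w2_summable]) auto
lemma zc_nonneg: "zc \<ge> 0" unfolding zc_def by (rule suminf_nonneg[OF summable_shift_powr]) (use \<eta> in auto)

lemma pair_sum: "finite I \<Longrightarrow> (\<Sum>m\<in>I. \<Sum>k\<in>{k\<in>I. k < m}. w k * (real m - real k) powr (- (1 + \<eta>))) \<le> \<kappa> * zc"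
  unfolding \<kappa>_def zc_def by (rule pair_sum_bound[OF \<eta> _ w_nonneg w_summable])

text \<open>The sum has about T terms, so even the crude mean value estimate gives O(T): the
  diagonal converges since 2 \<sigma> > 1, and the off-diagonal part is at most a power N'^1 times
  the decoupled pair sum.\<close>

lemma mean_square_initial:
  assumes K: "\<And>m. cmod (b m) \<le> K" and T: "T \<ge> 1" "real N \<le> T + 1"
  shows "integral {1..T} (\<lambda>u. (cmod (ptl \<alpha> b N (Complex \<sigma> u)))\<^sup>2) \<le> (K\<^sup>2 * \<kappa>2 + 12 * (K\<^sup>2 * (\<kappa> * zc))) * T"
proof -
  define a where "a m = b m * of_real ((real m + \<alpha>) powr (- \<sigma>))" for m
  have K0: "K \<ge> 0" using order_trans[OF norm_ge_zero K[of 0]] .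
  have am: "cmod (a m) \<le> K * (real m + \<alpha>) powr (- \<sigma>)" for m
    unfolding a_def norm_mult norm_of_real using K[of m] K0 by (intro mult_mono) auto
  have P: "ptl \<alpha> b N (Complex \<sigma> u) = (\<Sum>m\<in>{..<N}. a m * cis (- ln (real m + \<alpha>) * u))" for u
    unfolding ptl_def a_def dterm_Complex[OF \<alpha>(1)] by (simp add: mult_ac)
  define N' where "N' = real N + 1"
  have "integral {1..T} (\<lambda>u. (cmod (ptl \<alpha> b N (Complex \<sigma> u)))\<^sup>2) \<le> (T - 1) * (\<Sum>m\<in>{..<N}. (cmod (a m))\<^sup>2)
    + 4 * (\<Sum>m\<in>{..<N}. \<Sum>k\<in>{k\<in>{..<N}. k < m}. cmod (a m) * cmod (a k) * ((real m + \<alpha>) / (real m - real k)))"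
    unfolding P by (rule mean_value_trivial) (use \<alpha> T in auto)
  also have "(\<Sum>m\<in>{..<N}. (cmod (a m))\<^sup>2) \<le> (\<Sum>m\<in>{..<N}. K\<^sup>2 * (real m + \<alpha>) powr (- (2 * \<sigma>)))"
  proof (rule sum_mono)
    fix m
    have "(cmod (a m))\<^sup>2 \<le> (K * (real m + \<alpha>) powr (- \<sigma>))\<^sup>2" by (intro power_mono am) auto
    also have "\<dots> = K\<^sup>2 * ((real m + \<alpha>) powr (- \<sigma>) * (real m + \<alpha>) powr (- \<sigma>))" by (simp add: power2_eq_square)
    also have "\<dots> = K\<^sup>2 * (real m + \<alpha>) powr (- (2 * \<sigma>))" unfolding powr_add[symmetric] by simp
    finally show "(cmod (a m))\<^sup>2 \<le> K\<^sup>2 * (real m + \<alpha>) powr (- (2 * \<sigma>))" .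
  qed
  also have "\<dots> \<le> K\<^sup>2 * \<kappa>2"
    unfolding sum_distrib_left[symmetric] \<kappa>2_def by (intro mult_left_mono sum_le_suminf w2_summable) auto
  also have "(\<Sum>m\<in>{..<N}. \<Sum>k\<in>{k\<in>{..<N}. k < m}. cmod (a m) * cmod (a k) * ((real m + \<alpha>) / (real m - real k)))
      \<le> (\<Sum>m\<in>{..<N}. \<Sum>k\<in>{k\<in>{..<N}. k < m}. K\<^sup>2 * N' * (w k * (real m - real k) powr (- (1 + \<eta>))))"
  proof (intro sum_mono)
    fix m k assume tuple: "m \<in> {..<N}" "k \<in> {k \<in> {..<N}. k < m}"
    define x where "x = real m + \<alpha>"
    define y where "y = real k + \<alpha>"
    define d where "d = real m - real k"
    have pos: "x > 0" "y > 0" "d \<ge> 1" "x \<le> N'" "y \<le> N'" "d \<le> N'" "N' \<ge> 1"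
      using tuple \<alpha> by (auto simp: x_def y_def d_def N'_def)
    have "cmod (a m) * cmod (a k) * (x / d) \<le> (K * x powr (- \<sigma>)) * (K * y powr (- \<sigma>)) * (x / d)"
      using am[of m] am[of k] pos K0 unfolding x_def y_def by (intro mult_right_mono mult_mono) auto
    also have "\<dots> = K\<^sup>2 * ((x powr (- \<sigma>) * x powr 1) * y powr (- \<sigma>) * d powr (- 1))"
      using pos by (simp add: power2_eq_square powr_minus field_simps)
    \<comment> \<open>The exponents are split so that \<open>y\<close> and \<open>d\<close> each
      retain - (1 + \<eta>). The surplus powers 1 - \<sigma>, 1/2 and \<eta> are bounded by powers
      of \<open>N'\<close> and add up to exactly 1.\<close>
    also have "\<dots> = K\<^sup>2 * ((x powr (1 - \<sigma>)) * (y powr (1/2) * w k) * (d powr \<eta> * d powr (- (1 + \<eta>))))"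
      unfolding w_def y_def[symmetric] powr_add[symmetric] by (simp add: \<eta>_def)
    also have "\<dots> \<le> K\<^sup>2 * ((N' powr (1 - \<sigma>)) * (N' powr (1/2) * w k) * (N' powr \<eta> * d powr (- (1 + \<eta>))))"
      using pos \<sigma> \<eta> w_nonneg by (intro mult_left_mono mult_mono mult_right_mono powr_mono2) auto
    also have "\<dots> = K\<^sup>2 * ((N' powr (1 - \<sigma>) * N' powr (1/2) * N' powr \<eta>) * (w k * d powr (- (1 + \<eta>))))"
      by (simp only: mult_ac)
    also have "N' powr (1 - \<sigma>) * N' powr (1/2) * N' powr \<eta> = N'"
      unfolding powr_add[symmetric] using pos by (simp add: \<eta>_def)
    finally show "cmod (a m) * cmod (a k) * ((real m + \<alpha>) / (real m - real k)) \<le> K\<^sup>2 * N' * (w k * (real m - real k) powr (- (1 + \<eta>)))"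
      by (simp only: x_def d_def mult.assoc)
  qed
  also have "\<dots> \<le> K\<^sup>2 * N' * (\<kappa> * zc)"
    unfolding sum_distrib_left[symmetric] by (intro mult_left_mono pair_sum) (auto simp: N'_def)
  also have "K\<^sup>2 * N' * (\<kappa> * zc) = (K\<^sup>2 * (\<kappa> * zc)) * N'" by (simp only: mult_ac)
  also have "\<dots> \<le> (K\<^sup>2 * (\<kappa> * zc)) * (3 * T)"
    using T \<kappa>_nonneg zc_nonneg by (intro mult_left_mono) (auto simp: N'_def)
  finally have "integral {1..T} (\<lambda>u. (cmod (ptl \<alpha> b N (Complex \<sigma> u)))\<^sup>2) \<le> (T - 1) * (K\<^sup>2 * \<kappa>2) + 4 * ((K\<^sup>2 * (\<kappa> * zc)) * (3 * T))"
    using T by (simp add: mult_left_mono)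
  also have "(T - 1) * (K\<^sup>2 * \<kappa>2) \<le> T * (K\<^sup>2 * \<kappa>2)" using \<kappa>2_nonneg by (intro mult_right_mono) auto
  finally show ?thesis by (simp add: algebra_simps)
qed

text \<open>For fixed y the increments form a Dirichlet polynomial at abscissa \<sigma> + 1 whose
  indices all exceed T. The extra unit of decay turns O(T) into O(1 / T), uniformly in y and in the
  upper end \<open>M\<close>, and later pays for the factor |s|^2 of size T^2.\<close>

lemma mean_square_slice:
  assumes G: "\<And>m y. y \<in> {0..1} \<Longrightarrow> cmod (gap m y) \<le> G" and T: "T \<ge> 1" "T \<le> real N" and y: "y \<in> {0..1}"
  shows "integral {1..T} (\<lambda>u. (cmod (\<Sum>m=N..<M. gap m y * dterm (\<alpha> + y) m (Complex \<sigma> u + 1)))\<^sup>2)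
     \<le> G\<^sup>2 * (\<kappa>2 + 4 * (\<kappa> * zc)) / T"
proof -
  define \<beta> where "\<beta> = \<alpha> + y"
  have \<beta>: "\<beta> > 0" "\<alpha> \<le> \<beta>" "0 \<le> \<beta>" using y \<alpha> by (auto simp: \<beta>_def)
  define a where "a m = gap m y * of_real ((real m + \<beta>) powr (- (\<sigma> + 1)))" for m
  have G0: "G \<ge> 0" using order_trans[OF norm_ge_zero G[OF y, of 0]] .
  have am: "cmod (a m) \<le> G * (real m + \<beta>) powr (- (\<sigma> + 1))" for m
    unfolding a_def norm_mult norm_of_real using G[OF y, of m] G0 by (intro mult_mono) auto
  have c1: "Complex \<sigma> u + 1 = Complex (\<sigma> + 1) u" for u by (simp add: complex_eq_iff)
  have P: "(\<Sum>m=N..<M. gap m y * dterm (\<alpha> + y) m (Complex \<sigma> u + 1)) = (\<Sum>m\<in>{N..<M}. a m * cis (- ln (real m + \<beta>) * u))" for u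
    unfolding c1 \<beta>_def[symmetric] a_def dterm_Complex[OF \<beta>(1)] by (simp add: mult_ac)
  have N: "real N > 0" using T by simp
  have "integral {1..T} (\<lambda>u. (cmod (\<Sum>m=N..<M. gap m y * dterm (\<alpha> + y) m (Complex \<sigma> u + 1)))\<^sup>2) \<le> (T - 1) * (\<Sum>m\<in>{N..<M}. (cmod (a m))\<^sup>2)
    + 4 * (\<Sum>m\<in>{N..<M}. \<Sum>k\<in>{k\<in>{N..<M}. k < m}. cmod (a m) * cmod (a k) * ((real m + \<beta>) / (real m - real k)))"
    unfolding P by (rule mean_value_trivial) (use \<beta> T in auto)
  also have "(\<Sum>m\<in>{N..<M}. (cmod (a m))\<^sup>2) \<le> (\<Sum>m\<in>{N..<M}. (G\<^sup>2 * (1 / T\<^sup>2)) * (real m + \<alpha>) powr (- (2 * \<sigma>)))"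
  proof (rule sum_mono)
    fix m assume m: "m \<in> {N..<M}"
    have x: "real m + \<beta> \<ge> T" using m T \<beta> by simp
    have "(cmod (a m))\<^sup>2 \<le> (G * (real m + \<beta>) powr (- (\<sigma> + 1)))\<^sup>2" by (intro power_mono am) auto
    also have "\<dots> = G\<^sup>2 * ((real m + \<beta>) powr (- (\<sigma> + 1)) * (real m + \<beta>) powr (- (\<sigma> + 1)))" by (simp add: power2_eq_square)
    also have "\<dots> = G\<^sup>2 * ((real m + \<beta>) powr (- 2) * (real m + \<beta>) powr (- (2 * \<sigma>)))" unfolding powr_add[symmetric] by (simp add: algebra_simps)
    also have "\<dots> \<le> G\<^sup>2 * (T powr (- 2) * (real m + \<alpha>) powr (- (2 * \<sigma>)))"
      using x T \<beta> \<sigma> \<alpha> by (intro mult_left_mono mult_mono powr_mono2') auto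
    also have "T powr (- 2) = 1 / T\<^sup>2" using T by (simp add: powr_minus inverse_eq_divide)
    finally show "(cmod (a m))\<^sup>2 \<le> (G\<^sup>2 * (1 / T\<^sup>2)) * (real m + \<alpha>) powr (- (2 * \<sigma>))" by (simp only: mult.assoc)
  qed
  also have "\<dots> \<le> (G\<^sup>2 * (1 / T\<^sup>2)) * \<kappa>2"
    unfolding sum_distrib_left[symmetric] \<kappa>2_def by (intro mult_left_mono sum_le_suminf w2_summable) auto
  also have "(\<Sum>m\<in>{N..<M}. \<Sum>k\<in>{k\<in>{N..<M}. k < m}. cmod (a m) * cmod (a k) * ((real m + \<beta>) / (real m - real k)))
      \<le> (\<Sum>m\<in>{N..<M}. \<Sum>k\<in>{k\<in>{N..<M}. k < m}. G\<^sup>2 * (1 / T) * (w k * (real m - real k) powr (- (1 + \<eta>))))"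
  proof (intro sum_mono)
    fix m k assume tuple: "m \<in> {N..<M}" "k \<in> {k \<in> {N..<M}. k < m}"
    define x where "x = real m + \<beta>"
    define z where "z = real k + \<beta>"
    define d where "d = real m - real k"
    have pos: "x > 0" "z \<ge> T" "d \<ge> 1" "z \<le> x" "d \<le> x"
      using tuple \<beta> T by (auto simp: x_def z_def d_def)
    have "cmod (a m) * cmod (a k) * (x / d) \<le> (G * x powr (- (\<sigma> + 1))) * (G * z powr (- (\<sigma> + 1))) * (x / d)"
      using am[of m] am[of k] pos G0 unfolding x_def z_def by (intro mult_right_mono mult_mono) auto
    also have "\<dots> = G\<^sup>2 * ((x powr (- (\<sigma> + 1)) * x powr 1) * z powr (- (\<sigma> + 1)) * d powr (- 1))"
      using pos by (simp add: power2_eq_square powr_minus field_simps)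
    \<comment> \<open>The larger index has exponent - \<sigma> left; its part - \<eta> is passed to
      the difference \<open>d\<close> and its part - 1/2 to the smaller \<open>z\<close>, both of
      which are at most \<open>x\<close>.\<close>
    also have "\<dots> = G\<^sup>2 * ((x powr (- \<eta>) * x powr (- (1/2))) * z powr (- (\<sigma> + 1)) * d powr (- 1))"
      unfolding powr_add[symmetric] by (simp add: \<eta>_def)
    also have "\<dots> \<le> G\<^sup>2 * ((d powr (- \<eta>) * z powr (- (1/2))) * z powr (- (\<sigma> + 1)) * d powr (- 1))"
      using pos T \<eta> by (intro mult_left_mono mult_mono mult_right_mono powr_mono2') auto
    also have "\<dots> = G\<^sup>2 * (z powr (- 1) * (z powr (- (1 + \<eta>)) * d powr (- (1 + \<eta>))))"
    proof -
      have "(d powr (- \<eta>) * z powr (- (1/2))) * z powr (- (\<sigma> + 1)) * d powr (- 1) =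
         (z powr (- (1/2)) * z powr (- (\<sigma> + 1))) * (d powr (- \<eta>) * d powr (- 1))"
        by (simp only: mult_ac)
      moreover have "z powr (- (1/2)) * z powr (- (\<sigma> + 1)) = z powr (- 1) * z powr (- (1 + \<eta>))"
        unfolding powr_add[symmetric] by (simp add: \<eta>_def)
      moreover have "d powr (- \<eta>) * d powr (- 1) = d powr (- (1 + \<eta>))"
        unfolding powr_add[symmetric] by (simp add: algebra_simps)
      ultimately show ?thesis by (simp only: mult.assoc)
    qed
    also have "\<dots> \<le> G\<^sup>2 * (T powr (- 1) * (w k * d powr (- (1 + \<eta>))))"
      unfolding w_def z_def using pos T \<eta> \<alpha> \<beta> unfolding z_def by (intro mult_left_mono mult_mono mult_right_mono powr_mono2') auto
    also have "T powr (- 1) = 1 / T" using T by (simp add: powr_minus inverse_eq_divide)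
    finally show "cmod (a m) * cmod (a k) * ((real m + \<beta>) / (real m - real k)) \<le> G\<^sup>2 * (1 / T) * (w k * (real m - real k) powr (- (1 + \<eta>)))"
      by (simp only: x_def d_def mult.assoc)
  qed
  also have "\<dots> \<le> G\<^sup>2 * (1 / T) * (\<kappa> * zc)"
    unfolding sum_distrib_left[symmetric] using T by (intro mult_left_mono pair_sum) auto
  finally have "integral {1..T} (\<lambda>u. (cmod (\<Sum>m=N..<M. gap m y * dterm (\<alpha> + y) m (Complex \<sigma> u + 1)))\<^sup>2)
     \<le> (T - 1) * ((G\<^sup>2 * (1 / T\<^sup>2)) * \<kappa>2) + 4 * (G\<^sup>2 * (1 / T) * (\<kappa> * zc))"
    using T by (simp add: mult_left_mono)
  also have "(T - 1) * ((G\<^sup>2 * (1 / T\<^sup>2)) * \<kappa>2) \<le> T * ((G\<^sup>2 * (1 / T\<^sup>2)) * \<kappa>2)"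
    using \<kappa>2_nonneg by (intro mult_right_mono) auto
  also have "T * ((G\<^sup>2 * (1 / T\<^sup>2)) * \<kappa>2) + 4 * (G\<^sup>2 * (1 / T) * (\<kappa> * zc)) = G\<^sup>2 * (\<kappa>2 + 4 * (\<kappa> * zc)) / T"
    using T by (simp add: field_simps power2_eq_square)
  finally show ?thesis by simp
qed

lemma continuous_on_E_vertical: "continuous_on {1..} (\<lambda>u. E M (Complex \<sigma> u))"
  by (rule continuous_on_compose_vertical[OF holomorphic_on_imp_continuous_on[OF E_holomorphic]])
     (use \<sigma> in \<open>auto simp: S_def complex_eq_iff\<close>)

text \<open>The tail is s times an integral over y of the slices. Cauchy--Schwarz in y and an
  exchange of the two integrals reduce it to the slices, whose bound 1 / T against |s|^2 \<le> (2
  T)^2 leaves O(T). The bound is uniform in \<open>M\<close>.\<close>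

lemma mean_square_tail:
  assumes G: "\<And>m y. y \<in> {0..1} \<Longrightarrow> cmod (gap m y) \<le> G" and T: "T \<ge> 1" "T \<le> real N" and NM: "N \<le> M"
  shows "integral {1..T} (\<lambda>u. (cmod (E M (Complex \<sigma> u) - E N (Complex \<sigma> u)))\<^sup>2)
     \<le> 4 * (G\<^sup>2 * (\<kappa>2 + 4 * (\<kappa> * zc))) * T"
proof -
  define Q where "Q u y = (\<Sum>m=N..<M. gap m y * dterm (\<alpha> + y) m (Complex \<sigma> u + 1))" for u y
  define c where "c = G\<^sup>2 * (\<kappa>2 + 4 * (\<kappa> * zc)) / T"
  have c1: "Complex \<sigma> u + 1 = Complex (\<sigma> + 1) u" for u by (simp add: complex_eq_iff)
  have Qc: "continuous_on {0..1} (Q u)" for u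
    unfolding Q_def by (intro continuous_intros continuous_on_gap_dterm)
  have eq: "E M (Complex \<sigma> u) - E N (Complex \<sigma> u) = Complex \<sigma> u * integral {0..1} (Q u)" if "u \<ge> 1" for u
  proof -
    have "Complex \<sigma> u \<noteq> 1" using that by (simp add: complex_eq_iff)
    then have "E M (Complex \<sigma> u) - E N (Complex \<sigma> u) = (\<Sum>m=N..<M. incr m (Complex \<sigma> u))"
      using E_sum[OF _ NM, of "Complex \<sigma> u"] by simp
    also have "\<dots> = Complex \<sigma> u * integral {0..1} (Q u)"
      unfolding incr_def Q_def sum_distrib_left[symmetric]
      by (subst integral_sum) (auto intro!: integrable_continuous_interval continuous_on_gap_dterm)
    finally show ?thesis .
  qed
  \<comment> \<open>Joint continuity in (u, y), needed to exchange the integrals. It is read off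
    from an explicit exponential form, valid because \<alpha> + y stays positive on the
    rectangle.\<close>
  have jc: "continuous_on (cbox (1, 0) (T, 1)) (\<lambda>p. (cmod (Q (fst p) (snd p)))\<^sup>2)"
  proof -
    have "Q (fst p) (snd p) = (\<Sum>m=N..<M. gap m (snd p) * (exp (of_real (- (\<sigma> + 1) * ln (real m + (\<alpha> + snd p)))) * exp (\<i> * of_real (- ln (real m + (\<alpha> + snd p)) * fst p))))"
      if "p \<in> cbox (1, 0) (T, 1)" for p
    proof -
      have "snd p \<ge> 0" using that by (auto simp: cbox_Pair_eq)
      then have pos: "\<alpha> + snd p > 0" using \<alpha> by simp
      show ?thesis unfolding Q_def c1 dterm_Complex[OF pos]
        using pos by (intro sum.cong refl) (simp add: cis_conv_exp powr_def exp_of_real[symmetric] del: exp_of_real)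
    qed
    moreover have "continuous_on (cbox (1, 0) (T, 1)) (\<lambda>p. (\<Sum>m=N..<M. gap m (snd p) * (exp (of_real (- (\<sigma> + 1) * ln (real m + (\<alpha> + snd p)))) * exp (\<i> * of_real (- ln (real m + (\<alpha> + snd p)) * fst p)))))"
      unfolding gap_def using \<alpha>
      by (intro continuous_intros) (auto simp: cbox_Pair_eq add_nonneg_pos add_pos_nonneg dest!: less_imp_neq)
    ultimately show ?thesis
      by (intro continuous_intros) (simp cong: continuous_on_cong)
  qed
  have sw: "integral {1..T} (\<lambda>u. integral {0..1} (\<lambda>y. (cmod (Q u y))\<^sup>2)) = integral {0..1} (\<lambda>y. integral {1..T} (\<lambda>u. (cmod (Q u y))\<^sup>2))"
    using integral_swap_continuous[of 1 0 T 1 "\<lambda>u y. (cmod (Q u y))\<^sup>2"] jc by (simp add: split_beta)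
  have i1: "(\<lambda>u. integral {0..1} (\<lambda>y. (cmod (Q u y))\<^sup>2)) integrable_on {1..T}"
    using integral_integrable_2dim[OF jc] by simp
  have jc2: "continuous_on (cbox (0, 1) (1, T)) (\<lambda>p. (cmod (Q (snd p) (fst p)))\<^sup>2)"
  proof -
    have "(\<lambda>p. (cmod (Q (snd p) (fst p)))\<^sup>2) = (\<lambda>p. (cmod (Q (fst p) (snd p)))\<^sup>2) \<circ> prod.swap" by auto
    moreover have "continuous_on (cbox (0, 1) (1, T)) ((\<lambda>p. (cmod (Q (fst p) (snd p)))\<^sup>2) \<circ> prod.swap)"
      by (intro continuous_on_compose continuous_on_swap continuous_on_subset[OF jc]) (auto simp: cbox_Pair_eq)
    ultimately show ?thesis by simp
  qed
  have i2: "(\<lambda>y. integral {1..T} (\<lambda>u. (cmod (Q u y))\<^sup>2)) integrable_on {0..1}"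
    using integral_integrable_2dim[OF jc2] by simp
  have "integral {1..T} (\<lambda>u. (cmod (E M (Complex \<sigma> u) - E N (Complex \<sigma> u)))\<^sup>2) \<le>
      integral {1..T} (\<lambda>u. (T + 1)\<^sup>2 * integral {0..1} (\<lambda>y. (cmod (Q u y))\<^sup>2))"
  proof (rule integral_le)
    show "(\<lambda>u. (cmod (E M (Complex \<sigma> u) - E N (Complex \<sigma> u)))\<^sup>2) integrable_on {1..T}"
      by (intro integrable_continuous_interval continuous_intros continuous_on_subset[OF continuous_on_E_vertical]) auto
    show "(\<lambda>u. (T + 1)\<^sup>2 * integral {0..1} (\<lambda>y. (cmod (Q u y))\<^sup>2)) integrable_on {1..T}"
      using integrable_cmul[OF i1, of "(T + 1)\<^sup>2"] by simp
    fix u assume u: "u \<in> {1..T}"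
    have "cmod (Complex \<sigma> u) \<le> \<bar>\<sigma>\<bar> + \<bar>u\<bar>" using cmod_le[of "Complex \<sigma> u"] by simp
    also have "\<dots> \<le> T + 1" using u \<sigma> by simp
    finally have "(cmod (Complex \<sigma> u))\<^sup>2 \<le> (T + 1)\<^sup>2" by (intro power_mono) auto
    then have "(cmod (Complex \<sigma> u))\<^sup>2 * (cmod (integral {0..1} (Q u)))\<^sup>2 \<le> (T + 1)\<^sup>2 * integral {0..1} (\<lambda>y. (cmod (Q u y))\<^sup>2)"
      by (intro mult_mono norm_integral_unit_square_le Qc) auto
    then show "(cmod (E M (Complex \<sigma> u) - E N (Complex \<sigma> u)))\<^sup>2 \<le> (T + 1)\<^sup>2 * integral {0..1} (\<lambda>y. (cmod (Q u y))\<^sup>2)"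
      using eq[of u] u by (simp add: norm_mult power_mult_distrib)
  qed
  also have "\<dots> = (T + 1)\<^sup>2 * integral {0..1} (\<lambda>y. integral {1..T} (\<lambda>u. (cmod (Q u y))\<^sup>2))" by (simp add: sw)
  also have "\<dots> \<le> (T + 1)\<^sup>2 * integral {0..1::real} (\<lambda>y. c)"
    unfolding c_def Q_def
    by (intro mult_left_mono integral_le i2[unfolded Q_def] mean_square_slice[OF G T]) auto
  also have "\<dots> = (T + 1)\<^sup>2 * c" by simp
  also have "\<dots> \<le> (2 * T)\<^sup>2 * c"
    using T \<kappa>_nonneg \<kappa>2_nonneg zc_nonneg unfolding c_def by (intro mult_right_mono power_mono divide_nonneg_nonneg mult_nonneg_nonneg add_nonneg_nonneg) auto
  also have "\<dots> = 4 * (G\<^sup>2 * (\<kappa>2 + 4 * (\<kappa> * zc))) * T" using T by (simp add: c_def power2_eq_square)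
  finally show ?thesis .
qed

lemma sum5_square_le:
  fixes x1 x2 x3 x4 x5 :: real
  shows "(x1 + x2 + x3 + x4 + x5)\<^sup>2 \<le> 5 * (x1\<^sup>2 + x2\<^sup>2 + x3\<^sup>2 + x4\<^sup>2 + x5\<^sup>2)"
proof -
  have "0 \<le> (x1 - x2)\<^sup>2 + (x1 - x3)\<^sup>2 + (x1 - x4)\<^sup>2 + (x1 - x5)\<^sup>2 + (x2 - x3)\<^sup>2 + (x2 - x4)\<^sup>2
     + (x2 - x5)\<^sup>2 + (x3 - x4)\<^sup>2 + (x3 - x5)\<^sup>2 + (x4 - x5)\<^sup>2" by simp
  then show ?thesis by (simp add: power2_eq_square algebra_simps)
qed

text \<open>With N the ceiling of T, Z splits into five parts: the partial sum, the tail up to M,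
  the bounded boundary term, the pole term and a remainder. Each has mean square O(T), and the
  constant 5 is the cost of squaring a sum of five.\<close>

lemma mean_square:
  "\<exists>C. \<forall>\<^sub>F T in at_top. integral {1..T} (\<lambda>u. (cmod (Z (Complex \<sigma> u)))\<^sup>2) \<le> C * T"
proof -
  obtain G where G: "G > 0" "\<And>m y. y \<in> {0..1} \<Longrightarrow> cmod (gap m y) \<le> G" using gap_bounded by blast
  obtain K where K: "K > 0" "\<And>m. cmod (dev_sum m) \<le> K" using dev_sum_bounded by blast
  obtain K' where K': "K' > 0" "\<And>m. cmod (b m) \<le> K'" using b_bounded by blast
  define A1 where "A1 = K'\<^sup>2 * \<kappa>2 + 12 * (K'\<^sup>2 * (\<kappa> * zc))"
  define A2 where "A2 = 4 * (G\<^sup>2 * (\<kappa>2 + 4 * (\<kappa> * zc)))"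
  define mu where "mu = (cmod mean)\<^sup>2"
  have "\<forall>\<^sub>F T in at_top. integral {1..T} (\<lambda>u. (cmod (Z (Complex \<sigma> u)))\<^sup>2) \<le> 5 * (A1 + A2 + K\<^sup>2 + 3 * mu + 1) * T"
    using eventually_ge_at_top[of 1]
  proof eventually_elim
    case (elim T)
    define N where "N = nat \<lceil>T\<rceil>"
    have N: "T \<le> real N" "real N \<le> T + 1" using elim unfolding N_def by linarith+
    obtain g where g: "summable g" "\<And>m s. \<sigma> \<le> Re s \<Longrightarrow> cmod s \<le> T + 1 \<Longrightarrow> cmod (incr m s) \<le> g m"
      using incr_summable_bound[of \<sigma> "T + 1"] \<sigma> elim by auto
    \<comment> \<open>M may depend on T without harm, because the tail estimate is uniform in M; it
      is taken so large that the remainder is below 1 on the whole segment.\<close>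
    obtain M where M: "M \<ge> N" "norm (\<Sum>m. g (m + M)) < 1"
    proof -
      obtain M0 where "\<And>n. n \<ge> M0 \<Longrightarrow> norm (\<Sum>i. g (i + n)) < 1"
        using suminf_exist_split[OF _ g(1), of 1] by auto
      then show ?thesis using that[of "max M0 N"] by simp
    qed
    define s where "s u = Complex \<sigma> u" for u
    have s1: "s u \<noteq> 1" if "u \<ge> 1" for u using that by (simp add: s_def complex_eq_iff)
    have rem: "cmod (Z (s u) - E M (s u)) \<le> 1" if u: "u \<in> {1..T}" for u
    proof -
      have "cmod (s u) \<le> \<bar>\<sigma>\<bar> + \<bar>u\<bar>" using cmod_le[of "s u"] by (simp add: s_def)
      then have incr: "cmod (incr m (s u)) \<le> g m" for m using u \<sigma> by (intro g(2)) (auto simp: s_def)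
      have S: "s u \<in> S" "Re (s u) > 0" using \<sigma> s1[of u] u by (auto simp: S_def s_def)
      have "Z (s u) - E M (s u) = (\<Sum>m. incr m (s u)) - (\<Sum>m<M. incr m (s u))"
        using Z_eq_L[of "s u"] S s1[of u] u E_eq_sum[OF S(1), of M, symmetric] by (simp add: L_def)
      also have "\<dots> = (\<Sum>m. incr (m + M) (s u))" by (rule suminf_minus_initial_segment[symmetric, OF incr_summable[OF S(2)]])
      also have "cmod \<dots> \<le> (\<Sum>m. g (m + M))"
        by (rule norm_suminf_le[OF incr]) (use g(1) in \<open>simp add: summable_iff_shift\<close>)
      finally show ?thesis using M(2) by simp
    qed
    have bd: "(cmod (Z (s u)))\<^sup>2 \<le> 5 * ((cmod (ptl \<alpha> b N (s u)))\<^sup>2 + (cmod (E M (s u) - E N (s u)))\<^sup>2 + K\<^sup>2 + mu * (3 * T) * (1 / u\<^sup>2) + 1)"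
      if u: "u \<in> {1..T}" for u
    proof -
      define q where "q = mean * dterm \<alpha> N (s u - 1) / (s u - 1)"
      have "Z (s u) = ptl \<alpha> b N (s u) + (E M (s u) - E N (s u)) + (- (dev_sum N * dterm \<alpha> N (s u))) + q + (Z (s u) - E M (s u))"
        by (simp add: E_def[of N] q_def)
      then have "cmod (Z (s u)) \<le> cmod (ptl \<alpha> b N (s u)) + cmod (E M (s u) - E N (s u)) + cmod (dev_sum N * dterm \<alpha> N (s u)) + cmod q + cmod (Z (s u) - E M (s u))"
        by (smt (verit) norm_triangle_ineq norm_minus_cancel)
      also have "cmod (dev_sum N * dterm \<alpha> N (s u)) \<le> K * 1"
      proof -
        have "(real N + \<alpha>) powr (- \<sigma>) \<le> (real N + \<alpha>) powr 0" using N elim \<sigma> \<alpha> by (intro powr_mono) auto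
        then have "cmod (dterm \<alpha> N (s u)) \<le> 1" using N elim \<alpha> by (simp add: norm_dterm s_def)
        then show ?thesis unfolding norm_mult using K by (intro mult_mono) auto
      qed
      also note rem[OF u]
      finally have "cmod (Z (s u)) \<le> cmod (ptl \<alpha> b N (s u)) + cmod (E M (s u) - E N (s u)) + K + cmod q + 1" by simp
      then have "(cmod (Z (s u)))\<^sup>2 \<le> (cmod (ptl \<alpha> b N (s u)) + cmod (E M (s u) - E N (s u)) + K + cmod q + 1)\<^sup>2"
        by (intro power_mono) auto
      also have "\<dots> \<le> 5 * ((cmod (ptl \<alpha> b N (s u)))\<^sup>2 + (cmod (E M (s u) - E N (s u)))\<^sup>2 + K\<^sup>2 + (cmod q)\<^sup>2 + 1\<^sup>2)"
        by (rule sum5_square_le)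
      \<comment> \<open>The pole term is of size N^(1 - \<sigma>) / |s - 1|: the numerator squared
        is at most N + \<alpha>, hence O(T), and 1 / u^2 has integral at most 1 over [1, T].\<close>
      also have "(cmod q)\<^sup>2 \<le> mu * (3 * T) * (1 / u\<^sup>2)"
      proof -
        define x where "x = real N + \<alpha>"
        have x: "x \<ge> 1" "x \<le> 3 * T" using N elim \<alpha> by (auto simp: x_def)
        have "(x powr (- (\<sigma> - 1)))\<^sup>2 = x powr (2 - 2 * \<sigma>)" by (simp add: power2_eq_square powr_add[symmetric])
        also have "\<dots> \<le> x powr 1" using x \<sigma> by (intro powr_mono) auto
        finally have 1: "(x powr (- (\<sigma> - 1)))\<^sup>2 \<le> 3 * T" using x by simp
        have "u \<le> cmod (s u - 1)" using abs_Im_le_cmod[of "s u - 1"] u by (simp add: s_def)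
        then have 2: "u\<^sup>2 \<le> (cmod (s u - 1))\<^sup>2" using u by (intro power_mono) auto
        have "(cmod q)\<^sup>2 = mu * (x powr (- (\<sigma> - 1)))\<^sup>2 / (cmod (s u - 1))\<^sup>2"
          by (simp add: q_def norm_mult norm_divide power_mult_distrib power_divide mu_def norm_dterm \<alpha> x_def s_def)
        also have "\<dots> \<le> (mu * (3 * T)) / u\<^sup>2"
          using 1 2 u elim by (intro frac_le mult_left_mono mult_nonneg_nonneg) (auto simp: mu_def)
        finally show ?thesis by simp
      qed
      finally show ?thesis by simp
    qed
    have c1: "continuous_on {1..T} (\<lambda>u. ptl \<alpha> b N (s u))" unfolding s_def
      by (rule continuous_on_compose_vertical[OF holomorphic_on_imp_continuous_on[OF ptl_holomorphic[OF \<alpha>(1), of b N UNIV]]]) auto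
    have c2: "continuous_on {1..T} (\<lambda>u. E M (s u))" for M unfolding s_def
      by (rule continuous_on_subset[OF continuous_on_E_vertical]) auto
    have cZ: "continuous_on {1..T} (\<lambda>u. Z (s u))" unfolding s_def
      by (rule continuous_on_compose_vertical[OF holomorphic_on_imp_continuous_on[of Z "- {1}"]])
         (use Z in \<open>auto simp: is_periodic_hurwitz_zeta_def complex_eq_iff\<close>)
    have inv: "((\<lambda>u. 1 / u\<^sup>2) has_integral (- 1 / T - (- 1 / 1))) {1..T}"
    proof (rule fundamental_theorem_of_calculus[OF elim])
      fix x :: real assume "x \<in> {1..T}"
      then have "((\<lambda>u. - 1 / u) has_real_derivative 1 / x\<^sup>2) (at x within {1..T})"
        by (auto intro!: derivative_eq_intros simp: power2_eq_square)
      then show "((\<lambda>u. - 1 / u) has_vector_derivative 1 / x\<^sup>2) (at x within {1..T})"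
        by (simp add: has_real_derivative_iff_has_vector_derivative)
    qed
    have i: "(\<lambda>u. (cmod (ptl \<alpha> b N (s u)))\<^sup>2) integrable_on {1..T}" "(\<lambda>u. (cmod (E M (s u) - E N (s u)))\<^sup>2) integrable_on {1..T}"
      by (intro integrable_continuous_interval continuous_intros c1 c2)+
    have hi: "((\<lambda>u. 5 * ((cmod (ptl \<alpha> b N (s u)))\<^sup>2 + (cmod (E M (s u) - E N (s u)))\<^sup>2 + K\<^sup>2 + mu * (3 * T) * (1 / u\<^sup>2) + 1)) has_integral
       5 * (integral {1..T} (\<lambda>u. (cmod (ptl \<alpha> b N (s u)))\<^sup>2) + integral {1..T} (\<lambda>u. (cmod (E M (s u) - E N (s u)))\<^sup>2)
         + K\<^sup>2 * (T - 1) + mu * (3 * T) * (- 1 / T - (- 1 / 1)) + 1 * (T - 1))) {1..T}"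
    proof (intro has_integral_mult_right has_integral_add integrable_integral i inv)
      show "((\<lambda>u. K\<^sup>2) has_integral K\<^sup>2 * (T - 1)) {1..T}" "((\<lambda>u. 1) has_integral 1 * (T - 1)) {1..T}"
        using has_integral_const_real[of "K\<^sup>2" 1 T] has_integral_const_real[of "1::real" 1 T] elim by (simp_all add: mult.commute)
    qed
    have "integral {1..T} (\<lambda>u. (cmod (Z (s u)))\<^sup>2) \<le> 5 * (integral {1..T} (\<lambda>u. (cmod (ptl \<alpha> b N (s u)))\<^sup>2) + integral {1..T} (\<lambda>u. (cmod (E M (s u) - E N (s u)))\<^sup>2)
         + K\<^sup>2 * (T - 1) + mu * (3 * T) * (- 1 / T - (- 1 / 1)) + 1 * (T - 1))"
      by (rule has_integral_le[OF integrable_integral hi bd])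
         (intro integrable_continuous_interval continuous_intros cZ)
    also have "\<dots> \<le> 5 * (A1 * T + A2 * T + K\<^sup>2 * T + 3 * mu * T + 1 * T)"
    proof (intro mult_left_mono add_mono)
      show "integral {1..T} (\<lambda>u. (cmod (ptl \<alpha> b N (s u)))\<^sup>2) \<le> A1 * T"
        unfolding A1_def s_def by (rule mean_square_initial[OF K'(2) elim N(2)])
      show "integral {1..T} (\<lambda>u. (cmod (E M (s u) - E N (s u)))\<^sup>2) \<le> A2 * T"
        unfolding A2_def s_def by (rule mean_square_tail[OF G(2) elim N(1) M(1)])
      have "mu * (3 * T) * (- 1 / T - (- 1 / 1)) \<le> mu * (3 * T) * 1"
        using elim by (intro mult_left_mono) (auto simp: mu_def)
      then show "mu * (3 * T) * (- 1 / T - (- 1 / 1)) \<le> 3 * mu * T" by (simp add: mult_ac)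
    qed auto
    finally show ?case by (simp add: s_def algebra_simps)
  qed
  then show ?thesis by blast
qed

text \<open>The boundary line is any \<sigma> strictly between 1/2 and 1 rather than 1/2 itself,
  where the constants of the mean square would diverge. Letting \<sigma> vary still reaches every
  compact subset of Re s > 1/2.\<close>

lemma continued_dirichlet_hurwitz: "continued_dirichlet \<alpha> \<sigma> 1 b Z"
proof
  obtain K where K: "K > 0" "\<And>m. cmod (b m) \<le> K" using b_bounded by blast
  show "summable (\<lambda>m. cmod (b m) * (real m + \<alpha>) powr - 3)"
  proof (rule summable_comparison_test'[of "\<lambda>m. K * (real m + \<alpha>) powr - 3" 0])
    show "summable (\<lambda>m. K * (real m + \<alpha>) powr - 3)"
      by (intro summable_mult summable_shift_powr) (use \<alpha> in auto)
    show "norm (cmod (b m) * (real m + \<alpha>) powr - 3) \<le> K * (real m + \<alpha>) powr - 3" for m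
      using mult_right_mono[OF K(2)[of m], of "(real m + \<alpha>) powr - 3"] by (simp add: abs_mult)
  qed
  show "(\<lambda>m. b m * dterm \<alpha> m s) sums Z s" if "3 \<le> Re s" for s
    by (rule Z_sums) (use that in simp)
  have "Z analytic_on - {1}"
    using Z by (simp add: is_periodic_hurwitz_zeta_def analytic_on_open open_delete open_Compl)
  then show "Z analytic_on {s. \<sigma> \<le> Re s \<and> 1 \<le> Im s}"
    by (rule analytic_on_subset) auto
  show "\<exists>B. \<exists>C::nat. \<forall>s. \<sigma> \<le> Re s \<and> Re s \<le> \<sigma>2 \<and> 1 \<le> Im s \<longrightarrow> cmod (Z s) \<le> B * Im s ^ C" for \<sigma>2
    using growth[of \<sigma> \<sigma>2] \<sigma> by fastforce
  show "\<exists>C. \<forall>\<^sub>F T in at_top. integral {1..T} (\<lambda>u. (cmod (Z (Complex \<sigma> u)))\<^sup>2) \<le> C * T"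
    by (rule mean_square)
qed (use \<alpha> \<sigma> in auto)

end

end

section \<open>Almost sure convergence of Dirichlet series with orthonormal coefficients\<close>

text \<open>The derivative in the shift is dominated by that of a real function \<phi>, whose
  increment is a difference of consecutive values. Sums of these bounds therefore telescope.\<close>

lemma dterm_diff_bound:
  assumes \<beta>: "\<beta> > 0" and s: "Re s > 0"
  shows "cmod (dterm \<beta> (Suc m) s - dterm \<beta> m s) \<le> cmod s / Re s * ((real m + \<beta>) powr (- Re s) - (real (Suc m) + \<beta>) powr (- Re s))"
proof -
  define \<phi> where "\<phi> y = - (cmod s / Re s) * (real m + (\<beta> + y)) powr (- Re s)" for y
  have "cmod (dterm (\<beta> + 1) m s - dterm (\<beta> + 0) m s) \<le> \<phi> 1 - \<phi> 0"
  proof (rule differentiable_bound_general[where f = "\<lambda>y. dterm (\<beta> + y) m s" and \<phi> = \<phi> and a = 0 and b = 1])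
    show "continuous_on {0..1} (\<lambda>y. dterm (\<beta> + y) m s)"
      by (rule continuous_on_vector_derivative) (rule has_vector_derivative_dterm, use \<beta> in auto)
    show "continuous_on {0..1} \<phi>" unfolding \<phi>_def using \<beta> s by (auto intro!: continuous_intros)
    fix y :: real assume y: "0 < y" "y < 1"
    show "((\<lambda>y. dterm (\<beta> + y) m s) has_vector_derivative (- s * dterm (\<beta> + y) m (s + 1))) (at y)"
      by (rule has_vector_derivative_dterm) (use \<beta> y in auto)
    have "(\<phi> has_real_derivative (cmod s * (real m + (\<beta> + y)) powr (- Re s - 1))) (at y)"
      unfolding \<phi>_def using \<beta> y s by (auto intro!: derivative_eq_intros)
    then show "(\<phi> has_vector_derivative (cmod s * (real m + (\<beta> + y)) powr (- Re s - 1))) (at y)"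
      by (simp add: has_real_derivative_iff_has_vector_derivative)
    show "cmod (- s * dterm (\<beta> + y) m (s + 1)) \<le> cmod s * (real m + (\<beta> + y)) powr (- Re s - 1)"
      using \<beta> y by (simp add: norm_mult norm_dterm)
  qed auto
  moreover have "dterm (\<beta> + 1) m s = dterm \<beta> (Suc m) s" by (simp add: dterm_def algebra_simps)
  moreover have "\<phi> 1 - \<phi> 0 = cmod s / Re s * ((real m + \<beta>) powr (- Re s) - (real (Suc m) + \<beta>) powr (- Re s))"
    by (simp add: \<phi>_def algebra_simps)
  ultimately show ?thesis by simp
qed

text \<open>Here \<open>y m\<close> are the terms of a Dirichlet series at \<tau>. Convergence there
  spreads to the right, uniformly on bounded sets at distance \<delta> from the line through \<tau>,
  since the factors (m + \<beta>)^(-(s - \<tau>)) have uniformly bounded variation.\<close>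

lemma abel_uniformly_convergent:
  fixes y :: "nat \<Rightarrow> complex"
  assumes \<beta>: "\<beta> > 0" and y: "convergent (\<lambda>n. \<Sum>m<n. y m)" and \<delta>: "\<delta> > 0"
    and K: "\<And>s. s \<in> K \<Longrightarrow> \<delta> \<le> Re (s - \<tau>)" "\<And>s. s \<in> K \<Longrightarrow> cmod (s - \<tau>) \<le> R"
  shows "uniformly_convergent_on K (\<lambda>n s. \<Sum>m<n. y m * dterm \<beta> m (s - \<tau>))"
proof (rule Cauchy_uniformly_convergent, rule uniformly_Cauchy_onI')
  fix e :: real assume e: "e > 0"
  \<comment> \<open>Final value plus total variation of the factors. The absolute value keeps
    \<open>C\<close> positive when \<open>K\<close> is empty and \<open>R\<close> negative.\<close>
  define C where "C = 1 + \<bar>R\<bar> / \<delta>"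
  have C: "C > 0" unfolding C_def using \<delta> by (intro add_pos_nonneg) auto
  define T where "T n = (\<Sum>m<n. y m)" for n
  have "Cauchy T" using y unfolding T_def[abs_def] by (rule convergent_Cauchy)
  then obtain n0 where n0: "\<And>m n. m \<ge> n0 \<Longrightarrow> n \<ge> n0 \<Longrightarrow> cmod (T m - T n) < e / (2 * C)"
    using CauchyD[of T "e / (2 * C)"] e C by auto
  show "\<exists>M. \<forall>s\<in>K. \<forall>m\<ge>M. \<forall>n>m. dist (\<Sum>k<m. y k * dterm \<beta> k (s - \<tau>)) (\<Sum>k<n. y k * dterm \<beta> k (s - \<tau>)) < e"
  proof (intro exI[of _ "max n0 1"] ballI allI impI)
    fix s N n assume s: "s \<in> K" and N: "max n0 1 \<le> N" "N < n"
    define t where "t = s - \<tau>"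
    have t: "\<delta> \<le> Re t" "cmod t \<le> R" using K[OF s] by (auto simp: t_def)
    define d where "d k = dterm \<beta> k t" for k
    define x where "x k = (real k + \<beta>) powr (- Re t)" for k
    define A where "A k = T k - T N" for k
    have A: "cmod (A k) \<le> e / (2 * C)" if "k \<ge> N" for k using n0[of k N] N that by (simp add: A_def)
    \<comment> \<open>Abel summation with \<open>A\<close> normalised to vanish at N, so that only
      one boundary term remains and every \<open>A\<close> that occurs is small.\<close>
    have summ: "(\<Sum>k=N..<n. y k * d k) = A n * d n - (\<Sum>k=N..<n. A (Suc k) * (d (Suc k) - d k))"
      if "N \<le> n" for n using that
    proof (induction n rule: dec_induct)
      case (step n)
      have "A (Suc n) = A n + y n" by (simp add: A_def T_def)
      then show ?case using step by (simp add: algebra_simps)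
    qed (simp add: A_def)
    have x1: "x N \<le> 1"
    proof -
      have "(real N + \<beta>) powr (- Re t) \<le> (real N + \<beta>) powr 0" using N \<beta> t \<delta> by (intro powr_mono) auto
      then show ?thesis using N \<beta> by (simp add: x_def)
    qed
    have xd: "cmod (d k) = x k" for k by (simp add: d_def x_def norm_dterm \<beta>)
    have dd: "cmod (d (Suc k) - d k) \<le> \<bar>R\<bar> / \<delta> * (x k - x (Suc k))" for k
    proof -
      have "cmod (d (Suc k) - d k) \<le> cmod t / Re t * (x k - x (Suc k))"
        unfolding d_def x_def by (rule dterm_diff_bound[OF \<beta>]) (use t \<delta> in simp)
      also have "\<dots> \<le> \<bar>R\<bar> / \<delta> * (x k - x (Suc k))"
      proof (rule mult_right_mono)
        show "cmod t / Re t \<le> \<bar>R\<bar> / \<delta>" using t \<delta> by (intro frac_le) auto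
        show "0 \<le> x k - x (Suc k)" unfolding x_def using \<beta> t \<delta> by (simp add: powr_mono2')
      qed
      finally show ?thesis .
    qed
    have "(\<Sum>k<n. y k * d k) = (\<Sum>k<N. y k * d k) + (\<Sum>k=N..<n. y k * d k)"
      using N sum.atLeastLessThan_concat[of 0 N n "\<lambda>k. y k * d k"] by (simp add: lessThan_atLeast0)
    then have "dist (\<Sum>k<N. y k * d k) (\<Sum>k<n. y k * d k) = cmod (\<Sum>k=N..<n. y k * d k)"
      by (simp add: dist_norm)
    also have "\<dots> = cmod (A n * d n - (\<Sum>k=N..<n. A (Suc k) * (d (Suc k) - d k)))" using N by (simp add: summ)
    also have "\<dots> \<le> cmod (A n * d n) + cmod (\<Sum>k=N..<n. A (Suc k) * (d (Suc k) - d k))" by (rule norm_triangle_ineq4)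
    also have "\<dots> \<le> e / (2 * C) * x n + (\<Sum>k=N..<n. e / (2 * C) * (\<bar>R\<bar> / \<delta> * (x k - x (Suc k))))"
    proof (intro add_mono sum_norm_le)
      show "cmod (A n * d n) \<le> e / (2 * C) * x n"
        unfolding norm_mult xd using A[of n] N by (intro mult_right_mono) (auto simp: x_def)
      show "cmod (A (Suc k) * (d (Suc k) - d k)) \<le> e / (2 * C) * (\<bar>R\<bar> / \<delta> * (x k - x (Suc k)))"
        if "k \<in> {N..<n}" for k
        unfolding norm_mult using that e C by (intro mult_mono A dd) auto
    qed
    also have "\<dots> = e / (2 * C) * (x n + \<bar>R\<bar> / \<delta> * (x N - x n))"
    proof -
      have "(\<Sum>k=N..<n. x k - x (Suc k)) = x N - x n" using N sum_Suc_diff'[of N n "\<lambda>k. - x k"] by simp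
      then show ?thesis unfolding sum_distrib_left[symmetric] distrib_left by simp
    qed
    also have "\<dots> \<le> e / (2 * C) * (1 + \<bar>R\<bar> / \<delta> * (1 - 0))"
    proof (intro mult_left_mono add_mono diff_mono)
      show "x n \<le> 1" using order_trans[OF _ x1, of "x n"] N \<beta> t \<delta> by (simp add: x_def powr_mono2')
    qed (use x1 \<delta> e C in \<open>auto simp: x_def\<close>)
    also have "\<dots> = e / 2"
    proof -
      have "1 + \<bar>R\<bar> / \<delta> * (1 - 0) = C" by (simp add: C_def)
      then show ?thesis using C by simp
    qed
    also have "\<dots> < e" using e by simp
    finally show "dist (\<Sum>k<N. y k * dterm \<beta> k (s - \<tau>)) (\<Sum>k<n. y k * dterm \<beta> k (s - \<tau>)) < e"
      by (simp add: d_def t_def)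
  qed
qed

text \<open>Only orthogonality is demanded: the factors attached to 2 and 4, say, are a coordinate
  and its square, which are orthogonal but dependent.\<close>

locale orthonormal_system = prob_space M for M :: "'w measure" +
  fixes X :: "nat \<Rightarrow> 'w \<Rightarrow> complex"
  assumes X_measurable [measurable]: "\<And>m. X m \<in> borel_measurable M"
    and X_norm: "\<And>m \<omega>. \<omega> \<in> space M \<Longrightarrow> cmod (X m \<omega>) = 1"
    and X_orth: "\<And>m k. m \<noteq> k \<Longrightarrow> (\<integral>\<omega>. X m \<omega> * cnj (X k \<omega>) \<partial>M) = 0"
begin

lemma cnj_X_measurable [measurable]: "(\<lambda>\<omega>. cnj (X m \<omega>)) \<in> borel_measurable M"
  by (rule borel_measurable_continuous_on[OF _ X_measurable]) (intro continuous_intros)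

definition block :: "(nat \<Rightarrow> complex) \<Rightarrow> nat \<Rightarrow> nat \<Rightarrow> 'w \<Rightarrow> complex" where
  "block c N k \<omega> = (\<Sum>m=N..<N + k. c m * X m \<omega>)"

lemma block_measurable [measurable]: "block c N k \<in> borel_measurable M"
  unfolding block_def[abs_def] by measurable

lemma block_bounded: "\<omega> \<in> space M \<Longrightarrow> cmod (block c N k \<omega>) \<le> (\<Sum>m=N..<N + k. cmod (c m))"
  unfolding block_def by (rule sum_norm_le) (simp add: norm_mult X_norm)

lemma block_square_integrable: "integrable M (\<lambda>\<omega>. (cmod (block c N k \<omega>))\<^sup>2)"
proof (rule integrable_const_bound)
  show "AE \<omega> in M. norm ((cmod (block c N k \<omega>))\<^sup>2) \<le> (\<Sum>m=N..<N + k. cmod (c m))\<^sup>2"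
    by (rule AE_I2) (auto intro!: power_mono block_bounded)
qed measurable

lemma integral_block_square: "(\<integral>\<omega>. (cmod (block c N k \<omega>))\<^sup>2 \<partial>M) = (\<Sum>m=N..<N + k. (cmod (c m))\<^sup>2)"
proof -
  let ?I = "{N..<N + k}"
  have i: "integrable M (\<lambda>\<omega>. X m \<omega> * cnj (X j \<omega>))" for m j
    by (rule integrable_const_bound[of _ 1]) (auto intro!: AE_I2 simp: norm_mult X_norm)
  have d: "(\<integral>\<omega>. X m \<omega> * cnj (X m \<omega>) \<partial>M) = 1" for m
  proof -
    have "(\<integral>\<omega>. X m \<omega> * cnj (X m \<omega>) \<partial>M) = (\<integral>\<omega>. 1 \<partial>M)"
      by (rule Bochner_Integration.integral_cong) (auto simp: complex_norm_square[symmetric] X_norm)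
    then show ?thesis by (simp add: prob_space)
  qed
  have "complex_of_real (\<integral>\<omega>. (cmod (block c N k \<omega>))\<^sup>2 \<partial>M) = (\<integral>\<omega>. of_real ((cmod (block c N k \<omega>))\<^sup>2) \<partial>M)"
    by (rule integral_complex_of_real[symmetric])
  also have "\<dots> = (\<integral>\<omega>. (\<Sum>m\<in>?I. \<Sum>j\<in>?I. (c m * cnj (c j)) * (X m \<omega> * cnj (X j \<omega>))) \<partial>M)"
    unfolding complex_norm_square block_def cnj_sum sum_product
    by (intro Bochner_Integration.integral_cong sum.cong) (simp_all add: mult_ac)
  also have "\<dots> = (\<Sum>m\<in>?I. \<Sum>j\<in>?I. (c m * cnj (c j)) * (\<integral>\<omega>. X m \<omega> * cnj (X j \<omega>) \<partial>M))"
    by (simp only: Bochner_Integration.integral_sum Bochner_Integration.integrable_sum integrable_mult_right i integral_mult_right_zero)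
  also have "\<dots> = (\<Sum>m\<in>?I. \<Sum>j\<in>?I. if m = j then c m * cnj (c m) else 0)"
    by (intro sum.cong refl) (auto simp: d X_orth)
  also have "\<dots> = (\<Sum>m\<in>?I. c m * cnj (c m))" by simp
  also have "\<dots> = of_real (\<Sum>m\<in>?I. (cmod (c m))\<^sup>2)"
    unfolding of_real_sum complex_norm_square ..
  finally show ?thesis unfolding of_real_eq_iff .
qed

text \<open>A pointwise majorant of \<open>max {\<bar>block c N k\<bar>\<^sup>2 | k \<le> 2 ^ j}\<close>, built by halving the block as in the
  proof of the Rademacher--Menshov inequality.\<close>

fun maximal :: "(nat \<Rightarrow> complex) \<Rightarrow> nat \<Rightarrow> nat \<Rightarrow> 'w \<Rightarrow> real" where
  "maximal c 0 N \<omega> = (cmod (block c N 1 \<omega>))\<^sup>2"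
| "maximal c (Suc j) N \<omega> = (1 + 1 / (real j + 1)) * (maximal c j N \<omega> + maximal c j (N + 2 ^ j) \<omega>)
     + (real j + 2) * (cmod (block c N (2 ^ j) \<omega>))\<^sup>2"

lemma maximal_nonneg: "maximal c j N \<omega> \<ge> 0"
  by (induction j arbitrary: N) auto

lemma maximal_measurable [measurable]: "maximal c j N \<in> borel_measurable M"
  by (induction j arbitrary: N) (simp_all add: maximal.simps[abs_def])

text \<open>A long block is the full first half plus an initial part of the second half. The square
  of the sum is split with weights 1 + t and 1 + 1 / t, the large weight falling on the full half,
  which is a single block and not a maximum.\<close>

lemma block_le_maximal: "k \<le> 2 ^ j \<Longrightarrow> (cmod (block c N k \<omega>))\<^sup>2 \<le> maximal c j N \<omega>"
proof (induction j arbitrary: N k)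
  case 0
  then consider "k = 0" | "k = 1" by fastforce
  then show ?case by cases (auto simp: block_def)
next
  case (Suc j)
  \<comment> \<open>The weight grows with the level, so that the factors 1 + 1 / t multiply up to
    only j + 1 instead of 2^j.\<close>
  define t where "t = real j + 1"
  have t: "t > 0" by (simp add: t_def)
  let ?m1 = "maximal c j N \<omega>" and ?m2 = "maximal c j (N + 2 ^ j) \<omega>" and ?b = "cmod (block c N (2 ^ j) \<omega>)"
  show ?case
  proof (cases "k \<le> 2 ^ j")
    case True
    have "(cmod (block c N k \<omega>))\<^sup>2 \<le> ?m1" by (rule Suc.IH[OF True])
    also have "\<dots> \<le> (1 + 1 / t) * (?m1 + ?m2) + (real j + 2) * ?b\<^sup>2"
      using t maximal_nonneg[of c j N \<omega>] maximal_nonneg[of c j "N + 2 ^ j" \<omega>]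
      by (intro add_increasing2) (auto simp: distrib_right)
    finally show ?thesis by (simp add: t_def)
  next
    case False
    define k' where "k' = k - 2 ^ j"
    have k': "k = 2 ^ j + k'" "k' \<le> 2 ^ j" using False Suc.prems by (auto simp: k'_def)
    let ?b' = "cmod (block c (N + 2 ^ j) k' \<omega>)"
    have "block c N k \<omega> = block c N (2 ^ j) \<omega> + block c (N + 2 ^ j) k' \<omega>"
      unfolding block_def k'(1) by (simp add: add.assoc sum.atLeastLessThan_concat)
    then have "(cmod (block c N k \<omega>))\<^sup>2 \<le> (?b + ?b')\<^sup>2"
      by (simp add: norm_triangle_ineq power_mono)
    also have "\<dots> \<le> (1 + t) * ?b\<^sup>2 + (1 + 1 / t) * ?b'\<^sup>2"
    proof -
      have "0 \<le> (t * ?b - ?b')\<^sup>2 / t" using t by simp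
      also have "\<dots> = t * ?b\<^sup>2 - 2 * ?b * ?b' + (1 / t) * ?b'\<^sup>2"
        using t by (simp add: power2_eq_square field_simps)
      finally show ?thesis by (simp add: power2_eq_square algebra_simps)
    qed
    also have "\<dots> \<le> (1 + t) * ?b\<^sup>2 + (1 + 1 / t) * (?m1 + ?m2)"
      using t Suc.IH[OF k'(2), of "N + 2 ^ j"] maximal_nonneg[of c j N \<omega>]
      by (intro add_left_mono mult_left_mono) auto
    finally show ?thesis by (simp add: t_def algebra_simps)
  qed
qed

lemma maximal_integrable: "integrable M (maximal c j N)"
  by (induction j arbitrary: N) (simp_all add: maximal.simps[abs_def] block_square_integrable)

text \<open>The weights close the induction: t^2 (1 + 1 / t) + (t + 1) = (t + 1)^2. The loss at
  length 2^j is thus quadratic in j, that is, in the logarithm of the length.\<close>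

lemma integral_maximal_le:
  "(\<integral>\<omega>. maximal c j N \<omega> \<partial>M) \<le> (real j + 1)\<^sup>2 * (\<Sum>m=N..<N + 2 ^ j. (cmod (c m))\<^sup>2)"
proof (induction j arbitrary: N)
  case 0
  then show ?case by (simp add: integral_block_square)
next
  case (Suc j)
  define t where "t = real j + 1"
  have t: "t > 0" by (simp add: t_def)
  define V1 V2 where "V1 = (\<Sum>m=N..<N + 2 ^ j. (cmod (c m))\<^sup>2)" and "V2 = (\<Sum>m=N + 2 ^ j..<N + 2 ^ j + 2 ^ j. (cmod (c m))\<^sup>2)"
  have V: "V1 \<ge> 0" "V2 \<ge> 0" by (auto simp: V1_def V2_def intro: sum_nonneg)
  have VV: "(\<Sum>m=N..<N + 2 ^ Suc j. (cmod (c m))\<^sup>2) = V1 + V2"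
    unfolding V1_def V2_def by (simp add: sum.atLeastLessThan_concat add.assoc mult_2)
  have "(\<integral>\<omega>. maximal c (Suc j) N \<omega> \<partial>M) =
      (1 + 1 / t) * ((\<integral>\<omega>. maximal c j N \<omega> \<partial>M) + (\<integral>\<omega>. maximal c j (N + 2 ^ j) \<omega> \<partial>M)) + (t + 1) * V1"
    by (simp add: maximal_integrable block_square_integrable integral_block_square V1_def t_def)
  also have "\<dots> \<le> (1 + 1 / t) * (t\<^sup>2 * V1 + t\<^sup>2 * V2) + (t + 1) * V1"
    using t Suc.IH[of N] Suc.IH[of "N + 2 ^ j"] unfolding V1_def V2_def t_def
    by (intro add_right_mono mult_left_mono add_mono) auto
  also have "\<dots> \<le> (t + 1)\<^sup>2 * (V1 + V2)"
  proof -
    have "(1 + 1 / t) * (t\<^sup>2 * V1 + t\<^sup>2 * V2) = (t * t + t) * (V1 + V2)" using t by (simp add: field_simps power2_eq_square)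
    moreover have "(t + 1) * V1 \<le> (t + 1) * (V1 + V2)" using t V by (intro mult_left_mono) auto
    ultimately show ?thesis by (simp add: power2_eq_square algebra_simps)
  qed
  finally show ?case unfolding VV by (simp add: t_def add_ac)
qed

text \<open>Moving from \<sigma>' to \<sigma> = \<sigma>' + \<delta> gains 2^(- \<delta> n) on the
  block from 2^n to 2^(n + 1), which beats the factor n + 1 of the maximal inequality. The block
  maxima then have a finite expected sum, so almost surely they are summable: the partial sums
  converge along powers of two and vary little in between.\<close>

lemma AE_convergent_point:
  assumes \<beta>: "\<beta> > 0" and \<sigma>: "\<sigma>' < \<sigma>" and S: "summable (\<lambda>m. (cmod (a m))\<^sup>2 * (real m + \<beta>) powr (- 2 * \<sigma>'))"
  shows "AE \<omega> in M. convergent (\<lambda>n. \<Sum>m<n. a m * X m \<omega> * of_real ((real m + \<beta>) powr (- \<sigma>)))"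
proof -
  define \<delta> where "\<delta> = \<sigma> - \<sigma>'"
  have \<delta>: "\<delta> > 0" using \<sigma> by (simp add: \<delta>_def)
  define c where "c m = a m * of_real ((real m + \<beta>) powr (- \<sigma>))" for m
  define S2 where "S2 = (\<Sum>m. (cmod (a m))\<^sup>2 * (real m + \<beta>) powr (- 2 * \<sigma>'))"
  \<comment> \<open>Up to the constant \<open>S2\<close>, the root mean square of the n-th block
    maximum.\<close>
  define e where "e n = (real n + 1) * (2 powr (- \<delta>)) ^ n" for n
  have S20: "S2 \<ge> 0" unfolding S2_def by (rule suminf_nonneg[OF S]) auto
  have e0: "e n > 0" for n by (simp add: e_def)
  define B where "B n \<omega> = sqrt (maximal c n (2 ^ n) \<omega>)" for n \<omega>
  have B0: "B n \<omega> \<ge> 0" for n \<omega> by (simp add: B_def maximal_nonneg)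
  have [measurable]: "B n \<in> borel_measurable M" for n unfolding B_def[abs_def] by measurable
  have c2: "(cmod (c m))\<^sup>2 \<le> ((2 powr (- \<delta>)) ^ n)\<^sup>2 * ((cmod (a m))\<^sup>2 * (real m + \<beta>) powr (- 2 * \<sigma>'))" if "m \<ge> 2 ^ n" for m n
  proof -
    have "(2::real) ^ n \<le> real m" using of_nat_mono[OF that, where 'a = real] by simp
    moreover have "2 powr real n = (2::real) ^ n" by (simp add: powr_realpow)
    ultimately have x: "real m + \<beta> > 0" "2 powr real n \<le> real m + \<beta>"
      using \<beta> by linarith+
    have "((real m + \<beta>) powr (- \<sigma>))\<^sup>2 = (real m + \<beta>) powr (- 2 * \<sigma>') * (real m + \<beta>) powr (- 2 * \<delta>)"
      by (simp add: power2_eq_square powr_add[symmetric] \<delta>_def algebra_simps)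
    also have "\<dots> \<le> (real m + \<beta>) powr (- 2 * \<sigma>') * (2 powr real n) powr (- 2 * \<delta>)"
      using x \<delta> by (intro mult_left_mono powr_mono2') auto
    also have "(2 powr real n) powr (- 2 * \<delta>) = ((2 powr (- \<delta>)) ^ n)\<^sup>2"
      by (simp add: powr_powr powr_realpow[symmetric] powr_add[symmetric] power2_eq_square mult_ac)
    finally have "(cmod (a m))\<^sup>2 * ((real m + \<beta>) powr (- \<sigma>))\<^sup>2 \<le>
        (cmod (a m))\<^sup>2 * ((real m + \<beta>) powr (- 2 * \<sigma>') * ((2 powr (- \<delta>)) ^ n)\<^sup>2)"
      by (rule mult_left_mono) simp
    moreover have "(cmod (c m))\<^sup>2 = (cmod (a m))\<^sup>2 * ((real m + \<beta>) powr (- \<sigma>))\<^sup>2"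
      by (simp add: c_def norm_mult power_mult_distrib)
    ultimately show ?thesis by (simp only: mult_ac)
  qed
  have W: "(\<integral>\<omega>. maximal c n (2 ^ n) \<omega> \<partial>M) \<le> (e n)\<^sup>2 * S2" for n
  proof -
    have "(\<integral>\<omega>. maximal c n (2 ^ n) \<omega> \<partial>M) \<le> (real n + 1)\<^sup>2 * (\<Sum>m=2^n..<2^n + 2 ^ n. (cmod (c m))\<^sup>2)"
      by (rule integral_maximal_le)
    also have "\<dots> \<le> (real n + 1)\<^sup>2 * (\<Sum>m=2^n..<2^n + 2 ^ n. ((2 powr (- \<delta>)) ^ n)\<^sup>2 * ((cmod (a m))\<^sup>2 * (real m + \<beta>) powr (- 2 * \<sigma>')))"
      by (intro mult_left_mono sum_mono c2) auto
    also have "\<dots> \<le> (real n + 1)\<^sup>2 * (((2 powr (- \<delta>)) ^ n)\<^sup>2 * S2)"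
      unfolding sum_distrib_left[symmetric] S2_def by (intro mult_left_mono sum_le_suminf S) auto
    finally show ?thesis by (simp add: e_def power_mult_distrib mult_ac)
  qed
  have EB: "(\<integral>\<^sup>+\<omega>. ennreal (B n \<omega>) \<partial>M) \<le> ennreal (e n * (S2 + 1))" for n
  proof -
    \<comment> \<open>The arithmetic-geometric inequality replaces Cauchy--Schwarz and needs only
      the expectation of \<open>maximal\<close>. Dividing by \<open>e n\<close> balances both parts
      to multiples of \<open>e n\<close>.\<close>
    have le: "B n \<omega> \<le> maximal c n (2 ^ n) \<omega> / e n + e n" for \<omega>
    proof -
      have "B n \<omega> * e n \<le> (B n \<omega>)\<^sup>2 + (e n)\<^sup>2"
        using sum_squares_bound[of "B n \<omega>" "e n"] mult_nonneg_nonneg[OF B0[of n \<omega>] less_imp_le[OF e0[of n]]] by linarith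
      also have "(B n \<omega>)\<^sup>2 = maximal c n (2 ^ n) \<omega>" by (simp add: B_def maximal_nonneg)
      finally show ?thesis using e0[of n] by (simp add: field_simps power2_eq_square)
    qed
    have "(\<integral>\<^sup>+\<omega>. ennreal (B n \<omega>) \<partial>M) \<le> (\<integral>\<^sup>+\<omega>. ennreal (maximal c n (2 ^ n) \<omega> / e n + e n) \<partial>M)"
      by (intro nn_integral_mono ennreal_leI le)
    also have "\<dots> = ennreal (\<integral>\<omega>. maximal c n (2 ^ n) \<omega> / e n + e n \<partial>M)"
      using e0[of n] by (intro nn_integral_eq_integral AE_I2) (auto simp: maximal_integrable maximal_nonneg)
    also have "(\<integral>\<omega>. maximal c n (2 ^ n) \<omega> / e n + e n \<partial>M) = (\<integral>\<omega>. maximal c n (2 ^ n) \<omega> \<partial>M) / e n + e n"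
      by (simp add: maximal_integrable prob_space)
    also have "\<dots> \<le> ((e n)\<^sup>2 * S2) / e n + e n" using W[of n] e0[of n] by (simp add: divide_right_mono)
    also have "\<dots> = e n * (S2 + 1)" using e0[of n] by (simp add: field_simps power2_eq_square)
    finally show ?thesis by (simp add: ennreal_leI)
  qed
  have es: "summable (\<lambda>n. e n * (S2 + 1))"
  proof (rule summable_mult2)
    define q where "q = 2 powr (- \<delta>)"
    have q: "0 < q" "q < 1" using \<delta> by (auto simp: q_def powr_less_one)
    \<comment> \<open>The series of (n + 1) q^n is the derivative of the geometric series.\<close>
    have "summable (\<lambda>n. diffs (\<lambda>_. 1) n * q ^ n)"
      by (rule termdiff_converges[of _ 1]) (use q in \<open>auto simp: summable_geometric\<close>)
    then show "summable e" by (simp add: e_def[abs_def] q_def diffs_def add.commute)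
  qed
  have "(\<integral>\<^sup>+\<omega>. (\<Sum>n. ennreal (B n \<omega>)) \<partial>M) = (\<Sum>n. \<integral>\<^sup>+\<omega>. ennreal (B n \<omega>) \<partial>M)"
    by (rule nn_integral_suminf) measurable
  also have "\<dots> \<le> (\<Sum>n. ennreal (e n * (S2 + 1)))" by (intro suminf_le EB) auto
  also have "(\<Sum>n. ennreal (e n * (S2 + 1))) = ennreal (\<Sum>n. e n * (S2 + 1))"
    by (rule suminf_ennreal2[OF _ es]) (use e0 S20 in \<open>auto intro!: mult_nonneg_nonneg less_imp_le\<close>)
  also have "\<dots> < \<infinity>" by simp
  finally have "(\<integral>\<^sup>+\<omega>. (\<Sum>n. ennreal (B n \<omega>)) \<partial>M) \<noteq> \<infinity>" by simp
  then have "AE \<omega> in M. (\<Sum>n. ennreal (B n \<omega>)) \<noteq> \<infinity>"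
    by (intro nn_integral_PInf_AE) measurable
  then show ?thesis
  proof eventually_elim
    case (elim \<omega>)
    have dev_sum: "summable (\<lambda>n. B n \<omega>)" 
      by (rule summable_suminf_not_top[OF B0 elim[unfolded infinity_ennreal_def]])
    define T where "T n = (\<Sum>m<n. c m * X m \<omega>)" for n
    have Tb: "T (2 ^ n + k) = T (2 ^ n) + block c (2 ^ n) k \<omega>" for n k
      unfolding T_def block_def by (simp add: lessThan_atLeast0 sum.atLeastLessThan_concat)
    have bB: "cmod (block c (2 ^ n) k \<omega>) \<le> B n \<omega>" if "k \<le> 2 ^ n" for n k
      unfolding B_def using block_le_maximal[OF that, of c "2 ^ n" \<omega>] by (simp add: real_le_rsqrt)
    have "summable (\<lambda>n. block c (2 ^ n) (2 ^ n) \<omega>)"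
      by (rule summable_comparison_test'[OF dev_sum, of 0]) (use bB in auto)
    \<comment> \<open>The term of index 0 lies in no dyadic block and enters as
      \<open>T 1\<close>.\<close>
    then have "convergent (\<lambda>n. T 1 + (\<Sum>i<n. block c (2 ^ i) (2 ^ i) \<omega>))"
      by (intro convergent_add convergent_const) (simp add: summable_iff_convergent)
    moreover have "T 1 + (\<Sum>i<n. block c (2 ^ i) (2 ^ i) \<omega>) = T (2 ^ n)" for n
    proof (induction n)
      case (Suc n)
      then show ?case using Tb[of n "2 ^ n"] by (simp add: add.assoc[symmetric] mult_2)
    qed simp
    ultimately obtain L where L: "(\<lambda>n. T (2 ^ n)) \<longlonglongrightarrow> L" by (auto simp: convergent_def)
    have "T \<longlonglongrightarrow> L"
    proof (rule LIMSEQ_I)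
      fix r :: real assume r: "r > 0"
      obtain n1 where n1: "\<And>n. n \<ge> n1 \<Longrightarrow> cmod (T (2 ^ n) - L) < r / 2"
        using LIMSEQ_D[OF L half_gt_zero[OF r]] by blast
      from LIMSEQ_D[OF summable_LIMSEQ_zero[OF dev_sum] half_gt_zero[OF r]]
      obtain n2 where n2': "\<forall>n\<ge>n2. norm (B n \<omega> - 0) < r / 2" ..
      have n2: "B n \<omega> < r / 2" if "n \<ge> n2" for n
        using n2'[rule_format, OF that] abs_ge_self[of "B n \<omega>"] unfolding real_norm_def diff_0_right by linarith
      show "\<exists>no. \<forall>k\<ge>no. cmod (T k - L) < r"
      proof (intro exI[of _ "2 ^ max n1 n2"] allI impI)
        fix k :: nat assume k: "2 ^ max n1 n2 \<le> k"
        then have "1 \<le> k" using order_trans[of 1 "2 ^ max n1 n2" k] by simp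
        then obtain n where n: "2 ^ n \<le> k" "k < 2 ^ (n + 1)" using ex_power_ivl1[of 2 k] by auto
        have "2 ^ max n1 n2 < (2::nat) ^ (n + 1)" using k n by linarith
        then have "max n1 n2 < n + 1" by (rule power_less_imp_less_exp[rotated]) simp
        then have nn: "n \<ge> n1" "n \<ge> n2" by auto
        have "T k = T (2 ^ n) + block c (2 ^ n) (k - 2 ^ n) \<omega>" using Tb[of n "k - 2 ^ n"] n by simp
        then have "cmod (T k - L) \<le> cmod (T (2 ^ n) - L) + cmod (block c (2 ^ n) (k - 2 ^ n) \<omega>)"
          by (metis add_diff_eq add.commute norm_triangle_ineq diff_add_eq)
        also have "\<dots> < r / 2 + r / 2"
        proof -
          have "k - 2 ^ n \<le> 2 ^ n" using n by (simp add: le_diff_conv)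
          from bB[OF this] n1[OF nn(1)] n2[OF nn(2)] show ?thesis by linarith
        qed
        finally show "cmod (T k - L) < r" by simp
      qed
    qed
    then have "convergent T" by (auto simp: convergent_def)
    then show ?case by (simp add: T_def[abs_def] c_def mult_ac)
  qed
qed

text \<open>Countably many abscissas decreasing to \<kappa> share one null set. Every compact K has
  a leftmost point and so lies strictly right of one of them, from which Abel summation carries
  convergence to K.\<close>

lemma AE_uniformly_convergent:
  assumes \<beta>: "\<beta> > 0" and S: "\<And>\<sigma>. \<sigma> > \<kappa> \<Longrightarrow> summable (\<lambda>m. (cmod (a m))\<^sup>2 * (real m + \<beta>) powr (- 2 * \<sigma>))"
  shows "AE \<omega> in M. \<forall>K. compact K \<and> K \<subseteq> {s. Re s > \<kappa>} \<longrightarrow>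
     uniformly_convergent_on K (\<lambda>n s. \<Sum>m<n. a m * X m \<omega> * dterm \<beta> m s)"
proof -
  define \<sigma> where "\<sigma> i = \<kappa> + 1 / (real i + 1)" for i :: nat
  have "AE \<omega> in M. \<forall>i. convergent (\<lambda>n. \<Sum>m<n. a m * X m \<omega> * of_real ((real m + \<beta>) powr (- \<sigma> i)))"
  proof (subst AE_all_countable, intro allI)
    fix i
    show "AE \<omega> in M. convergent (\<lambda>n. \<Sum>m<n. a m * X m \<omega> * of_real ((real m + \<beta>) powr (- \<sigma> i)))"
    proof (rule AE_convergent_point[OF \<beta> _ S])
      have "0 < 1 / (real i + 1)" by simp
      then have *: "\<kappa> < \<sigma> i" unfolding \<sigma>_def by linarith
      show "(\<kappa> + \<sigma> i) / 2 < \<sigma> i" using * by simp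
      show "\<kappa> < (\<kappa> + \<sigma> i) / 2" using * by simp
    qed
  qed
  then show ?thesis
  proof eventually_elim
    case (elim \<omega>)
    show ?case
    proof (intro allI impI)
      fix K assume K: "compact K \<and> K \<subseteq> {s. Re s > \<kappa>}"
      show "uniformly_convergent_on K (\<lambda>n s. \<Sum>m<n. a m * X m \<omega> * dterm \<beta> m s)"
      proof (cases "K = {}")
        case False
        have "continuous_on K Re" by (intro continuous_intros)
        from continuous_attains_inf[OF _ False this] K obtain s0 where s0: "s0 \<in> K" "\<And>s. s \<in> K \<Longrightarrow> Re s0 \<le> Re s" by blast
        then have "Re s0 - \<kappa> > 0" using K by auto
        from reals_Archimedean[OF this] obtain i where i: "1 / (real i + 1) < Re s0 - \<kappa>" by (auto simp: inverse_eq_divide add.commute)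
        define \<tau> where "\<tau> = complex_of_real (\<sigma> i)"
        obtain R where R: "\<And>s. s \<in> K \<Longrightarrow> cmod s \<le> R" using K compact_imp_bounded bounded_iff by metis
        have "uniformly_convergent_on K (\<lambda>n s. \<Sum>m<n. a m * X m \<omega> * of_real ((real m + \<beta>) powr (- \<sigma> i)) * dterm \<beta> m (s - \<tau>))"
        proof (rule abel_uniformly_convergent[OF \<beta>])
          show "convergent (\<lambda>n. \<Sum>m<n. a m * X m \<omega> * of_real ((real m + \<beta>) powr (- \<sigma> i)))" using elim by blast
          show "Re s0 - \<sigma> i > 0" using i by (simp add: \<sigma>_def)
          fix s assume s: "s \<in> K"
          show "Re s0 - \<sigma> i \<le> Re (s - \<tau>)" using s0(2)[OF s] by (simp add: \<tau>_def)
          show "cmod (s - \<tau>) \<le> R + cmod \<tau>" using R[OF s] norm_triangle_ineq4[of s \<tau>] by linarith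
        qed
        moreover have "complex_of_real ((real m + \<beta>) powr (- \<sigma> i)) * dterm \<beta> m (s - \<tau>) = dterm \<beta> m s" for m s
        proof -
          have "complex_of_real ((real m + \<beta>) powr (- \<sigma> i)) = dterm \<beta> m \<tau>"
            using dterm_Complex[OF \<beta>, of m "\<sigma> i" 0] by (simp add: \<tau>_def Complex_eq)
          then show ?thesis using dterm_add[OF \<beta>, of m \<tau> "s - \<tau>"] by simp
        qed
        ultimately show ?thesis by (simp add: mult.assoc)
      qed (auto simp: uniformly_convergent_on_def)
    qed
  qed
qed

end

section \<open>Characters and Weyl's criterion on the torus\<close>

lemma euclidean_product_eq: "product_topology (\<lambda>i. euclidean) UNIV = (euclidean :: ('i \<Rightarrow> 'a::topological_space) topology)"
  by (simp add: euclidean_product_topology)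

text \<open>Tychonoff. Functions that are \<open>undefined\<close> off I form a product over all
  indices whose factors off I are singletons.\<close>

lemma compact_PiE_euclidean:
  fixes S :: "'i \<Rightarrow> 'a::topological_space set"
  assumes "\<And>i. i \<in> I \<Longrightarrow> compact (S i)"
  shows "compact (PiE I S)"
proof -
  have eq: "PiE I S = PiE UNIV (\<lambda>i. if i \<in> I then S i else {undefined})"
    by (auto simp: PiE_def Pi_def extensional_def split: if_splits)
  have "compactin (product_topology (\<lambda>i. euclidean) UNIV) (PiE UNIV (\<lambda>i. if i \<in> I then S i else {undefined}))"
    unfolding compactin_PiE using assms by auto
  then show ?thesis by (simp only: eq euclidean_product_eq compactin_euclidean_iff)
qed

section \<open>Coordinates, characters and their integrals\<close>

type_synonym torus_pt = "(nat \<Rightarrow> complex) \<times> (nat \<Rightarrow> nat \<Rightarrow> complex)"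

text \<open>The index of pi is no coordinate of the torus and gets the neutral value 1; in the
  independence hypothesis it accounts for full turns.\<close>

fun coord :: "L_index \<Rightarrow> torus_pt \<Rightarrow> complex" where
  "coord (Ind_Prime p) \<omega> = fst \<omega> p"
| "coord (Ind_Hurwitz j m) \<omega> = snd \<omega> j m"
| "coord Ind_Pi \<omega> = 1"

abbreviation torus :: "nat \<Rightarrow> torus_pt set" where "torus r \<equiv> space (torus_haar r)"

lemma torus_eq: "torus r = PiE {p. prime p} (\<lambda>_. sphere 0 1) \<times> PiE {1..r} (\<lambda>_. PiE UNIV (\<lambda>_. sphere 0 1))"
  by (simp add: torus_haar_def space_pair_measure space_PiM)

lemma compact_torus: "compact (torus r)"
  unfolding torus_eq by (intro compact_Times compact_PiE_euclidean) auto

definition torus_indices :: "nat \<Rightarrow> L_index set" where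
  "torus_indices r = L_indices r - {Ind_Pi}"

lemma coord_norm: "\<omega> \<in> torus r \<Longrightarrow> i \<in> torus_indices r \<Longrightarrow> cmod (coord i \<omega>) = 1"
  by (cases i) (auto simp: torus_eq torus_indices_def L_indices_def PiE_iff mem_Times_iff)

lemma coord_nonzero: "\<omega> \<in> torus r \<Longrightarrow> i \<in> torus_indices r \<Longrightarrow> coord i \<omega> \<noteq> 0"
  using coord_norm by fastforce

lemma torus_eqI:
  assumes "\<omega> \<in> torus r" "\<omega>' \<in> torus r" "\<And>i. i \<in> torus_indices r \<Longrightarrow> coord i \<omega> = coord i \<omega>'"
  shows "\<omega> = \<omega>'"
proof -
  have 1: "fst \<omega> p = fst \<omega>' p" if "prime p" for p
  proof -
    have "Ind_Prime p \<in> torus_indices r" using that by (auto simp: torus_indices_def L_indices_def)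
    from assms(3)[OF this] show ?thesis by simp
  qed
  have 2: "snd \<omega> j m = snd \<omega>' j m" if "j \<in> {1..r}" for j m
  proof -
    have "Ind_Hurwitz j m \<in> torus_indices r" unfolding torus_indices_def L_indices_def
      using UN_I[of j "{1..r}" "Ind_Hurwitz j m" "\<lambda>j. range (Ind_Hurwitz j)"] that by blast
    from assms(3)[OF this] show ?thesis by simp
  qed
  have "fst \<omega> = fst \<omega>'"
    by (rule PiE_ext[of _ "{p. prime p}" "\<lambda>_. sphere 0 1"]) (use assms(1,2) 1 in \<open>auto simp: torus_eq mem_Times_iff\<close>)
  moreover have "snd \<omega> = snd \<omega>'"
    by (rule PiE_ext[of _ "{1..r}" "\<lambda>_. PiE UNIV (\<lambda>_. sphere 0 1)"]) (use assms(1,2) 2 in \<open>auto simp: torus_eq mem_Times_iff fun_eq_iff\<close>)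
  ultimately show ?thesis by (simp add: prod_eq_iff)
qed

lemma continuous_on_coord [continuous_intros]: "continuous_on A (coord i)"
proof (cases i)
  case (Ind_Prime p)
  have "continuous_on A (\<lambda>\<omega>. fst \<omega> p)"
    by (rule continuous_on_product_then_coordinatewise[where f = fst]) (intro continuous_intros)
  moreover have "coord i = (\<lambda>\<omega>. fst \<omega> p)" using Ind_Prime by (simp add: fun_eq_iff)
  ultimately show ?thesis by simp
next
  case (Ind_Hurwitz j m)
  have "continuous_on A (\<lambda>\<omega>. snd \<omega> j)"
    by (rule continuous_on_product_then_coordinatewise[where f = snd]) (intro continuous_intros)
  then have "continuous_on A (\<lambda>\<omega>. snd \<omega> j m)"
    by (rule continuous_on_product_then_coordinatewise[where f = "\<lambda>\<omega>. snd \<omega> j"])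
  moreover have "coord i = (\<lambda>\<omega>. snd \<omega> j m)" using Ind_Hurwitz by (simp add: fun_eq_iff)
  ultimately show ?thesis by simp
next
  case Ind_Pi
  then have "coord i = (\<lambda>\<omega>. 1)" by (simp add: fun_eq_iff)
  then show ?thesis by simp
qed

lemma measurable_circle_borel: "(\<lambda>x. x) \<in> circle_measure \<rightarrow>\<^sub>M borel"
  using measurable_restrict_space1[of "\<lambda>x::complex. x" borel borel "sphere 0 1"]
  by (simp cong: measurable_cong_sets add: sets_circle_measure)

lemma measurable_fst_coord: "prime p \<Longrightarrow> (\<lambda>\<omega>. fst \<omega> p) \<in> torus_haar r \<rightarrow>\<^sub>M circle_measure"
  unfolding torus_haar_def
  by (rule measurable_compose[OF measurable_fst measurable_component_singleton]) simp

lemma measurable_snd_coord: "j \<in> {1..r} \<Longrightarrow> (\<lambda>\<omega>. snd \<omega> j m) \<in> torus_haar r \<rightarrow>\<^sub>M circle_measure"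
proof -
  assume "j \<in> {1..r}"
  then have "(\<lambda>\<omega>. snd \<omega> j) \<in> torus_haar r \<rightarrow>\<^sub>M (\<Pi>\<^sub>M m\<in>UNIV. circle_measure)"
    unfolding torus_haar_def by (rule measurable_compose[OF measurable_snd measurable_component_singleton])
  from measurable_compose[OF this measurable_component_singleton[OF UNIV_I]] show ?thesis .
qed

lemma measurable_coord:
  assumes "i \<in> torus_indices r"
  shows "coord i \<in> borel_measurable (torus_haar r)"
proof (cases i)
  case (Ind_Prime p)
  then have "prime p" using assms by (auto simp: torus_indices_def L_indices_def)
  then have "(\<lambda>\<omega>. fst \<omega> p) \<in> borel_measurable (torus_haar r)"
    by (rule measurable_compose[OF measurable_fst_coord measurable_circle_borel])
  moreover have "coord i = (\<lambda>\<omega>. fst \<omega> p)" using Ind_Prime by (simp add: fun_eq_iff)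
  ultimately show ?thesis by simp
next
  case (Ind_Hurwitz j m)
  then have "j \<in> {1..r}" using assms by (auto simp: torus_indices_def L_indices_def)
  then have "(\<lambda>\<omega>. snd \<omega> j m) \<in> borel_measurable (torus_haar r)"
    by (rule measurable_compose[OF measurable_snd_coord measurable_circle_borel])
  moreover have "coord i = (\<lambda>\<omega>. snd \<omega> j m)" using Ind_Hurwitz by (simp add: fun_eq_iff)
  ultimately show ?thesis by simp
qed (use assms in \<open>simp add: torus_indices_def\<close>)

text \<open>Meaningful for \<open>n\<close> of finite support only; otherwise the product is \<open>1\<close>.\<close>

definition torus_char :: "(L_index \<Rightarrow> int) \<Rightarrow> torus_pt \<Rightarrow> complex" where
  "torus_char n \<omega> = (\<Prod>i\<in>{i. n i \<noteq> 0}. coord i \<omega> powi n i)"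

definition exponents :: "nat \<Rightarrow> (L_index \<Rightarrow> int) set" where
  "exponents r = {n. finite {i. n i \<noteq> 0} \<and> {i. n i \<noteq> 0} \<subseteq> torus_indices r}"

lemma torus_char_eq_prod:
  assumes "finite J" "{i. n i \<noteq> 0} \<subseteq> J"
  shows "torus_char n \<omega> = (\<Prod>i\<in>J. coord i \<omega> powi n i)"
  unfolding torus_char_def by (rule prod.mono_neutral_left) (use assms in auto)

lemma exponents_add: "n \<in> exponents r \<Longrightarrow> n' \<in> exponents r \<Longrightarrow> (\<lambda>i. n i + n' i) \<in> exponents r"
proof -
  assume a: "n \<in> exponents r" "n' \<in> exponents r"
  have "{i. n i + n' i \<noteq> 0} \<subseteq> {i. n i \<noteq> 0} \<union> {i. n' i \<noteq> 0}" by auto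
  then show ?thesis using a unfolding exponents_def by (auto dest: finite_subset)
qed

lemma torus_char_add:
  assumes "n \<in> exponents r" "n' \<in> exponents r" "\<omega> \<in> torus r"
  shows "torus_char (\<lambda>i. n i + n' i) \<omega> = torus_char n \<omega> * torus_char n' \<omega>"
proof -
  define J where "J = {i. n i \<noteq> 0} \<union> {i. n' i \<noteq> 0}"
  have J: "finite J" "J \<subseteq> torus_indices r" using assms by (auto simp: J_def exponents_def)
  have "torus_char (\<lambda>i. n i + n' i) \<omega> = (\<Prod>i\<in>J. coord i \<omega> powi (n i + n' i))"
    by (rule torus_char_eq_prod) (use J in \<open>auto simp: J_def\<close>)
  also have "\<dots> = (\<Prod>i\<in>J. coord i \<omega> powi n i * coord i \<omega> powi n' i)"
    by (intro prod.cong refl power_int_add) (use J coord_nonzero[OF assms(3)] in auto)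
  also have "\<dots> = torus_char n \<omega> * torus_char n' \<omega>"
    unfolding prod.distrib using torus_char_eq_prod[OF J(1), of n \<omega>] torus_char_eq_prod[OF J(1), of n' \<omega>] by (simp add: J_def)
  finally show ?thesis .
qed

lemma torus_char_norm: "n \<in> exponents r \<Longrightarrow> \<omega> \<in> torus r \<Longrightarrow> cmod (torus_char n \<omega>) = 1"
  unfolding torus_char_def prod_norm[symmetric]
  by (rule prod.neutral) (auto simp: norm_power_int exponents_def dest: coord_norm)

lemma torus_char_uminus: "n \<in> exponents r \<Longrightarrow> \<omega> \<in> torus r \<Longrightarrow> torus_char (\<lambda>i. - n i) \<omega> = cnj (torus_char n \<omega>)"
proof -
  assume a: "n \<in> exponents r" "\<omega> \<in> torus r"
  have "coord i \<omega> powi (- n i) = cnj (coord i \<omega> powi n i)" if "n i \<noteq> 0" for i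
  proof -
    have "cmod (coord i \<omega> powi n i) = 1"
      using a that coord_norm[of \<omega> r i] by (auto simp: norm_power_int exponents_def)
    then have "inverse (coord i \<omega> powi n i) = cnj (coord i \<omega> powi n i)"
      by (metis complex_norm_square divide_inverse inverse_unique mult.right_neutral mult_1 of_real_1 one_power2)
    then show ?thesis by (simp add: power_int_minus)
  qed
  then show ?thesis unfolding torus_char_def by simp
qed

lemma measurable_char: "n \<in> exponents r \<Longrightarrow> torus_char n \<in> borel_measurable (torus_haar r)"
proof -
  assume n: "n \<in> exponents r"
  have pw: "(\<lambda>\<omega>. coord i \<omega> powi k) \<in> borel_measurable (torus_haar r)" if "i \<in> torus_indices r" for i k
    unfolding power_int_def using measurable_coord[OF that] by (cases "k \<ge> 0") auto
  show ?thesis unfolding torus_char_def[abs_def] using n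
    by (intro borel_measurable_prod pw) (auto simp: exponents_def)
qed

lemma continuous_on_char:
  assumes "n \<in> exponents r"
  shows "continuous_on (torus r) (torus_char n)"
proof -
  have "continuous_on (torus r) (\<lambda>\<omega>. coord i \<omega> powi k)" if "i \<in> torus_indices r" for i k
    using coord_nonzero that by (intro continuous_on_power_int continuous_on_coord) auto
  then show ?thesis unfolding torus_char_def[abs_def] using assms by (intro continuous_on_prod) (auto simp: exponents_def)
qed

lemma integrable_char: "n \<in> exponents r \<Longrightarrow> integrable (torus_haar r) (torus_char n)"
proof -
  assume n: "n \<in> exponents r"
  interpret prob_space "torus_haar r" by (rule prob_space_torus_haar)
  show ?thesis
    by (rule integrable_const_bound[of _ 1]) (auto intro!: AE_I2 measurable_char n simp: torus_char_norm[OF n])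
qed

lemma coord_torus_mult: "i \<in> torus_indices r \<Longrightarrow> coord i (torus_mult r a \<omega>) = coord i a * coord i \<omega>"
  by (cases i) (auto simp: torus_mult_def torus_indices_def L_indices_def)

lemma torus_char_torus_mult: "n \<in> exponents r \<Longrightarrow> torus_char n (torus_mult r a \<omega>) = torus_char n a * torus_char n \<omega>"
  unfolding torus_char_def prod.distrib[symmetric]
  by (intro prod.cong refl) (auto simp: exponents_def coord_torus_mult power_int_mult_distrib)

lemma measurable_torus_mult:
  assumes a: "a \<in> torus r"
  shows "torus_mult r a \<in> torus_haar r \<rightarrow>\<^sub>M torus_haar r"
proof -
  have 1: "(\<lambda>\<omega>. \<lambda>p\<in>{p. prime p}. fst a p * fst \<omega> p) \<in> torus_haar r \<rightarrow>\<^sub>M (\<Pi>\<^sub>M p\<in>{p. prime p}. circle_measure)"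
  proof (rule measurable_restrict)
    fix p :: nat assume p: "p \<in> {p. prime p}"
    have "fst a p \<in> sphere 0 1" using a p by (auto simp: torus_eq)
    from measurable_compose[OF measurable_fst_coord measurable_circle_mult[OF this]] p
    show "(\<lambda>\<omega>. fst a p * fst \<omega> p) \<in> torus_haar r \<rightarrow>\<^sub>M circle_measure" by simp
  qed
  have 2: "(\<lambda>\<omega>. \<lambda>j\<in>{1..r}. \<lambda>m\<in>UNIV. snd a j m * snd \<omega> j m) \<in> torus_haar r \<rightarrow>\<^sub>M (\<Pi>\<^sub>M j\<in>{1..r}. \<Pi>\<^sub>M m\<in>UNIV. circle_measure)"
  proof (intro measurable_restrict)
    fix j m assume j: "j \<in> {1..r}"
    have "snd a j m \<in> sphere 0 1" using a j by (auto simp: torus_eq PiE_iff)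
    from measurable_compose[OF measurable_snd_coord[OF j] measurable_circle_mult[OF this]]
    show "(\<lambda>\<omega>. snd a j m * snd \<omega> j m) \<in> torus_haar r \<rightarrow>\<^sub>M circle_measure" .
  qed
  have "(\<lambda>\<omega>. (\<lambda>p\<in>{p. prime p}. fst a p * fst \<omega> p, \<lambda>j\<in>{1..r}. \<lambda>m\<in>UNIV. snd a j m * snd \<omega> j m)) \<in> torus_haar r \<rightarrow>\<^sub>M
     ((\<Pi>\<^sub>M p\<in>{p. prime p}. circle_measure) \<Otimes>\<^sub>M (\<Pi>\<^sub>M j\<in>{1..r}. \<Pi>\<^sub>M m\<in>UNIV. circle_measure))"
    by (rule measurable_Pair[OF 1 2])
  moreover have "(\<lambda>\<omega>. (\<lambda>p\<in>{p. prime p}. fst a p * fst \<omega> p, \<lambda>j\<in>{1..r}. \<lambda>m\<in>UNIV. snd a j m * snd \<omega> j m)) = torus_mult r a"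
    by (simp add: torus_mult_def fun_eq_iff)
  ultimately show ?thesis by (simp only: torus_haar_def)
qed

text \<open>Translation by a point where the character equals -1 preserves the Haar measure and
  changes the sign of the integral.\<close>

lemma integral_char:
  assumes n: "n \<in> exponents r" and i: "n i \<noteq> 0"
  shows "(\<integral>\<omega>. torus_char n \<omega> \<partial>torus_haar r) = 0"
proof -
  \<comment> \<open>One coordinate turned by pi / n i; its n i-th power is -1 for either sign of n
    i.\<close>
  define v where "v k = (if k = i then cis (pi / n i) else 1)" for k
  define a :: torus_pt where "a = ((\<lambda>p\<in>{p. prime p}. v (Ind_Prime p)), (\<lambda>j\<in>{1..r}. \<lambda>m. v (Ind_Hurwitz j m)))"
  have vn: "cmod (v k) = 1" for k by (simp add: v_def)
  have a: "a \<in> torus r" by (auto simp: a_def torus_eq vn)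
  have ca: "coord k a = v k" if "k \<in> torus_indices r" for k
    using that by (cases k) (auto simp: a_def torus_indices_def L_indices_def)
  have "torus_char n a = (\<Prod>k\<in>{k. n k \<noteq> 0}. if k = i then cis (pi / n i) powi n i else 1)"
    unfolding torus_char_def by (intro prod.cong refl) (use n in \<open>auto simp: ca v_def exponents_def\<close>)
  also have "\<dots> = cis (pi / n i) powi n i" using n i by (simp add: exponents_def)
  also have "\<dots> = -1" using i by (simp add: cis_power_int)
  finally have ch: "torus_char n a = -1" .
  have mm: "torus_mult r a \<in> torus_haar r \<rightarrow>\<^sub>M torus_haar r" by (rule measurable_torus_mult[OF a])
  have "(\<integral>\<omega>. torus_char n \<omega> \<partial>torus_haar r) = (\<integral>\<omega>. torus_char n \<omega> \<partial>distr (torus_haar r) (torus_haar r) (torus_mult r a))"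
    by (simp add: torus_haar_invariant[OF a])
  also have "\<dots> = (\<integral>\<omega>. torus_char n (torus_mult r a \<omega>) \<partial>torus_haar r)"
    by (rule integral_distr[OF mm measurable_char[OF n]])
  also have "\<dots> = - (\<integral>\<omega>. torus_char n \<omega> \<partial>torus_haar r)"
    by (simp add: torus_char_torus_mult[OF n] ch)
  finally show ?thesis by simp
qed

lemma torus_char_zero: "(\<forall>i. n i = 0) \<Longrightarrow> torus_char n \<omega> = 1"
  by (simp add: torus_char_def)

text \<open>Trigonometric polynomials. Equalities are asked for on the torus only, since the
  functions are arbitrary elsewhere and characters multiply as expected only where coordinates are
  nonzero.\<close>

inductive trig :: "nat \<Rightarrow> (torus_pt \<Rightarrow> complex) \<Rightarrow> bool" for r where
  trig_char: "n \<in> exponents r \<Longrightarrow> (\<And>\<omega>. \<omega> \<in> torus r \<Longrightarrow> f \<omega> = c * torus_char n \<omega>) \<Longrightarrow> trig r f"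
| trig_add: "trig r f \<Longrightarrow> trig r g \<Longrightarrow> (\<And>\<omega>. \<omega> \<in> torus r \<Longrightarrow> h \<omega> = f \<omega> + g \<omega>) \<Longrightarrow> trig r h"

lemma trig_mult_char:
  assumes "trig r g" "n \<in> exponents r"
  shows "(\<And>\<omega>. \<omega> \<in> torus r \<Longrightarrow> h \<omega> = c * torus_char n \<omega> * g \<omega>) \<Longrightarrow> trig r h"
  using assms(1)
proof (induction arbitrary: h rule: trig.induct)
  case (trig_char n' f c')
  show ?case
    by (rule trig.trig_char[OF exponents_add[OF assms(2) trig_char(1)], where c = "c * c'"])
       (simp add: trig_char torus_char_add[OF assms(2) trig_char(1)])
next
  case (trig_add f g h')
  have "trig r (\<lambda>\<omega>. c * torus_char n \<omega> * f \<omega>)" "trig r (\<lambda>\<omega>. c * torus_char n \<omega> * g \<omega>)" using trig_add by auto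
  then show ?case by (rule trig.trig_add) (simp add: trig_add algebra_simps)
qed

lemma trig_mult:
  assumes "trig r f" "trig r g"
  shows "(\<And>\<omega>. \<omega> \<in> torus r \<Longrightarrow> h \<omega> = f \<omega> * g \<omega>) \<Longrightarrow> trig r h"
  using assms(1)
proof (induction arbitrary: h rule: trig.induct)
  case (trig_char n f c)
  show ?case by (rule trig_mult_char[OF assms(2) trig_char(1), where c = c]) (simp add: trig_char)
next
  case (trig_add f f' h')
  have "trig r (\<lambda>\<omega>. f \<omega> * g \<omega>)" "trig r (\<lambda>\<omega>. f' \<omega> * g \<omega>)" using trig_add by auto
  then show ?case by (rule trig.trig_add) (simp add: trig_add algebra_simps)
qed

lemma trig_continuous: "trig r f \<Longrightarrow> continuous_on (torus r) f"
proof (induction rule: trig.induct)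
  case (trig_char n f c)
  have "continuous_on (torus r) (\<lambda>\<omega>. c * torus_char n \<omega>)" by (intro continuous_intros continuous_on_char trig_char)
  then show ?case using trig_char by (simp cong: continuous_on_cong)
next
  case (trig_add f g h)
  have "continuous_on (torus r) (\<lambda>\<omega>. f \<omega> + g \<omega>)" by (intro continuous_intros trig_add)
  then show ?case using trig_add by (simp cong: continuous_on_cong)
qed

lemma exponents_zero: "(\<lambda>i. 0) \<in> exponents r" by (simp add: exponents_def)

lemma exponents_single: "i \<in> torus_indices r \<Longrightarrow> (\<lambda>k. if k = i then e else 0) \<in> exponents r"
  by (auto simp: exponents_def)

lemma torus_char_single: "torus_char (\<lambda>k. if k = i then e else 0) \<omega> = coord i \<omega> powi e"
  by (subst torus_char_eq_prod[of "{i}"]) auto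

text \<open>Stone--Weierstrass for the real algebra of those real functions that are trigonometric
  polynomials over the complex numbers. Points are separated by real and imaginary parts of
  coordinates.\<close>

lemma trig_dense:
  assumes f: "continuous_on (torus r) f" and e: "e > 0"
  shows "\<exists>g. trig r (\<lambda>\<omega>. complex_of_real (g \<omega>)) \<and> (\<forall>\<omega>\<in>torus r. \<bar>f \<omega> - g \<omega>\<bar> < e)"
proof -
  define R where "R = {g. trig r (\<lambda>\<omega>. complex_of_real (g \<omega>))}"
  interpret function_ring_on R "torus r"
  proof
    show "compact (torus r)" by (rule compact_torus)
    fix f g assume f: "f \<in> R"
    then have "continuous_on (torus r) (\<lambda>\<omega>. Re (complex_of_real (f \<omega>)))"
      unfolding R_def by (intro continuous_intros trig_continuous) auto
    then show "continuous_on (torus r) f" by simp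
    assume g: "g \<in> R"
    show "(\<lambda>x. f x + g x) \<in> R" using f g unfolding R_def by (auto intro: trig_add)
    show "(\<lambda>x. f x * g x) \<in> R" using f g unfolding R_def by (auto intro: trig_mult)
  next
    fix c :: real
    show "(\<lambda>_. c) \<in> R" unfolding R_def
      by (auto intro!: trig_char[OF exponents_zero, where c = "complex_of_real c"] simp: torus_char_zero)
  next
    fix x y assume xy: "x \<in> torus r" "y \<in> torus r" "x \<noteq> y"
    then obtain i where i: "i \<in> torus_indices r" "coord i x \<noteq> coord i y" using torus_eqI by blast
    have tp: "trig r (\<lambda>\<omega>. c * coord i \<omega>)" for c
      by (rule trig_char[OF exponents_single[OF i(1), of 1], where c = c]) (simp add: torus_char_single)
    \<comment> \<open>On the circle the conjugate of a coordinate is its inverse, hence the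
      character with exponent -1; combined with the coordinate itself it yields real and imaginary
      parts.\<close>
    have tm: "trig r (\<lambda>\<omega>. c * cnj (coord i \<omega>))" for c
      by (rule trig_char[OF exponents_single[OF i(1), of "-1"], where c = c])
         (use torus_char_uminus[OF exponents_single[OF i(1), of 1]] in \<open>simp add: torus_char_single if_distrib cong: if_cong\<close>)
    have re: "(\<lambda>\<omega>. Re (coord i \<omega>)) \<in> R" unfolding R_def
      by (rule CollectI, rule trig_add[OF tp[of "1/2"] tm[of "1/2"]]) (simp add: complex_eq_iff)
    have im: "(\<lambda>\<omega>. Im (coord i \<omega>)) \<in> R" unfolding R_def
      by (rule CollectI, rule trig_add[OF tp[of "-\<i>/2"] tm[of "\<i>/2"]]) (simp add: complex_eq_iff)
    have "Re (coord i x) \<noteq> Re (coord i y) \<or> Im (coord i x) \<noteq> Im (coord i y)"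
      using i(2) by (simp add: complex_eq_iff)
    then show "\<exists>f\<in>R. f x \<noteq> f y"
      by (elim disjE) (rule bexI[OF _ re], assumption, rule bexI[OF _ im], assumption)
  qed
  from Stone_Weierstrass_basic[OF f e] show ?thesis unfolding R_def by blast
qed

text \<open>The minus sign matches (m + \<alpha>)^(-i k h): the k-th point carries the values by
  which the shift by i k h rotates the coefficients.\<close>

definition orbit :: "nat \<Rightarrow> real \<Rightarrow> (nat \<Rightarrow> real) \<Rightarrow> (nat \<Rightarrow> real) \<Rightarrow> nat \<Rightarrow> torus_pt" where
  "orbit r h1 h2 \<alpha> k = ((\<lambda>p\<in>{p. prime p}. cis (- (real k * L_elem h1 h2 \<alpha> (Ind_Prime p)))),
     (\<lambda>j\<in>{1..r}. \<lambda>m. cis (- (real k * L_elem h1 h2 \<alpha> (Ind_Hurwitz j m)))))"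

lemma orbit_torus: "orbit r h1 h2 \<alpha> k \<in> torus r"
  by (auto simp: orbit_def torus_eq)

lemma coord_orbit: "i \<in> torus_indices r \<Longrightarrow> coord i (orbit r h1 h2 \<alpha> k) = cis (- (real k * L_elem h1 h2 \<alpha> i))"
  by (cases i) (auto simp: orbit_def torus_indices_def L_indices_def)

text \<open>Independence is given for the set of values, while relations are indexed by the family.
  Injectivity of the family translates one into the other.\<close>

lemma rat_independent_familyD:
  fixes q :: "'i \<Rightarrow> int"
  assumes ind: "rat_independent_family x I" and J: "finite J" "J \<subseteq> I" and 0: "(\<Sum>i\<in>J. of_int (q i) * x i) = 0" and i: "i \<in> J"
  shows "q i = 0"
proof -
  interpret rat: vector_space "\<lambda>(q::rat) (y::real). of_rat q * y"
    by unfold_locales (auto simp: algebra_simps of_rat_add of_rat_mult)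
  have inj: "inj_on x J" using ind J inj_on_subset unfolding rat_independent_family_def by blast
  have "rat.independent (x ` I)" using ind by (simp add: rat_independent_family_def)
  then have *: "\<And>t u v. finite t \<Longrightarrow> t \<subseteq> x ` I \<Longrightarrow> (\<Sum>v\<in>t. of_rat (u v) * v) = 0 \<Longrightarrow> v \<in> t \<Longrightarrow> u v = 0"
    unfolding rat.independent_explicit_module by blast
  define u where "u v = rat_of_int (q (the_inv_into J x v))" for v
  have ux: "u (x k) = of_int (q k)" if "k \<in> J" for k using that inj by (simp add: u_def the_inv_into_f_f)
  have "(\<Sum>v\<in>x ` J. of_rat (u v) * v) = (\<Sum>k\<in>J. of_int (q k) * x k)"
    unfolding sum.reindex[OF inj] by (intro sum.cong) (auto simp: ux)
  then have "u (x i) = 0" using *[of "x ` J" u "x i"] J 0 i by auto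
  then show ?thesis using ux[OF i] by simp
qed

lemma cesaro_unit_power:
  assumes z: "cmod z = 1" "z \<noteq> 1"
  shows "(\<lambda>N. (\<Sum>k=0..N. z ^ k) / of_nat (N + 1)) \<longlonglongrightarrow> 0"
proof (rule Lim_null_comparison)
  show "\<forall>\<^sub>F N in sequentially. cmod ((\<Sum>k=0..N. z ^ k) / of_nat (N + 1)) \<le> 2 / cmod (1 - z) / real (N + 1)"
  proof (intro always_eventually allI)
    fix N
    have "(\<Sum>k=0..N. z ^ k) = (1 - z ^ Suc N) / (1 - z)"
      using z sum_gp0[of z N] by (simp add: atLeast0AtMost)
    also have "cmod \<dots> \<le> 2 / cmod (1 - z)"
      unfolding norm_divide using norm_triangle_ineq4[of 1 "z ^ Suc N"] z
      by (intro divide_right_mono) (auto simp: norm_power norm_mult)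
    finally show "cmod ((\<Sum>k=0..N. z ^ k) / of_nat (N + 1)) \<le> 2 / cmod (1 - z) / real (N + 1)"
      unfolding norm_divide norm_of_nat by (intro divide_right_mono) auto
  qed
  show "(\<lambda>N. 2 / cmod (1 - z) / real (N + 1)) \<longlonglongrightarrow> 0"
    by real_asymp
qed

text \<open>Along the orbit a character is a geometric sequence z^k, and for a nontrivial character
  the averages tend to 0 once z \<noteq> 1. If z were 1, the frequency would be an integer multiple
  of 2 pi, which is a rational relation in the independent family.\<close>

lemma cesaro_char:
  assumes ind: "rat_independent_family (L_elem h1 h2 \<alpha>) (L_indices r)" and n: "n \<in> exponents r"
  shows "(\<lambda>N. (\<Sum>k=0..N. torus_char n (orbit r h1 h2 \<alpha> k)) / of_nat (N + 1)) \<longlonglongrightarrow> (\<integral>\<omega>. torus_char n \<omega> \<partial>torus_haar r)"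
proof (cases "\<forall>i. n i = 0")
  case True
  interpret prob_space "torus_haar r" by (rule prob_space_torus_haar)
  have eq1: "(\<Sum>k=0..N. 1) / (1 + complex_of_nat N) = 1" for N
    by (simp add: divide_eq_1_iff) (metis of_nat_Suc of_nat_neq_0)
  show ?thesis using True eq1 by (simp add: torus_char_zero prob_space)
next
  case False
  then obtain i where i: "n i \<noteq> 0" by blast
  define J where "J = {i. n i \<noteq> 0}"
  have J: "finite J" "J \<subseteq> torus_indices r" "i \<in> J" using n i by (auto simp: J_def exponents_def)
  define x where "x = (\<Sum>k\<in>J. of_int (n k) * L_elem h1 h2 \<alpha> k)"
  define z where "z = cis (- x)"
  have ch: "torus_char n (orbit r h1 h2 \<alpha> k) = z ^ k" for k
  proof -
    have "torus_char n (orbit r h1 h2 \<alpha> k) = (\<Prod>i\<in>J. cis (of_int (n i) * (- (real k * L_elem h1 h2 \<alpha> i))))"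
      unfolding torus_char_def J_def[symmetric] using J by (intro prod.cong refl) (auto simp: coord_orbit cis_power_int)
    also have "\<dots> = cis (\<Sum>i\<in>J. of_int (n i) * (- (real k * L_elem h1 h2 \<alpha> i)))"
      unfolding cis_conv_exp exp_sum[OF J(1), symmetric] of_real_sum sum_distrib_left by simp
    also have "(\<Sum>i\<in>J. of_int (n i) * (- (real k * L_elem h1 h2 \<alpha> i))) = real k * (- x)"
      unfolding x_def sum_distrib_left sum_negf[symmetric] by (intro sum.cong) (auto simp: mult_ac)
    also have "cis (real k * (- x)) = z ^ k" unfolding z_def by (rule Complex.DeMoivre[symmetric])
    finally show ?thesis .
  qed
  have "z \<noteq> 1"
  proof
    assume "z = 1"
    then have "cos (- x) = 1" by (metis z_def cis.simps(1) one_complex.simps(1))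
    then obtain m :: int where m: "- x = of_int m * 2 * pi" using cos_one_2pi_int[of "- x"] by (auto simp: mult_ac)
    \<comment> \<open>The relation is extended by the coefficient 2 m at the index of pi, which lies
      outside \<open>J\<close> because characters involve genuine coordinates only.\<close>
    define q where "q k = (if k = Ind_Pi then 2 * m else n k)" for k
    have pi: "Ind_Pi \<notin> J" using J by (auto simp: torus_indices_def)
    have "(\<Sum>k\<in>insert Ind_Pi J. of_int (q k) * L_elem h1 h2 \<alpha> k) = of_int (2 * m) * pi + x"
      using J(1) pi unfolding x_def by (auto simp: q_def intro!: sum.cong)
    also have "\<dots> = 0" using m by simp
    finally have s0: "(\<Sum>k\<in>insert Ind_Pi J. of_int (q k) * L_elem h1 h2 \<alpha> k) = 0" .
    have "q i = 0"
      by (rule rat_independent_familyD[OF ind _ _ s0]) (use J in \<open>auto simp: torus_indices_def L_indices_def\<close>)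
    then show False using i pi J(3) by (auto simp: q_def split: if_splits)
  qed
  then show ?thesis using cesaro_unit_power[of z] integral_char[OF n i] by (simp add: ch z_def)
qed

text \<open>Weyl's criterion. Measurability is obtained along the way: a continuous function is a
  limit of trigonometric polynomials, which are measurable for the product sigma-algebra, so this
  algebra need not be compared with the Borel sets of the topology.\<close>

theorem equidistribution:
  assumes ind: "rat_independent_family (L_elem h1 h2 \<alpha>) (L_indices r)"
    and f: "continuous_on (torus r) f"
  shows "f \<in> borel_measurable (torus_haar r)"
    and "(\<lambda>N. (\<Sum>k=0..N. f (orbit r h1 h2 \<alpha> k)) / real (N + 1)) \<longlonglongrightarrow> (\<integral>\<omega>. f \<omega> \<partial>torus_haar r)"
proof -
  interpret prob_space "torus_haar r" by (rule prob_space_torus_haar)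
  have trig_m: "g \<in> borel_measurable (torus_haar r)" if "trig r g" for g
    using that
  proof (induction rule: trig.induct)
    case (trig_char n f c)
    have "(\<lambda>\<omega>. c * torus_char n \<omega>) \<in> borel_measurable (torus_haar r)" using measurable_char[OF trig_char(1)] by measurable
    then show ?case using trig_char by (simp cong: measurable_cong)
  next
    case (trig_add f g h)
    have "(\<lambda>\<omega>. f \<omega> + g \<omega>) \<in> borel_measurable (torus_haar r)" using trig_add by measurable
    then show ?case using trig_add by (simp cong: measurable_cong)
  qed
  have trig_lim: "integrable (torus_haar r) g \<and> (\<lambda>N. (\<Sum>k=0..N. g (orbit r h1 h2 \<alpha> k)) / of_nat (N + 1)) \<longlonglongrightarrow> (\<integral>\<omega>. g \<omega> \<partial>torus_haar r)" if "trig r g" for g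
    using that
  proof (induction rule: trig.induct)
    case (trig_char n f c)
    have i: "integrable (torus_haar r) f \<longleftrightarrow> integrable (torus_haar r) (\<lambda>\<omega>. c * torus_char n \<omega>)"
      by (rule Bochner_Integration.integrable_cong) (use trig_char in auto)
    have "(\<integral>\<omega>. f \<omega> \<partial>torus_haar r) = (\<integral>\<omega>. c * torus_char n \<omega> \<partial>torus_haar r)"
      by (rule Bochner_Integration.integral_cong) (use trig_char in auto)
    then show ?case using tendsto_mult_left[OF cesaro_char[OF ind trig_char(1)], of c] i integrable_char[OF trig_char(1)]
      by (simp add: trig_char(2)[OF orbit_torus] sum_distrib_left)
  next
    case (trig_add f g h)
    have i: "integrable (torus_haar r) h \<longleftrightarrow> integrable (torus_haar r) (\<lambda>\<omega>. f \<omega> + g \<omega>)"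
      by (rule Bochner_Integration.integrable_cong) (use trig_add in auto)
    have "(\<integral>\<omega>. h \<omega> \<partial>torus_haar r) = (\<integral>\<omega>. f \<omega> + g \<omega> \<partial>torus_haar r)"
      by (rule Bochner_Integration.integral_cong) (use trig_add in auto)
    then show ?case using trig_add.IH tendsto_add[OF conjunct2[OF trig_add.IH(1)] conjunct2[OF trig_add.IH(2)]] i
      by (simp add: trig_add(3)[OF orbit_torus] sum.distrib add_divide_distrib)
  qed
  have "\<forall>n. \<exists>g. trig r (\<lambda>\<omega>. complex_of_real (g \<omega>)) \<and> (\<forall>\<omega>\<in>torus r. \<bar>f \<omega> - g \<omega>\<bar> < 1 / (real n + 1))"
    by (intro allI trig_dense[OF f]) auto
  from choice[OF this] obtain g where gg: "\<forall>n. trig r (\<lambda>\<omega>. complex_of_real (g n \<omega>)) \<and> (\<forall>\<omega>\<in>torus r. \<bar>f \<omega> - g n \<omega>\<bar> < 1 / (real n + 1))" ..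
  have g: "trig r (\<lambda>\<omega>. complex_of_real (g n \<omega>))" "\<And>\<omega>. \<omega> \<in> torus r \<Longrightarrow> \<bar>f \<omega> - g n \<omega>\<bar> < 1 / (real n + 1)" for n
    using gg by blast+
  have gm: "g n \<in> borel_measurable (torus_haar r)" for n
    using measurable_compose[OF trig_m[OF g(1)[of n]] borel_measurable_Re] by simp
  have z: "(\<lambda>n. 1 / (real n + 1)) \<longlonglongrightarrow> 0" using LIMSEQ_inverse_real_of_nat by (simp add: inverse_eq_divide add.commute)
  show fm: "f \<in> borel_measurable (torus_haar r)"
  proof (rule borel_measurable_LIMSEQ_real[OF _ gm])
    fix \<omega> assume \<omega>: "\<omega> \<in> torus r"
    have "(\<lambda>n. g n \<omega> - f \<omega>) \<longlonglongrightarrow> 0"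
      by (rule Lim_null_comparison[OF _ z]) (use g(2)[OF \<omega>] in \<open>auto intro!: always_eventually simp: abs_minus_commute less_imp_le\<close>)
    then show "(\<lambda>n. g n \<omega>) \<longlonglongrightarrow> f \<omega>" by (simp add: LIM_zero_iff)
  qed
  obtain B where B: "\<And>\<omega>. \<omega> \<in> torus r \<Longrightarrow> \<bar>f \<omega>\<bar> \<le> B"
    using compact_imp_bounded[OF compact_continuous_image[OF f compact_torus]] unfolding bounded_iff by auto
  have fi: "integrable (torus_haar r) f"
    by (rule integrable_const_bound[of _ B]) (use B fm in \<open>auto intro: AE_I2\<close>)
  show "(\<lambda>N. (\<Sum>k=0..N. f (orbit r h1 h2 \<alpha> k)) / real (N + 1)) \<longlonglongrightarrow> (\<integral>\<omega>. f \<omega> \<partial>torus_haar r)"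
  proof (rule LIMSEQ_I)
    fix e :: real assume e: "e > 0"
    obtain n where n: "1 / (real n + 1) < e / 4" using reals_Archimedean[of "e / 4"] e by (auto simp: inverse_eq_divide add.commute)
    have gi: "integrable (torus_haar r) (\<lambda>\<omega>. complex_of_real (g n \<omega>))" and
      gl: "(\<lambda>N. (\<Sum>k=0..N. complex_of_real (g n (orbit r h1 h2 \<alpha> k))) / of_nat (N + 1)) \<longlonglongrightarrow> (\<integral>\<omega>. complex_of_real (g n \<omega>) \<partial>torus_haar r)"
      using trig_lim[OF g(1)[of n]] by auto
    have gi': "integrable (torus_haar r) (g n)" using integrable_Re[OF gi] by simp
    have "(\<lambda>N. complex_of_real ((\<Sum>k=0..N. g n (orbit r h1 h2 \<alpha> k)) / real (N + 1))) \<longlonglongrightarrow> of_real (\<integral>\<omega>. g n \<omega> \<partial>torus_haar r)"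
      using gl by simp
    then have "(\<lambda>N. (\<Sum>k=0..N. g n (orbit r h1 h2 \<alpha> k)) / real (N + 1)) \<longlonglongrightarrow> (\<integral>\<omega>. g n \<omega> \<partial>torus_haar r)"
      unfolding tendsto_of_real_iff .
    moreover have "e / 4 > 0" using e by simp
    ultimately obtain N0 where N0: "\<And>N. N \<ge> N0 \<Longrightarrow> \<bar>(\<Sum>k=0..N. g n (orbit r h1 h2 \<alpha> k)) / real (N + 1) - (\<integral>\<omega>. g n \<omega> \<partial>torus_haar r)\<bar> < e / 4"
      unfolding lim_sequentially dist_real_def by blast
    have d: "\<bar>f \<omega> - g n \<omega>\<bar> \<le> e / 4" if "\<omega> \<in> torus r" for \<omega> using g(2)[OF that, of n] n by linarith
    have I: "\<bar>(\<integral>\<omega>. f \<omega> \<partial>torus_haar r) - (\<integral>\<omega>. g n \<omega> \<partial>torus_haar r)\<bar> \<le> e / 4"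
    proof -
      have "\<bar>\<integral>\<omega>. f \<omega> - g n \<omega> \<partial>torus_haar r\<bar> \<le> (\<integral>\<omega>. \<bar>f \<omega> - g n \<omega>\<bar> \<partial>torus_haar r)"
        by (rule integral_abs_bound)
      also have "\<dots> \<le> (\<integral>\<omega>. e / 4 \<partial>torus_haar r)"
        by (rule integral_mono) (use fi gi' d in auto)
      finally show ?thesis using fi gi' by (simp add: prob_space)
    qed
    show "\<exists>no. \<forall>N\<ge>no. norm ((\<Sum>k=0..N. f (orbit r h1 h2 \<alpha> k)) / real (N + 1) - (\<integral>\<omega>. f \<omega> \<partial>torus_haar r)) < e"
    proof (intro exI[of _ N0] allI impI)
      fix N assume N: "N \<ge> N0"
      have "\<bar>(\<Sum>k=0..N. f (orbit r h1 h2 \<alpha> k)) - (\<Sum>k=0..N. g n (orbit r h1 h2 \<alpha> k))\<bar> \<le> (\<Sum>k=0..N. e / 4)"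
        unfolding sum_subtractf[symmetric] by (rule order_trans[OF sum_abs], rule sum_mono, rule d[OF orbit_torus])
      then have "\<bar>(\<Sum>k=0..N. f (orbit r h1 h2 \<alpha> k)) / real (N + 1) - (\<Sum>k=0..N. g n (orbit r h1 h2 \<alpha> k)) / real (N + 1)\<bar> \<le> e / 4"
        unfolding diff_divide_distrib[symmetric] abs_divide by (simp add: field_simps)
      then show "norm ((\<Sum>k=0..N. f (orbit r h1 h2 \<alpha> k)) / real (N + 1) - (\<integral>\<omega>. f \<omega> \<partial>torus_haar r)) < e"
        using N0[OF N] I e unfolding real_norm_def by linarith
    qed
  qed
qed

section \<open>Lipschitz approximation on spaces of holomorphic functions\<close>

lemma compact_exhaustion:
  fixes S :: "complex set"
  assumes "open S"
  shows "\<exists>C. (\<forall>n. compact (C n)) \<and> (\<forall>n. C n \<subseteq> S) \<and> (\<forall>m n. m \<le> n \<longrightarrow> C m \<subseteq> C n) \<and>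
     (\<forall>K. compact K \<longrightarrow> K \<subseteq> S \<longrightarrow> (\<exists>N::nat. \<forall>n\<ge>N. K \<subseteq> C n))"
proof (rule open_Union_compact_subsets[OF assms])
  fix C :: "nat \<Rightarrow> complex set"
  assume C: "\<And>n. compact (C n)" "\<And>n. C n \<subseteq> S" "\<And>n. C n \<subseteq> interior (C (Suc n))"
    "\<And>K. compact K \<Longrightarrow> K \<subseteq> S \<Longrightarrow> \<exists>N. \<forall>n\<ge>N. K \<subseteq> C n"
  have "C m \<subseteq> C n" if "m \<le> n" for m n
    by (rule lift_Suc_mono_le[OF _ that]) (use C(3) interior_subset in blast)
  then show ?thesis by (intro exI[of _ C] conjI allI impI C)
qed

text \<open>Inserting 0 gives the empty set the norm 0 and changes nothing otherwise. Empty compact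
  sets are used to switch off components.\<close>

definition sup_norm :: "complex set \<Rightarrow> (complex \<Rightarrow> complex) \<Rightarrow> real" where
  "sup_norm K g = Sup (insert 0 ((\<lambda>z. cmod (g z)) ` K))"

lemma sup_norm_le: "c \<ge> 0 \<Longrightarrow> (\<And>z. z \<in> K \<Longrightarrow> cmod (g z) \<le> c) \<Longrightarrow> sup_norm K g \<le> c"
  unfolding sup_norm_def by (rule cSup_least) auto

lemma sup_norm_bdd:
  assumes "compact K" "continuous_on K g"
  shows "bdd_above (insert 0 ((\<lambda>z. cmod (g z)) ` K))"
proof -
  have "compact ((\<lambda>z. cmod (g z)) ` K)"
    by (intro compact_continuous_image continuous_intros assms)
  from bounded_imp_bdd_above[OF compact_imp_bounded[OF this]] show ?thesis by simp
qed

lemma sup_norm_ge: "compact K \<Longrightarrow> continuous_on K g \<Longrightarrow> z \<in> K \<Longrightarrow> cmod (g z) \<le> sup_norm K g"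
  unfolding sup_norm_def by (rule cSup_upper[OF _ sup_norm_bdd]) auto

lemma sup_norm_nonneg: "compact K \<Longrightarrow> continuous_on K g \<Longrightarrow> 0 \<le> sup_norm K g"
  unfolding sup_norm_def by (rule cSup_upper[OF _ sup_norm_bdd]) auto

lemma sup_norm_triangle:
  assumes "compact K" "continuous_on K f" "continuous_on K g" "continuous_on K h"
  shows "sup_norm K (\<lambda>z. f z - h z) \<le> sup_norm K (\<lambda>z. f z - g z) + sup_norm K (\<lambda>z. g z - h z)"
proof (rule sup_norm_le)
  have c: "continuous_on K (\<lambda>z. f z - g z)" "continuous_on K (\<lambda>z. g z - h z)" using assms by (auto intro: continuous_intros)
  show "0 \<le> sup_norm K (\<lambda>z. f z - g z) + sup_norm K (\<lambda>z. g z - h z)"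
    by (intro add_nonneg_nonneg sup_norm_nonneg assms c)
  fix z assume z: "z \<in> K"
  have "cmod (f z - h z) \<le> cmod (f z - g z) + cmod (g z - h z)" using norm_triangle_ineq[of "f z - g z" "g z - h z"] by simp
  then show "cmod (f z - h z) \<le> sup_norm K (\<lambda>z. f z - g z) + sup_norm K (\<lambda>z. g z - h z)"
    using sup_norm_ge[OF assms(1) c(1) z] sup_norm_ge[OF assms(1) c(2) z] by linarith
qed

lemma sup_norm_commute: "sup_norm K (\<lambda>z. f z - g z) = sup_norm K (\<lambda>z. g z - f z)"
  unfolding sup_norm_def by (simp add: norm_minus_commute)

lemma sup_norm_mono:
  assumes "compact L" "continuous_on L g" "K \<subseteq> L"
  shows "sup_norm K g \<le> sup_norm L g"
  by (rule sup_norm_le) (use assms sup_norm_nonneg sup_norm_ge in auto)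

lemma hol_space_restrict: "f holomorphic_on G \<Longrightarrow> (\<lambda>s\<in>G. f s) \<in> hol_space G"
  by (auto simp: hol_space_def cong: holomorphic_cong)

lemma hol_space_continuous: "f \<in> hol_space G \<Longrightarrow> K \<subseteq> G \<Longrightarrow> continuous_on K f"
  unfolding hol_space_def using holomorphic_on_imp_continuous_on holomorphic_on_subset by blast

section \<open>The product space with components 0 to r, and its pseudometrics\<close>

definition component :: "(complex \<Rightarrow> complex) \<times> (nat \<Rightarrow> complex \<Rightarrow> complex) \<Rightarrow> nat \<Rightarrow> complex \<Rightarrow> complex" where
  "component x j = (if j = 0 then fst x else snd x j)"

definition tuple :: "nat \<Rightarrow> (nat \<Rightarrow> complex \<Rightarrow> complex) \<Rightarrow> (complex \<Rightarrow> complex) \<times> (nat \<Rightarrow> complex \<Rightarrow> complex)" where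
  "tuple r f = (f 0, \<lambda>j\<in>{1..r}. f j)"

lemma component_tuple: "j \<le> r \<Longrightarrow> component (tuple r f) j = f j"
  by (auto simp: component_def tuple_def)

abbreviation Hspace :: "nat \<Rightarrow> (nat \<Rightarrow> complex set) \<Rightarrow> ((complex \<Rightarrow> complex) \<times> (nat \<Rightarrow> complex \<Rightarrow> complex)) set" where
  "Hspace r G \<equiv> topspace (H_product r (G 0) G)"

lemma Hspace_eq: "Hspace r G = hol_space (G 0) \<times> PiE {1..r} (\<lambda>j. hol_space (G j))"
  by (simp add: H_product_def)

lemma tuple_in_Hspace: "(\<And>j. j \<le> r \<Longrightarrow> f j \<in> hol_space (G j)) \<Longrightarrow> tuple r f \<in> Hspace r G"
  by (auto simp: Hspace_eq tuple_def)

lemma component_in_hol_space: "x \<in> Hspace r G \<Longrightarrow> j \<le> r \<Longrightarrow> component x j \<in> hol_space (G j)"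
  by (auto simp: Hspace_eq component_def mem_Times_iff PiE_iff)

text \<open>A pseudometric for each family of compact sets, one set per component. The product space
  is handled through these instead of through a single metric.\<close>

definition rho :: "nat \<Rightarrow> (nat \<Rightarrow> complex set) \<Rightarrow> (complex \<Rightarrow> complex) \<times> (nat \<Rightarrow> complex \<Rightarrow> complex) \<Rightarrow>
    (complex \<Rightarrow> complex) \<times> (nat \<Rightarrow> complex \<Rightarrow> complex) \<Rightarrow> real" where
  "rho r K x y = (\<Sum>j\<le>r. sup_norm (K j) (\<lambda>z. component x j z - component y j z))"

definition compact_family :: "nat \<Rightarrow> (nat \<Rightarrow> complex set) \<Rightarrow> (nat \<Rightarrow> complex set) \<Rightarrow> bool" where
  "compact_family r G K \<longleftrightarrow> (\<forall>j\<le>r. compact (K j) \<and> K j \<subseteq> G j)"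

lemma component_continuous: "compact_family r G K \<Longrightarrow> x \<in> Hspace r G \<Longrightarrow> j \<le> r \<Longrightarrow> continuous_on (K j) (component x j)"
  by (rule hol_space_continuous[OF component_in_hol_space]) (auto simp: compact_family_def)

lemma rho_nonneg:
  assumes "compact_family r G K" "x \<in> Hspace r G" "y \<in> Hspace r G"
  shows "0 \<le> rho r K x y"
  unfolding rho_def using assms component_continuous[OF assms(1)]
  by (intro sum_nonneg sup_norm_nonneg continuous_intros) (auto simp: compact_family_def)

lemma rho_refl: "rho r K x x = 0"
  unfolding rho_def by (rule sum.neutral) (auto simp: sup_norm_def image_constant_conv insert_absorb split: if_splits)

lemma rho_commute: "rho r K x y = rho r K y x"
  unfolding rho_def by (intro sum.cong refl sup_norm_commute)

lemma rho_triangle: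
  assumes "compact_family r G K" "x \<in> Hspace r G" "y \<in> Hspace r G" "z \<in> Hspace r G"
  shows "rho r K x z \<le> rho r K x y + rho r K y z"
  unfolding rho_def sum.distrib[symmetric] using assms component_continuous[OF assms(1)]
  by (intro sum_mono sup_norm_triangle) (auto simp: compact_family_def)

lemma rho_mono:
  assumes "compact_family r G L" "x \<in> Hspace r G" "y \<in> Hspace r G" "\<And>j. j \<le> r \<Longrightarrow> K j \<subseteq> L j"
  shows "rho r K x y \<le> rho r L x y"
  unfolding rho_def using assms component_continuous[OF assms(1)]
  by (intro sum_mono sup_norm_mono continuous_intros) (auto simp: compact_family_def)

lemma rho_component:
  assumes "compact_family r G K" "x \<in> Hspace r G" "y \<in> Hspace r G" "j \<le> r" "z \<in> K j"
  shows "cmod (component x j z - component y j z) \<le> rho r K x y"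
proof -
  have c: "continuous_on (K j) (\<lambda>z. component x j z - component y j z)" if "j \<le> r" for j
    using assms that component_continuous[OF assms(1)] by (intro continuous_intros) auto
  have "cmod (component x j z - component y j z) \<le> sup_norm (K j) (\<lambda>z. component x j z - component y j z)"
    by (rule sup_norm_ge[OF _ c]) (use assms in \<open>auto simp: compact_family_def\<close>)
  also have "\<dots> \<le> rho r K x y" unfolding rho_def
    by (rule member_le_sum) (use assms c in \<open>auto simp: compact_family_def intro!: sup_norm_nonneg\<close>)
  finally show ?thesis .
qed

lemma rho_le:
  assumes "\<And>j z. j \<le> r \<Longrightarrow> z \<in> K j \<Longrightarrow> cmod (component x j z - component y j z) \<le> c j" "\<And>j. j \<le> r \<Longrightarrow> c j \<ge> 0"
  shows "rho r K x y \<le> (\<Sum>j\<le>r. c j)"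
  unfolding rho_def by (intro sum_mono sup_norm_le) (use assms in auto)

text \<open>A neighbourhood in the product of finitely many function spaces contains a box; each
  side of the box is a sup-norm ball on some compact set, and finitely many radii have a positive
  minimum.\<close>

lemma openin_H_product_rho:
  assumes U: "openin (H_product r (G 0) G) U" and x: "x \<in> U"
  shows "\<exists>K e. compact_family r G K \<and> e > 0 \<and> (\<forall>y\<in>Hspace r G. rho r K x y < e \<longrightarrow> y \<in> U)"
proof -
  have xH: "x \<in> Hspace r G" using openin_subset[OF U] x by blast
  from U x obtain V W where VW: "openin (hol_topology (G 0)) V" "openin (product_topology (\<lambda>j. hol_topology (G j)) {1..r}) W"
      "fst x \<in> V" "snd x \<in> W" "V \<times> W \<subseteq> U"
    unfolding H_product_def openin_prod_topology_alt by (metis prod.collapse)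
  from VW(2,4) obtain Ui where Ui: "\<forall>j\<in>{1..r}. openin (hol_topology (G j)) (Ui j)" "snd x \<in> PiE {1..r} Ui" "PiE {1..r} Ui \<subseteq> W"
    unfolding openin_product_topology_alt by blast
  define B where "B j = (if j = 0 then V else Ui j)" for j
  have B: "openin (hol_topology (G j)) (B j)" "component x j \<in> B j" if "j \<le> r" for j
    using that VW Ui by (auto simp: B_def component_def PiE_iff)
  have "\<forall>j. \<exists>K e. j \<le> r \<longrightarrow> compact K \<and> K \<subseteq> G j \<and> e > 0 \<and> {g \<in> hol_space (G j). \<forall>z\<in>K. dist (g z) (component x j z) < e} \<subseteq> B j"
  proof
    fix j
    show "\<exists>K e. j \<le> r \<longrightarrow> compact K \<and> K \<subseteq> G j \<and> e > 0 \<and> {g \<in> hol_space (G j). \<forall>z\<in>K. dist (g z) (component x j z) < e} \<subseteq> B j"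
    proof (cases "j \<le> r")
      case True
      then show ?thesis using B(1)[OF True] B(2)[OF True] unfolding openin_hol_topology by blast
    qed auto
  qed
  from choice[OF this] obtain K where "\<forall>j. \<exists>e. j \<le> r \<longrightarrow> compact (K j) \<and> K j \<subseteq> G j \<and> e > 0 \<and> {g \<in> hol_space (G j). \<forall>z\<in>K j. dist (g z) (component x j z) < e} \<subseteq> B j" ..
  from choice[OF this] obtain e where Ke: "\<forall>j. j \<le> r \<longrightarrow> compact (K j) \<and> K j \<subseteq> G j \<and> e j > 0 \<and> {g \<in> hol_space (G j). \<forall>z\<in>K j. dist (g z) (component x j z) < e j} \<subseteq> B j" ..
  define d where "d = Min (e ` {..r})"
  have d: "d > 0" "\<And>j. j \<le> r \<Longrightarrow> d \<le> e j" using Ke by (auto simp: d_def)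
  have cf: "compact_family r G K" using Ke by (auto simp: compact_family_def)
  show ?thesis
  proof (intro exI[of _ K] exI[of _ d] conjI ballI impI)
    fix y assume y: "y \<in> Hspace r G" "rho r K x y < d"
    have yB: "component y j \<in> B j" if j: "j \<le> r" for j
    proof -
      have "dist (component y j z) (component x j z) < e j" if "z \<in> K j" for z
        using rho_component[OF cf xH y(1) j that] y(2) d(2)[OF j] by (simp add: dist_norm norm_minus_commute)
      then show ?thesis using Ke j component_in_hol_space[OF y(1) j] by blast
    qed
    have "fst y \<in> V" using yB[of 0] by (simp add: component_def B_def)
    moreover have "snd y \<in> PiE {1..r} Ui"
    proof (rule PiE_I)
      fix j assume "j \<in> {1..r}" then show "snd y j \<in> Ui j" using yB[of j] by (simp add: component_def B_def split: if_splits)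
    qed (use y(1) in \<open>auto simp: Hspace_eq mem_Times_iff PiE_iff extensional_def\<close>)
    ultimately show "y \<in> U" using VW(5) Ui(3) by (metis mem_Times_iff subsetD)
  qed (use cf d in auto)
qed

text \<open>Lower semicontinuous functions are increasing limits of Lipschitz functions; this reduces both
  measurability and weak convergence to Lipschitz test functions.\<close>

lemma lsc_regularisation:
  fixes \<rho> :: "nat \<Rightarrow> 'a \<Rightarrow> 'a \<Rightarrow> real" and f :: "'a \<Rightarrow> real"
  assumes nonneg: "\<And>i x y. x \<in> X \<Longrightarrow> y \<in> X \<Longrightarrow> 0 \<le> \<rho> i x y" and refl: "\<And>i x. \<rho> i x x = 0"
    and sym: "\<And>i x y. \<rho> i x y = \<rho> i y x"
    and triangle: "\<And>i x y z. x \<in> X \<Longrightarrow> y \<in> X \<Longrightarrow> z \<in> X \<Longrightarrow> \<rho> i x z \<le> \<rho> i x y + \<rho> i y z"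
    and mono: "\<And>i k x y. i \<le> k \<Longrightarrow> x \<in> X \<Longrightarrow> y \<in> X \<Longrightarrow> \<rho> i x y \<le> \<rho> k x y"
    and bound: "\<And>x. x \<in> X \<Longrightarrow> \<bar>f x\<bar> \<le> M"
    and lsc: "\<And>x e. x \<in> X \<Longrightarrow> e > 0 \<Longrightarrow> \<exists>i d. d > 0 \<and> (\<forall>y\<in>X. \<rho> i x y < d \<longrightarrow> f y > f x - e)"
  obtains F :: "nat \<Rightarrow> 'a \<Rightarrow> real" where
    "\<And>k x. x \<in> X \<Longrightarrow> - M \<le> F k x \<and> F k x \<le> f x"
    "\<And>k x y. x \<in> X \<Longrightarrow> y \<in> X \<Longrightarrow> \<bar>F k x - F k y\<bar> \<le> real k * \<rho> k x y"
    "\<And>x. x \<in> X \<Longrightarrow> (\<lambda>k. F k x) \<longlonglongrightarrow> f x"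
proof -
  \<comment> \<open>Inf-convolution with \<open>real k * \<rho> k\<close>. The Lipschitz constant
    and the pseudometric grow together, since different points may need different
    pseudometrics.\<close>
  define F where "F k x = (INF y\<in>X. f y + real k * \<rho> k x y)" for k x
  have lb: "- M \<le> f y + real k * \<rho> k x y" if "x \<in> X" "y \<in> X" for k x y
    using bound[OF that(2)] mult_nonneg_nonneg[OF of_nat_0_le_iff nonneg[OF that, of k], of k] by linarith
  have bdd: "bdd_below ((\<lambda>y. f y + real k * \<rho> k x y) ` X)" if "x \<in> X" for k x
    using lb[OF that] by (intro bdd_belowI[of _ "- M"]) auto
  have F_le: "F k x \<le> f y + real k * \<rho> k x y" if "x \<in> X" "y \<in> X" for k x y
    unfolding F_def by (rule cINF_lower[OF bdd[OF that(1)] that(2)])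
  have le_F: "c \<le> F k x" if "x \<in> X" "\<And>y. y \<in> X \<Longrightarrow> c \<le> f y + real k * \<rho> k x y" for c k x
    unfolding F_def by (rule cINF_greatest) (use that in auto)
  have 1: "- M \<le> F k x \<and> F k x \<le> f x" if "x \<in> X" for k x
    using F_le[OF that that, of k] le_F[OF that lb[OF that]] by (simp add: refl)
  have half: "F k x - real k * \<rho> k x y \<le> F k y" if "x \<in> X" "y \<in> X" for k x y
  proof (rule le_F[OF that(2)])
    fix z assume z: "z \<in> X"
    have "F k x \<le> f z + real k * \<rho> k x z" by (rule F_le[OF that(1) z])
    also have "real k * \<rho> k x z \<le> real k * (\<rho> k x y + \<rho> k y z)" by (intro mult_left_mono triangle that z) auto
    finally show "F k x - real k * \<rho> k x y \<le> f z + real k * \<rho> k y z" by (simp add: distrib_left)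
  qed
  have 2: "\<bar>F k x - F k y\<bar> \<le> real k * \<rho> k x y" if "x \<in> X" "y \<in> X" for k x y
    using half[OF that, of k] half[OF that(2,1), of k] sym[of k x y] by simp
  have 3: "(\<lambda>k. F k x) \<longlonglongrightarrow> f x" if x: "x \<in> X" for x
  proof (rule LIMSEQ_I)
    fix e :: real assume e: "e > 0"
    then obtain i d where d: "d > 0" "\<And>y. y \<in> X \<Longrightarrow> \<rho> i x y < d \<Longrightarrow> f y > f x - e / 2" using lsc[OF x, of "e / 2"] by auto
    \<comment> \<open>From this index on, the penalty outside the d-ball is at least 2 M, the
      largest possible drop of f; only the ball, where f is nearly at least f x, can influence the
      infimum.\<close>
    obtain k1 :: nat where k1: "2 * M / d < real k1" using reals_Archimedean2 by blast
    have "norm (F k x - f x) < e" if k: "k \<ge> max i k1" for k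
    proof -
      have "f x - e / 2 \<le> F k x"
      proof (rule le_F[OF x])
        fix y assume y: "y \<in> X"
        have m: "\<rho> i x y \<le> \<rho> k x y" by (rule mono[OF _ x y]) (use k in simp)
        show "f x - e / 2 \<le> f y + real k * \<rho> k x y"
        proof (cases "\<rho> i x y < d")
          case True
          then show ?thesis using d(2)[OF y True] mult_nonneg_nonneg[OF of_nat_0_le_iff nonneg[OF x y, of k], of k] by linarith
        next
          case False
          have "2 * M \<le> real k1 * d" using k1 d(1) by (simp add: field_simps)
          also have "\<dots> \<le> real k * \<rho> k x y" using k m False d(1) by (intro mult_mono) auto
          finally show ?thesis using bound[OF x] bound[OF y] e by linarith
        qed
      qed
      then show ?thesis using 1[OF x, of k] e by simp
    qed
    then show "\<exists>no. \<forall>k\<ge>no. norm (F k x - f x) < e" by blast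
  qed
  show ?thesis by (rule that[of F, OF 1 2 3])
qed

section \<open>Weak convergence of joint shifts\<close>

text \<open>The interface between the analysis and the probability: approximation of the shifts by
  partial sums in discrete mean square, almost sure convergence of the random series, and
  equidistribution of the orbit. \<open>X_orb\<close> links them, as evaluating the random factors
  on the orbit produces the shifted partial sums.\<close>

locale joint_shifts =
  fixes r :: nat and G :: "nat \<Rightarrow> complex set" and a :: "nat \<Rightarrow> nat \<Rightarrow> complex" and \<beta> hh \<kappa> :: "nat \<Rightarrow> real"
    and F :: "nat \<Rightarrow> complex \<Rightarrow> complex" and X :: "nat \<Rightarrow> nat \<Rightarrow> torus_pt \<Rightarrow> complex" and orb :: "nat \<Rightarrow> torus_pt"
  assumes G_open: "\<And>j. j \<le> r \<Longrightarrow> open (G j)" and G_sub: "\<And>j. j \<le> r \<Longrightarrow> G j \<subseteq> {s. Re s > \<kappa> j}"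
    and \<beta>: "\<And>j. j \<le> r \<Longrightarrow> \<beta> j > 0"
    and F_hol: "\<And>j k. j \<le> r \<Longrightarrow> (\<lambda>s. F j (s + \<i> * of_nat k * of_real (hh j))) holomorphic_on G j"
    and approx: "\<And>j K e. j \<le> r \<Longrightarrow> compact K \<Longrightarrow> K \<subseteq> {s. Re s > \<kappa> j} \<Longrightarrow> e > 0 \<Longrightarrow>
      \<exists>n0. \<forall>n\<ge>n0. \<exists>k0 q. (\<forall>k. 0 \<le> q k) \<and>
       (\<forall>k\<ge>k0. \<forall>z\<in>K. (cmod (F j (z + \<i> * of_nat k * of_real (hh j)) - ptl (\<beta> j) (a j) n (z + \<i> * of_nat k * of_real (hh j))))\<^sup>2 \<le> q k) \<and>
       (\<forall>\<^sub>F N in sequentially. (\<Sum>k=k0..N. q k) \<le> e * (real N + 1))"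
    and X_cont: "\<And>j m. j \<le> r \<Longrightarrow> continuous_on (torus r) (X j m)"
    and X_meas: "\<And>j m. j \<le> r \<Longrightarrow> X j m \<in> borel_measurable (torus_haar r)"
    and X_AE: "\<And>j. j \<le> r \<Longrightarrow> AE \<omega> in torus_haar r. \<forall>K. compact K \<and> K \<subseteq> {s. Re s > \<kappa> j} \<longrightarrow>
       uniformly_convergent_on K (\<lambda>n s. \<Sum>m<n. a j m * X j m \<omega> * dterm (\<beta> j) m s)"
    and orb_torus: "\<And>k. orb k \<in> torus r"
    and X_orb: "\<And>j k m s. j \<le> r \<Longrightarrow> X j m (orb k) * dterm (\<beta> j) m s = dterm (\<beta> j) m (s + \<i> * of_nat k * of_real (hh j))"
    and equi: "\<And>f :: torus_pt \<Rightarrow> real. continuous_on (torus r) f \<Longrightarrow> (\<lambda>N. (\<Sum>k=0..N. f (orb k)) / real (N + 1)) \<longlonglongrightarrow> (\<integral>\<omega>. f \<omega> \<partial>torus_haar r)"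
begin

text \<open>The unimodular factors \<open>u\<close> are free variables, so that continuity in them
  can be established once and then combined with any dependence on the torus point.\<close>

definition "partZ n u = tuple r (\<lambda>j. \<lambda>s\<in>G j. \<Sum>m<n. a j m * u j m * dterm (\<beta> j) m s)" for n :: nat and u :: "nat \<Rightarrow> nat \<Rightarrow> complex"
definition "shiftZ k = tuple r (\<lambda>j. \<lambda>s\<in>G j. F j (s + \<i> * of_nat k * of_real (hh j)))" for k :: nat
definition "limZ \<omega> = tuple r (\<lambda>j. hol_series (G j) (\<lambda>m s. a j m * X j m \<omega> * dterm (\<beta> j) m s))" for \<omega>
definition "good j \<omega> \<longleftrightarrow> (\<forall>K. compact K \<and> K \<subseteq> G j \<longrightarrow> uniformly_convergent_on K (\<lambda>n s. \<Sum>m<n. a j m * X j m \<omega> * dterm (\<beta> j) m s))" for j \<omega>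
definition "U \<omega> = (\<lambda>j m. if j \<le> r then X j m \<omega> else 0)" for \<omega>
text \<open>Factors set to 0 where the series fails to converge, in accordance with the default
  value of \<open>hol_series\<close>. With them the partial sums converge at every point, while
  \<open>U\<close> is continuous on the torus; the two agree almost everywhere.\<close>

definition "V \<omega> = (\<lambda>j m. if j \<le> r \<and> good j \<omega> then X j m \<omega> else 0)" for \<omega>

lemma partial_sum_holomorphic: "j \<le> r \<Longrightarrow> (\<lambda>s. \<Sum>m<n. a j m * c m * dterm (\<beta> j) m s) holomorphic_on A"
  by (intro holomorphic_intros) (auto simp: \<beta>)

lemma part_in: "partZ n u \<in> Hspace r G"
  unfolding partZ_def by (intro tuple_in_Hspace hol_space_restrict partial_sum_holomorphic)

lemma shiftZ_in: "shiftZ k \<in> Hspace r G"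
  unfolding shiftZ_def by (intro tuple_in_Hspace hol_space_restrict F_hol)

lemma series_uniform_limit:
  assumes "good j \<omega>" "compact K" "K \<subseteq> G j"
  shows "uniform_limit K (\<lambda>n s. \<Sum>m<n. a j m * X j m \<omega> * dterm (\<beta> j) m s) (\<lambda>s. \<Sum>m. a j m * X j m \<omega> * dterm (\<beta> j) m s) sequentially"
proof -
  have "uniformly_convergent_on K (\<lambda>n s. \<Sum>m<n. a j m * X j m \<omega> * dterm (\<beta> j) m s)"
    using assms by (auto simp: good_def)
  then show ?thesis unfolding uniformly_convergent_uniform_limit_iff by (simp add: suminf_eq_lim)
qed

lemma hol_series_in:
  assumes j: "j \<le> r"
  shows "hol_series (G j) (\<lambda>m s. a j m * X j m \<omega> * dterm (\<beta> j) m s) \<in> hol_space (G j)"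
proof (cases "good j \<omega>")
  case True
  have "(\<lambda>s. \<Sum>m. a j m * X j m \<omega> * dterm (\<beta> j) m s) holomorphic_on G j"
  proof (rule holomorphic_uniform_sequence[OF G_open[OF j] partial_sum_holomorphic[OF j, of "\<lambda>m. X j m \<omega>"]])
    fix x assume "x \<in> G j"
    then obtain d where "d > 0" "cball x d \<subseteq> G j" using G_open[OF j] open_contains_cball by blast
    then show "\<exists>d>0. cball x d \<subseteq> G j \<and> uniform_limit (cball x d) (\<lambda>n s. \<Sum>m<n. a j m * X j m \<omega> * dterm (\<beta> j) m s) (\<lambda>s. \<Sum>m. a j m * X j m \<omega> * dterm (\<beta> j) m s) sequentially"
      using series_uniform_limit[OF True] by auto
  qed
  then show ?thesis using True unfolding hol_series_def good_def by (simp add: hol_space_restrict)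
next
  case False
  then show ?thesis unfolding hol_series_def good_def
    by (simp only: if_False) (intro hol_space_restrict holomorphic_intros)
qed

lemma limZ_in: "limZ \<omega> \<in> Hspace r G"
  unfolding limZ_def by (intro tuple_in_Hspace hol_series_in)

section \<open>Lipschitz test functions: measurability and averages\<close>

definition lipschitz :: "((complex \<Rightarrow> complex) \<times> (nat \<Rightarrow> complex \<Rightarrow> complex) \<Rightarrow> real) \<Rightarrow> (nat \<Rightarrow> complex set) \<Rightarrow> real \<Rightarrow> bool" where
  "lipschitz \<Phi> K L \<longleftrightarrow> compact_family r G K \<and> L \<ge> 0 \<and> (\<forall>x\<in>Hspace r G. \<forall>y\<in>Hspace r G. \<bar>\<Phi> x - \<Phi> y\<bar> \<le> L * rho r K x y)"

text \<open>A partial sum involves finitely many coordinates, each multiplied by a function bounded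
  on the compact sets. The Lipschitz condition then bounds the change of the test function by a
  continuous function vanishing at the point considered.\<close>

lemma part_continuous:
  assumes \<Phi>: "lipschitz \<Phi> K L"
  shows "continuous_on UNIV (\<lambda>u. \<Phi> (partZ n u))"
proof (rule continuous_at_imp_continuous_on, rule ballI)
  fix v :: "nat \<Rightarrow> nat \<Rightarrow> complex"
  have K: "compact_family r G K" and L: "L \<ge> 0" using \<Phi> by (auto simp: lipschitz_def)
  define C where "C j m = cmod (a j m) * sup_norm (K j) (dterm (\<beta> j) m)" for j m
  define R where "R u = L * (\<Sum>j\<le>r. \<Sum>m<n. cmod (u j m - v j m) * C j m)" for u :: "nat \<Rightarrow> nat \<Rightarrow> complex"
  have cj: "continuous_on UNIV (\<lambda>u::nat \<Rightarrow> nat \<Rightarrow> complex. u j m)" for j m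
    by (rule continuous_on_product_then_coordinatewise[where f = "\<lambda>u. u j"]) (rule continuous_on_product_coordinates)
  have "continuous_on UNIV R" unfolding R_def by (intro continuous_intros cj)
  then have "isCont R v" by (simp add: continuous_on_eq_continuous_at)
  moreover have "R v = 0" by (simp add: R_def)
  ultimately have R0: "(R \<longlongrightarrow> 0) (at v)" by (simp add: isCont_def)
  have dc: "continuous_on (K j) (dterm (\<beta> j) m)" if "j \<le> r" for j m
    using holomorphic_on_imp_continuous_on[OF dterm_holomorphic[OF \<beta>[OF that]]] .
  have C0: "C j m \<ge> 0" if "j \<le> r" for j m
    unfolding C_def using K that by (intro mult_nonneg_nonneg sup_norm_nonneg dc) (auto simp: compact_family_def)
  have bound: "\<bar>\<Phi> (partZ n u) - \<Phi> (partZ n v)\<bar> \<le> R u" for u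
  proof -
    have "\<bar>\<Phi> (partZ n u) - \<Phi> (partZ n v)\<bar> \<le> L * rho r K (partZ n u) (partZ n v)"
      using \<Phi> part_in by (auto simp: lipschitz_def)
    also have "\<dots> \<le> R u" unfolding R_def
    proof (intro mult_left_mono L rho_le)
      fix j z assume j: "j \<le> r" and z: "z \<in> K j"
      then have zG: "z \<in> G j" using K by (auto simp: compact_family_def)
      have "component (partZ n u) j z - component (partZ n v) j z = (\<Sum>m<n. (u j m - v j m) * (a j m * dterm (\<beta> j) m z))"
        using zG by (simp add: partZ_def component_tuple j sum_subtractf[symmetric] algebra_simps)
      also have "cmod \<dots> \<le> (\<Sum>m<n. cmod (u j m - v j m) * C j m)"
      proof (rule sum_norm_le)
        fix m
        have "cmod (dterm (\<beta> j) m z) \<le> sup_norm (K j) (dterm (\<beta> j) m)"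
          using K j z dc[OF j] by (intro sup_norm_ge) (auto simp: compact_family_def)
        then show "cmod ((u j m - v j m) * (a j m * dterm (\<beta> j) m z)) \<le> cmod (u j m - v j m) * C j m"
          unfolding norm_mult C_def by (intro mult_left_mono) auto
      qed
      finally show "cmod (component (partZ n u) j z - component (partZ n v) j z) \<le> (\<Sum>m<n. cmod (u j m - v j m) * C j m)" .
    qed (intro sum_nonneg mult_nonneg_nonneg C0 norm_ge_zero)
    finally show ?thesis .
  qed
  have "((\<lambda>u. \<Phi> (partZ n u) - \<Phi> (partZ n v)) \<longlongrightarrow> 0) (at v)"
    by (rule Lim_null_comparison[OF always_eventually R0]) (use bound in auto)
  then show "isCont (\<lambda>u. \<Phi> (partZ n u)) v" unfolding isCont_def by (rule LIM_zero_cancel)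
qed

lemma part_measurable:
  assumes \<Phi>: "lipschitz \<Phi> K L" and u: "\<And>j m. (\<lambda>\<omega>. u \<omega> j m) \<in> borel_measurable (torus_haar r)"
  shows "(\<lambda>\<omega>. \<Phi> (partZ n (u \<omega>))) \<in> borel_measurable (torus_haar r)"
proof (rule measurable_compose[of u _ borel])
  show "u \<in> borel_measurable (torus_haar r)"
    by (intro measurable_coordinatewise_then_product u)
  show "(\<lambda>u. \<Phi> (partZ n u)) \<in> borel_measurable borel"
    by (rule borel_measurable_continuous_onI[OF part_continuous[OF \<Phi>]])
qed

text \<open>Convergence on all compact sets is Cauchy's criterion in countable form: an exhaustion
  by compacts, tolerances 1 / (t + 1), and sup norms of differences of partial sums. It remains to
  see that these sup norms are measurable.\<close>

lemma good_measurable: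
  assumes j: "j \<le> r"
  shows "Measurable.pred (torus_haar r) (good j)"
proof -
  from compact_exhaustion[OF G_open[OF j]] obtain Ks :: "nat \<Rightarrow> complex set"
    where Ks': "(\<forall>n. compact (Ks n)) \<and> (\<forall>n. Ks n \<subseteq> G j) \<and> (\<forall>m n. m \<le> n \<longrightarrow> Ks m \<subseteq> Ks n) \<and>
     (\<forall>K. compact K \<longrightarrow> K \<subseteq> G j \<longrightarrow> (\<exists>N::nat. \<forall>n\<ge>N. K \<subseteq> Ks n))" ..
  then have Ks: "\<And>i. compact (Ks i)" "\<And>i. Ks i \<subseteq> G j" "\<And>K. compact K \<Longrightarrow> K \<subseteq> G j \<Longrightarrow> \<exists>N. \<forall>i\<ge>N. K \<subseteq> Ks i"
    by simp_all
  define S where "S \<omega> n s = (\<Sum>m<n. a j m * X j m \<omega> * dterm (\<beta> j) m s)" for \<omega> n s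
  define D where "D i m n \<omega> = sup_norm (Ks i) (\<lambda>s. S \<omega> m s - S \<omega> n s)" for i m n \<omega>
  have Sc: "continuous_on A (S \<omega> n)" for A \<omega> n unfolding S_def[abs_def]
    by (rule holomorphic_on_imp_continuous_on[OF partial_sum_holomorphic[OF j]])
  have [measurable]: "D i m n \<in> borel_measurable (torus_haar r)" for i m n
  proof -
    define K where "K j' = (if j' = j then Ks i else {})" for j'
    define \<Phi> where "\<Phi> x = sup_norm (Ks i) (component x j)" for x
    \<comment> \<open>The difference of two cut-offs turns one partial sum of length max m n into
      the difference of the m-th and n-th. As \<open>K\<close> is empty for the other components,
      the sup norm on \<open>Ks i\<close> is a Lipschitz function of this single partial
      sum.\<close>
    define u where "u \<omega> j' m' = (if j' = j then ((if m' < m then 1 else 0) - (if m' < n then 1 else 0)) * X j m' \<omega> else 0)" for \<omega> j' m'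
    have cf: "compact_family r G K" using Ks by (auto simp: compact_family_def K_def)
    have half: "\<Phi> x \<le> \<Phi> y + rho r K x y" if xy: "x \<in> Hspace r G" "y \<in> Hspace r G" for x y
      unfolding \<Phi>_def
    proof (rule sup_norm_le)
      have c: "continuous_on (Ks i) (component y j)" by (rule hol_space_continuous[OF component_in_hol_space[OF xy(2) j] Ks(2)])
      show "0 \<le> sup_norm (Ks i) (component y j) + rho r K x y" by (intro add_nonneg_nonneg sup_norm_nonneg Ks c rho_nonneg[OF cf] xy)
      fix z assume z: "z \<in> Ks i"
      have "cmod (component x j z) \<le> cmod (component y j z) + cmod (component x j z - component y j z)" by (metis add.commute diff_add_cancel norm_triangle_ineq)
      then show "cmod (component x j z) \<le> sup_norm (Ks i) (component y j) + rho r K x y"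
        using sup_norm_ge[OF Ks(1) c z] rho_component[OF cf xy j, of z] z by (simp add: K_def)
    qed
    have "\<bar>\<Phi> x - \<Phi> y\<bar> \<le> 1 * rho r K x y" if xy: "x \<in> Hspace r G" "y \<in> Hspace r G" for x y
      using half[OF xy] half[OF xy(2,1)] rho_commute[of r K x y] by simp
    then have lip: "lipschitz \<Phi> K 1" using cf by (auto simp: lipschitz_def)
    have um: "(\<lambda>\<omega>. u \<omega> j' m') \<in> borel_measurable (torus_haar r)" for j' m'
      unfolding u_def using X_meas[OF j, of m'] by (cases "j' = j") auto
    have "\<Phi> (partZ (max m n) (u \<omega>)) = D i m n \<omega>" for \<omega>
    proof -
      have "component (partZ (max m n) (u \<omega>)) j s = S \<omega> m s - S \<omega> n s" if s: "s \<in> Ks i" for s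
      proof -
        let ?t = "\<lambda>m'. a j m' * X j m' \<omega> * dterm (\<beta> j) m' s"
        have "component (partZ (max m n) (u \<omega>)) j s = (\<Sum>m'<max m n. (if m' < m then ?t m' else 0) - (if m' < n then ?t m' else 0))"
          using s Ks(2) by (auto simp: partZ_def component_tuple j u_def algebra_simps intro!: sum.cong)
        also have "\<dots> = (\<Sum>m'\<in>{..<max m n} \<inter> {..<m}. ?t m') - (\<Sum>m'\<in>{..<max m n} \<inter> {..<n}. ?t m')"
          by (simp add: sum_subtractf sum.inter_restrict)
        also have "{..<max m n} \<inter> {..<m} = {..<m}" by auto
        also have "{..<max m n} \<inter> {..<n} = {..<n}" by auto
        finally show ?thesis by (simp add: S_def)
      qed
      then show ?thesis unfolding \<Phi>_def D_def sup_norm_def by (intro arg_cong[of _ _ Sup] arg_cong[of _ _ "insert 0"] image_cong) auto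
    qed
    then have "(\<lambda>\<omega>. \<Phi> (partZ (max m n) (u \<omega>))) = D i m n" by auto
    with part_measurable[where u = u and n = "max m n", OF lip um] show ?thesis by simp
  qed
  have "good j \<omega> \<longleftrightarrow> (\<forall>i. \<forall>t::nat. \<exists>N. \<forall>m. m \<ge> N \<longrightarrow> (\<forall>n. n \<ge> N \<longrightarrow> D i m n \<omega> \<le> 1 / (real t + 1)))" for \<omega>
  proof
    assume g: "good j \<omega>"
    show "\<forall>i. \<forall>t::nat. \<exists>N. \<forall>m. m \<ge> N \<longrightarrow> (\<forall>n. n \<ge> N \<longrightarrow> D i m n \<omega> \<le> 1 / (real t + 1))"
    proof (intro allI)
      fix i t :: nat
      have "uniformly_convergent_on (Ks i) (S \<omega>)" using g Ks unfolding good_def S_def[abs_def] by auto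
      then have "uniformly_Cauchy_on (Ks i) (S \<omega>)" by (rule uniformly_convergent_Cauchy)
      moreover have "1 / (real t + 1) > 0" by simp
      ultimately obtain N where N: "\<forall>s\<in>Ks i. \<forall>m\<ge>N. \<forall>n\<ge>N. dist (S \<omega> m s) (S \<omega> n s) < 1 / (real t + 1)"
        unfolding uniformly_Cauchy_on_def by blast
      show "\<exists>N. \<forall>m. m \<ge> N \<longrightarrow> (\<forall>n. n \<ge> N \<longrightarrow> D i m n \<omega> \<le> 1 / (real t + 1))"
        unfolding D_def using N by (intro exI[of _ N] allI impI sup_norm_le) (auto simp: dist_norm less_imp_le)
    qed
  next
    assume D: "\<forall>i. \<forall>t::nat. \<exists>N. \<forall>m. m \<ge> N \<longrightarrow> (\<forall>n. n \<ge> N \<longrightarrow> D i m n \<omega> \<le> 1 / (real t + 1))"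
    have uc: "uniformly_convergent_on (Ks i) (S \<omega>)" for i
    proof (rule Cauchy_uniformly_convergent, rule uniformly_Cauchy_onI)
      fix e :: real assume "e > 0"
      then obtain t where t: "1 / (real t + 1) < e" using reals_Archimedean[of e] by (auto simp: inverse_eq_divide add.commute)
      from D obtain N where N: "\<And>m n. m \<ge> N \<Longrightarrow> n \<ge> N \<Longrightarrow> D i m n \<omega> \<le> 1 / (real t + 1)" by blast
      have "dist (S \<omega> m s) (S \<omega> n s) < e" if "s \<in> Ks i" "m \<ge> N" "n \<ge> N" for s m n
      proof -
        have "cmod (S \<omega> m s - S \<omega> n s) \<le> D i m n \<omega>" unfolding D_def
          by (rule sup_norm_ge[OF Ks(1) _ that(1)]) (intro continuous_intros Sc)
        then show ?thesis using N[OF that(2,3)] t by (simp add: dist_norm)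
      qed
      then show "\<exists>N. \<forall>s\<in>Ks i. \<forall>m\<ge>N. \<forall>n\<ge>N. dist (S \<omega> m s) (S \<omega> n s) < e" by blast
    qed
    show "good j \<omega>" unfolding good_def S_def[symmetric]
    proof (intro allI impI)
      fix K assume K: "compact K \<and> K \<subseteq> G j"
      then obtain N where "\<forall>i\<ge>N. K \<subseteq> Ks i" using Ks(3) by blast
      then have "K \<subseteq> Ks N" by simp
      then show "uniformly_convergent_on K (\<lambda>n s. S \<omega> n s)" using uc[of N] uniformly_convergent_on_subset by blast
    qed
  qed
  then have "good j = (\<lambda>\<omega>. \<forall>i. \<forall>t::nat. \<exists>N. \<forall>m. m \<ge> N \<longrightarrow> (\<forall>n. n \<ge> N \<longrightarrow> D i m n \<omega> \<le> 1 / (real t + 1)))" by auto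
  then show ?thesis by simp
qed

lemma AE_good: "AE \<omega> in torus_haar r. \<forall>j. j \<le> r \<longrightarrow> good j \<omega>"
proof (subst AE_all_countable, intro allI)
  fix j
  show "AE \<omega> in torus_haar r. j \<le> r \<longrightarrow> good j \<omega>"
  proof (cases "j \<le> r")
    case True
    from X_AE[OF this] show ?thesis
    proof eventually_elim
      case (elim \<omega>)
      then show ?case using G_sub[OF True] unfolding good_def by blast
    qed
  qed auto
qed

text \<open>True at every point: where component j converges this is uniform convergence on
  compacts, and elsewhere both the partial sums and the limit are 0. Pointwise limits everywhere
  then give measurability of the random element.\<close>

lemma rho_part_limZ:
  assumes K: "compact_family r G K"
  shows "(\<lambda>n. rho r K (partZ n (V \<omega>)) (limZ \<omega>)) \<longlonglongrightarrow> 0"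
proof -
  have "(\<lambda>n. sup_norm (K j) (\<lambda>z. component (partZ n (V \<omega>)) j z - component (limZ \<omega>) j z)) \<longlonglongrightarrow> 0" if j: "j \<le> r" for j
  proof (rule LIMSEQ_I)
    fix e :: real assume e: "e > 0"
    have Kj: "compact (K j)" "K j \<subseteq> G j" using K j by (auto simp: compact_family_def)
    have c: "continuous_on (K j) (\<lambda>z. component (partZ n (V \<omega>)) j z - component (limZ \<omega>) j z)" for n
      using component_continuous[OF K part_in j] component_continuous[OF K limZ_in j] by (intro continuous_intros)
    have "\<exists>N. \<forall>n\<ge>N. \<forall>z\<in>K j. cmod (component (partZ n (V \<omega>)) j z - component (limZ \<omega>) j z) \<le> e / 2"
    proof (cases "good j \<omega>")
      case True
      have hs: "hol_series (G j) (\<lambda>m s. a j m * X j m \<omega> * dterm (\<beta> j) m s) = (\<lambda>s\<in>G j. \<Sum>m. a j m * X j m \<omega> * dterm (\<beta> j) m s)"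
        using True unfolding hol_series_def good_def by simp
      have "\<forall>\<^sub>F n in sequentially. \<forall>z\<in>K j. dist (\<Sum>m<n. a j m * X j m \<omega> * dterm (\<beta> j) m z) (\<Sum>m. a j m * X j m \<omega> * dterm (\<beta> j) m z) < e / 2"
        by (rule uniform_limitD[OF series_uniform_limit[OF True Kj] half_gt_zero[OF e]])
      then obtain N where N: "\<And>n z. n \<ge> N \<Longrightarrow> z \<in> K j \<Longrightarrow> dist (\<Sum>m<n. a j m * X j m \<omega> * dterm (\<beta> j) m z) (\<Sum>m. a j m * X j m \<omega> * dterm (\<beta> j) m z) < e / 2"
        unfolding eventually_sequentially by blast
      show ?thesis
      proof (intro exI[of _ N] allI impI ballI)
        fix n z assume nz: "n \<ge> N" "z \<in> K j"
        then have "z \<in> G j" using Kj by auto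
        then have "cmod (component (partZ n (V \<omega>)) j z - component (limZ \<omega>) j z) =
           dist (\<Sum>m<n. a j m * X j m \<omega> * dterm (\<beta> j) m z) (\<Sum>m. a j m * X j m \<omega> * dterm (\<beta> j) m z)"
          using True j by (simp add: partZ_def limZ_def component_tuple hs V_def dist_norm)
        then show "cmod (component (partZ n (V \<omega>)) j z - component (limZ \<omega>) j z) \<le> e / 2" using N[OF nz] by simp
      qed
    next
      case False
      have hs: "hol_series (G j) (\<lambda>m s. a j m * X j m \<omega> * dterm (\<beta> j) m s) = (\<lambda>s\<in>G j. 0)"
        using False unfolding hol_series_def good_def by (simp only: if_False)
      show ?thesis using False j Kj e
        by (intro exI[of _ 0]) (auto simp: partZ_def limZ_def component_tuple hs V_def subset_eq)
    qed
    then obtain N where N: "\<And>n z. n \<ge> N \<Longrightarrow> z \<in> K j \<Longrightarrow> cmod (component (partZ n (V \<omega>)) j z - component (limZ \<omega>) j z) \<le> e / 2" by blast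
    show "\<exists>no. \<forall>n\<ge>no. norm (sup_norm (K j) (\<lambda>z. component (partZ n (V \<omega>)) j z - component (limZ \<omega>) j z) - 0) < e"
    proof (intro exI[of _ N] allI impI)
      fix n assume n: "n \<ge> N"
      have "sup_norm (K j) (\<lambda>z. component (partZ n (V \<omega>)) j z - component (limZ \<omega>) j z) \<le> e / 2"
        by (rule sup_norm_le) (use e N[OF n] in auto)
      then show "norm (sup_norm (K j) (\<lambda>z. component (partZ n (V \<omega>)) j z - component (limZ \<omega>) j z) - 0) < e"
        using sup_norm_nonneg[OF Kj(1) c[of n]] e by simp
    qed
  qed
  then have "(\<lambda>n. rho r K (partZ n (V \<omega>)) (limZ \<omega>)) \<longlonglongrightarrow> (\<Sum>j\<le>r. 0)"
    unfolding rho_def by (intro tendsto_sum) auto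
  then show ?thesis by simp
qed

lemma lipschitz_tendsto:
  assumes \<Phi>: "lipschitz \<Phi> K L"
  shows "(\<lambda>n. \<Phi> (partZ n (V \<omega>))) \<longlonglongrightarrow> \<Phi> (limZ \<omega>)"
proof -
  have K: "compact_family r G K" using \<Phi> by (simp add: lipschitz_def)
  have "(\<lambda>n. L * rho r K (partZ n (V \<omega>)) (limZ \<omega>)) \<longlonglongrightarrow> 0"
    using tendsto_mult_right_zero[OF rho_part_limZ[OF K]] .
  then have "(\<lambda>n. \<Phi> (partZ n (V \<omega>)) - \<Phi> (limZ \<omega>)) \<longlonglongrightarrow> 0"
    by (rule Lim_null_comparison[OF always_eventually, rotated]) (use \<Phi> part_in limZ_in in \<open>auto simp: lipschitz_def\<close>)
  then show ?thesis by (rule LIM_zero_cancel)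
qed

lemma V_measurable: "(\<lambda>\<omega>. V \<omega> j m) \<in> borel_measurable (torus_haar r)"
proof (cases "j \<le> r")
  case True
  note [measurable] = good_measurable[OF True] X_meas[OF True]
  have "(\<lambda>\<omega>. if good j \<omega> then X j m \<omega> else 0) \<in> borel_measurable (torus_haar r)" by measurable
  then show ?thesis using True by (simp add: V_def)
qed (simp add: V_def)

lemma limZ_measurable:
  assumes \<Phi>: "lipschitz \<Phi> K L"
  shows "(\<lambda>\<omega>. \<Phi> (limZ \<omega>)) \<in> borel_measurable (torus_haar r)"
  by (rule borel_measurable_LIMSEQ_real[OF lipschitz_tendsto[OF \<Phi>] part_measurable[OF \<Phi> V_measurable]])

lemma U_measurable: "(\<lambda>\<omega>. U \<omega> j m) \<in> borel_measurable (torus_haar r)"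
  using X_meas by (cases "j \<le> r") (simp_all add: U_def)

lemma integral_part_tendsto:
  assumes \<Phi>: "lipschitz \<Phi> K L" and M: "\<forall>x\<in>Hspace r G. \<bar>\<Phi> x\<bar> \<le> M"
  shows "(\<lambda>n. \<integral>\<omega>. \<Phi> (partZ n (U \<omega>)) \<partial>torus_haar r) \<longlonglongrightarrow> (\<integral>\<omega>. \<Phi> (limZ \<omega>) \<partial>torus_haar r)"
proof (rule integral_dominated_convergence[where w = "\<lambda>_. M"])
  interpret prob_space "torus_haar r" by (rule prob_space_torus_haar)
  show "integrable (torus_haar r) (\<lambda>_. M)" by simp
  show "AE \<omega> in torus_haar r. (\<lambda>n. \<Phi> (partZ n (U \<omega>))) \<longlonglongrightarrow> \<Phi> (limZ \<omega>)"
    using AE_good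
  proof eventually_elim
    case (elim \<omega>)
    then have "U \<omega> = V \<omega>" by (auto simp: U_def V_def fun_eq_iff)
    then show ?case using lipschitz_tendsto[OF \<Phi>, of \<omega>] by simp
  qed
qed (use M part_in in \<open>auto intro!: limZ_measurable[OF \<Phi>] part_measurable[OF \<Phi> U_measurable]\<close>)

lemma cesaro_part:
  assumes \<Phi>: "lipschitz \<Phi> K L"
  shows "(\<lambda>N. (\<Sum>k=0..N. \<Phi> (partZ n (U (orb k)))) / real (N + 1)) \<longlonglongrightarrow> (\<integral>\<omega>. \<Phi> (partZ n (U \<omega>)) \<partial>torus_haar r)"
proof (rule equi)
  have "continuous_on (torus r) U"
  proof (intro continuous_on_coordinatewise_then_product)
    fix j m show "continuous_on (torus r) (\<lambda>\<omega>. U \<omega> j m)"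
      using X_cont by (cases "j \<le> r") (simp_all add: U_def)
  qed
  then show "continuous_on (torus r) (\<lambda>\<omega>. \<Phi> (partZ n (U \<omega>)))"
    by (rule continuous_on_compose2[OF part_continuous[OF \<Phi>]]) auto
qed

lemma component_part_orb:
  assumes "j \<le> r" "z \<in> G j"
  shows "component (partZ n (U (orb k))) j z = ptl (\<beta> j) (a j) n (z + \<i> * of_nat k * of_real (hh j))"
  using assms by (simp add: partZ_def component_tuple U_def ptl_def mult.assoc X_orb)

text \<open>Three comparisons: shifts with partial sums on the orbit, by the discrete mean square;
  these with their torus integral, by equidistribution; and that integral with the limit, by
  dominated convergence. The length n is fixed by the first and third before N tends to
  infinity.\<close>

theorem cesaro_lipschitz:
  assumes \<Phi>: "lipschitz \<Phi> K L" and M: "\<forall>x\<in>Hspace r G. \<bar>\<Phi> x\<bar> \<le> M"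
  shows "(\<lambda>N. (\<Sum>k=0..N. \<Phi> (shiftZ k)) / real (N + 1)) \<longlonglongrightarrow> (\<integral>\<omega>. \<Phi> (limZ \<omega>) \<partial>torus_haar r)"
proof (rule LIMSEQ_I)
  fix e :: real assume e: "e > 0"
  have K: "compact_family r G K" and L: "L \<ge> 0" using \<Phi> by (auto simp: lipschitz_def)
  have M0: "M \<ge> 0" using bspec[OF M shiftZ_in[of 0]] by linarith
  \<comment> \<open>Each of the r + 1 components contributes at most 2 \<eta> on average, so the
    Lipschitz constant L leaves at most e / 8; L + 1 avoids a zero denominator.\<close>
  define \<eta> where "\<eta> = e / (16 * (L + 1) * (real r + 1))"
  have \<eta>: "\<eta> > 0" using e L by (simp add: \<eta>_def)
  have "\<forall>j. \<exists>n0. j \<le> r \<longrightarrow> (\<forall>n\<ge>n0. \<exists>k0 q. (\<forall>k. 0 \<le> q k) \<and>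
       (\<forall>k\<ge>k0. \<forall>z\<in>K j. (cmod (F j (z + \<i> * of_nat k * of_real (hh j)) - ptl (\<beta> j) (a j) n (z + \<i> * of_nat k * of_real (hh j))))\<^sup>2 \<le> q k) \<and>
       (\<forall>\<^sub>F N in sequentially. (\<Sum>k=k0..N. q k) \<le> \<eta>\<^sup>2 * (real N + 1)))"
  proof
    fix j
    show "\<exists>n0. j \<le> r \<longrightarrow> (\<forall>n\<ge>n0. \<exists>k0 q. (\<forall>k. 0 \<le> q k) \<and>
       (\<forall>k\<ge>k0. \<forall>z\<in>K j. (cmod (F j (z + \<i> * of_nat k * of_real (hh j)) - ptl (\<beta> j) (a j) n (z + \<i> * of_nat k * of_real (hh j))))\<^sup>2 \<le> q k) \<and>
       (\<forall>\<^sub>F N in sequentially. (\<Sum>k=k0..N. q k) \<le> \<eta>\<^sup>2 * (real N + 1)))"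
    proof (cases "j \<le> r")
      case True
      have "compact (K j)" "K j \<subseteq> {s. Re s > \<kappa> j}" using K True G_sub[OF True] by (auto simp: compact_family_def)
      from approx[OF True this, of "\<eta>\<^sup>2"] \<eta> show ?thesis by simp
    qed auto
  qed
  from choice[OF this] obtain n0 where n0: "\<forall>j. j \<le> r \<longrightarrow> (\<forall>n\<ge>n0 j. \<exists>k0 q. (\<forall>k. 0 \<le> q k) \<and>
       (\<forall>k\<ge>k0. \<forall>z\<in>K j. (cmod (F j (z + \<i> * of_nat k * of_real (hh j)) - ptl (\<beta> j) (a j) n (z + \<i> * of_nat k * of_real (hh j))))\<^sup>2 \<le> q k) \<and>
       (\<forall>\<^sub>F N in sequentially. (\<Sum>k=k0..N. q k) \<le> \<eta>\<^sup>2 * (real N + 1)))" ..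
  have "e / 4 > 0" using e by simp
  from LIMSEQ_D[OF integral_part_tendsto[OF \<Phi> M] this] obtain n1 where
    n1: "\<forall>n\<ge>n1. norm ((\<integral>\<omega>. \<Phi> (partZ n (U \<omega>)) \<partial>torus_haar r) - (\<integral>\<omega>. \<Phi> (limZ \<omega>) \<partial>torus_haar r)) < e / 4" by blast
  define n where "n = max n1 (Max (n0 ` {..r}))"
  have n: "n \<ge> n1" "\<And>j. j \<le> r \<Longrightarrow> n \<ge> n0 j" by (auto simp: n_def intro: max.coboundedI2 Max_ge)
  have "\<forall>j. \<exists>kq. j \<le> r \<longrightarrow> (\<forall>k. 0 \<le> snd kq k) \<and>
       (\<forall>k\<ge>fst kq. \<forall>z\<in>K j. (cmod (F j (z + \<i> * of_nat k * of_real (hh j)) - ptl (\<beta> j) (a j) n (z + \<i> * of_nat k * of_real (hh j))))\<^sup>2 \<le> snd kq k) \<and>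
       (\<forall>\<^sub>F N in sequentially. (\<Sum>k=fst kq..N. snd kq k) \<le> \<eta>\<^sup>2 * (real N + 1))"
  proof
    fix j
    show "\<exists>kq. j \<le> r \<longrightarrow> (\<forall>k. 0 \<le> snd kq k) \<and>
       (\<forall>k\<ge>fst kq. \<forall>z\<in>K j. (cmod (F j (z + \<i> * of_nat k * of_real (hh j)) - ptl (\<beta> j) (a j) n (z + \<i> * of_nat k * of_real (hh j))))\<^sup>2 \<le> snd kq k) \<and>
       (\<forall>\<^sub>F N in sequentially. (\<Sum>k=fst kq..N. snd kq k) \<le> \<eta>\<^sup>2 * (real N + 1))"
    proof (cases "j \<le> r")
      case True
      from n0[rule_format, OF True n(2)[OF True]] obtain k0 q where kq: "(\<forall>k. 0 \<le> q k) \<and>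
       (\<forall>k\<ge>k0. \<forall>z\<in>K j. (cmod (F j (z + \<i> * of_nat k * of_real (hh j)) - ptl (\<beta> j) (a j) n (z + \<i> * of_nat k * of_real (hh j))))\<^sup>2 \<le> q k) \<and>
       (\<forall>\<^sub>F N in sequentially. (\<Sum>k=k0..N. q k) \<le> \<eta>\<^sup>2 * (real N + 1))" by (elim exE)
      show ?thesis by (rule exI[of _ "(k0, q)"]) (unfold fst_conv snd_conv, intro impI, rule kq)
    qed auto
  qed
  from choice[OF this] obtain kq :: "nat \<Rightarrow> nat \<times> (nat \<Rightarrow> real)" where kq: "\<forall>j. j \<le> r \<longrightarrow> (\<forall>k. 0 \<le> snd (kq j) k) \<and>
       (\<forall>k\<ge>fst (kq j). \<forall>z\<in>K j. (cmod (F j (z + \<i> * of_nat k * of_real (hh j)) - ptl (\<beta> j) (a j) n (z + \<i> * of_nat k * of_real (hh j))))\<^sup>2 \<le> snd (kq j) k) \<and>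
       (\<forall>\<^sub>F N in sequentially. (\<Sum>k=fst (kq j)..N. snd (kq j) k) \<le> \<eta>\<^sup>2 * (real N + 1))" ..
  define q where "q j = snd (kq j)" for j
  define k0 where "k0 = Max ((\<lambda>j. fst (kq j)) ` {..r})"
  have k0: "fst (kq j) \<le> k0" if "j \<le> r" for j using that by (auto simp: k0_def)
  have q0: "q j k \<ge> 0" if "j \<le> r" for j k using kq that by (auto simp: q_def)
  have close: "\<bar>\<Phi> (shiftZ k) - \<Phi> (partZ n (U (orb k)))\<bar> \<le> L * (\<Sum>j\<le>r. \<eta> + q j k / \<eta>)" if k: "k \<ge> k0" for k
  proof -
    have "\<bar>\<Phi> (shiftZ k) - \<Phi> (partZ n (U (orb k)))\<bar> \<le> L * rho r K (shiftZ k) (partZ n (U (orb k)))"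
      using \<Phi> shiftZ_in part_in by (auto simp: lipschitz_def)
    also have "rho r K (shiftZ k) (partZ n (U (orb k))) \<le> (\<Sum>j\<le>r. \<eta> + q j k / \<eta>)"
    proof (rule rho_le)
      fix j z assume j: "j \<le> r" and z: "z \<in> K j"
      then have zG: "z \<in> G j" using K by (auto simp: compact_family_def)
      define x where "x = cmod (component (shiftZ k) j z - component (partZ n (U (orb k))) j z)"
      have "x\<^sup>2 \<le> q j k"
        using kq j z k k0[OF j] zG unfolding x_def q_def by (auto simp: component_part_orb shiftZ_def component_tuple)
      then have "x\<^sup>2 / \<eta> \<le> q j k / \<eta>" using \<eta> by (simp add: divide_right_mono)
      \<comment> \<open>In place of Cauchy--Schwarz: linear in the square, so the averaged bound
        \<eta>^2 for the squares yields 2 \<eta> for the first powers and can be summed over k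
        directly.\<close>
      moreover have "x \<le> \<eta> + x\<^sup>2 / \<eta>"
      proof (cases "x \<le> \<eta>")
        case False
        then have "x * \<eta> \<le> x * x" using \<eta> by (intro mult_left_mono) auto
        then have "x \<le> x\<^sup>2 / \<eta>" using \<eta> by (simp add: field_simps power2_eq_square)
        then show ?thesis using \<eta> by simp
      qed (use \<eta> in \<open>simp add: add_increasing2\<close>)
      ultimately show "cmod (component (shiftZ k) j z - component (partZ n (U (orb k))) j z) \<le> \<eta> + q j k / \<eta>" by (simp add: x_def)
    qed (use \<eta> q0 in auto)
    finally show ?thesis using L by (simp add: mult_left_mono)
  qed
  have ev1: "\<forall>\<^sub>F N in sequentially. \<forall>j\<in>{..r}. (\<Sum>k=fst (kq j)..N. q j k) \<le> \<eta>\<^sup>2 * (real N + 1)"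
    by (rule eventually_ball_finite) (use kq in \<open>auto simp: q_def\<close>)
  \<comment> \<open>The first k0 shifts are not controlled by the mean square; the bound M of the
    test function makes them negligible after averaging.\<close>
  have ev2: "\<forall>\<^sub>F N in sequentially. 2 * M * real k0 \<le> e / 8 * (real N + 1)" using e by real_asymp
  have ev3: "\<forall>\<^sub>F N in sequentially. \<bar>(\<Sum>k=0..N. \<Phi> (partZ n (U (orb k)))) / real (N + 1) - (\<integral>\<omega>. \<Phi> (partZ n (U \<omega>)) \<partial>torus_haar r)\<bar> < e / 4"
    using tendstoD[OF cesaro_part[OF \<Phi>, of n] \<open>e / 4 > 0\<close>] by (simp only: dist_real_def)
  have "\<forall>\<^sub>F N in sequentially. norm ((\<Sum>k=0..N. \<Phi> (shiftZ k)) / real (N + 1) - (\<integral>\<omega>. \<Phi> (limZ \<omega>) \<partial>torus_haar r)) < e"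
    using ev1 ev2 ev3
  proof eventually_elim
    case (elim N)
    have small: "\<bar>\<Phi> (shiftZ k) - \<Phi> (partZ n (U (orb k)))\<bar> \<le> 2 * M" for k
      using bspec[OF M shiftZ_in[of k]] bspec[OF M part_in[of n "U (orb k)"]] by linarith
    have "\<bar>(\<Sum>k=0..N. \<Phi> (shiftZ k)) - (\<Sum>k=0..N. \<Phi> (partZ n (U (orb k))))\<bar> \<le> (\<Sum>k=0..N. \<bar>\<Phi> (shiftZ k) - \<Phi> (partZ n (U (orb k)))\<bar>)"
      unfolding sum_subtractf[symmetric] by (rule sum_abs)
    also have "\<dots> \<le> (\<Sum>k=0..N. (if k < k0 then 2 * M else 0) + L * (\<Sum>j\<le>r. \<eta> + (if k \<ge> fst (kq j) then q j k else 0) / \<eta>))"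
    proof (rule sum_mono)
      fix k
      show "\<bar>\<Phi> (shiftZ k) - \<Phi> (partZ n (U (orb k)))\<bar> \<le> (if k < k0 then 2 * M else 0) + L * (\<Sum>j\<le>r. \<eta> + (if k \<ge> fst (kq j) then q j k else 0) / \<eta>)"
      proof (cases "k < k0")
        case True
        have "0 \<le> L * (\<Sum>j\<le>r. \<eta> + (if k \<ge> fst (kq j) then q j k else 0) / \<eta>)"
          using L \<eta> q0 by (intro mult_nonneg_nonneg sum_nonneg add_nonneg_nonneg divide_nonneg_nonneg) auto
        then show ?thesis using True small[of k] by simp
      next
        case False
        then have "(\<Sum>j\<le>r. \<eta> + (if k \<ge> fst (kq j) then q j k else 0) / \<eta>) = (\<Sum>j\<le>r. \<eta> + q j k / \<eta>)"
          using k0 by (intro sum.cong refl) (force simp: not_less)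
        then show ?thesis using close[of k] False by simp
      qed
    qed
    also have "\<dots> = (\<Sum>k=0..N. if k < k0 then 2 * M else 0) + L * (\<Sum>j\<le>r. \<Sum>k=0..N. \<eta> + (if k \<ge> fst (kq j) then q j k else 0) / \<eta>)"
      unfolding sum.distrib[of "\<lambda>k. if k < k0 then 2 * M else 0"] sum_distrib_left[symmetric] by (subst sum.swap) simp
    also have "\<dots> \<le> 2 * M * real k0 + L * (\<Sum>j\<le>r. 2 * \<eta> * (real N + 1))"
    proof (intro add_mono mult_left_mono L sum_mono)
      have "(\<Sum>k=0..N. if k < k0 then 2 * M else 0) = (\<Sum>k\<in>{0..N} \<inter> {..<k0}. 2 * M)"
        unfolding sum.inter_restrict[OF finite_atLeastAtMost] by simp
      also have "\<dots> \<le> (\<Sum>k\<in>{..<k0}. 2 * M)" by (rule sum_mono2) (use M0 in auto)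
      also have "\<dots> = 2 * M * real k0" by simp
      finally show "(\<Sum>k=0..N. if k < k0 then 2 * M else 0) \<le> 2 * M * real k0" .
      fix j assume "j \<in> {..r}"
      then have "(\<Sum>k=fst (kq j)..N. q j k) \<le> \<eta>\<^sup>2 * (real N + 1)" using elim(1) by blast
      moreover have "(\<Sum>k=0..N. if k \<ge> fst (kq j) then q j k else 0) = (\<Sum>k\<in>{0..N} \<inter> {fst (kq j)..}. q j k)"
        unfolding sum.inter_restrict[OF finite_atLeastAtMost] by simp
      moreover have "{0..N} \<inter> {fst (kq j)..} = {fst (kq j)..N}" by auto
      ultimately have "(\<Sum>k=0..N. if k \<ge> fst (kq j) then q j k else 0) / \<eta> \<le> \<eta>\<^sup>2 * (real N + 1) / \<eta>"
        using \<eta> by (simp add: divide_right_mono)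
      moreover have "\<eta>\<^sup>2 * (real N + 1) / \<eta> = \<eta> * (real N + 1)" using \<eta> by (simp add: power2_eq_square)
      ultimately show "(\<Sum>k=0..N. \<eta> + (if k \<ge> fst (kq j) then q j k else 0) / \<eta>) \<le> 2 * \<eta> * (real N + 1)"
        using \<eta> by (simp add: sum.distrib sum_divide_distrib[symmetric] power2_eq_square algebra_simps)
    qed
    also have "L * (\<Sum>j\<le>r. 2 * \<eta> * (real N + 1)) \<le> e / 8 * (real N + 1)"
    proof -
      have "L * (\<Sum>j\<le>r. 2 * \<eta> * (real N + 1)) = (L * (2 * (real r + 1) * \<eta>)) * (real N + 1)" by (simp add: algebra_simps)
      also have "L * (2 * (real r + 1) * \<eta>) \<le> (L + 1) * (2 * (real r + 1) * \<eta>)" using \<eta> by (intro mult_right_mono) auto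
      also have "(L + 1) * (2 * (real r + 1) * \<eta>) = 2 * (((L + 1) * (real r + 1)) * \<eta>)" by (simp only: mult_ac)
      also have "((L + 1) * (real r + 1)) * \<eta> = e / 16"
      proof -
        have "L + 1 \<noteq> 0" "real r + 1 \<noteq> 0" using L by auto
        then show ?thesis unfolding \<eta>_def by (simp add: divide_simps)
      qed
      also have "2 * (e / 16) = e / 8" by simp
      finally show ?thesis by (simp add: mult_right_mono)
    qed
    finally have "\<bar>(\<Sum>k=0..N. \<Phi> (shiftZ k)) - (\<Sum>k=0..N. \<Phi> (partZ n (U (orb k))))\<bar> \<le> e / 4 * (real N + 1)" using elim(2) by simp
    then have "\<bar>(\<Sum>k=0..N. \<Phi> (shiftZ k)) / real (N + 1) - (\<Sum>k=0..N. \<Phi> (partZ n (U (orb k)))) / real (N + 1)\<bar> \<le> e / 4"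
      unfolding diff_divide_distrib[symmetric] abs_divide by (simp add: field_simps)
    moreover have "\<bar>(\<integral>\<omega>. \<Phi> (partZ n (U \<omega>)) \<partial>torus_haar r) - (\<integral>\<omega>. \<Phi> (limZ \<omega>) \<partial>torus_haar r)\<bar> < e / 4"
      using n1 n(1) unfolding real_norm_def by blast
    ultimately show ?case using elim(3) e unfolding real_norm_def by linarith
  qed
  then show "\<exists>no. \<forall>N\<ge>no. norm ((\<Sum>k=0..N. \<Phi> (shiftZ k)) / real (N + 1) - (\<integral>\<omega>. \<Phi> (limZ \<omega>) \<partial>torus_haar r)) < e"
    unfolding eventually_sequentially .
qed

section \<open>From Lipschitz to lower semicontinuous and continuous test functions\<close>

lemma lsc_approximation:
  fixes f :: "_ \<Rightarrow> real"
  assumes f: "\<forall>x\<in>Hspace r G. \<bar>f x\<bar> \<le> M"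
    and lsc: "\<forall>c. openin (H_product r (G 0) G) {x \<in> Hspace r G. f x > c}"
  shows "\<exists>\<Phi> K. (\<forall>k. lipschitz (\<Phi> k) (K k) (real k)) \<and> (\<forall>k. \<forall>x\<in>Hspace r G. - M \<le> \<Phi> k x \<and> \<Phi> k x \<le> f x) \<and>
     (\<forall>x\<in>Hspace r G. (\<lambda>k::nat. \<Phi> k x) \<longlonglongrightarrow> f x)"
proof -
  have "\<forall>j. \<exists>C. j \<le> r \<longrightarrow> (\<forall>n. compact (C n)) \<and> (\<forall>n. C n \<subseteq> G j) \<and> (\<forall>m n. m \<le> n \<longrightarrow> C m \<subseteq> C n) \<and>
     (\<forall>K. compact K \<longrightarrow> K \<subseteq> G j \<longrightarrow> (\<exists>N::nat. \<forall>n\<ge>N. K \<subseteq> C n))"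
    using compact_exhaustion[OF G_open] by simp
  from choice[OF this] obtain C :: "nat \<Rightarrow> nat \<Rightarrow> complex set" where
    C': "\<forall>j. j \<le> r \<longrightarrow> (\<forall>n. compact (C j n)) \<and> (\<forall>n. C j n \<subseteq> G j) \<and> (\<forall>m n. m \<le> n \<longrightarrow> C j m \<subseteq> C j n) \<and>
     (\<forall>K. compact K \<longrightarrow> K \<subseteq> G j \<longrightarrow> (\<exists>N::nat. \<forall>n\<ge>N. K \<subseteq> C j n))" ..
  define K where "K i j = C j i" for i j
  have cf: "compact_family r G (K i)" for i using C' by (simp add: compact_family_def K_def)
  have Kmono: "K i j \<subseteq> K k j" if "i \<le> k" "j \<le> r" for i k j using C' that by (simp add: K_def)
  have lsc': "\<exists>i d. d > 0 \<and> (\<forall>y\<in>Hspace r G. rho r (K i) x y < d \<longrightarrow> f y > f x - e)" if x: "x \<in> Hspace r G" and e: "e > 0" for x e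
  proof -
    have "x \<in> {y \<in> Hspace r G. f y > f x - e}" using x e by simp
    from openin_H_product_rho[OF lsc[rule_format] this] obtain L d where L: "compact_family r G L" "d > 0"
      "\<And>y. y \<in> Hspace r G \<Longrightarrow> rho r L x y < d \<Longrightarrow> f y > f x - e" by auto
    have "\<forall>j. \<exists>N. j \<le> r \<longrightarrow> (\<forall>n\<ge>N. L j \<subseteq> C j n)"
      using C' L(1) by (simp add: compact_family_def)
    from choice[OF this] obtain N where N: "\<forall>j. j \<le> r \<longrightarrow> (\<forall>n\<ge>N j. L j \<subseteq> C j n)" ..
    \<comment> \<open>One stage of the exhaustions that swallows the compact set of every component,
      possible because there are only r + 1 of them.\<close>
    define i where "i = Max (N ` {..r})"
    have "L j \<subseteq> K i j" if "j \<le> r" for j using N that by (simp add: K_def i_def)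
    then have "rho r L x y \<le> rho r (K i) x y" if "y \<in> Hspace r G" for y
      by (intro rho_mono[OF cf x that])
    then show ?thesis using L(2,3) by (meson order_le_less_trans)
  qed
  obtain \<Phi> where \<Phi>: "\<And>k x. x \<in> Hspace r G \<Longrightarrow> - M \<le> \<Phi> k x \<and> \<Phi> k x \<le> f x"
    "\<And>k x y. x \<in> Hspace r G \<Longrightarrow> y \<in> Hspace r G \<Longrightarrow> \<bar>\<Phi> k x - \<Phi> k y\<bar> \<le> real k * rho r (K k) x y"
    "\<And>x. x \<in> Hspace r G \<Longrightarrow> (\<lambda>k. \<Phi> k x) \<longlonglongrightarrow> f x"
  proof (rule lsc_regularisation[where X = "Hspace r G" and \<rho> = "\<lambda>i. rho r (K i)" and f = f and M = M])
    show "rho r (K i) x y = rho r (K i) y x" for i x y by (rule rho_commute)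
    show "rho r (K i) x y \<le> rho r (K k) x y" if "i \<le> k" "x \<in> Hspace r G" "y \<in> Hspace r G" for i k x y
      by (rule rho_mono[OF cf that(2,3) Kmono[OF that(1)]])
  qed (use rho_nonneg[OF cf] rho_refl rho_triangle[OF cf] f lsc' in auto)
  show ?thesis
  proof (intro exI[of _ \<Phi>] exI[of _ K] conjI allI)
    show "lipschitz (\<Phi> k) (K k) (real k)" for k unfolding lipschitz_def using cf \<Phi>(2) by auto
  qed (use \<Phi> in auto)
qed

lemma lsc_measurable:
  fixes f :: "_ \<Rightarrow> real"
  assumes f: "\<forall>x\<in>Hspace r G. \<bar>f x\<bar> \<le> M"
    and lsc: "\<forall>c. openin (H_product r (G 0) G) {x \<in> Hspace r G. f x > c}"
  shows "(\<lambda>\<omega>. f (limZ \<omega>)) \<in> borel_measurable (torus_haar r)"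
proof -
  from lsc_approximation[OF f lsc] obtain \<Phi> K where \<Phi>: "\<And>k. lipschitz (\<Phi> k) (K k) (real k)"
    "\<And>x. x \<in> Hspace r G \<Longrightarrow> (\<lambda>k. \<Phi> k x) \<longlonglongrightarrow> f x" by blast
  show ?thesis by (rule borel_measurable_LIMSEQ_real[OF \<Phi>(2)[OF limZ_in] limZ_measurable[OF \<Phi>(1)]])
qed

text \<open>The indicator of an open set is lower semicontinuous, so its composition with the random
  element is measurable; open sets generate the Borel sets.\<close>

lemma measurable_limZ: "limZ \<in> torus_haar r \<rightarrow>\<^sub>M borel_of (H_product r (G 0) G)"
  unfolding borel_of_def
proof (rule measurable_measure_of)
  show "{U. openin (H_product r (G 0) G) U} \<subseteq> Pow (Hspace r G)" using openin_subset by blast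
  show "limZ \<in> torus r \<rightarrow> Hspace r G" using limZ_in by blast
  fix U assume "U \<in> {U. openin (H_product r (G 0) G) U}"
  then have U: "openin (H_product r (G 0) G) U" by simp
  have "{x \<in> Hspace r G. indicat_real U x > c} = (if c < 0 then Hspace r G else if c < 1 then U else {})" for c
    using openin_subset[OF U] by (auto simp: indicator_def)
  then have "\<forall>c. openin (H_product r (G 0) G) {x \<in> Hspace r G. indicat_real U x > c}"
    using U by simp
  then have [measurable]: "(\<lambda>\<omega>. indicat_real U (limZ \<omega>)) \<in> borel_measurable (torus_haar r)"
    by (intro lsc_measurable[of _ 1]) (auto simp: indicator_def)
  have "limZ -` U \<inter> torus r = {\<omega> \<in> torus r. indicat_real U (limZ \<omega>) > 1/2}"
    by (auto simp: indicator_def split: if_splits)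
  also have "\<dots> \<in> sets (torus_haar r)" by measurable
  finally show "limZ -` U \<inter> torus r \<in> sets (torus_haar r)" .
qed

text \<open>One-sided by nature: the Lipschitz approximants lie below f, so their averages bound
  those of f from below, while their integrals rise to that of f.\<close>

lemma cesaro_lsc:
  fixes f :: "_ \<Rightarrow> real"
  assumes f: "\<forall>x\<in>Hspace r G. \<bar>f x\<bar> \<le> M"
    and lsc: "\<forall>c. openin (H_product r (G 0) G) {x \<in> Hspace r G. f x > c}" and e: "e > 0"
  shows "\<forall>\<^sub>F N in sequentially. (\<Sum>k=0..N. f (shiftZ k)) / real (N + 1) > (\<integral>\<omega>. f (limZ \<omega>) \<partial>torus_haar r) - e"
proof -
  interpret prob_space "torus_haar r" by (rule prob_space_torus_haar)
  from lsc_approximation[OF f lsc] obtain \<Phi> K where \<Phi>: "\<And>k. lipschitz (\<Phi> k) (K k) (real k)"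
    "\<And>k x. x \<in> Hspace r G \<Longrightarrow> - M \<le> \<Phi> k x \<and> \<Phi> k x \<le> f x"
    "\<And>x. x \<in> Hspace r G \<Longrightarrow> (\<lambda>k. \<Phi> k x) \<longlonglongrightarrow> f x" by blast
  have b: "\<forall>x\<in>Hspace r G. \<bar>\<Phi> k x\<bar> \<le> M" for k
  proof
    fix x assume x: "x \<in> Hspace r G"
    show "\<bar>\<Phi> k x\<bar> \<le> M" using \<Phi>(2)[OF x, of k] bspec[OF f x] by linarith
  qed
  have "(\<lambda>k. \<integral>\<omega>. \<Phi> k (limZ \<omega>) \<partial>torus_haar r) \<longlonglongrightarrow> (\<integral>\<omega>. f (limZ \<omega>) \<partial>torus_haar r)"
  proof (rule integral_dominated_convergence[where w = "\<lambda>_. M"])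
    show "(\<lambda>\<omega>. f (limZ \<omega>)) \<in> borel_measurable (torus_haar r)" by (rule lsc_measurable[OF f lsc])
    show "(\<lambda>\<omega>. \<Phi> k (limZ \<omega>)) \<in> borel_measurable (torus_haar r)" for k by (rule limZ_measurable[OF \<Phi>(1)])
  qed (use \<Phi>(3)[OF limZ_in] bspec[OF b limZ_in] in auto)
  from order_tendstoD(1)[OF this, of "(\<integral>\<omega>. f (limZ \<omega>) \<partial>torus_haar r) - e"] e
  have "\<forall>\<^sub>F k in sequentially. (\<integral>\<omega>. f (limZ \<omega>) \<partial>torus_haar r) - e < (\<integral>\<omega>. \<Phi> k (limZ \<omega>) \<partial>torus_haar r)" by simp
  from eventually_happens[OF this] obtain k where k: "(\<integral>\<omega>. f (limZ \<omega>) \<partial>torus_haar r) - e < (\<integral>\<omega>. \<Phi> k (limZ \<omega>) \<partial>torus_haar r)"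
    by (auto simp only: trivial_limit_sequentially)
  from order_tendstoD(1)[OF cesaro_lipschitz[OF \<Phi>(1) b] k]
  show ?thesis
  proof eventually_elim
    case (elim N)
    have "(\<Sum>i=0..N. \<Phi> k (shiftZ i)) / real (N + 1) \<le> (\<Sum>i=0..N. f (shiftZ i)) / real (N + 1)"
      by (intro divide_right_mono sum_mono) (use \<Phi>(2)[OF shiftZ_in] in auto)
    then show ?case using elim by linarith
  qed
qed

theorem weak_limit:
  "weakly_converges (H_product r (G 0) G)
     (\<lambda>N. distr (uniform_count_measure {0..N}) (borel_of (H_product r (G 0) G)) shiftZ)
     (distr (torus_haar r) (borel_of (H_product r (G 0) G)) limZ)"
proof -
  let ?H = "H_product r (G 0) G"
  have ms: "shiftZ \<in> measurable (uniform_count_measure {0..N}) (borel_of ?H)" for N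
    using shiftZ_in by (simp add: measurable_def space_borel_of sets_uniform_count_measure space_uniform_count_measure)
  show ?thesis
    unfolding weakly_converges_def
  proof (intro conjI allI impI)
    show "prob_space (distr (uniform_count_measure {0..N}) (borel_of ?H) shiftZ)" for N
      by (rule prob_space.prob_space_distr[OF _ ms]) (rule prob_space_uniform_count_measure, auto)
    show "prob_space (distr (torus_haar r) (borel_of ?H) limZ)"
      by (rule prob_space.prob_space_distr[OF prob_space_torus_haar measurable_limZ])
    fix f assume f: "continuous_map ?H euclideanreal f \<and> bounded (f ` topspace ?H)"
    then obtain M where M: "\<forall>x\<in>Hspace r G. \<bar>f x\<bar> \<le> M" unfolding bounded_iff by auto
    have op: "openin ?H {x \<in> Hspace r G. f x \<in> S}" if "open S" for S
      by (rule openin_continuous_map_preimage[OF conjunct1[OF f]]) (use that in simp)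
    have fm: "f \<in> borel_measurable (borel_of ?H)"
    proof (rule borel_measurableI)
      fix S :: "real set" assume "open S"
      have "f -` S \<inter> space (borel_of ?H) = {x \<in> Hspace r G. f x \<in> S}" by (auto simp: space_borel_of)
      then show "f -` S \<inter> space (borel_of ?H) \<in> sets (borel_of ?H)"
        using op[OF \<open>open S\<close>] by (simp add: sets_borel_of)
    qed
    have lim: "(\<lambda>N. (\<Sum>k=0..N. f (shiftZ k)) / real (N + 1)) \<longlonglongrightarrow> (\<integral>\<omega>. f (limZ \<omega>) \<partial>torus_haar r)"
    proof (rule tendstoI)
      fix e :: real assume e: "e > 0"
      have "\<forall>c. openin ?H {x \<in> Hspace r G. f x > c}" using op[OF open_greaterThan] by simp
      from cesaro_lsc[OF M this e]
      have 1: "\<forall>\<^sub>F N in sequentially. (\<integral>\<omega>. f (limZ \<omega>) \<partial>torus_haar r) - e < (\<Sum>k=0..N. f (shiftZ k)) / real (N + 1)" .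
      \<comment> \<open>A continuous function and its negative are both lower semicontinuous; the
        two one-sided bounds give the limit.\<close>
      have M': "\<forall>x\<in>Hspace r G. \<bar>- f x\<bar> \<le> M" using M by simp
      have "{x \<in> Hspace r G. - f x > c} = {x \<in> Hspace r G. f x \<in> {..<-c}}" for c by auto
      then have "\<forall>c. openin ?H {x \<in> Hspace r G. - f x > c}" using op[OF open_lessThan] by simp
      from cesaro_lsc[OF M' this e]
      have 2: "\<forall>\<^sub>F N in sequentially. (\<integral>\<omega>. - f (limZ \<omega>) \<partial>torus_haar r) - e < (\<Sum>k=0..N. - f (shiftZ k)) / real (N + 1)" .
      show "\<forall>\<^sub>F N in sequentially. dist ((\<Sum>k=0..N. f (shiftZ k)) / real (N + 1)) (\<integral>\<omega>. f (limZ \<omega>) \<partial>torus_haar r) < e"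
        using 1 2
      proof eventually_elim
        case (elim N)
        have "(\<Sum>k=0..N. - f (shiftZ k)) / real (N + 1) = - ((\<Sum>k=0..N. f (shiftZ k)) / real (N + 1))" by (simp add: sum_negf)
        then have "- (\<integral>\<omega>. f (limZ \<omega>) \<partial>torus_haar r) - e < - ((\<Sum>k=0..N. f (shiftZ k)) / real (N + 1))"
          using elim(2) by simp
        then show ?case using elim(1) unfolding dist_real_def by linarith
      qed
    qed
    have "(\<integral>x. f x \<partial>distr (uniform_count_measure {0..N}) (borel_of ?H) shiftZ) = (\<Sum>k=0..N. f (shiftZ k)) / real (N + 1)" for N
      by (subst integral_distr[OF ms fm]) (simp add: integral_uniform_count_measure)
    moreover have "(\<integral>x. f x \<partial>distr (torus_haar r) (borel_of ?H) limZ) = (\<integral>\<omega>. f (limZ \<omega>) \<partial>torus_haar r)"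
      by (rule integral_distr[OF measurable_limZ fm])
    ultimately show "(\<lambda>N. \<integral>x. f x \<partial>distr (uniform_count_measure {0..N}) (borel_of ?H) shiftZ) \<longlonglongrightarrow>
        (\<integral>x. f x \<partial>distr (torus_haar r) (borel_of ?H) limZ)"
      using lim by simp
  qed auto
qed

end

section \<open>The coefficients as characters\<close>

lemma product_topology_cong:
  assumes "\<And>i. i \<in> I \<Longrightarrow> X i = Y i"
  shows "product_topology X I = product_topology Y I"
proof -
  have "openin (product_topology X I) S" if "\<And>i. i \<in> I \<Longrightarrow> X i = Y i" and S: "openin (product_topology Y I) S"
    for X Y :: "'a \<Rightarrow> 'b topology" and S
    unfolding openin_product_topology_alt
  proof
    fix x assume "x \<in> S"
    then obtain U where U: "finite {i \<in> I. U i \<noteq> topspace (Y i)}" "\<forall>i\<in>I. openin (Y i) (U i)" "x \<in> PiE I U" "PiE I U \<subseteq> S"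
      using S unfolding openin_product_topology_alt by blast
    have "{i \<in> I. U i \<noteq> topspace (X i)} = {i \<in> I. U i \<noteq> topspace (Y i)}" using that(1) by auto
    then show "\<exists>U. finite {i \<in> I. U i \<noteq> topspace (X i)} \<and> (\<forall>i\<in>I. openin (X i) (U i)) \<and> x \<in> PiE I U \<and> PiE I U \<subseteq> S"
      using U that(1) by (intro exI[of _ U]) auto
  qed
  from this[of X Y] this[of Y X] show ?thesis using assms unfolding topology_eq by auto
qed

text \<open>The product sees the family only on the indices 1 to r. This permits storing the domain
  of the first component under index 0.\<close>

lemma H_product_cong:
  assumes "\<And>j. j \<in> {1..r} \<Longrightarrow> G j = G' j"
  shows "H_product r D G = H_product r D G'"
  unfolding H_product_def by (intro arg_cong[of _ _ "prod_topology (hol_topology D)"] product_topology_cong) (simp add: assms)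

text \<open>A compact set keeps a distance from the edge of an open half-plane. The cap u holds the
  new abscissa within the range where a mean square is available.\<close>

lemma compact_in_smaller_halfplane:
  assumes K: "compact K" "K \<subseteq> {s. Re s > \<kappa>}" and u: "\<kappa> < u"
  obtains \<sigma> where "\<kappa> < \<sigma>" "\<sigma> < u" "K \<subseteq> {s. Re s > \<sigma>}"
proof (cases "K = {}")
  case True
  show ?thesis by (rule that[of "(\<kappa> + u) / 2"]) (use u True in auto)
next
  case False
  have "continuous_on K Re" by (intro continuous_intros)
  then obtain z where z: "z \<in> K" "\<forall>w\<in>K. Re z \<le> Re w"
    using continuous_attains_inf[OF K(1) False] by blast
  then have "\<kappa> < min (Re z) u" using K u by auto
  then obtain \<sigma> where "\<kappa> < \<sigma>" "\<sigma> < min (Re z) u" using dense by blast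
  then show ?thesis using z by (intro that[of \<sigma>]) force+
qed

lemma (in continued_dirichlet) ptl_approx_compact:
  assumes h: "h > 0" and e: "e > 0" and K: "compact K" "K \<subseteq> {s. Re s > \<sigma>0}"
  shows "\<exists>n0. \<forall>n\<ge>n0. \<exists>k0 q. (\<forall>k. 0 \<le> q k) \<and>
       (\<forall>k\<ge>k0. \<forall>z\<in>K. (cmod (F (z + \<i> * of_nat k * of_real h) - ptl \<beta> a n (z + \<i> * of_nat k * of_real h)))\<^sup>2 \<le> q k) \<and>
       (\<forall>\<^sub>F N in sequentially. (\<Sum>k=k0..N. q k) \<le> e * (real N + 1))"
proof -
  obtain \<sigma>l where l: "\<sigma>0 < \<sigma>l" "K \<subseteq> {s. Re s > \<sigma>l}"
    using compact_in_smaller_halfplane[OF K, of "\<sigma>0 + 1"] by auto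
  obtain R where R: "R > 0" "\<forall>z\<in>K. cmod z \<le> R" using compact_imp_bounded[OF K(1)] bounded_pos by blast
  define \<sigma>r where "\<sigma>r = max \<sigma>l R"
  have lr: "\<sigma>l \<le> \<sigma>r" by (simp add: \<sigma>r_def)
  have KB: "\<sigma>l \<le> Re z \<and> Re z \<le> \<sigma>r \<and> \<bar>Im z\<bar> \<le> R" if "z \<in> K" for z
    using that l R abs_Re_le_cmod[of z] abs_Im_le_cmod[of z] by (force simp: \<sigma>r_def)
  obtain n0 where n0: "\<forall>n\<ge>n0. \<exists>k0 q. (\<forall>k. 0 \<le> q k) \<and>
     (\<forall>k\<ge>k0. \<forall>z. \<sigma>l \<le> Re z \<and> Re z \<le> \<sigma>r \<and> \<bar>Im z\<bar> \<le> R \<longrightarrow>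
        (cmod (F (z + \<i> * of_nat k * of_real h) - ptl \<beta> a n (z + \<i> * of_nat k * of_real h)))\<^sup>2 \<le> q k) \<and>
     (\<forall>\<^sub>F N in sequentially. (\<Sum>k=k0..N. q k) \<le> e * (real N + 1))"
    using ptl_approx[OF h e l(1) lr less_imp_le[OF R(1)]] ..
  show ?thesis
  proof (rule exI[of _ n0], intro allI impI)
    fix n assume "n \<ge> n0"
    from n0[rule_format, OF this] obtain k0 q where q: "\<forall>k. 0 \<le> q k"
      "\<forall>k\<ge>k0. \<forall>z. \<sigma>l \<le> Re z \<and> Re z \<le> \<sigma>r \<and> \<bar>Im z\<bar> \<le> R \<longrightarrow>
        (cmod (F (z + \<i> * of_nat k * of_real h) - ptl \<beta> a n (z + \<i> * of_nat k * of_real h)))\<^sup>2 \<le> q k"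
      "\<forall>\<^sub>F N in sequentially. (\<Sum>k=k0..N. q k) \<le> e * (real N + 1)" by (elim exE conjE)
    show "\<exists>k0 q. (\<forall>k. 0 \<le> q k) \<and>
       (\<forall>k\<ge>k0. \<forall>z\<in>K. (cmod (F (z + \<i> * of_nat k * of_real h) - ptl \<beta> a n (z + \<i> * of_nat k * of_real h)))\<^sup>2 \<le> q k) \<and>
       (\<forall>\<^sub>F N in sequentially. (\<Sum>k=k0..N. q k) \<le> e * (real N + 1))"
    proof (intro exI[of _ k0] exI[of _ q] conjI)
      show "\<forall>k\<ge>k0. \<forall>z\<in>K. (cmod (F (z + \<i> * of_nat k * of_real h) - ptl \<beta> a n (z + \<i> * of_nat k * of_real h)))\<^sup>2 \<le> q k"
        using q(2) KB by blast
    next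
      show "\<forall>k. 0 \<le> q k" by (rule q(1))
    next
      show "\<forall>\<^sub>F N in sequentially. (\<Sum>k=k0..N. q k) \<le> e * (real N + 1)" by (rule q(3))
    qed
  qed
qed

text \<open>The factorisation of an integer as the exponent vector of a character, which turns the
  multiplicative extension of \<omega>1 into a character of the torus.\<close>

definition prime_exponents :: "nat \<Rightarrow> L_index \<Rightarrow> int" where
  "prime_exponents m i = (case i of Ind_Prime p \<Rightarrow> if prime p then int (multiplicity p m) else 0 | _ \<Rightarrow> 0)"

lemma prime_exponents_support: "{i. prime_exponents m i \<noteq> 0} = Ind_Prime ` prime_factors m"
proof (intro set_eqI)
  fix i
  show "i \<in> {i. prime_exponents m i \<noteq> 0} \<longleftrightarrow> i \<in> Ind_Prime ` prime_factors m"
    by (cases i) (auto simp: prime_exponents_def prime_factors_multiplicity)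
qed

lemma prime_exponents_in: "prime_exponents m \<in> exponents r"
  by (auto simp: exponents_def prime_exponents_support torus_indices_def L_indices_def in_prime_factors_iff)

lemma torus_char_prime_exponents: "torus_char (prime_exponents m) \<omega> = omega_ext (fst \<omega>) m"
proof -
  have "torus_char (prime_exponents m) \<omega> = (\<Prod>p\<in>prime_factors m. coord (Ind_Prime p) \<omega> powi prime_exponents m (Ind_Prime p))"
    unfolding torus_char_def prime_exponents_support by (subst prod.reindex) (auto simp: inj_on_def)
  also have "\<dots> = omega_ext (fst \<omega>) m"
    unfolding omega_ext_def by (intro prod.cong refl) (auto simp: prime_exponents_def in_prime_factors_iff)
  finally show ?thesis .
qed

text \<open>Unique factorisation; it is what makes the random factors of the Dirichlet series
  orthogonal.\<close>

lemma inj_prime_exponents: "inj_on prime_exponents {m. m > 0}"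
proof (rule inj_onI)
  fix m k assume tuple: "m \<in> {m. m > 0}" "k \<in> {m. m > 0}" "prime_exponents m = prime_exponents k"
  have "multiplicity p m = multiplicity p k" if "prime p" for p
    using fun_cong[OF tuple(3), of "Ind_Prime p"] that by (simp add: prime_exponents_def)
  then show "m = k" using multiplicity_eq_imp_eq[of m k] tuple by simp
qed

text \<open>Component 0 is the Dirichlet series, whose m-th term belongs to the integer m + 1; the
  Hurwitz-type components have one independent coordinate per term.\<close>

definition coeff_exponents :: "nat \<Rightarrow> nat \<Rightarrow> L_index \<Rightarrow> int" where
  "coeff_exponents j m = (if j = 0 then prime_exponents (Suc m) else (\<lambda>i. if i = Ind_Hurwitz j m then 1 else 0))"

lemma coeff_exponents_in: "j \<le> r \<Longrightarrow> coeff_exponents j m \<in> exponents r"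
  unfolding coeff_exponents_def
  by (cases "j = 0") (auto simp: prime_exponents_in torus_indices_def L_indices_def intro!: exponents_single bexI[of _ j])

lemma inj_coeff_exponents: "inj (coeff_exponents j)"
proof (rule injI)
  fix m k assume *: "coeff_exponents j m = coeff_exponents j k"
  show "m = k"
  proof (cases "j = 0")
    case True
    then show ?thesis using inj_onD[OF inj_prime_exponents, of "Suc m" "Suc k"] * by (simp add: coeff_exponents_def)
  next
    case False
    then show ?thesis using fun_cong[OF *, of "Ind_Hurwitz j m"] by (simp add: coeff_exponents_def split: if_splits)
  qed
qed

lemma torus_char_coeff_exponents:
  "torus_char (coeff_exponents j m) \<omega> = (if j = 0 then omega_ext (fst \<omega>) (Suc m) else snd \<omega> j m)"
  using torus_char_single[of "Ind_Hurwitz j m" 1 \<omega>] by (simp add: coeff_exponents_def torus_char_prime_exponents)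

text \<open>The product of one character with the conjugate of another is the character of the
  difference, which is nonzero by injectivity and so integrates to 0.\<close>

lemma orthonormal_char:
  assumes n: "\<And>m. n m \<in> exponents r" and inj: "inj n"
  shows "orthonormal_system (torus_haar r) (\<lambda>m. torus_char (n m))"
proof -
  interpret prob_space "torus_haar r" by (rule prob_space_torus_haar)
  show ?thesis
  proof
    fix m k :: nat assume "m \<noteq> k"
    then have "n m \<noteq> n k" using inj by (simp add: inj_eq)
    then obtain i where i: "n m i \<noteq> n k i" by (auto simp: fun_eq_iff)
    have mi: "(\<lambda>i. - n k i) \<in> exponents r" using n[of k] by (simp add: exponents_def)
    have "(\<integral>\<omega>. torus_char (n m) \<omega> * cnj (torus_char (n k) \<omega>) \<partial>torus_haar r) = (\<integral>\<omega>. torus_char (\<lambda>i. n m i + - n k i) \<omega> \<partial>torus_haar r)"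
      by (intro Bochner_Integration.integral_cong refl)
        (simp only: torus_char_add[OF n mi] torus_char_uminus[OF n])
    also have "\<dots> = 0" by (rule integral_char[OF exponents_add[OF n mi], where i = i]) (use i in simp)
    finally show "(\<integral>\<omega>. torus_char (n m) \<omega> * cnj (torus_char (n k) \<omega>) \<partial>torus_haar r) = 0" .
  qed (auto intro: measurable_char torus_char_norm n)
qed

lemma torus_char_orbit:
  assumes "n \<in> exponents r"
  shows "torus_char n (orbit r h1 h2 \<alpha> k) = cis (- (real k * (\<Sum>i\<in>{i. n i \<noteq> 0}. of_int (n i) * L_elem h1 h2 \<alpha> i)))"
proof -
  have "torus_char n (orbit r h1 h2 \<alpha> k) = (\<Prod>i\<in>{i. n i \<noteq> 0}. cis (of_int (n i) * (- (real k * L_elem h1 h2 \<alpha> i))))"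
    unfolding torus_char_def
  proof (intro prod.cong refl)
    fix i assume "i \<in> {i. n i \<noteq> 0}"
    then have "i \<in> torus_indices r" using assms by (auto simp: exponents_def)
    from coord_orbit[OF this, of h1 h2 \<alpha> k]
    show "coord i (orbit r h1 h2 \<alpha> k) powi n i = cis (of_int (n i) * (- (real k * L_elem h1 h2 \<alpha> i)))"
      by (simp only: cis_power_int)
  qed
  also have "\<dots> = cis (\<Sum>i\<in>{i. n i \<noteq> 0}. of_int (n i) * (- (real k * L_elem h1 h2 \<alpha> i)))"
    using assms unfolding cis_conv_exp of_real_sum sum_distrib_left by (simp only: exponents_def mem_Collect_eq exp_sum)
  also have "(\<Sum>i | n i \<noteq> 0. of_int (n i) * (- (real k * L_elem h1 h2 \<alpha> i)))
      = - (real k * (\<Sum>i\<in>{i. n i \<noteq> 0}. of_int (n i) * L_elem h1 h2 \<alpha> i))"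
    unfolding sum_distrib_left sum_negf[symmetric] by (intro sum.cong refl) (simp only: mult_ac mult_minus_right)
  finally show ?thesis .
qed

text \<open>The frequency at which the orbit rotates the m-th coefficient. For component 0 it is the
  logarithm of the prime factorisation of m + 1, and in all cases it is the step times ln (m +
  \<beta>), matching the vertical shift.\<close>

lemma coeff_exponents_sum:
  "(\<Sum>i\<in>{i. coeff_exponents j m i \<noteq> 0}. of_int (coeff_exponents j m i) * L_elem h1 h2 \<alpha> i)
     = (if j = 0 then h1 * ln (real m + 1) else h2 j * ln (real m + \<alpha> j))"
proof (cases "j = 0")
  case True
  have ln_eq: "ln (real m + 1) = (\<Sum>p\<in>prime_factors (Suc m). real (multiplicity p (Suc m)) * ln (real p))"
  proof -
    have "real m + 1 = real (\<Prod>p\<in>prime_factors (Suc m). p ^ multiplicity p (Suc m))"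
      using prime_factorization_nat[of "Suc m"] by simp
    also have "ln \<dots> = (\<Sum>p\<in>prime_factors (Suc m). ln (real p ^ multiplicity p (Suc m)))"
      unfolding of_nat_prod of_nat_power
      by (subst ln_prod) (auto simp: in_prime_factors_iff prime_gt_0_nat)
    also have "\<dots> = (\<Sum>p\<in>prime_factors (Suc m). real (multiplicity p (Suc m)) * ln (real p))"
      by (intro sum.cong refl ln_realpow)
    finally show ?thesis .
  qed
  have "(\<Sum>i\<in>{i. coeff_exponents j m i \<noteq> 0}. of_int (coeff_exponents j m i) * L_elem h1 h2 \<alpha> i)
     = (\<Sum>p\<in>prime_factors (Suc m). of_int (prime_exponents (Suc m) (Ind_Prime p)) * L_elem h1 h2 \<alpha> (Ind_Prime p))"
    unfolding coeff_exponents_def if_P[OF True] prime_exponents_support by (subst sum.reindex) (auto simp: inj_on_def)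
  also have "\<dots> = (\<Sum>p\<in>prime_factors (Suc m). h1 * (real (multiplicity p (Suc m)) * ln (real p)))"
    by (intro sum.cong refl) (auto simp: prime_exponents_def in_prime_factors_iff)
  finally show ?thesis using True by (simp only: ln_eq sum_distrib_left simp_thms if_True)
next
  case False
  then have "{i. coeff_exponents j m i \<noteq> 0} = {Ind_Hurwitz j m}" by (auto simp: coeff_exponents_def)
  then show ?thesis using False by (simp add: coeff_exponents_def)
qed

lemma dterm_vertical_shift:
  assumes "\<beta> > 0"
  shows "dterm \<beta> m (s + \<i> * of_nat k * of_real h) = cis (- (real k * (h * ln (real m + \<beta>)))) * dterm \<beta> m s"
proof -
  have "dterm \<beta> m (\<i> * of_nat k * of_real h) = cis (- (real k * (h * ln (real m + \<beta>))))"
    unfolding dterm_eq_exp[OF assms] cis_conv_exp by (simp add: mult_ac)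
  then show ?thesis by (simp add: dterm_add[OF assms] mult_ac)
qed

lemma matsumoto_analytic_at:
  assumes "matsumoto_class \<sigma>0 \<phi> c" "Re s \<ge> \<sigma>0" "s \<notin> poles_right \<sigma>0 \<phi>"
  shows "\<phi> analytic_on {s}"
proof (rule nicely_meromorphic_on_imp_analytic_at)
  show "\<phi> nicely_meromorphic_on {s. Re s \<ge> \<sigma>0}" using assms(1) unfolding matsumoto_class_def by (elim conjE)
  show "s \<in> {s. Re s \<ge> \<sigma>0}" "\<not> is_pole \<phi> s" using assms(2,3) by (simp_all add: poles_right_def)
qed

lemma analytic_shift_holomorphic:
  assumes "\<And>s. s \<in> G \<Longrightarrow> F analytic_on {s + v}"
  shows "(\<lambda>s. F (s + v)) holomorphic_on G"
proof (rule analytic_imp_holomorphic)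
  have "F \<circ> (\<lambda>s. s + v) analytic_on G"
  proof (rule analytic_on_compose)
    show "(\<lambda>s. s + v) analytic_on G" by (intro analytic_intros)
    show "F analytic_on (\<lambda>s. s + v) ` G"
      by (subst analytic_on_analytic_at) (use assms in blast)
  qed
  then show "(\<lambda>s. F (s + v)) analytic_on G" by (simp add: o_def)
qed

lemma powr_eq_dterm:
  assumes "\<beta> > 0"
  shows "(of_nat m + of_real \<beta>) powr (- s) = dterm \<beta> m s"
  unfolding dterm_def by simp

lemma Suc_powr_eq_dterm: "of_nat (Suc m) powr (- s) = dterm 1 m s"
  unfolding dterm_def by (simp add: add_ac)

section \<open>Matsumoto and periodic Hurwitz zeta-functions as continued Dirichlet series\<close>

text \<open>The poles lie in a compact set off the line Re s = \<sigma>0, so above a suitable height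
  the continuation is analytic up to and on this line; growth and mean square are then part of the
  class.\<close>

lemma continued_dirichlet_matsumoto:
  assumes M: "matsumoto_class \<sigma>0 \<phi> c"
  obtains T1 where "continued_dirichlet 1 \<sigma>0 T1 (\<lambda>m. c (Suc m)) \<phi>"
proof -
  have sums: "\<And>s. Re s > 1 \<Longrightarrow> (\<lambda>k. c (Suc k) * dterm 1 k s) sums \<phi> s"
    using M unfolding matsumoto_class_def Suc_powr_eq_dterm by blast
  have \<sigma>0: "1/2 \<le> \<sigma>0" "\<sigma>0 < 1" using M by (simp_all add: matsumoto_class_def)
  obtain K where K: "compact K" "K \<inter> {s. Re s = \<sigma>0} = {}" "poles_right \<sigma>0 \<phi> \<subseteq> K"
    using M unfolding matsumoto_class_def by blast
  obtain C2 B T0 where gr: "T0 > 0" "\<And>s. Re s \<ge> \<sigma>0 \<Longrightarrow> \<bar>Im s\<bar> \<ge> T0 \<Longrightarrow> cmod (\<phi> s) \<le> B * \<bar>Im s\<bar> powr C2"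
    using M unfolding matsumoto_class_def by blast
  have bigo: "(\<lambda>T. integral {0..T} (\<lambda>t. (cmod (\<phi> (Complex \<sigma>0 t)))\<^sup>2)) \<in> O[at_top](\<lambda>T. T)"
    using M unfolding matsumoto_class_def by blast
  obtain R where R: "R > 0" "\<forall>z\<in>K. cmod z \<le> R" using compact_imp_bounded[OF K(1)] bounded_pos by blast
  \<comment> \<open>\<open>R + 1\<close> lies above the compact set of poles and is at least 1;
    \<open>T0\<close> is where the growth bound begins.\<close>
  define T1 where "T1 = max T0 (R + 1)"
  have T1: "T1 \<ge> 1" "T1 \<ge> T0" "T1 > R" using R by (auto simp: T1_def)
  have an: "\<phi> analytic_on {s}" if "Re s \<ge> \<sigma>0" "s \<notin> poles_right \<sigma>0 \<phi>" for s
    by (rule matsumoto_analytic_at[OF M that])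
  \<comment> \<open>The given mean square starts at height 0, below \<open>T1\<close>. Integrability
    on the full range comes from the line being free of poles and justifies passing to the smaller
    range.\<close>
  have line: "continuous_on {0..T} (\<lambda>t. (cmod (\<phi> (Complex \<sigma>0 t)))\<^sup>2)" for T
  proof -
    have "\<phi> analytic_on {s. Re s = \<sigma>0}"
      by (subst analytic_on_analytic_at) (use an K in blast)
    then have "continuous_on {s. Re s = \<sigma>0} \<phi>"
      by (intro holomorphic_on_imp_continuous_on analytic_imp_holomorphic)
    then have "continuous_on {0..T} (\<lambda>t. \<phi> (Complex \<sigma>0 t))"
      by (rule continuous_on_compose2) (auto intro!: continuous_intros simp: Complex_eq)
    then show ?thesis by (intro continuous_intros)
  qed
  have "continued_dirichlet 1 \<sigma>0 T1 (\<lambda>m. c (Suc m)) \<phi>"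
  proof
    \<comment> \<open>Plain convergence at 3/2 bounds the terms there; a further 3/2 in the exponent
      makes the series absolutely convergent at 3.\<close>
    have "summable (\<lambda>k. c (Suc k) * dterm 1 k (3/2))" using sums[of "3/2"] by (simp add: sums_iff)
    then have "Bseq (\<lambda>k. c (Suc k) * dterm 1 k (3/2))"
      by (intro convergent_imp_Bseq) (auto dest: summable_LIMSEQ_zero simp: convergent_def)
    then obtain A where A: "A > 0" "\<forall>k. cmod (c (Suc k) * dterm 1 k (3/2)) \<le> A" by (auto elim: BseqE)
    show "summable (\<lambda>m. cmod (c (Suc m)) * (real m + 1) powr - 3)"
    proof (rule summable_comparison_test'[of "\<lambda>m. A * (real m + 1) powr - (3/2)" 0])
      show "summable (\<lambda>m. A * (real m + 1) powr - (3/2))"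
        by (intro summable_mult summable_shift_powr) auto
      fix m
      have "(real m + 1) powr - 3 = (real m + 1) powr - (3/2) * (real m + 1) powr - (3/2)"
        by (simp add: powr_add[symmetric])
      then have "cmod (c (Suc m)) * (real m + 1) powr - 3 = cmod (c (Suc m) * dterm 1 m (3/2)) * (real m + 1) powr - (3/2)"
        by (simp add: norm_mult norm_dterm)
      also have "\<dots> \<le> A * (real m + 1) powr - (3/2)" by (rule mult_right_mono) (use A in auto)
      finally show "norm (cmod (c (Suc m)) * (real m + 1) powr - 3) \<le> A * (real m + 1) powr - (3/2)"
        by (simp add: abs_mult)
    qed
    show "(\<lambda>m. c (Suc m) * dterm 1 m s) sums \<phi> s" if "3 \<le> Re s" for s
      by (rule sums) (use that in simp)
    have "s \<notin> poles_right \<sigma>0 \<phi>" if "T1 \<le> Im s" for s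
      using that K(3) R T1 abs_Im_le_cmod[of s] by fastforce
    then show "\<phi> analytic_on {s. \<sigma>0 \<le> Re s \<and> T1 \<le> Im s}"
      by (subst analytic_on_analytic_at) (use an in blast)
    show "\<exists>B. \<exists>C::nat. \<forall>s. \<sigma>0 \<le> Re s \<and> Re s \<le> \<sigma>2 \<and> T1 \<le> Im s \<longrightarrow> cmod (\<phi> s) \<le> B * Im s ^ C" for \<sigma>2
    proof (intro exI allI impI)
      fix s assume s: "\<sigma>0 \<le> Re s \<and> Re s \<le> \<sigma>2 \<and> T1 \<le> Im s"
      then have I: "Im s \<ge> 1" using T1 by auto
      have "cmod (\<phi> s) \<le> B * \<bar>Im s\<bar> powr C2" using gr(2)[of s] s T1 by auto
      also have "\<dots> \<le> \<bar>B\<bar> * \<bar>Im s\<bar> powr C2" by (intro mult_right_mono) auto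
      \<comment> \<open>A real exponent is rounded up to a natural one; a negative one becomes 0,
        which is admissible since Im s \<ge> 1.\<close>
      also have "\<bar>Im s\<bar> powr C2 \<le> Im s powr real (nat \<lceil>C2\<rceil>)" using I by (auto intro!: powr_mono) linarith
      also have "Im s powr real (nat \<lceil>C2\<rceil>) = Im s ^ nat \<lceil>C2\<rceil>" using I by (intro powr_realpow) auto
      finally show "cmod (\<phi> s) \<le> \<bar>B\<bar> * Im s ^ nat \<lceil>C2\<rceil>" by (simp add: mult_left_mono)
    qed
    obtain C where C: "\<forall>\<^sub>F T in at_top. norm (integral {0..T} (\<lambda>t. (cmod (\<phi> (Complex \<sigma>0 t)))\<^sup>2)) \<le> C * norm T"
      using bigo by (elim landau_o.bigE)
    show "\<exists>C. \<forall>\<^sub>F T in at_top. integral {T1..T} (\<lambda>u. (cmod (\<phi> (Complex \<sigma>0 u)))\<^sup>2) \<le> C * T"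
    proof
      show "\<forall>\<^sub>F T in at_top. integral {T1..T} (\<lambda>u. (cmod (\<phi> (Complex \<sigma>0 u)))\<^sup>2) \<le> C * T"
        using C eventually_ge_at_top[of 0]
      proof eventually_elim
        case (elim T)
        have "integral {T1..T} (\<lambda>u. (cmod (\<phi> (Complex \<sigma>0 u)))\<^sup>2) \<le> integral {0..T} (\<lambda>u. (cmod (\<phi> (Complex \<sigma>0 u)))\<^sup>2)"
        proof (rule integral_subset_le)
          show sub: "{T1..T} \<subseteq> {0..T}" using T1 by auto
          show "(\<lambda>u. (cmod (\<phi> (Complex \<sigma>0 u)))\<^sup>2) integrable_on {T1..T}"
            by (rule integrable_continuous_real[OF continuous_on_subset[OF line sub]])
          show "(\<lambda>u. (cmod (\<phi> (Complex \<sigma>0 u)))\<^sup>2) integrable_on {0..T}"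
            by (rule integrable_continuous_real[OF line])
        qed auto
        then show ?case using elim by simp
      qed
    qed
  qed (use T1 \<sigma>0 in auto)
  then show ?thesis by (rule that)
qed

text \<open>The domain avoids the whole vertical line through each pole, so no vertical shift meets
  a pole.\<close>

lemma matsumoto_shift_holomorphic:
  assumes M: "matsumoto_class \<sigma>0 \<phi> c" and D: "D \<subseteq> D_matsumoto \<sigma>0 \<phi>"
  shows "(\<lambda>s. \<phi> (s + \<i> * of_nat k * of_real h)) holomorphic_on D"
proof (rule analytic_shift_holomorphic)
  fix s assume "s \<in> D"
  then have s: "Re s > \<sigma>0" "\<forall>z\<in>poles_right \<sigma>0 \<phi>. Re s \<noteq> Re z" using D by (auto simp: D_matsumoto_def)
  have re: "Re (s + \<i> * of_nat k * of_real h) = Re s" by simp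
  show "\<phi> analytic_on {s + \<i> * of_nat k * of_real h}"
  proof (rule matsumoto_analytic_at[OF M])
    show "Re (s + \<i> * of_nat k * of_real h) \<ge> \<sigma>0" unfolding re using s(1) by simp
    show "s + \<i> * of_nat k * of_real h \<notin> poles_right \<sigma>0 \<phi>"
      using s(2) re by metis
  qed
qed

context periodic_hurwitz
begin

text \<open>A shifted point can hit 1 only from Re s = 1, and the domain contains such points only
  if the mean vanishes, in which case 1 is a regular point.\<close>

lemma shift_holomorphic:
  assumes D: "D \<subseteq> D_hurwitz b l"
  shows "(\<lambda>s. Z (s + \<i> * of_nat k * of_real h)) holomorphic_on D"
proof (rule analytic_shift_holomorphic)
  fix s assume s: "s \<in> D"
  have an: "Z analytic_on {z}" if "z \<noteq> 1" for z
  proof -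
    have "Z analytic_on - {1}"
      using Z by (simp add: is_periodic_hurwitz_zeta_def analytic_on_open open_delete open_Compl)
    then show ?thesis by (rule analytic_on_subset) (use that in auto)
  qed
  show "Z analytic_on {s + \<i> * of_nat k * of_real h}"
  proof (cases "s + \<i> * of_nat k * of_real h = 1")
    case True
    have "Re s = Re (s + \<i> * of_nat k * of_real h)" by simp
    then have "Re s = 1" using True by simp
    then have "mean = 0" using s D by (auto simp: D_hurwitz_def mean_def split: if_splits)
    then show ?thesis unfolding True by (rule Z_analytic_at_1)
  next
    case False
    then show ?thesis by (rule an)
  qed
qed

lemma ptl_approx_half_plane:
  assumes h: "h > 0" and e: "e > 0" and K: "compact K" "K \<subseteq> {s. Re s > 1/2}"
  shows "\<exists>n0. \<forall>n\<ge>n0. \<exists>k0 q. (\<forall>k. 0 \<le> q k) \<and>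
       (\<forall>k\<ge>k0. \<forall>z\<in>K. (cmod (Z (z + \<i> * of_nat k * of_real h) - ptl \<alpha> b n (z + \<i> * of_nat k * of_real h)))\<^sup>2 \<le> q k) \<and>
       (\<forall>\<^sub>F N in sequentially. (\<Sum>k=k0..N. q k) \<le> e * (real N + 1))"
proof -
  obtain \<sigma> where \<sigma>: "1/2 < \<sigma>" "\<sigma> < 1" "K \<subseteq> {s. Re s > \<sigma>}"
    using compact_in_smaller_halfplane[OF K, of 1] by auto
  show ?thesis
    by (rule continued_dirichlet.ptl_approx_compact[OF continued_dirichlet_hurwitz[OF \<sigma>(1,2)] h e K(1) \<sigma>(3)])
qed

lemma coeff_square_summable:
  assumes "\<sigma> > 1/2"
  shows "summable (\<lambda>m. (cmod (b m))\<^sup>2 * (real m + \<alpha>) powr (- 2 * \<sigma>))"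
proof -
  obtain \<tau> where \<tau>: "1/2 < \<tau>" "\<tau> < min \<sigma> 1" using dense[of "1/2" "min \<sigma> 1"] assms by auto
  then have 2: "\<tau> < 1" "\<tau> < \<sigma>" by auto
  show ?thesis by (rule continued_dirichlet.coeff_square_summable[OF continued_dirichlet_hurwitz[OF \<tau>(1) 2(1)] 2(2)])
qed

end

theorem theorem4p2:
  fixes r :: nat and \<sigma>0 :: real
    and \<phi> :: "complex \<Rightarrow> complex" and c :: "nat \<Rightarrow> complex"
    and \<zeta> :: "nat \<Rightarrow> complex \<Rightarrow> complex"
    and b :: "nat \<Rightarrow> nat \<Rightarrow> complex" and l :: "nat \<Rightarrow> nat" and \<alpha> :: "nat \<Rightarrow> real"
    and h1 :: real and h2 :: "nat \<Rightarrow> real"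
    and D1 :: "complex set" and D2 :: "nat \<Rightarrow> complex set"
  assumes "r \<ge> 1"
    and "matsumoto_class \<sigma>0 \<phi> c"
    and "\<And>j. j \<in> {1..r} \<Longrightarrow> minimal_period (b j) (l j)"
    and "\<And>j. j \<in> {1..r} \<Longrightarrow> 0 < \<alpha> j \<and> \<alpha> j < 1"
    and "\<And>j. j \<in> {1..r} \<Longrightarrow> is_periodic_hurwitz_zeta (\<alpha> j) (b j) (\<zeta> j)"
    and "h1 > 0" and "\<And>j. j \<in> {1..r} \<Longrightarrow> h2 j > 0"
    and "rat_independent_family (L_elem h1 h2 \<alpha>) (L_indices r)"
    and "open D1" and "D1 \<subseteq> D_matsumoto \<sigma>0 \<phi>"
    and "\<And>j. j \<in> {1..r} \<Longrightarrow> open (D2 j)"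
    and "\<And>j. j \<in> {1..r} \<Longrightarrow> D2 j \<subseteq> D_hurwitz (b j) (l j)"
  shows "weakly_converges (H_product r D1 D2)
           (\<lambda>N. P_shift r D1 D2 \<phi> \<zeta> h1 h2 N)
           (P_Z r D1 D2 c \<alpha> b)"
proof -
  note M = assms(2) and D1 = assms(10)
  \<comment> \<open>All data are put under one index, 0 for the Matsumoto component and 1 to r for
    the periodic Hurwitz ones.\<close>
  define G where "G j = (if j = 0 then D1 else D2 j)" for j
  define a where "a j m = (if j = 0 then c (Suc m) else b j m)" for j m
  define \<beta> where "\<beta> j = (if j = 0 then 1 else \<alpha> j)" for j
  define hh where "hh j = (if j = 0 then h1 else h2 j)" for j
  define \<kappa> where "\<kappa> j = (if j = 0 then \<sigma>0 else 1/2)" for j :: nat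
  define F where "F j = (if j = 0 then \<phi> else \<zeta> j)" for j
  define X where "X j m = torus_char (coeff_exponents j m)" for j m
  define orb where "orb = orbit r h1 h2 \<alpha>"
  note defs = G_def a_def \<beta>_def hh_def \<kappa>_def F_def
  obtain T1 where "continued_dirichlet 1 \<sigma>0 T1 (\<lambda>m. c (Suc m)) \<phi>"
    by (rule continued_dirichlet_matsumoto[OF M])
  then interpret \<phi>: continued_dirichlet 1 \<sigma>0 T1 "\<lambda>m. c (Suc m)" \<phi> .
  have hurwitz: "periodic_hurwitz (\<alpha> j) (b j) (l j) (\<zeta> j)" if "j \<in> {1..r}" for j
    using assms(3-5)[OF that] by unfold_locales (auto simp: minimal_period_def)
  have hj: "j \<in> {1..r}" if "j \<le> r" "j \<noteq> 0" for j using that by auto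
  have \<beta>_pos: "\<beta> j > 0" if "j \<le> r" for j using assms(4)[of j] that by (auto simp: \<beta>_def)
  interpret joint_shifts r G a \<beta> hh \<kappa> F X orb
  proof
    fix j k m :: nat assume j: "j \<le> r"
    show "open (G j)" using assms(9) assms(11)[of j] j by (auto simp: G_def)
    show "G j \<subseteq> {s. Re s > \<kappa> j}"
    proof (cases "j = 0")
      case True
      then show ?thesis using D1 by (auto simp: defs D_matsumoto_def)
    next
      case False
      then show ?thesis using assms(12)[OF hj[OF j False]] by (auto simp: defs D_hurwitz_def split: if_splits)
    qed
    show "\<beta> j > 0" by (rule \<beta>_pos[OF j])
    show "(\<lambda>s. F j (s + \<i> * of_nat k * of_real (hh j))) holomorphic_on G j"
    proof (cases "j = 0")
      case True
      then show ?thesis using matsumoto_shift_holomorphic[OF M D1] by (simp add: defs)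
    next
      case False
      then show ?thesis
        using periodic_hurwitz.shift_holomorphic[OF hurwitz assms(12)] hj[OF j False] by (simp add: defs)
    qed
    have exps: "coeff_exponents j m \<in> exponents r" for m by (rule coeff_exponents_in[OF j])
    show "continuous_on (torus r) (X j m)" unfolding X_def by (rule continuous_on_char[OF exps])
    show "X j m \<in> borel_measurable (torus_haar r)" unfolding X_def by (rule measurable_char[OF exps])
    show "AE \<omega> in torus_haar r. \<forall>K. compact K \<and> K \<subseteq> {s. Re s > \<kappa> j} \<longrightarrow>
       uniformly_convergent_on K (\<lambda>n s. \<Sum>m<n. a j m * X j m \<omega> * dterm (\<beta> j) m s)"
      unfolding X_def
    proof (rule orthonormal_system.AE_uniformly_convergent[OF orthonormal_char[OF exps inj_coeff_exponents] \<beta>_pos[OF j]])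
      fix \<sigma> assume \<sigma>: "\<kappa> j < \<sigma>"
      show "summable (\<lambda>m. (cmod (a j m))\<^sup>2 * (real m + \<beta> j) powr (- 2 * \<sigma>))"
      proof (cases "j = 0")
        case True
        then show ?thesis using \<phi>.coeff_square_summable[of \<sigma>] \<sigma> by (simp add: defs)
      next
        case False
        then show ?thesis
          using periodic_hurwitz.coeff_square_summable[OF hurwitz[OF hj[OF j False]], of \<sigma>] \<sigma> by (simp add: defs)
      qed
    qed
    show "X j m (orb k) * dterm (\<beta> j) m s = dterm (\<beta> j) m (s + \<i> * of_nat k * of_real (hh j))" for s
      unfolding X_def orb_def torus_char_orbit[OF exps] coeff_exponents_sum dterm_vertical_shift[OF \<beta>_pos[OF j]]
      by (simp add: defs)
    fix K :: "complex set" and e :: real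
    assume K: "compact K" "K \<subseteq> {s. Re s > \<kappa> j}" and e: "e > 0"
    show "\<exists>n0. \<forall>n\<ge>n0. \<exists>k0 q. (\<forall>k. 0 \<le> q k) \<and>
       (\<forall>k\<ge>k0. \<forall>z\<in>K. (cmod (F j (z + \<i> * of_nat k * of_real (hh j)) - ptl (\<beta> j) (a j) n (z + \<i> * of_nat k * of_real (hh j))))\<^sup>2 \<le> q k) \<and>
       (\<forall>\<^sub>F N in sequentially. (\<Sum>k=k0..N. q k) \<le> e * (real N + 1))"
    proof (cases "j = 0")
      case True
      have "a j = (\<lambda>m. c (Suc m))" using True by (simp add: a_def fun_eq_iff)
      then show ?thesis using \<phi>.ptl_approx_compact[OF assms(6) e K(1)] K(2) True by (simp add: defs)
    next
      case False
      have "a j = b j" using False by (simp add: a_def fun_eq_iff)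
      then show ?thesis
        using periodic_hurwitz.ptl_approx_half_plane[OF hurwitz[OF hj[OF j False]] assms(7)[OF hj[OF j False]] e K(1)] K(2) False
        by (simp add: defs)
    qed
  next
    show "orb k \<in> torus r" for k by (simp add: orb_def orbit_torus)
    show "(\<lambda>N. (\<Sum>k=0..N. f (orb k)) / real (N + 1)) \<longlonglongrightarrow> (\<integral>\<omega>. f \<omega> \<partial>torus_haar r)"
      if "continuous_on (torus r) f" for f :: "torus_pt \<Rightarrow> real"
      unfolding orb_def by (rule equidistribution(2)[OF assms(8) that])
  qed
  \<comment> \<open>\<open>G\<close> and \<open>D2\<close> may differ at index 0, which lies outside
    the index set of the second factor.\<close>
  have H: "H_product r D1 D2 = H_product r (G 0) G"
    using H_product_cong[of r G D2 D1] by (simp add: G_def)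
  have sZ: "shifted_Z r D1 D2 \<phi> \<zeta> h1 h2 = shiftZ"
    by (auto simp: shifted_Z_def shiftZ_def tuple_def defs fun_eq_iff)
  have series: "hol_series (G j) (\<lambda>m s. a j m * X j m \<omega> * dterm (\<beta> j) m s) =
      (if j = 0 then random_matsumoto D1 c (fst \<omega>) else random_hurwitz (D2 j) (\<alpha> j) (b j) (snd \<omega> j))"
    if "j \<le> r" for j \<omega>
  proof (cases "j = 0")
    case True
    then show ?thesis
      unfolding random_matsumoto_def Suc_powr_eq_dterm X_def torus_char_coeff_exponents by (simp add: defs)
  next
    case False
    have "\<alpha> j > 0" using assms(4)[OF hj[OF that False]] by simp
    then show ?thesis
      using False unfolding random_hurwitz_def powr_eq_dterm[OF \<open>\<alpha> j > 0\<close>] X_def torus_char_coeff_exponents by (simp add: defs)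
  qed
  have lZ: "random_Z r D1 D2 c \<alpha> b = limZ"
    unfolding limZ_def tuple_def random_Z_def by (auto simp: series fun_eq_iff)
  show ?thesis using weak_limit unfolding P_shift_def P_Z_def H sZ lZ .
qed

end
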